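(* Let $|F|\in L^2_{\mathrm{loc}}(\Omega_T)$ and assume that $u\in L^2_{\mathrm{loc}}(0,T;W^{1,2}_{\mathrm{loc}}(\Omega;\mathbb{R}^N))$ is a weak solution to $u_t-\operatorname{div}\mathcal{A}(z,\nabla u)=-\operatorname{div}F$ in $\Omega_T$. Let $2\le q<2\left(1+\frac2n\right)$ and let $Q=Q_\rho$ be a parabolic cylinder such that $2Q\Subset\Omega_T$. Then there exists a constant $c=c(n,N,q,\nu,L)$ such that $$\left(\frac1{|Q|}\iint_{Q}\frac{|u-u_{Q}|^q}{\rho^q}\,dz\right)^{\frac1q}\le c\,\frac1{|2Q|}\iint_{2Q}\frac{|u-u_{2Q}|}{2\rho}\,dz+c\left(\frac1{|2Q|}\iint_{2Q}|F|^2\,dz\right)^{\frac12}.$$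
   Context: $\Omega\subset\mathbb{R}^n$, $n\ge1$, is a bounded open domain, $T>0$, $\Omega_T=\Omega\times(0,T)$, $N\ge1$, $0<\nu<L<\infty$. $\mathcal{A}:\Omega_T\times\mathbb{R}^{Nn}\to\mathbb{R}^{Nn}$ is a Carathéodory vector field ($\mathcal{A}(\cdot,\xi)$ measurable for every $\xi$, $\mathcal{A}(z,\cdot)$ continuous for a.e. $z$) with $\nu|\xi|^2\le\mathcal{A}(z,\xi)\cdot\xi$ and $|\mathcal{A}(z,\xi)|\le L|\xi|$ for a.e. $z\in\Omega_T$ and every $\xi\in\mathbb{R}^{Nn}$. $F:\Omega_T\to\mathbb{R}^{Nn}$ is measurable. We write $z=(x,t)$, $dz=dx\,dt$, and $\nabla$ is the gradient in $x$. $u\in L^2_{\mathrm{loc}}(0,T;W^{1,2}_{\mathrm{loc}}(\Omega;\mathbb{R}^N))$ means that for all $\Omega'\Subset\Omega$ and $0<t_1<t_2<T$ one has $u(\cdot,t)\in W^{1,2}(\Omega';\mathbb{R}^N)$ for a.e. $t\in(t_1,t_2)$ and $\int_{t_1}^{t_2}\int_{\Omega'}(|u|^2+|\nabla u|^2)\,dx\,dt<\infty$. Such a $u$ is a weak solution if $\iint_{\Omega_T}(-u\cdot\varphi_t+\mathcal{A}(z,\nabla u)\cdot\nabla\varphi)\,dz=\iint_{\Omega_T}F\cdot\nabla\varphi\,dz$ for every $\varphi\in C_0^\infty(\Omega_T;\mathbb{R}^N)$. Parabolic cylinders: $Q_\rho=B_\rho(x_0)\times(t_0-\rho^2,t_0+\rho^2)$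 and $2Q_\rho=B_{2\rho}(x_0)\times(t_0-(2\rho)^2,t_0+(2\rho)^2)$. $u_Q=\frac1{|Q|}\iint_Q u\,dz$ (componentwise). $Q\Subset\Omega_T$ means that the closure of $Q$ is a compact subset of $\Omega_T$. *)

theory Defs
  imports "HOL-Analysis.Analysis"
begin

text \<open>
  Space-time points are pairs \<open>z = (x, t)\<close>. Matrices in \<open>real ^ 'n ^ 'N\<close> have \<open>N\<close> rows and
  \<open>n\<close> columns, so the gradient of a map \<open>u\<close> has the entries \<open>\<nabla>u $ i $ j = \<partial>\<^sub>j u\<^sub>i\<close>; the library
  norm and inner product on this type are the Euclidean ones of \<open>\<real>\<^sup>N\<^sup>n\<close>.
  Measurability and ``almost every'' refer to Lebesgue measure.
\<close>

definition compactly_contained :: "'a::topological_space set \<Rightarrow> 'a set \<Rightarrow> bool"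
  where "compactly_contained A B \<longleftrightarrow> compact (closure A) \<and> closure A \<subseteq> B"

definition average :: "'a::euclidean_space set \<Rightarrow> ('a \<Rightarrow> 'b) \<Rightarrow> 'b::euclidean_space"
  where "average Q f = (1 / measure lebesgue Q) *\<^sub>R (LINT z:Q|lebesgue. f z)"

definition cylinder :: "real ^ 'n \<Rightarrow> real \<Rightarrow> real \<Rightarrow> ((real ^ 'n) \<times> real) set"
  where "cylinder x0 t0 \<rho> = ball x0 \<rho> \<times> {t0 - \<rho>\<^sup>2 <..< t0 + \<rho>\<^sup>2}"

subsection \<open>Test functions\<close>

primrec Ck :: "nat \<Rightarrow> ('a::euclidean_space \<Rightarrow> 'b::euclidean_space) \<Rightarrow> bool"
  where
    "Ck 0 f \<longleftrightarrow> continuous_on UNIV f"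
  | "Ck (Suc k) f \<longleftrightarrow> f differentiable_on UNIV \<and>
       (\<forall>b\<in>Basis. Ck k (\<lambda>x. frechet_derivative f (at x) b))"

text \<open>Elements of \<open>C\<^sub>0\<^sup>\<infinity>(U)\<close>, extended by zero to the whole space.\<close>

definition test_function :: "'a set \<Rightarrow> ('a::euclidean_space \<Rightarrow> 'b::euclidean_space) \<Rightarrow> bool"
  where "test_function U \<phi> \<longleftrightarrow>
    (\<forall>k. Ck k \<phi>) \<and> compactly_contained {x. \<phi> x \<noteq> 0} U"

definition time_derivative ::
  "((real ^ 'n) \<times> real \<Rightarrow> real ^ 'N) \<Rightarrow> (real ^ 'n) \<times> real \<Rightarrow> real ^ 'N"
  where "time_derivative \<phi> z = frechet_derivative \<phi> (at z) (0, 1)"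

definition spatial_gradient ::
  "((real ^ 'n) \<times> real \<Rightarrow> real ^ 'N) \<Rightarrow> (real ^ 'n) \<times> real \<Rightarrow> real ^ 'n ^ 'N"
  where "spatial_gradient \<phi> z = (\<chi> i j. frechet_derivative \<phi> (at z) (axis j 1, 0) $ i)"

subsection \<open>Function spaces\<close>

definition square_integrable :: "'a set \<Rightarrow> ('a::euclidean_space \<Rightarrow> 'b::euclidean_space) \<Rightarrow> bool"
  where "square_integrable U f \<longleftrightarrow>
    f \<in> borel_measurable (lebesgue_on U) \<and> set_integrable lebesgue U (\<lambda>x. (norm (f x))\<^sup>2)"

definition locally_square_integrable ::
  "'a set \<Rightarrow> ('a::euclidean_space \<Rightarrow> 'b::euclidean_space) \<Rightarrow> bool"
  where "locally_square_integrable U f \<longleftrightarrow>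
    f \<in> borel_measurable (lebesgue_on U) \<and>
    (\<forall>K. compact K \<and> K \<subseteq> U \<longrightarrow> set_integrable lebesgue K (\<lambda>x. (norm (f x))\<^sup>2))"

text \<open>
  \<open>v \<in> W\<^sup>1\<^sup>,\<^sup>2(U; \<real>\<^sup>N)\<close> with weak gradient \<open>G\<close>. The gradient, which is unique up to null sets, is an
  explicit argument.
\<close>

definition W12 ::
  "(real ^ 'n) set \<Rightarrow> (real ^ 'n \<Rightarrow> real ^ 'N) \<Rightarrow> (real ^ 'n \<Rightarrow> real ^ 'n ^ 'N) \<Rightarrow> bool"
  where "W12 U v G \<longleftrightarrow>
    square_integrable U v \<and> square_integrable U G \<and>
    (\<forall>\<phi> :: real ^ 'n \<Rightarrow> real. test_function U \<phi> \<longrightarrow>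
      (\<forall>j. (LINT x:U|lebesgue. frechet_derivative \<phi> (at x) (axis j 1) *\<^sub>R v x) =
           - (LINT x:U|lebesgue. \<phi> x *\<^sub>R column j (G x))))"

text \<open>
  \<open>u \<in> L\<^sup>2\<^sub>l\<^sub>o\<^sub>c(0, T; W\<^sup>1\<^sup>,\<^sup>2\<^sub>l\<^sub>o\<^sub>c(\<Omega>; \<real>\<^sup>N))\<close>, where \<open>Du\<close> is a jointly measurable representative of the weak
  gradient of \<open>u\<close> in \<open>x\<close>.
\<close>

definition L2loc_W12loc ::
  "(real ^ 'n) set \<Rightarrow> real \<Rightarrow> ((real ^ 'n) \<times> real \<Rightarrow> real ^ 'N) \<Rightarrow>
    ((real ^ 'n) \<times> real \<Rightarrow> real ^ 'n ^ 'N) \<Rightarrow> bool"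
  where "L2loc_W12loc \<Omega> T u Du \<longleftrightarrow>
    u \<in> borel_measurable (lebesgue_on (\<Omega> \<times> {0<..<T})) \<and>
    Du \<in> borel_measurable (lebesgue_on (\<Omega> \<times> {0<..<T})) \<and>
    (\<forall>\<Omega>' t1 t2. open \<Omega>' \<and> compactly_contained \<Omega>' \<Omega> \<and> 0 < t1 \<and> t1 < t2 \<and> t2 < T \<longrightarrow>
      (AE t in lebesgue. t \<in> {t1<..<t2} \<longrightarrow> W12 \<Omega>' (\<lambda>x. u (x, t)) (\<lambda>x. Du (x, t))) \<and>
      set_integrable lebesgue (\<Omega>' \<times> {t1<..<t2})
        (\<lambda>z. (norm (u z))\<^sup>2 + (norm (Du z))\<^sup>2))"

subsection \<open>The parabolic system\<close>

definition caratheodory ::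
  "'z::euclidean_space set \<Rightarrow> ('z \<Rightarrow> 'a::euclidean_space \<Rightarrow> 'a) \<Rightarrow> bool"
  where "caratheodory D \<A> \<longleftrightarrow>
    (\<forall>\<xi>. (\<lambda>z. \<A> z \<xi>) \<in> borel_measurable (lebesgue_on D)) \<and>
    (AE z in lebesgue_on D. continuous_on UNIV (\<A> z))"

definition growth_conditions ::
  "'z::euclidean_space set \<Rightarrow> real \<Rightarrow> real \<Rightarrow> ('z \<Rightarrow> 'a::euclidean_space \<Rightarrow> 'a) \<Rightarrow> bool"
  where "growth_conditions D \<nu> L \<A> \<longleftrightarrow>
    (AE z in lebesgue_on D. \<forall>\<xi>.
      \<nu> * (norm \<xi>)\<^sup>2 \<le> \<A> z \<xi> \<bullet> \<xi> \<and> norm (\<A> z \<xi>) \<le> L * norm \<xi>)"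

definition weak_solution ::
  "(real ^ 'n) set \<Rightarrow> real \<Rightarrow>
    ((real ^ 'n) \<times> real \<Rightarrow> real ^ 'n ^ 'N \<Rightarrow> real ^ 'n ^ 'N) \<Rightarrow>
    ((real ^ 'n) \<times> real \<Rightarrow> real ^ 'n ^ 'N) \<Rightarrow>
    ((real ^ 'n) \<times> real \<Rightarrow> real ^ 'N) \<Rightarrow> ((real ^ 'n) \<times> real \<Rightarrow> real ^ 'n ^ 'N) \<Rightarrow> bool"
  where "weak_solution \<Omega> T \<A> F u Du \<longleftrightarrow>
    L2loc_W12loc \<Omega> T u Du \<and>
    (\<forall>\<phi>. test_function (\<Omega> \<times> {0<..<T}) \<phi> \<longrightarrow>
      (LINT z:\<Omega> \<times> {0<..<T}|lebesgue.
         - (u z \<bullet> time_derivative \<phi> z) + \<A> z (Du z) \<bullet> spatial_gradient \<phi> z) =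
      (LINT z:\<Omega> \<times> {0<..<T}|lebesgue. F z \<bullet> spatial_gradient \<phi> z))"

end

theory Submission
  imports Defs
begin

text \<open>
  The parabolic Sobolev-Poincare inequality in the proof below rests on one scale-by-scale estimate.
  Neither a Sobolev embedding on time slices nor a bound for the solution that is uniform in time is
  used; the equation itself plays the role of the missing time derivative.

  \<^emph>\<open>Gain of integrability.\<close> Let the scalar function \<open>U\<close> have the weak spatial gradient \<open>G\<close> and satisfy
  \<open>U\<^sub>t = div g\<close>. Mollify \<open>U\<close> with a kernel \<open>moll s\<close> adapted to the cylinder of radius \<open>s\<close> in space and
  \<open>s\<^sup>2\<close> in time. The derivative of \<open>moll s\<close> in \<open>s\<close> is a parabolic divergence, so that differentiating
  the mollified function in \<open>s\<close> moves one derivative onto \<open>U\<close>: the spatial part gives \<open>G\<close>, and the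
  temporal part gives, through the equation, \<open>g\<close> with a kernel that is one power of \<open>s\<close> smaller.
  Hence this derivative is at most a constant times the average of \<open>\<bar>G\<bar> + \<bar>g\<bar>\<close> over the cylinder of
  radius \<open>s\<close> (\<open>conv_smoll_le\<close>). Averaging over a cylinder of radius \<open>s\<close> maps \<open>L\<^sup>2\<close> to \<open>L\<^sup>q\<close> with a norm of order
  \<open>s powr (- (n + 2) (1/2 - 1/q))\<close>, and summing over the scales \<open>\<delta> / 2 ^ k\<close> yields a geometric series
  that converges exactly if \<open>q < 2 (1 + 2/n)\<close>. This is \<open>gain_of_integrability\<close>; together with the
  trivial bound for \<open>U * moll \<delta>\<close> by the \<open>L\<^sup>1\<close> norm it becomes \<open>local_Lq_estimate\<close>.

  \<^emph>\<open>Caccioppoli inequality.\<close> The weak equation, mollified, holds pointwise and can be tested with \<open>U\<close>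
  times a cutoff function; since no derivative of \<open>U\<close> in time survives, the identity passes to the
  limit of vanishing scale (\<open>energy_identity\<close>). Ellipticity, growth and Young's inequality turn it
  into \<open>caccioppoli\<close>.

  \<^emph>\<open>From L1 to Lq.\<close> For \<open>q = 2\<close> the gain carries a factor \<open>\<delta>\<^sup>2\<close> against the factor \<open>1 / h\<^sup>2\<close> of the
  Caccioppoli inequality. Taking \<open>\<delta>\<close> a small multiple of \<open>h\<close> makes the \<open>L\<^sup>2\<close> norm on the larger cylinder
  absorbable, and iterating over cylinders between radius \<open>3/2 \<rho>\<close> and \<open>2 \<rho>\<close> bounds the \<open>L\<^sup>2\<close> norm by the
  \<open>L\<^sup>1\<close> norm and the data (\<open>system_L2_estimate\<close>). One more application of the gain, now with the given
  \<open>q\<close>, yields \<open>system_Lq_estimate\<close>. It is applied to \<open>u\<close> minus its mean over the doubled cylinder;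
  changing that mean to the mean over the smaller cylinder costs a constant (\<open>oscillation_estimate\<close>).

  All these estimates concern Borel functions that are square integrable on the whole space-time and
  vanish outside a cylinder. A weak solution is brought into this form by
  \<open>weak_solution_imp_parabolic_system\<close>.
\<close>

section \<open>Calculus of smooth functions\<close>

lemma Ck_Suc_imp_Ck: "Ck (Suc k) f \<Longrightarrow> Ck k f"
proof (induction k arbitrary: f)
  case 0
  then show ?case
    by (auto intro!: differentiable_imp_continuous_on)
next
  case (Suc k)
  then show ?case
    by (metis Ck.simps(2))
qed

lemma Ck_SucI:
  assumes "\<And>x. (f has_derivative f' x) (at x)"
    and "\<And>b. b \<in> Basis \<Longrightarrow> Ck k (\<lambda>x. f' x b)"
  shows "Ck (Suc k) f"
proof -
  have "f differentiable_on UNIV"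
    using assms(1) by (auto simp: differentiable_on_def differentiable_def)
  moreover have "(\<lambda>x. frechet_derivative f (at x) b) = (\<lambda>x. f' x b)" for b
    using frechet_derivative_at[OF assms(1)] by metis
  ultimately show ?thesis
    using assms(2) by simp
qed

lemma Ck_Suc_has_derivative:
  "Ck (Suc k) f \<Longrightarrow> (f has_derivative frechet_derivative f (at x)) (at x)"
  by (auto simp: differentiable_on_def frechet_derivative_works)

lemma Ck_const: "Ck k (\<lambda>x. c)"
proof (induction k arbitrary: c)
  case (Suc k)
  show ?case
    by (rule Ck_SucI[where f' = "\<lambda>_ _. 0"]) (auto intro: Suc)
qed simp

lemma Ck_bounded_linear:
  assumes "bounded_linear f"
  shows "Ck k f"
proof (cases k)
  case 0
  then show ?thesis
    using assms linear_continuous_on by auto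
next
  case (Suc m)
  then show ?thesis
    using Ck_SucI[where f = f and f' = "\<lambda>_. f"] assms
    by (simp add: bounded_linear_imp_has_derivative Ck_const del: Ck.simps)
qed

lemma Ck_add: "Ck k f \<Longrightarrow> Ck k g \<Longrightarrow> Ck k (\<lambda>x. f x + g x)"
proof (induction k arbitrary: f g)
  case 0
  then show ?case by (auto intro: continuous_on_add)
next
  case (Suc k)
  show ?case
    apply (rule Ck_SucI)
     apply (rule has_derivative_add[OF Ck_Suc_has_derivative[OF Suc(2)] Ck_Suc_has_derivative[OF Suc(3)]])
    using Suc by auto
qed

lemma Ck_bilinear:
  assumes B: "bounded_bilinear pr"
  shows "Ck k f \<Longrightarrow> Ck k g \<Longrightarrow> Ck k (\<lambda>x. pr (f x) (g x))"
proof (induction k arbitrary: f g)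
  case 0
  then show ?case by (auto intro: bounded_bilinear.continuous_on[OF B])
next
  case (Suc k)
  show ?case
    apply (rule Ck_SucI)
     apply (rule bounded_bilinear.FDERIV[OF B Ck_Suc_has_derivative[OF Suc(2)] Ck_Suc_has_derivative[OF Suc(3)]])
    using Suc Ck_Suc_imp_Ck[of k f] Ck_Suc_imp_Ck[of k g] by (auto intro!: Ck_add)
qed

text \<open>
  The chain rule for \<open>\<real> \<rightarrow> \<real>\<close> outer functions is all that is composed here; it reduces to the product
  rule, because the derivative of \<open>f \<circ> g\<close> in direction \<open>b\<close> is \<open>f' \<circ> g\<close> times a function of one order
  less.
\<close>

lemma Ck_compose_real:
  fixes f :: "real \<Rightarrow> real" and g :: "'a::euclidean_space \<Rightarrow> real"
  shows "Ck k f \<Longrightarrow> Ck k g \<Longrightarrow> Ck k (\<lambda>x. f (g x))"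
proof (induction k arbitrary: f g)
  case 0
  then show ?case
    by (auto intro!: continuous_on_compose2[of UNIV f UNIV g])
next
  case (Suc k)
  have d: "((\<lambda>x. f (g x)) has_derivative
      (\<lambda>b. frechet_derivative g (at x) b * frechet_derivative f (at (g x)) 1)) (at x)" for x
  proof -
    have lin: "linear (frechet_derivative f (at (g x)))"
      using Ck_Suc_has_derivative[OF Suc(2)] has_derivative_linear by blast
    have "((\<lambda>x. f (g x)) has_derivative
      (\<lambda>b. frechet_derivative f (at (g x)) (frechet_derivative g (at x) b))) (at x)"
      using has_derivative_compose[OF Ck_Suc_has_derivative[OF Suc(3)] Ck_Suc_has_derivative[OF Suc(2)]]
      by simp
    moreover have "frechet_derivative f (at (g x)) r = r * frechet_derivative f (at (g x)) 1" for r
      using linear_cmul[OF lin, of r 1] by simp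
    ultimately show ?thesis
      by (rule has_derivative_eq_rhs[OF _ ext])
  qed
  show ?case
    apply (rule Ck_SucI)
     apply (rule d)
    apply (rule Ck_bilinear[OF bounded_bilinear_mult])
    using Suc(3) apply simp
    apply (rule Suc(1)[where f = "\<lambda>y. frechet_derivative f (at y) 1"])
    using Suc(2) apply simp
    using Ck_Suc_imp_Ck[OF Suc(3)] .
qed

definition smooth :: "('a::euclidean_space \<Rightarrow> 'b::euclidean_space) \<Rightarrow> bool"
  where "smooth f \<longleftrightarrow> (\<forall>k. Ck k f)"

lemma smooth_const [intro]: "smooth (\<lambda>x. c)"
  and smooth_linear: "bounded_linear h \<Longrightarrow> smooth h"
  and smooth_add [intro]: "smooth f \<Longrightarrow> smooth g \<Longrightarrow> smooth (\<lambda>x. f x + g x)"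
  and smooth_scaleR [intro]: "smooth r \<Longrightarrow> smooth f \<Longrightarrow> smooth (\<lambda>x. r x *\<^sub>R f x)"
  and smooth_mult [intro]: "smooth r \<Longrightarrow> smooth r' \<Longrightarrow> smooth (\<lambda>x. r x * r' x)"
  and smooth_inner [intro]: "smooth f' \<Longrightarrow> smooth g' \<Longrightarrow> smooth (\<lambda>x. f' x \<bullet> g' x)"
  and smooth_compose_real: "smooth \<beta> \<Longrightarrow> smooth r \<Longrightarrow> smooth (\<lambda>x. \<beta> (r x))"
  for r r' :: "'a::euclidean_space \<Rightarrow> real" and \<beta> :: "real \<Rightarrow> real"
    and f g :: "'a \<Rightarrow> 'b::euclidean_space" and f' g' :: "'a \<Rightarrow> 'c::euclidean_space"
  by (auto simp: smooth_def Ck_const Ck_bounded_linear Ck_compose_real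
      intro: Ck_bilinear[OF bounded_bilinear_scaleR] Ck_bilinear[OF bounded_bilinear_mult]
        Ck_add Ck_bilinear[OF bounded_bilinear_inner])

lemma smooth_minus [intro]: "smooth f \<Longrightarrow> smooth (\<lambda>x. - f x)"
  using smooth_scaleR[OF smooth_const[of "-1"]] by fastforce

lemma smooth_diff [intro]: "smooth f \<Longrightarrow> smooth g \<Longrightarrow> smooth (\<lambda>x. f x - g x)"
  using smooth_add[OF _ smooth_minus] by fastforce

lemma smooth_fst [intro]: "smooth (fst :: 'a::euclidean_space \<times> 'b::euclidean_space \<Rightarrow> 'a)"
  and smooth_snd [intro]: "smooth (snd :: 'a::euclidean_space \<times> 'b::euclidean_space \<Rightarrow> 'b)"
  by (intro smooth_linear bounded_linear_fst bounded_linear_snd)+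

lemma smooth_has_derivative:
  "smooth f \<Longrightarrow> (f has_derivative frechet_derivative f (at x)) (at x)"
  using Ck_Suc_has_derivative[of 0 f x] unfolding smooth_def by blast

lemma smooth_imp_continuous: "smooth f \<Longrightarrow> continuous_on S f"
  unfolding smooth_def using continuous_on_subset by (metis Ck.simps(1) subset_UNIV)

section \<open>A smooth function supported on a half-line\<close>

text \<open>
  The functions \<open>p(1/x) exp(-1/x)\<close>, extended by zero to \<open>x \<le> 0\<close>, form a family that is closed under
  differentiation, which makes the smoothness at zero an induction on the order.
\<close>

definition flat :: "real poly \<Rightarrow> real \<Rightarrow> real"
  where "flat p x = (if 0 < x then poly p (1 / x) * exp (- (1 / x)) else 0)"

lemma poly_exp_tendsto_0: "((\<lambda>x. poly p x * exp (- x)) \<longlongrightarrow> (0::real)) at_top"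
proof (induction p)
  case (pCons a p)
  have "((\<lambda>x. a * exp (- x) + x * (poly p x * exp (- x))) \<longlongrightarrow> 0) at_top"
  proof -
    have "((\<lambda>x. poly p x * exp (- x) * x) \<longlongrightarrow> 0) at_top" for p :: "real poly"
    proof -
      have e: "poly p x * exp (-x) * x = (\<Sum>i\<le>degree p. coeff p i * (x ^ (Suc i) / exp x))" for x
        by (auto simp: poly_altdef sum_distrib_right exp_minus divide_simps intro!: sum.cong)
      show ?thesis
        unfolding e
        by (rule tendsto_eq_intros tendsto_mult_right_zero tendsto_power_div_exp_0 refl)+ simp
    qed
    then have "((\<lambda>x. x * (poly p x * exp (- x))) \<longlongrightarrow> 0) at_top"
      by (simp add: mult.commute)
    moreover have "((\<lambda>x. a * exp (- x)) \<longlongrightarrow> 0) at_top"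
      by (intro tendsto_mult_right_zero filterlim_compose[OF exp_at_bot] filterlim_uminus_at_bot_at_top)
    ultimately show ?thesis
      using tendsto_add[of "\<lambda>x. a * exp (- x)" 0 at_top "\<lambda>x. x * (poly p x * exp (- x))" 0] by simp
  qed
  then show ?case
    by (simp add: algebra_simps)
qed simp

lemma flat_tendsto_0: "(flat p \<longlongrightarrow> 0) (at 0)"
proof -
  have "((\<lambda>x. poly p (inverse x) * exp (- inverse x)) \<longlongrightarrow> 0) (at_right 0)"
    using filterlim_compose[OF poly_exp_tendsto_0 filterlim_inverse_at_top_right] .
  then have "(flat p \<longlongrightarrow> 0) (at_right 0)"
    by (rule Lim_transform_eventually)
      (auto simp: eventually_at_filter flat_def field_simps)
  moreover have "(flat p \<longlongrightarrow> 0) (at_left 0)"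
    by (rule tendsto_eventually) (auto simp: eventually_at_filter flat_def)
  ultimately show ?thesis
    by (simp add: filterlim_at_split)
qed

text \<open>
  At the origin the difference quotient is again of the form \<open>flat q\<close>, with \<open>q\<close> equal to \<open>p\<close> times the
  variable, and hence tends to zero.
\<close>

lemma flat_deriv:
  "(flat p has_real_derivative flat ([:0,0,1:] * (p - pderiv p)) x) (at x)"
proof -
  consider "x < 0" | "x = 0" | "0 < x" by linarith
  then show ?thesis
  proof cases
    case 1
    have "((\<lambda>_. 0) has_real_derivative 0) (at x)" by simp
    moreover have "\<forall>\<^sub>F y in nhds x. flat p y = 0"
      using eventually_nhds_in_open[of "{..<0}" x] 1
      by (auto elim!: eventually_mono simp: flat_def)
    ultimately show ?thesis
      using 1 DERIV_cong_ev[of x x "flat p" "\<lambda>_. 0"] by (auto simp: flat_def)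
  next
    case 2
    have "((\<lambda>h. flat ([:0,1:] * p) h) \<longlongrightarrow> 0) (at 0)"
      by (rule flat_tendsto_0)
    then have "((\<lambda>h. flat p h / h) \<longlongrightarrow> 0) (at 0)"
      by (rule Lim_transform_eventually) (auto simp: eventually_at_filter flat_def)
    then show ?thesis
      using 2 by (simp add: DERIV_def flat_def)
  next
    case 3
    have "((\<lambda>x. poly p (1 / x) * exp (- (1 / x))) has_real_derivative
        poly (pderiv p) (1 / x) * (- 1 / x\<^sup>2) * exp (- (1 / x)) +
        poly p (1 / x) * (exp (- (1 / x)) * (1 / x\<^sup>2))) (at x)"
      using 3 by (auto intro!: derivative_eq_intros DERIV_chain2[OF poly_DERIV] simp: power2_eq_square)
    moreover have "\<forall>\<^sub>F y in nhds x. flat p y = poly p (1 / y) * exp (- (1 / y))"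
      using eventually_nhds_in_open[of "{0<..}" x] 3
      by (auto elim!: eventually_mono simp: flat_def)
    moreover have "flat ([:0,0,1:] * (p - pderiv p)) x =
        poly (pderiv p) (1 / x) * (- 1 / x\<^sup>2) * exp (- (1 / x)) +
        poly p (1 / x) * (exp (- (1 / x)) * (1 / x\<^sup>2))"
      using 3 by (simp add: flat_def field_simps power2_eq_square)
    ultimately show ?thesis
      using DERIV_cong_ev[of x x "flat p" "\<lambda>y. poly p (1 / y) * exp (- (1 / y))"] by simp
  qed
qed

lemma smooth_flat: "smooth (flat p)"
proof -
  have "Ck k (flat p)" for k
  proof (induction k arbitrary: p)
    case 0
    show ?case
      using DERIV_isCont[OF flat_deriv] by (simp add: continuous_at_imp_continuous_on)
  next
    case (Suc k)
    show ?case
      by (rule Ck_SucI[OF flat_deriv[unfolded has_field_derivative_def]])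
        (auto intro: Suc)
  qed
  then show ?thesis by (simp add: smooth_def)
qed

definition bump :: "real \<Rightarrow> real" where "bump = flat 1"

definition bump' :: "real \<Rightarrow> real" where "bump' = flat [:0, 0, 1:]"

lemma bump_deriv: "(bump has_real_derivative bump' x) (at x)"
  using flat_deriv[of 1 x] by (simp add: bump_def bump'_def)

lemma smooth_bump: "smooth bump" and smooth_bump': "smooth bump'"
  by (simp_all add: bump_def bump'_def smooth_flat)

lemma bump_pos_iff: "0 < bump x \<longleftrightarrow> 0 < x"
  and bump_nonneg: "0 \<le> bump x" and bump_le_1: "bump x \<le> 1"
  and bump_eq_0: "x \<le> 0 \<Longrightarrow> bump x = 0"
  by (auto simp: bump_def flat_def)

text \<open>
  The bound is \<open>y\<^sup>2 exp(-y) \<le> 4\<close> for \<open>y = 1/x\<close>. Any absolute constant would do; it enters the bounds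
  for the derivatives of the kernel.
\<close>

lemma bump'_nonneg: "0 \<le> bump' x" and bump'_le: "bump' x \<le> 4"
  and bump'_eq_0: "x \<le> 0 \<Longrightarrow> bump' x = 0"
proof -
  have "y\<^sup>2 * exp (- y) \<le> 4" if "y > 0" for y :: real
  proof -
    have "(y / 2)\<^sup>2 \<le> (exp (y / 2))\<^sup>2"
      using that exp_ge_add_one_self[of "y/2"] by (intro power_mono) linarith+
    also have "\<dots> = exp y"
      by (simp add: power2_eq_square flip: exp_add)
    finally show ?thesis
      by (simp add: exp_minus field_simps power2_eq_square)
  qed
  from this[of "1/x"] show "bump' x \<le> 4"
    by (auto simp: bump'_def flat_def power2_eq_square)
qed (auto simp: bump'_def flat_def)

section \<open>Differentiation and integration\<close>

text \<open>
  Differentiation under the integral sign. By the mean value theorem the difference quotients of the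
  kernel are bounded by \<open>M\<close>, so that \<open>M \<bar>U\<bar>\<close> dominates.
\<close>

lemma has_real_derivative_integral:
  fixes U :: "'a::euclidean_space \<Rightarrow> real"
  assumes U: "integrable lborel U" and r: "0 < r"
    and d: "\<And>s w. \<bar>s - s0\<bar> < r \<Longrightarrow> ((\<lambda>s. k s w) has_real_derivative k' s w) (at s)"
    and b': "\<And>s w. \<bar>s - s0\<bar> < r \<Longrightarrow> \<bar>k' s w\<bar> \<le> M"
    and b: "\<And>s w. \<bar>s - s0\<bar> < r \<Longrightarrow> \<bar>k s w\<bar> \<le> M'"
    and m: "\<And>s. \<bar>s - s0\<bar> < r \<Longrightarrow> k s \<in> borel_measurable borel"
    and m': "k' s0 \<in> borel_measurable borel"
  shows "((\<lambda>s. \<integral>w. U w * k s w \<partial>lborel) has_real_derivative (\<integral>w. U w * k' s0 w \<partial>lborel)) (at s0)"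
proof -
  have Um [measurable]: "U \<in> borel_measurable borel"
    using U by auto
  have int: "integrable lborel (\<lambda>w. U w * k s w)" if "\<bar>s - s0\<bar> < r" for s
  proof (rule Bochner_Integration.integrable_bound[of _ "\<lambda>w. M' * U w"])
    show "AE w in lborel. norm (U w * k s w) \<le> norm (M' * U w)"
    proof (rule AE_I2)
      fix w
      show "norm (U w * k s w) \<le> norm (M' * U w)"
        using mult_right_mono[OF order_trans[OF b[OF that] abs_ge_self] abs_ge_zero, of w "U w"]
        by (simp add: abs_mult mult.commute)
    qed
    show "integrable lborel (\<lambda>w. M' * U w)"
      using U by simp
    show "(\<lambda>w. U w * k s w) \<in> borel_measurable lborel"
      using m[OF that] by measurable
  qed
  show ?thesis
    unfolding DERIV_def tendsto_at_iff_sequentially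
  proof (intro allI impI)
    fix X :: "nat \<Rightarrow> real"
    assume X0: "\<forall>i. X i \<in> UNIV - {0}" and X: "X \<longlonglongrightarrow> 0"
    from X r have "\<forall>\<^sub>F n in sequentially. \<bar>X n\<bar> < r"
      using order_tendstoD(2)[OF tendsto_rabs_zero[OF X]] by simp
    then obtain N where N: "\<And>n. n \<ge> N \<Longrightarrow> \<bar>X n\<bar> < r"
      by (auto simp: eventually_sequentially)
    let ?q = "\<lambda>n w. U w * ((k (s0 + X (n + N)) w - k s0 w) / X (n + N))"
    have "(\<lambda>n. \<integral>w. ?q n w \<partial>lborel) \<longlonglongrightarrow> (\<integral>w. U w * k' s0 w \<partial>lborel)"
    proof (rule integral_dominated_convergence[where w = "\<lambda>w. \<bar>M * U w\<bar>"])
      show "integrable lborel (\<lambda>w. \<bar>M * U w\<bar>)"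
        using U by auto
      show "(\<lambda>w. U w * k' s0 w) \<in> borel_measurable lborel"
        using m' by measurable
      show "?q n \<in> borel_measurable lborel" for n
      proof -
        have [measurable]: "k (s0 + X (n + N)) \<in> borel_measurable borel" "k s0 \<in> borel_measurable borel"
          using m[of "s0 + X (n+N)"] m[of s0] N[of "n+N"] r by simp_all
        show ?thesis by measurable
      qed
      show "AE w in lborel. (\<lambda>n. ?q n w) \<longlonglongrightarrow> U w * k' s0 w"
      proof (intro AE_I2 tendsto_mult tendsto_const)
        fix w
        have "((\<lambda>h. (k (s0 + h) w - k s0 w) / h) \<longlongrightarrow> k' s0 w) (at 0)"
          using d[of s0 w] r by (simp add: DERIV_def)
        then have "(\<lambda>n. (k (s0 + X n) w - k s0 w) / X n) \<longlonglongrightarrow> k' s0 w"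
          unfolding tendsto_at_iff_sequentially using X0 X by (auto simp: o_def)
        then show "(\<lambda>n. (k (s0 + X (n + N)) w - k s0 w) / X (n + N)) \<longlonglongrightarrow> k' s0 w"
          by (rule LIMSEQ_ignore_initial_segment)
      qed
      show "AE w in lborel. norm (?q n w) \<le> \<bar>M * U w\<bar>" for n
      proof (intro AE_I2)
        fix w
        let ?h = "X (n + N)"
        have h: "\<bar>?h\<bar> < r" "?h \<noteq> 0"
          using N X0 by auto
        have "norm (k (s0 + ?h) w - k s0 w) \<le> M * norm (s0 + ?h - s0)"
        proof (rule field_differentiable_bound[where S = "{s0 - r<..<s0 + r}" and f' = "\<lambda>s. k' s w"])
          show "((\<lambda>s. k s w) has_field_derivative k' z w) (at z within {s0 - r<..<s0 + r})"
            if "z \<in> {s0 - r<..<s0 + r}" for z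
            using d[of z w] that by (auto intro: has_field_derivative_at_within simp: abs_less_iff)
          show "norm (k' z w) \<le> M" if "z \<in> {s0 - r<..<s0 + r}" for z
            using b'[of z w] that by (auto simp: abs_less_iff)
        qed (use h in \<open>auto simp: abs_less_iff\<close>)
        then have "\<bar>(k (s0 + ?h) w - k s0 w) / ?h\<bar> \<le> M"
          using h by (simp add: divide_simps)
        then show "norm (?q n w) \<le> \<bar>M * U w\<bar>"
          using mult_left_mono[OF order_trans[OF _ abs_ge_self] abs_ge_zero, of _ M "U w"]
            by (simp only: abs_mult mult.commute[of M] real_norm_def)
      qed
    qed
    moreover have "(\<integral>w. ?q n w \<partial>lborel) =
        ((\<integral>w. U w * k (s0 + X (n + N)) w \<partial>lborel) - (\<integral>w. U w * k s0 w \<partial>lborel)) / X (n + N)" for n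
    proof -
      let ?F = "\<lambda>w. U w * k (s0 + X (n + N)) w" and ?G = "\<lambda>w. U w * k s0 w"
      have "(\<integral>w. ?F w - ?G w \<partial>lborel) = (\<integral>w. ?F w \<partial>lborel) - (\<integral>w. ?G w \<partial>lborel)"
        using int[of "s0 + X (n + N)"] int[of s0] N[of "n+N"] r
        by (intro Bochner_Integration.integral_diff) simp_all
      moreover have "?q n = (\<lambda>w. (?F w - ?G w) / X (n + N))"
        by (rule ext) (simp only: right_diff_distrib times_divide_eq_right)
      ultimately show ?thesis
        by (simp only: integral_divide_zero)
    qed
    ultimately show "((\<lambda>h. ((\<integral>w. U w * k (s0 + h) w \<partial>lborel) - (\<integral>w. U w * k s0 w \<partial>lborel)) / h) \<circ> X)
        \<longlonglongrightarrow> (\<integral>w. U w * k' s0 w \<partial>lborel)"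
      unfolding o_def by - (rule LIMSEQ_offset[where k = N], simp only:)
  qed
qed

lemma distr_lborel_reflect: "distr lborel borel (\<lambda>w. z - w) = (lborel :: 'a::euclidean_space measure)"
  using lborel_affine[of "-1" z] by (simp add: density_1)

lemma nn_integral_reflect:
  fixes z :: "'a::euclidean_space"
  assumes [measurable]: "f \<in> borel_measurable borel"
  shows "(\<integral>\<^sup>+w. f (z - w) \<partial>lborel) = (\<integral>\<^sup>+w. f w \<partial>lborel)"
proof -
  have "(\<integral>\<^sup>+w. f w \<partial>lborel) = (\<integral>\<^sup>+w. f w \<partial>(distr lborel borel (\<lambda>w. z - w)))"
    by (simp add: distr_lborel_reflect)
  also have "\<dots> = (\<integral>\<^sup>+w. f (z - w) \<partial>lborel)"
    by (rule nn_integral_distr) auto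
  finally show ?thesis by simp
qed

lemma nn_integral_translate:
  fixes z :: "'a::euclidean_space"
  assumes [measurable]: "f \<in> borel_measurable borel"
  shows "(\<integral>\<^sup>+w. f (w - z) \<partial>lborel) = (\<integral>\<^sup>+w. f w \<partial>lborel)"
  using nn_integral_reflect[of "\<lambda>w. f (- w)" z] nn_integral_reflect[of f 0] by simp

lemma integral_reflect:
  fixes z :: "'a::euclidean_space" and f :: "'a \<Rightarrow> real"
  assumes [measurable]: "f \<in> borel_measurable borel"
  shows "(\<integral>w. f (z - w) \<partial>lborel) = (\<integral>w. f w \<partial>lborel)"
proof -
  have "(\<integral>w. f w \<partial>lborel) = (\<integral>w. f w \<partial>(distr lborel borel (\<lambda>w. z - w)))"
    by (simp add: distr_lborel_reflect)
  also have "\<dots> = (\<integral>w. f (z - w) \<partial>lborel)"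
    by (rule integral_distr) auto
  finally show ?thesis by simp
qed

lemma integral_translate:
  fixes z :: "'a::euclidean_space" and f :: "'a \<Rightarrow> real"
  assumes [measurable]: "f \<in> borel_measurable borel"
  shows "(\<integral>w. f (w - z) \<partial>lborel) = (\<integral>w. f w \<partial>lborel)"
  using integral_reflect[of "\<lambda>w. f (- w)" z] integral_reflect[of f 0] by simp

lemma integrable_indicator_cball:
  "integrable lborel (indicator (cball (z::'a::euclidean_space) R) :: 'a \<Rightarrow> real)"
  by (rule integrable_real_indicator[OF _ emeasure_bounded_finite]) auto

lemma integrable_bounded_support:
  fixes f :: "'a::euclidean_space \<Rightarrow> real"
  assumes "f \<in> borel_measurable borel" "\<And>z. \<bar>f z\<bar> \<le> M" "bounded K" "\<And>z. z \<notin> K \<Longrightarrow> f z = 0"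
  shows "integrable lborel f"
proof -
  obtain R where "\<forall>z\<in>K. norm z \<le> R"
    using assms(3) unfolding bounded_iff by blast
  then have R: "K \<subseteq> cball 0 R"
    by auto
  have "integrable lborel (\<lambda>z::'a. M * indicator (cball 0 R) z)"
    by (intro integrable_mult_right integrable_indicator_cball)
  then show ?thesis
  proof (rule Bochner_Integration.integrable_bound)
    show "AE z in lborel. norm (f z) \<le> norm (M * indicator (cball 0 R) z)"
    proof (rule AE_I2)
      fix z
      show "norm (f z) \<le> norm (M * indicator (cball 0 R) z)"
        using assms(2)[of z] assms(4)[of z] R by (cases "z \<in> K") (auto simp: subset_iff)
    qed
  qed (use assms in auto)
qed

text \<open>
  Integration by parts in its simplest form. Difference quotients in direction \<open>e\<close> have integral zero by
  translation invariance and are bounded, with a common bounded support; pass to the limit. Only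
  differentiability in the one direction \<open>e\<close> enters, so the lemma applies to products of mollified
  functions with cutoff functions that are merely once differentiable.
\<close>

lemma integral_directional_derivative_0:
  fixes f :: "'a::euclidean_space \<Rightarrow> real"
  assumes f [measurable]: "f \<in> borel_measurable borel" and fM: "\<And>z. \<bar>f z\<bar> \<le> M'" and K: "bounded K" "\<And>z. z \<notin> K \<Longrightarrow> f z = 0"
    and d: "\<And>z. ((\<lambda>s. f (z + s *\<^sub>R e)) has_real_derivative f' z) (at 0)"
    and M: "\<And>z. \<bar>f' z\<bar> \<le> M" and f' [measurable]: "f' \<in> borel_measurable borel"
  shows "(\<integral>z. f' z \<partial>lborel) = 0"
proof -
  have M0: "0 \<le> M" using M[of 0] by linarith
  have ds: "((\<lambda>s. f (z + s *\<^sub>R e)) has_real_derivative f' (z + s *\<^sub>R e)) (at s)" for z s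
    using d[of "z + s *\<^sub>R e"] DERIV_shift[of "\<lambda>s. f (z + s *\<^sub>R e)" "f' (z + s *\<^sub>R e)" 0 s]
    by (simp add: algebra_simps)
  have lip: "\<bar>f (z + s *\<^sub>R e) - f z\<bar> \<le> M * \<bar>s\<bar>" for z s
    using field_differentiable_bound[of UNIV "\<lambda>s. f (z + s *\<^sub>R e)" "\<lambda>s. f' (z + s *\<^sub>R e)" M 0 s] ds M
    by simp
  obtain B where B: "\<And>z. z \<in> K \<Longrightarrow> norm z \<le> B"
    using K by (auto simp: bounded_iff)
  let ?h = "\<lambda>n. 1 / real (Suc n)"
  let ?q = "\<lambda>n z. (f (z + ?h n *\<^sub>R e) - f z) / ?h n"
  have if0: "integrable lborel f"
    by (rule integrable_bounded_support[OF f fM K])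
  have "(\<lambda>n. \<integral>z. ?q n z \<partial>lborel) \<longlonglongrightarrow> (\<integral>z. f' z \<partial>lborel)"
  proof (rule integral_dominated_convergence[where w = "\<lambda>z. M * indicator (cball 0 (B + norm e)) z"])
    show "integrable lborel (\<lambda>z. M * indicator (cball 0 (B + norm e)) z)"
      by (intro integrable_mult_right integrable_indicator_cball)
    show "AE z in lborel. (\<lambda>n. ?q n z) \<longlonglongrightarrow> f' z"
    proof (rule AE_I2)
      fix z
      have "((\<lambda>h. (f (z + h *\<^sub>R e) - f z) / h) \<longlongrightarrow> f' z) (at 0)"
        using d[of z] by (simp add: DERIV_def)
      note * = this[unfolded tendsto_at_iff_sequentially, rule_format, of ?h]
      have "((\<lambda>h. (f (z + h *\<^sub>R e) - f z) / h) \<circ> ?h) \<longlonglongrightarrow> f' z"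
        by (rule *) (simp, rule lim_1_over_n[THEN LIMSEQ_Suc])
      then show "(\<lambda>n. ?q n z) \<longlonglongrightarrow> f' z"
        by (simp only: o_def)
    qed
    show "AE z in lborel. norm (?q n z) \<le> M * indicator (cball 0 (B + norm e)) z" for n
    proof (rule AE_I2)
      fix z
      show "norm (?q n z) \<le> M * indicator (cball 0 (B + norm e)) z"
      proof (cases "z \<in> cball 0 (B + norm e)")
        case True
        then show ?thesis using lip[of z "?h n"]
          by (simp only: abs_divide real_norm_def) (simp add: pos_divide_le_eq pos_le_divide_eq abs_of_nonneg)
      next
        case False
        then have "B + norm e < norm z" by simp
        moreover have "norm (?h n *\<^sub>R e) \<le> norm e"
          using mult_left_mono[of 1 "1 + real n" "norm e"] by (simp add: divide_simps)
        moreover have "norm z \<le> norm (z + ?h n *\<^sub>R e) + norm (?h n *\<^sub>R e)"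
          using norm_triangle_ineq4[of "z + ?h n *\<^sub>R e" "?h n *\<^sub>R e"] by simp
        ultimately have "z + ?h n *\<^sub>R e \<notin> K" "z \<notin> K"
          using B[of z] B[of "z + ?h n *\<^sub>R e"] norm_ge_zero[of e] by linarith+
        then show ?thesis using K(2) M0 by simp
      qed
    qed
    show "?q n \<in> borel_measurable lborel" for n by measurable
  qed (use f' in measurable)
  moreover have "(\<integral>z. ?q n z \<partial>lborel) = 0" for n
  proof -
    have "integrable lborel (\<lambda>z. f (z + ?h n *\<^sub>R e))"
    proof -
      have "integrable (distr lborel borel ((+) (?h n *\<^sub>R e))) f"
        using if0 by (simp only: lborel_distr_plus)
      then show ?thesis
        by (subst (asm) integrable_distr_eq) (auto simp: add.commute)
    qed
    moreover have "(\<integral>z. f (z + ?h n *\<^sub>R e) \<partial>lborel) = (\<integral>z. f z \<partial>lborel)"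
      using integral_translate[of f "- (?h n *\<^sub>R e)"] by simp
    ultimately have "(\<integral>z. f (z + ?h n *\<^sub>R e) - f z \<partial>lborel) = 0"
      using if0 by (subst Bochner_Integration.integral_diff) auto
    then show ?thesis by (simp only: integral_divide_zero)
  qed
  ultimately have "(\<lambda>n. 0) \<longlonglongrightarrow> (\<integral>z. f' z \<partial>lborel)"
    by (simp only:)
  from LIMSEQ_unique[OF this tendsto_const] show ?thesis .
qed

section \<open>Square-integrable functions\<close>

definition L2 :: "('a::euclidean_space \<Rightarrow> real) \<Rightarrow> bool"
  where "L2 f \<longleftrightarrow> f \<in> borel_measurable borel \<and> integrable lborel (\<lambda>z. (f z)\<^sup>2)"

definition N2 :: "('a::euclidean_space \<Rightarrow> real) \<Rightarrow> real"
  where "N2 f = sqrt (\<integral>z. (f z)\<^sup>2 \<partial>lborel)"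

lemma L2_measurable [measurable_dest]: "L2 f \<Longrightarrow> f \<in> borel_measurable borel"
  by (simp add: L2_def)

lemma L2_mult_integrable: "L2 f \<Longrightarrow> L2 g \<Longrightarrow> integrable lborel (\<lambda>z. f z * g z)"
proof (rule Bochner_Integration.integrable_bound[of _ "\<lambda>z. (f z)\<^sup>2 + (g z)\<^sup>2"])
  assume fg: "L2 f" "L2 g"
  then show "integrable lborel (\<lambda>z. (f z)\<^sup>2 + (g z)\<^sup>2)"
    by (simp add: L2_def)
  show "(\<lambda>z. f z * g z) \<in> borel_measurable lborel"
    using fg by measurable
  show "AE z in lborel. norm (f z * g z) \<le> norm ((f z)\<^sup>2 + (g z)\<^sup>2)"
  proof (rule AE_I2)
    fix z
    have "2 * (\<bar>f z\<bar> * \<bar>g z\<bar>) \<le> (f z)\<^sup>2 + (g z)\<^sup>2"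
      using sum_squares_bound[of "\<bar>f z\<bar>" "\<bar>g z\<bar>"] by simp
    moreover have "0 \<le> \<bar>f z\<bar> * \<bar>g z\<bar>" by simp
    ultimately have "\<bar>f z\<bar> * \<bar>g z\<bar> \<le> (f z)\<^sup>2 + (g z)\<^sup>2"
      by linarith
    then show "norm (f z * g z) \<le> norm ((f z)\<^sup>2 + (g z)\<^sup>2)"
      by (simp add: abs_mult)
  qed
qed

lemma L2_add: "L2 f \<Longrightarrow> L2 g \<Longrightarrow> L2 (\<lambda>z. f z + g z)"
  and L2_cmult: "L2 f \<Longrightarrow> L2 (\<lambda>z. c * f z)"
proof -
  assume fg: "L2 f" "L2 g"
  show "L2 (\<lambda>z. f z + g z)"
    unfolding L2_def power2_sum
    using fg L2_mult_integrable[OF fg] unfolding L2_def by (auto simp: mult.assoc)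
next
  assume "L2 f" then show "L2 (\<lambda>z. c * f z)"
    unfolding L2_def by (auto simp: power_mult_distrib)
qed

lemma L2_diff: "L2 f \<Longrightarrow> L2 g \<Longrightarrow> L2 (\<lambda>z. f z - g z)"
  using L2_add[of f "\<lambda>z. (-1) * g z"] L2_cmult[of g "-1"] by simp

lemma L2_bounded_mult:
  assumes f: "L2 f" and h: "h \<in> borel_measurable borel" "\<And>z. \<bar>h z\<bar> \<le> M"
  shows "L2 (\<lambda>z. h z * f z)"
  unfolding L2_def
proof
  show "integrable lborel (\<lambda>z. (h z * f z)\<^sup>2)"
  proof (rule Bochner_Integration.integrable_bound[of _ "\<lambda>z. M\<^sup>2 * (f z)\<^sup>2"])
    have "(h z)\<^sup>2 \<le> M\<^sup>2" for z
      using h(2)[of z] by (metis abs_ge_zero abs_le_square_iff abs_of_nonneg order_trans)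
    then show "AE z in lborel. norm ((h z * f z)\<^sup>2) \<le> norm (M\<^sup>2 * (f z)\<^sup>2)"
      by (intro AE_I2) (simp add: power_mult_distrib mult_right_mono)
  qed (use f h in \<open>auto simp: L2_def\<close>)
qed (use f h in \<open>auto simp: L2_def\<close>)

lemma N2_nonneg: "0 \<le> N2 f"
  by (simp add: N2_def)

lemma N2_square: "(N2 f)\<^sup>2 = (\<integral>z. (f z)\<^sup>2 \<partial>lborel)"
  by (simp add: N2_def)

lemma N2_cauchy_schwarz:
  assumes "L2 f" "L2 g"
  shows "(\<integral>z. \<bar>f z * g z\<bar> \<partial>lborel) \<le> N2 f * N2 g"
proof -
  have fg: "integrable lborel (\<lambda>z. \<bar>f z * g z\<bar>)"
    using L2_mult_integrable[OF assms] by simp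
  have "(\<integral>\<^sup>+z. ennreal \<bar>f z\<bar> * ennreal \<bar>g z\<bar> \<partial>lborel)\<^sup>2 \<le>
      (\<integral>\<^sup>+z. (ennreal \<bar>f z\<bar>)\<^sup>2 \<partial>lborel) * (\<integral>\<^sup>+z. (ennreal \<bar>g z\<bar>)\<^sup>2 \<partial>lborel)"
    using assms by (intro Cauchy_Schwarz_nn_integral) auto
  moreover have "(\<integral>\<^sup>+z. ennreal \<bar>f z\<bar> * ennreal \<bar>g z\<bar> \<partial>lborel) = ennreal (\<integral>z. \<bar>f z * g z\<bar> \<partial>lborel)"
    using fg by (subst nn_integral_eq_integral[symmetric]) (auto simp: abs_mult ennreal_mult)
  moreover have "(\<integral>\<^sup>+z. (ennreal \<bar>f z\<bar>)\<^sup>2 \<partial>lborel) = ennreal ((N2 f)\<^sup>2)" if "L2 f" for f :: "'a \<Rightarrow> real"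
    using that unfolding N2_square L2_def
    by (subst nn_integral_eq_integral[symmetric]) (auto simp: ennreal_power)
  ultimately have "ennreal ((\<integral>z. \<bar>f z * g z\<bar> \<partial>lborel)\<^sup>2) \<le> ennreal ((N2 f * N2 g)\<^sup>2)"
    using assms by (simp add: ennreal_power power_mult_distrib flip: ennreal_mult)
  then have "(\<integral>z. \<bar>f z * g z\<bar> \<partial>lborel)\<^sup>2 \<le> (N2 f * N2 g)\<^sup>2"
    by (simp add: ennreal_le_iff)
  then show ?thesis
    by (rule power2_le_imp_le) (simp add: N2_nonneg)
qed

lemma N2_abs_integral_mult_le:
  assumes "L2 f" "L2 g"
  shows "\<bar>\<integral>z. f z * g z \<partial>lborel\<bar> \<le> N2 f * N2 g"
  using N2_cauchy_schwarz[OF assms] integral_abs_bound[of lborel "\<lambda>z. f z * g z"] by linarith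

lemma N2_triangle:
  assumes "L2 f" "L2 g"
  shows "N2 (\<lambda>z. f z + g z) \<le> N2 f + N2 g"
proof (rule power2_le_imp_le)
  have "(N2 (\<lambda>z. f z + g z))\<^sup>2 = (N2 f)\<^sup>2 + (N2 g)\<^sup>2 + 2 * (\<integral>z. f z * g z \<partial>lborel)"
    using assms L2_mult_integrable[OF assms]
    by (simp add: N2_square power2_sum L2_def mult.assoc)
  also have "\<dots> \<le> (N2 f + N2 g)\<^sup>2"
    using N2_abs_integral_mult_le[OF assms] by (simp add: power2_sum)
  finally show "(N2 (\<lambda>z. f z + g z))\<^sup>2 \<le> (N2 f + N2 g)\<^sup>2" .
qed (simp add: N2_nonneg)

lemma N2_minus_commute: "N2 (\<lambda>z. f z - g z) = N2 (\<lambda>z. g z - f z)"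
  by (simp add: N2_def power2_commute)

lemma N2_mono:
  assumes "L2 g" "f \<in> borel_measurable borel" "\<And>z. \<bar>f z\<bar> \<le> \<bar>g z\<bar>"
  shows "L2 f" "N2 f \<le> N2 g"
proof -
  have le: "(f z)\<^sup>2 \<le> (g z)\<^sup>2" for z
    using assms(3) by (simp add: abs_le_square_iff)
  show f: "L2 f"
    unfolding L2_def
    using assms le
    by (auto simp: L2_def intro!: Bochner_Integration.integrable_bound[of lborel "\<lambda>z. (g z)\<^sup>2" "\<lambda>z. (f z)\<^sup>2"])
  then show "N2 f \<le> N2 g"
    unfolding N2_def using assms le by (auto simp: L2_def intro!: integral_mono)
qed

lemma N2_tendsto_dominated:
  fixes f :: "nat \<Rightarrow> 'a::euclidean_space \<Rightarrow> real"
  assumes "\<And>n. f n \<in> borel_measurable borel" and "L2 g"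
    and "\<And>n z. \<bar>f n z\<bar> \<le> \<bar>g z\<bar>" and "AE z in lborel. (\<lambda>n. f n z) \<longlonglongrightarrow> 0"
  shows "(\<lambda>n. N2 (f n)) \<longlonglongrightarrow> 0"
proof -
  have "(\<lambda>n. \<integral>z. (f n z)\<^sup>2 \<partial>lborel) \<longlonglongrightarrow> (\<integral>z. 0 \<partial>(lborel :: 'a measure))"
  proof (rule integral_dominated_convergence[where w = "\<lambda>z. (g z)\<^sup>2"])
    show "AE z in lborel. (\<lambda>n. (f n z)\<^sup>2) \<longlonglongrightarrow> 0"
      using assms(4) tendsto_power[of _ "0::real" _ 2] by (auto elim!: eventually_mono)
    show "AE z in lborel. norm ((f n z)\<^sup>2) \<le> (g z)\<^sup>2" for n
      using assms(3) by (simp add: abs_le_square_iff)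
  qed (use assms in \<open>auto simp: L2_def\<close>)
  then have "(\<lambda>n. \<integral>z. (f n z)\<^sup>2 \<partial>lborel) \<longlonglongrightarrow> 0" by simp
  from tendsto_real_sqrt[OF this] show ?thesis
    by (simp add: N2_def)
qed

lemma L2_bounded_support:
  assumes "f \<in> borel_measurable borel" "\<And>z. \<bar>f z\<bar> \<le> M" "bounded K" "\<And>z. z \<notin> K \<Longrightarrow> f z = 0"
  shows "L2 f"
proof -
  have "(f z)\<^sup>2 \<le> M\<^sup>2" for z
    using assms(2)[of z] by (metis abs_ge_zero abs_le_square_iff abs_of_nonneg order_trans)
  then show ?thesis
    using assms by (auto simp: L2_def intro!: integrable_bounded_support[where M="M\<^sup>2" and K = K])
qed

lemma L2_bounded_support_integrable:
  fixes f :: "'a::euclidean_space \<Rightarrow> real"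
  assumes f: "L2 f" and K: "bounded K" "\<And>z. z \<notin> K \<Longrightarrow> f z = 0"
  shows "integrable lborel f"
proof -
  obtain R where "\<forall>z\<in>K. norm z \<le> R"
    using K unfolding bounded_iff by blast
  then have R: "z \<in> cball 0 R" if "z \<in> K" for z
    using that by auto
  have "L2 (indicator (cball (0::'a) R) :: 'a \<Rightarrow> real)"
    by (rule L2_bounded_support[where M = 1 and K = "cball 0 R"])
      (auto intro: borel_measurable_indicator split: split_indicator)
  from L2_mult_integrable[OF this f] have "integrable lborel (\<lambda>z. indicator (cball 0 R) z * f z)" .
  moreover have "indicator (cball 0 R) z * f z = f z" for z
    using K(2)[of z] R[of z] by (auto simp: indicator_def)
  ultimately show ?thesis by simp
qed

text \<open>
  A measurable function is almost everywhere a limit of continuous ones. Clamping these to the range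
  of \<open>U\<close> and multiplying them by a continuous cutoff makes the convergence dominated.
\<close>

lemma L2_approx_continuous_bounded:
  fixes U :: "'a::euclidean_space \<Rightarrow> real"
  assumes U: "U \<in> borel_measurable borel" "\<And>z. \<bar>U z\<bar> \<le> M"
    and z: "\<And>z. z \<notin> cball 0 R \<Longrightarrow> U z = 0" and t: "0 < \<tau>"
  shows "\<exists>c. continuous_on UNIV c \<and> (\<forall>z. z \<notin> cball 0 (R + 1) \<longrightarrow> c z = 0) \<and>
    L2 c \<and> N2 (\<lambda>z. U z - c z) < \<tau>"
proof -
  have M0: "0 \<le> M" using U(2)[of 0] by linarith
  have "U \<in> borel_measurable (lebesgue_on UNIV)"
    using U(1) by (simp add: measurable_completion borel_measurable_if_D)
  then have "U measurable_on UNIV"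
    by (intro lebesgue_measurable_imp_measurable_on_real) auto
  then obtain N g where N: "negligible N" and g: "\<And>n. continuous_on UNIV (g n)"
    and lim: "\<And>x. x \<notin> N \<Longrightarrow> (\<lambda>n. g n x) \<longlonglongrightarrow> U x"
    unfolding measurable_on_def by auto
  define ct where "ct z = max 0 (min 1 (R + 1 - norm z))" for z :: 'a
  define c where "c n z = ct z * max (-M) (min M (g n z))" for n :: nat and z
  have c: "continuous_on UNIV (c n)" for n
    unfolding c_def ct_def by (intro continuous_intros g)
  have [measurable]: "c n \<in> borel_measurable borel" for n
    using c by (rule borel_measurable_continuous_onI)
  have cM: "\<bar>c n z\<bar> \<le> M" for n z
  proof -
    have "\<bar>c n z\<bar> \<le> 1 * M"
      unfolding c_def abs_mult using M0 by (intro mult_mono) (auto simp: ct_def)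
    then show ?thesis by simp
  qed
  have c0: "c n z = 0" if "z \<notin> cball 0 (R + 1)" for n z
    using that by (simp add: c_def ct_def)
  have cL: "L2 (c n)" for n
    using cM c0 by (intro L2_bounded_support[where K = "cball 0 (R+1)"]) auto
  have UL: "L2 U"
    using U z by (intro L2_bounded_support[where K = "cball 0 R"]) auto
  have "(\<lambda>n. N2 (\<lambda>z. U z - c n z)) \<longlonglongrightarrow> 0"
  proof (rule N2_tendsto_dominated)
    show "L2 (\<lambda>z. 2 * M * indicator (cball (0::'a) (R + 1)) z)"
      using M0 by (intro L2_bounded_support[where K = "cball 0 (R+1)" and M = "2 * M"])
        (auto intro!: borel_measurable_times borel_measurable_indicator split: split_indicator)
    show "\<bar>U z - c n z\<bar> \<le> \<bar>2 * M * indicator (cball (0::'a) (R + 1)) z\<bar>" for n z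
    proof (cases "z \<in> cball 0 (R + 1)")
      case True
      then show ?thesis
        using U(2)[of z] cM[of n z] M0 by simp
    next
      case False
      then have "z \<notin> cball 0 R" by auto
      with False show ?thesis
        using c0[of z n] z[of z] by simp
    qed
    have "AE z in lborel. z \<notin> N"
      using AE_not_in[OF N[unfolded negligible_iff_null_sets]] by (simp only: AE_completion_iff)
    then show "AE z in lborel. (\<lambda>n. U z - c n z) \<longlonglongrightarrow> 0"
    proof eventually_elim
      case (elim z)
      have "(\<lambda>n. c n z) \<longlonglongrightarrow> ct z * max (-M) (min M (U z))"
        unfolding c_def by (intro tendsto_intros lim elim)
      moreover have "ct z * max (-M) (min M (U z)) = U z"
      proof (cases "z \<in> cball 0 R")
        case True
        then have "ct z = 1" by (simp add: ct_def)
        then show ?thesis using U(2)[of z] M0 by (auto simp: max_def min_def abs_le_iff)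
      next
        case False
        then show ?thesis using z[of z] M0 by (simp add: max_def min_def)
      qed
      ultimately have "(\<lambda>n. c n z) \<longlonglongrightarrow> U z" by simp
      from tendsto_diff[OF tendsto_const[of "U z"] this] show ?case by simp
    qed
  qed (use U in measurable)
  from order_tendstoD(2)[OF this t] obtain n where "N2 (\<lambda>z. U z - c n z) < \<tau>"
    by (auto simp: eventually_sequentially)
  then show ?thesis
    using c[of n] c0[of _ n] cL[of n] by blast
qed

text \<open>
  Truncation reduces the claim to bounded functions.
\<close>

lemma L2_approx_continuous:
  fixes U :: "'a::euclidean_space \<Rightarrow> real"
  assumes U: "L2 U" and z: "\<And>z. z \<notin> cball 0 R \<Longrightarrow> U z = 0" and t: "0 < \<tau>"
  shows "\<exists>c. continuous_on UNIV c \<and> (\<forall>z. z \<notin> cball 0 (R + 1) \<longrightarrow> c z = 0) \<and>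
    L2 c \<and> N2 (\<lambda>z. U z - c z) < \<tau>"
proof -
  define V where "V n z = max (- real n) (min (real n) (U z))" for n z
  have [measurable]: "U \<in> borel_measurable borel"
    using U by (simp add: L2_def)
  have VU: "\<bar>V n z\<bar> \<le> \<bar>U z\<bar>" "\<bar>U z - V n z\<bar> \<le> \<bar>U z\<bar>" "\<bar>V n z\<bar> \<le> real n" for n z
    by (auto simp: V_def max_def min_def)
  have "(\<lambda>n. N2 (\<lambda>z. U z - V n z)) \<longlonglongrightarrow> 0"
  proof (rule N2_tendsto_dominated[OF _ U VU(2)])
    show "AE z in lborel. (\<lambda>n. U z - V n z) \<longlonglongrightarrow> 0"
    proof (rule AE_I2)
      fix z
      obtain m where m: "\<bar>U z\<bar> < real m" using reals_Archimedean2 by blast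
      have "U z - V n z = 0" if "m \<le> n" for n
        using that m by (auto simp: V_def)
      then show "(\<lambda>n. U z - V n z) \<longlonglongrightarrow> 0"
        by (intro tendsto_eventually) (auto simp: eventually_sequentially)
    qed
  qed (unfold V_def, measurable)
  from order_tendstoD(2)[OF this, of "\<tau>/2"] t obtain n where n: "N2 (\<lambda>z. U z - V n z) < \<tau> / 2"
    by (auto simp: eventually_sequentially)
  have Vm: "V n \<in> borel_measurable borel" unfolding V_def by measurable
  have VL: "L2 (V n)" using N2_mono(1)[OF U Vm VU(1)] .
  have "V n z = 0" if "z \<notin> cball 0 R" for z
    using z[OF that] by (simp add: V_def)
  from L2_approx_continuous_bounded[OF Vm VU(3) this half_gt_zero[OF t]]
  obtain c where c: "continuous_on UNIV c" "\<forall>z. z \<notin> cball 0 (R + 1) \<longrightarrow> c z = 0"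
      "L2 c" "N2 (\<lambda>z. V n z - c z) < \<tau> / 2"
    by blast
  have "N2 (\<lambda>z. U z - c z) \<le> N2 (\<lambda>z. U z - V n z) + N2 (\<lambda>z. V n z - c z)"
    using N2_triangle[OF L2_diff[OF U VL] L2_diff[OF VL c(3)]] by simp
  with n c(4) have "N2 (\<lambda>z. U z - c z) < \<tau>" by linarith
  with c(1-3) show ?thesis by blast
qed

section \<open>Convolution with mollifiers\<close>

definition conv :: "('a::euclidean_space \<Rightarrow> real) \<Rightarrow> ('a \<Rightarrow> real) \<Rightarrow> 'a \<Rightarrow> real"
  where "conv U m z = (\<integral>w. U w * m (z - w) \<partial>lborel)"

definition mollifier :: "('a::euclidean_space \<Rightarrow> real) \<Rightarrow> bool"
  where "mollifier m \<longleftrightarrow> m \<in> borel_measurable borel \<and> (\<forall>y. 0 \<le> m y) \<and> (\<exists>M. \<forall>y. m y \<le> M) \<and>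
    (\<integral>y. m y \<partial>lborel) = 1"

lemma mollifierD:
  assumes "mollifier m"
  shows "m \<in> borel_measurable borel" "0 \<le> m y" "(\<integral>y. m y \<partial>lborel) = 1" "integrable lborel m"
    "(\<integral>w. m (z - w) \<partial>lborel) = 1" "(\<integral>\<^sup>+w. ennreal (m (w - z)) \<partial>lborel) = 1"
    "integrable lborel (\<lambda>w. m (z - w))"
proof -
  show m [measurable]: "m \<in> borel_measurable borel" and m0: "0 \<le> m y"
    and m1: "(\<integral>y. m y \<partial>lborel) = 1" for y
    using assms by (auto simp: mollifier_def)
  show mi: "integrable lborel m"
    using m1 not_integrable_integral_eq by fastforce
  show mz: "(\<integral>w. m (z - w) \<partial>lborel) = 1" for z
    using integral_reflect[OF m] m1 by simp
  show "integrable lborel (\<lambda>w. m (z - w))"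
    using mz not_integrable_integral_eq by fastforce
  have "(\<integral>\<^sup>+w. ennreal (m w) \<partial>lborel) = ennreal (\<integral>y. m y \<partial>lborel)"
    by (rule nn_integral_eq_integral[OF mi]) (simp add: m0)
  then show "(\<integral>\<^sup>+w. ennreal (m (w - z)) \<partial>lborel) = 1"
    using nn_integral_translate[of "\<lambda>w. ennreal (m w)" z] m1 by simp
qed

lemma conv_measurable [measurable]:
  assumes [measurable]: "U \<in> borel_measurable borel" "m \<in> borel_measurable borel"
  shows "conv U m \<in> borel_measurable borel"
proof -
  have "(\<lambda>z. \<integral>w. U w * m (z - w) \<partial>lborel) \<in> borel_measurable lborel"
    by (rule lborel.borel_measurable_lebesgue_integral) measurable
  then show ?thesis
    unfolding conv_def[abs_def] by simp
qed

lemma integrable_mult_bounded: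
  fixes U :: "'a::euclidean_space \<Rightarrow> real"
  assumes U: "integrable lborel U" and h: "h \<in> borel_measurable borel" "\<And>w. \<bar>h w\<bar> \<le> M"
  shows "integrable lborel (\<lambda>w. U w * h w)"
proof (rule Bochner_Integration.integrable_bound[of _ "\<lambda>w. U w * M"])
  show "AE w in lborel. norm (U w * h w) \<le> norm (U w * M)"
  proof (rule AE_I2)
    fix w
    have "\<bar>h w\<bar> \<le> \<bar>M\<bar>" using h(2)[of w] by linarith
    then show "norm (U w * h w) \<le> norm (U w * M)"
      by (simp add: abs_mult mult_left_mono)
  qed
  show "integrable lborel (\<lambda>w. U w * M)" using U by simp
  show "(\<lambda>w. U w * h w) \<in> borel_measurable lborel"
    using U h(1) by (auto intro: borel_measurable_times)
qed

lemma conv_integrable: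
  assumes U: "integrable lborel U" and m: "mollifier m"
  shows "integrable lborel (\<lambda>w. U w * m (z - w))"
proof -
  obtain M where M: "\<And>y. m y \<le> M" using m by (auto simp: mollifier_def)
  have [measurable]: "m \<in> borel_measurable borel" by (rule mollifierD(1)[OF m])
  show ?thesis
    by (rule integrable_mult_bounded[OF U, of _ M]) (measurable, simp add: mollifierD(2)[OF m] M)
qed

lemma conv_diff:
  assumes "integrable lborel U" "integrable lborel V" "mollifier m"
  shows "conv (\<lambda>w. U w - V w) m z = conv U m z - conv V m z"
  unfolding conv_def left_diff_distrib
  by (intro Bochner_Integration.integral_diff conv_integrable assms)

text \<open>
  Jensen's inequality for the probability density \<open>w \<mapsto> m (z - w)\<close>, in the form that a variance is
  nonnegative.
\<close>

lemma conv_square_le: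
  assumes U: "L2 U" "integrable lborel U" and m: "mollifier m"
  shows "(conv U m z)\<^sup>2 \<le> conv (\<lambda>w. (U w)\<^sup>2) m z"
proof -
  define a where "a = conv U m z"
  have i1: "integrable lborel (\<lambda>w. (U w)\<^sup>2 * m (z - w))"
    using conv_integrable[OF _ m, of "\<lambda>w. (U w)\<^sup>2"] U(1) by (simp add: L2_def)
  have i2: "integrable lborel (\<lambda>w. U w * m (z - w))"
    using conv_integrable[OF U(2) m] .
  have i3: "integrable lborel (\<lambda>w. m (z - w))" by (rule mollifierD(7)[OF m])
  have "0 \<le> (\<integral>w. (U w - a)\<^sup>2 * m (z - w) \<partial>lborel)"
    using mollifierD(2)[OF m] by (intro integral_nonneg_AE) auto
  also have "(\<lambda>w. (U w - a)\<^sup>2 * m (z - w)) =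
      (\<lambda>w. (U w)\<^sup>2 * m (z - w) - 2 * a * (U w * m (z - w)) + a\<^sup>2 * m (z - w))"
    by (rule ext) (simp add: power2_diff algebra_simps)
  also have "(\<integral>w. (U w)\<^sup>2 * m (z - w) - 2 * a * (U w * m (z - w)) + a\<^sup>2 * m (z - w) \<partial>lborel) =
      (\<integral>w. (U w)\<^sup>2 * m (z - w) \<partial>lborel) - 2 * a * (\<integral>w. U w * m (z - w) \<partial>lborel)
      + a\<^sup>2 * (\<integral>w. m (z - w) \<partial>lborel)"
    using i1 i2 i3 by simp
  also have "\<dots> = conv (\<lambda>w. (U w)\<^sup>2) m z - a\<^sup>2"
    using mollifierD(5)[OF m, of z] by (simp add: a_def conv_def power2_eq_square)
  finally show ?thesis by (simp add: a_def)
qed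

lemma nn_integral_conv:
  fixes V :: "'a::euclidean_space \<Rightarrow> real"
  assumes V: "integrable lborel V" "\<And>w. 0 \<le> V w" and m: "mollifier m"
  shows "(\<integral>\<^sup>+z. ennreal (conv V m z) \<partial>lborel) = (\<integral>\<^sup>+w. ennreal (V w) \<partial>lborel)"
proof -
  have [measurable]: "V \<in> borel_measurable borel" using V by auto
  have [measurable]: "m \<in> borel_measurable borel" by (rule mollifierD(1)[OF m])
  have "(\<integral>\<^sup>+z. ennreal (conv V m z) \<partial>lborel) =
      (\<integral>\<^sup>+z. (\<integral>\<^sup>+w. ennreal (V w * m (z - w)) \<partial>lborel) \<partial>lborel)"
    unfolding conv_def
    by (subst nn_integral_eq_integral[OF conv_integrable[OF V(1) m]])
      (simp_all add: V(2) mollifierD(2)[OF m])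
  also have "\<dots> = (\<integral>\<^sup>+w. (\<integral>\<^sup>+z. ennreal (V w * m (z - w)) \<partial>lborel) \<partial>lborel)"
    by (rule lborel_pair.Fubini'[symmetric]) measurable
  also have "\<dots> = (\<integral>\<^sup>+w. ennreal (V w) * (\<integral>\<^sup>+z. ennreal (m (z - w)) \<partial>lborel) \<partial>lborel)"
    by (subst nn_integral_cmult[symmetric]) (simp_all add: ennreal_mult V(2) mollifierD(2)[OF m])
  also have "\<dots> = (\<integral>\<^sup>+w. ennreal (V w) \<partial>lborel)"
    by (simp add: mollifierD(6)[OF m])
  finally show ?thesis .
qed

lemma conv_L2:
  assumes U: "L2 U" "integrable lborel U" and m: "mollifier m"
  shows "L2 (conv U m)" "N2 (conv U m) \<le> N2 U"
proof -
  have [measurable]: "U \<in> borel_measurable borel" using U by (simp add: L2_def)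
  have [measurable]: "m \<in> borel_measurable borel" by (rule mollifierD(1)[OF m])
  have i: "integrable lborel (\<lambda>z. (U z)\<^sup>2)" using U by (simp add: L2_def)
  have "(\<integral>\<^sup>+z. ennreal ((conv U m z)\<^sup>2) \<partial>lborel) \<le> (\<integral>\<^sup>+z. ennreal (conv (\<lambda>w. (U w)\<^sup>2) m z) \<partial>lborel)"
    by (intro nn_integral_mono ennreal_leI conv_square_le U m)
  also have "\<dots> = (\<integral>\<^sup>+w. ennreal ((U w)\<^sup>2) \<partial>lborel)"
    by (rule nn_integral_conv[OF i _ m]) simp
  also have "\<dots> = ennreal (\<integral>w. (U w)\<^sup>2 \<partial>lborel)"
    by (rule nn_integral_eq_integral[OF i]) simp
  finally have le: "(\<integral>\<^sup>+z. ennreal ((conv U m z)\<^sup>2) \<partial>lborel) \<le> ennreal (\<integral>w. (U w)\<^sup>2 \<partial>lborel)" .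
  then have int: "integrable lborel (\<lambda>z. (conv U m z)\<^sup>2)"
    by (intro integrableI_bounded) (auto intro: le_less_trans)
  then show "L2 (conv U m)"
    by (simp add: L2_def)
  have "(\<integral>z. (conv U m z)\<^sup>2 \<partial>lborel) \<le> (\<integral>w. (U w)\<^sup>2 \<partial>lborel)"
    using le nn_integral_eq_integral[OF int] by simp
  then show "N2 (conv U m) \<le> N2 U"
    by (simp add: N2_def)
qed

text \<open>
  Replacing \<open>U\<close> by a continuous function \<open>c\<close> costs \<open>N2 (U - c)\<close> twice, since convolution with a mollifier
  does not increase the norm. For \<open>c\<close> the convergence is uniform by uniform continuity and takes place
  in a fixed ball.
\<close>

lemma conv_L2_tendsto:
  fixes U :: "'a::euclidean_space \<Rightarrow> real"
  assumes U: "L2 U" "\<And>z. z \<notin> cball 0 R \<Longrightarrow> U z = 0"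
    and m: "\<And>n. mollifier (m n)"
    and supp: "\<And>\<delta>. 0 < \<delta> \<Longrightarrow> \<forall>\<^sub>F n in sequentially. \<forall>y. \<delta> \<le> norm y \<longrightarrow> m n y = 0"
  shows "(\<lambda>n. N2 (\<lambda>z. conv U (m n) z - U z)) \<longlonglongrightarrow> 0"
proof (rule LIMSEQ_I)
  fix \<tau> :: real assume "0 < \<tau>"
  then have t: "0 < \<tau> / 3" by simp
  obtain c where c: "continuous_on UNIV c" "\<And>z. z \<notin> cball 0 (R + 1) \<Longrightarrow> c z = 0"
      "L2 c" "N2 (\<lambda>z. U z - c z) < \<tau> / 3"
    using L2_approx_continuous[OF U t] by blast
  have Ui: "integrable lborel U"
    by (rule L2_bounded_support_integrable[OF U(1) bounded_cball U(2)])
  have ci: "integrable lborel c"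
    by (rule L2_bounded_support_integrable[OF c(3) bounded_cball c(2)])
  let ?I = "indicator (cball (0::'a) (R + 2)) :: 'a \<Rightarrow> real"
  have IL: "L2 (\<lambda>z. \<omega> * ?I z)" for \<omega> :: real
    by (rule L2_bounded_support[where M = "\<bar>\<omega>\<bar>" and K = "cball 0 (R + 2)"])
      (auto intro!: borel_measurable_times borel_measurable_indicator split: split_indicator)
  \<comment> \<open>The modulus of continuity must beat the volume of the ball of radius \<open>R + 2\<close>, which contains the
    supports of \<open>c\<close> and of its mollifications; adding 1 avoids a division by zero.\<close>
  define \<omega> where "\<omega> = \<tau> / 3 / (N2 ?I + 1)"
  have N1: "0 < N2 ?I + 1" using N2_nonneg[of ?I] by linarith
  then have \<omega>: "0 < \<omega>" using t unfolding \<omega>_def by (rule divide_pos_pos[rotated])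
  have "uniformly_continuous_on UNIV c"
  proof -
    have uc: "uniformly_continuous_on (cball 0 (R + 3)) c"
      by (rule compact_uniformly_continuous[OF continuous_on_subset[OF c(1)]]) auto
    show ?thesis
      unfolding uniformly_continuous_on_def
    proof (intro allI impI)
      fix e :: real assume "0 < e"
      obtain d where d0: "0 < d" and d: "\<And>x y. x \<in> cball 0 (R+3) \<Longrightarrow> y \<in> cball 0 (R+3) \<Longrightarrow>
          dist y x < d \<Longrightarrow> dist (c y) (c x) < e"
        using uc \<open>0 < e\<close>
        unfolding uniformly_continuous_on_def by blast
      have "dist (c y) (c x) < e" if xy: "dist y x < min d 1" for x y
      proof (cases "x \<in> cball 0 (R+3) \<and> y \<in> cball 0 (R+3)")
        case True
        then show ?thesis using d xy by auto
      next
        case False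
        have "norm x \<le> norm y + dist y x" "norm y \<le> norm x + dist y x"
          using norm_triangle_sub[of x y] norm_triangle_sub[of y x]
          by (auto simp: dist_norm norm_minus_commute)
        with False xy have "x \<notin> cball 0 (R+1)" "y \<notin> cball 0 (R+1)" by auto
        then show ?thesis using c(2) \<open>0 < e\<close> by simp
      qed
      then show "\<exists>d>0. \<forall>x\<in>UNIV. \<forall>x'\<in>UNIV. dist x' x < d \<longrightarrow> dist (c x') (c x) < e"
        using d0 by (intro exI[of _ "min d 1"]) auto
    qed
  qed
  then obtain \<delta> where "0 < \<delta>" and \<delta>: "\<And>x y. dist y x < \<delta> \<Longrightarrow> dist (c y) (c x) < \<omega>"
    unfolding uniformly_continuous_on_def using \<omega> by blast
  then have "0 < min \<delta> 1" by simp
  from supp[OF this] obtain n0 where n0: "\<And>n y. n0 \<le> n \<Longrightarrow> min \<delta> 1 \<le> norm y \<Longrightarrow> m n y = 0"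
    unfolding eventually_sequentially by blast
  have "norm (N2 (\<lambda>z. conv U (m n) z - U z) - 0) < \<tau>" if n: "n0 \<le> n" for n
  proof -
    let ?d = "\<lambda>z. conv c (m n) z - c z"
    have cL: "L2 (conv c (m n))" by (rule conv_L2[OF c(3) ci m])
    have pw: "\<bar>?d z\<bar> \<le> \<bar>\<omega> * ?I z\<bar>" for z
    proof -
      have "?d z = (\<integral>w. c w * m n (z - w) - c z * m n (z - w) \<partial>lborel)"
        using conv_integrable[OF ci m[of n], of z] mollifierD(5)[OF m[of n], of z]
          mollifierD(7)[OF m[of n], of z]
        by (simp add: conv_def)
      also have "\<bar>\<dots>\<bar> \<le> (\<integral>w. \<bar>c w * m n (z - w) - c z * m n (z - w)\<bar> \<partial>lborel)"
        by (rule integral_abs_bound)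
      also have "\<dots> \<le> (\<integral>w. \<omega> * ?I z * m n (z - w) \<partial>lborel)"
      proof (rule integral_mono)
        show "integrable lborel (\<lambda>w. \<bar>c w * m n (z - w) - c z * m n (z - w)\<bar>)"
          using conv_integrable[OF ci m[of n], of z] mollifierD(7)[OF m[of n], of z] by auto
        show "integrable lborel (\<lambda>w. \<omega> * ?I z * m n (z - w))"
          using mollifierD(7)[OF m[of n], of z] by auto
        fix w
        have m0: "0 \<le> m n (z - w)" by (rule mollifierD(2)[OF m])
        show "\<bar>c w * m n (z - w) - c z * m n (z - w)\<bar> \<le> \<omega> * ?I z * m n (z - w)"
        proof (cases "norm (z - w) < min \<delta> 1")
          case False
          then have "m n (z - w) = 0" by (intro n0[OF n]) (simp only: not_less)
          then show ?thesis by simp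
        next
          case True
          then have "\<bar>c w - c z\<bar> < \<omega>"
            using \<delta>[of w z] by (simp add: dist_norm norm_minus_commute)
          moreover have "\<bar>c w - c z\<bar> = 0" if "z \<notin> cball 0 (R + 2)"
          proof -
            have "norm z \<le> norm w + norm (z - w)" by (simp add: norm_triangle_sub)
            then have "z \<notin> cball 0 (R + 1)" "w \<notin> cball 0 (R + 1)" using that True by auto
            then show ?thesis using c(2) by simp
          qed
          ultimately have "\<bar>c w - c z\<bar> \<le> \<omega> * ?I z"
            by (cases "z \<in> cball 0 (R + 2)") auto
          then show ?thesis
            using mult_right_mono[OF _ m0] m0 by (simp add: abs_mult flip: left_diff_distrib)
        qed
      qed
      also have "\<dots> = \<omega> * ?I z"
        using mollifierD(5)[OF m[of n], of z] by simp
      finally show ?thesis using \<omega> by (simp add: abs_mult)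
    qed
    have dm: "?d \<in> borel_measurable borel"
      using cL c(3) by (auto simp: L2_def intro: borel_measurable_diff)
    have "N2 ?d \<le> N2 (\<lambda>z. \<omega> * ?I z)"
      by (rule N2_mono(2)[OF IL dm pw])
    also have "\<dots> = \<omega> * N2 ?I"
      using \<omega> by (simp add: N2_def power_mult_distrib real_sqrt_mult)
    also have "\<dots> < \<omega> * (N2 ?I + 1)"
      using \<omega> by simp
    also have "\<dots> = \<tau> / 3"
      unfolding \<omega>_def by (rule nonzero_eq_divide_eq[THEN iffD1, OF _ refl]) (use N1 in linarith)
    finally have d: "N2 ?d < \<tau> / 3" .
    have Uc: "L2 (\<lambda>z. U z - c z)" "integrable lborel (\<lambda>z. U z - c z)"
      using L2_diff[OF U(1) c(3)] Ui ci by auto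
    have e: "(\<lambda>z. conv U (m n) z - U z) =
        (\<lambda>z. (conv (\<lambda>z. U z - c z) (m n) z + ?d z) + (c z - U z))"
      using conv_diff[OF Ui ci m] by auto
    have dL: "L2 ?d" by (rule L2_diff[OF cL c(3)])
    have "N2 (\<lambda>z. conv U (m n) z - U z) \<le>
        N2 (conv (\<lambda>z. U z - c z) (m n)) + N2 ?d + N2 (\<lambda>z. c z - U z)"
      unfolding e
      using N2_triangle[OF L2_add[OF conv_L2(1)[OF Uc m] dL] L2_diff[OF c(3) U(1)]]
        N2_triangle[OF conv_L2(1)[OF Uc m] dL] by (rule order_trans[OF _ add_right_mono])
    also have "\<dots> < \<tau> / 3 + \<tau> / 3 + \<tau> / 3"
      using conv_L2(2)[OF Uc m, of n] c(4) d N2_minus_commute[of c U] by linarith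
    finally show ?thesis using N2_nonneg[of "\<lambda>z. conv U (m n) z - U z"] by simp
  qed
  then show "\<exists>no. \<forall>n\<ge>no. norm (N2 (\<lambda>z. conv U (m n) z - U z) - 0) < \<tau>"
    by blast
qed

text \<open>
  The squares converge to zero in \<open>L\<^sup>1\<close>, so a subsequence of them converges almost everywhere. The lemma is used to pass from mollified functions to \<open>U\<close> with Fatou's lemma.
\<close>

lemma N2_tendsto_AE_subseq:
  fixes f :: "nat \<Rightarrow> 'a::euclidean_space \<Rightarrow> real"
  assumes "\<And>n. L2 (f n)" "(\<lambda>n. N2 (f n)) \<longlonglongrightarrow> 0"
  shows "\<exists>r::nat \<Rightarrow> nat. strict_mono r \<and> (AE z in lborel. (\<lambda>n. f (r n) z) \<longlonglongrightarrow> 0)"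
proof -
  have "(\<lambda>n. \<integral>z. norm ((f n z)\<^sup>2) \<partial>lborel) \<longlonglongrightarrow> 0"
    using tendsto_power[OF assms(2), of 2] by (simp add: N2_square)
  moreover have "integrable lborel (\<lambda>z. (f n z)\<^sup>2)" for n
    using assms(1) by (simp add: L2_def)
  ultimately obtain r :: "nat \<Rightarrow> nat" where r: "strict_mono r" "AE z in lborel. (\<lambda>n. (f (r n) z)\<^sup>2) \<longlonglongrightarrow> 0"
    using tendsto_L1_AE_subseq[of lborel "\<lambda>n z. (f n z)\<^sup>2"] by blast
  from r(2) have "AE z in lborel. (\<lambda>n. f (r n) z) \<longlonglongrightarrow> 0"
  proof eventually_elim
    case (elim z)
    from tendsto_real_sqrt[OF this] have "(\<lambda>n. \<bar>f (r n) z\<bar>) \<longlonglongrightarrow> 0" by simp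
    then show ?case by (simp add: tendsto_rabs_zero_iff)
  qed
  with r(1) show ?thesis by blast
qed

section \<open>The parabolic kernel\<close>

text \<open>
  A smooth function that is positive exactly on the parabolic cylinder of radius \<open>s\<close> about the origin.
  The exponents 2 and 4 of \<open>s\<close> make \<open>kern s\<close> a parabolic dilation of \<open>kern 1\<close>; the squares of
  the space and time variables keep the function smooth at the origin.
\<close>

definition kern :: "real \<Rightarrow> (real ^ 'n) \<times> real \<Rightarrow> real"
  where "kern s y = bump (1 - (fst y \<bullet> fst y) / s\<^sup>2) * bump (1 - (snd y)\<^sup>2 / s ^ 4)"

definition kern_mass :: "'n::finite itself \<Rightarrow> real"
  where "kern_mass _ = (\<integral>y. kern 1 (y :: (real ^ 'n) \<times> real) \<partial>lborel)"

definition moll :: "real \<Rightarrow> (real ^ 'n::finite) \<times> real \<Rightarrow> real"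
  where "moll s y = kern s y / (kern_mass TYPE('n) * s ^ (CARD('n) + 2))"

text \<open>
  \<open>dkern s y e\<close> is the derivative of \<open>kern s\<close> at \<open>y\<close> in direction \<open>e\<close>, see \<open>kern_has_derivative\<close>.
\<close>

definition dkern :: "real \<Rightarrow> (real ^ 'n) \<times> real \<Rightarrow> (real ^ 'n) \<times> real \<Rightarrow> real"
  where "dkern s y e =
    bump' (1 - (fst y \<bullet> fst y) / s\<^sup>2) * (- (2 * (fst y \<bullet> fst e) / s\<^sup>2)) * bump (1 - (snd y)\<^sup>2 / s ^ 4)
    + bump (1 - (fst y \<bullet> fst y) / s\<^sup>2) * (bump' (1 - (snd y)\<^sup>2 / s ^ 4) * (- (2 * (snd y * snd e) / s ^ 4)))"

definition dmoll :: "real \<Rightarrow> (real ^ 'n::finite) \<times> real \<Rightarrow> (real ^ 'n) \<times> real \<Rightarrow> real"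
  where "dmoll s y e = dkern s y e / (kern_mass TYPE('n) * s ^ (CARD('n) + 2))"

lemma mem_cylinder: "y \<in> cylinder x0 t0 s \<longleftrightarrow> dist x0 (fst y) < s \<and> \<bar>snd y - t0\<bar> < s\<^sup>2"
  by (cases y) (auto simp: cylinder_def)

lemma mem_cylinder_0: "y \<in> cylinder 0 0 s \<longleftrightarrow> norm (fst y) < s \<and> \<bar>snd y\<bar> < s\<^sup>2"
  by (auto simp: mem_cylinder)

lemma mem_cylinder_diff: "w \<in> cylinder (fst z) (snd z) s \<longleftrightarrow> z - w \<in> cylinder 0 0 s"
  by (simp add: mem_cylinder dist_norm abs_minus_commute norm_minus_commute[of "fst w"])

lemma smooth_kern: "smooth (kern s)"
proof -
  have "smooth (\<lambda>y :: (real^'n) \<times> real. bump (1 - (1 / s\<^sup>2) * (fst y \<bullet> fst y)) * bump (1 - (1 / s ^ 4) * (snd y * snd y)))"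
    by (intro smooth_mult smooth_compose_real[OF smooth_bump] smooth_diff smooth_const smooth_inner smooth_fst smooth_snd)
  then show ?thesis
    by (simp add: kern_def[abs_def] power2_eq_square)
qed

lemma kern_has_derivative: "(kern s has_derivative dkern s y) (at y)"
proof -
  have 1: "((\<lambda>y. bump (1 - (fst y \<bullet> fst y) / s\<^sup>2)) has_derivative
      (\<lambda>e. bump' (1 - (fst y \<bullet> fst y) / s\<^sup>2) * (- (2 * (fst y \<bullet> fst e) / s\<^sup>2)))) (at y)"
    for y :: "(real ^ 'n) \<times> real"
  proof -
    have "((\<lambda>y. 1 - (fst y \<bullet> fst y) / s\<^sup>2) has_derivative (\<lambda>e. - (2 * (fst y \<bullet> fst e) / s\<^sup>2))) (at y)"
      unfolding divide_inverse by (auto intro!: derivative_eq_intros simp: inner_commute)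
    from has_derivative_compose[OF this bump_deriv[unfolded has_field_derivative_def]]
    show ?thesis .
  qed
  have 2: "((\<lambda>y. bump (1 - (snd y)\<^sup>2 / s ^ 4)) has_derivative
      (\<lambda>e. bump' (1 - (snd y)\<^sup>2 / s ^ 4) * (- (2 * (snd y * snd e) / s ^ 4)))) (at y)"
    for y :: "(real ^ 'n) \<times> real"
  proof -
    have "((\<lambda>y. 1 - (snd y)\<^sup>2 / s ^ 4) has_derivative (\<lambda>e. - (2 * (snd y * snd e) / s ^ 4))) (at y)"
      unfolding divide_inverse by (auto intro!: derivative_eq_intros)
    from has_derivative_compose[OF this bump_deriv[unfolded has_field_derivative_def]]
    show ?thesis .
  qed
  show ?thesis
    unfolding kern_def[abs_def] dkern_def[abs_def]
    by (rule has_derivative_eq_rhs[OF has_derivative_mult[OF 1 2]]) (simp add: add.commute)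
qed

lemma kern_nonneg: "0 \<le> kern s y" and kern_le_1: "kern s y \<le> 1"
  unfolding kern_def by (simp_all add: bump_nonneg bump_le_1 mult_le_one)

lemma sq_div_less_1_iff: "0 < s \<Longrightarrow> 0 < 1 - (a::real) / s \<longleftrightarrow> a < s"
  by (simp add: field_simps)

lemma kern_support_iff:
  assumes "0 < s"
  shows "0 < 1 - (fst y \<bullet> fst y) / s\<^sup>2 \<and> 0 < 1 - (snd y)\<^sup>2 / s ^ 4 \<longleftrightarrow> y \<in> cylinder 0 0 s"
proof -
  have "fst y \<bullet> fst y < s\<^sup>2 \<longleftrightarrow> norm (fst y) < s"
    using assms abs_square_less_1 by (metis abs_norm_cancel abs_of_pos dot_square_norm power2_less_eq_zero_iff power_mono_iff abs_le_square_iff not_le)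
  moreover have "(snd y)\<^sup>2 < s ^ 4 \<longleftrightarrow> \<bar>snd y\<bar> < s\<^sup>2"
  proof -
    have "s ^ 4 = (s\<^sup>2)\<^sup>2" by simp
    then show ?thesis
      by (metis abs_le_square_iff abs_of_nonneg not_le zero_le_power2)
  qed
  ultimately show ?thesis
    using assms by (simp add: sq_div_less_1_iff mem_cylinder_0)
qed

lemma kern_eq_0: "0 < s \<Longrightarrow> y \<notin> cylinder 0 0 s \<Longrightarrow> kern s y = 0"
  using kern_support_iff[of s y] by (auto simp: kern_def bump_eq_0 not_less)

lemma kern_pos: "0 < s \<Longrightarrow> y \<in> cylinder 0 0 s \<Longrightarrow> 0 < kern s y"
  using kern_support_iff[of s y] by (simp add: kern_def bump_pos_iff)

lemma dkern_eq_0: "0 < s \<Longrightarrow> y \<notin> cylinder 0 0 s \<Longrightarrow> dkern s y e = 0"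
  using kern_support_iff[of s y] by (auto simp: dkern_def bump_eq_0 bump'_eq_0 not_less)

lemma abs_mult_le_mult: "\<bar>a\<bar> \<le> A \<Longrightarrow> \<bar>b\<bar> \<le> B \<Longrightarrow> \<bar>a * b\<bar> \<le> A * (B::real)"
  unfolding abs_mult by (intro mult_mono) auto

text \<open>
  On the support of the kernel \<open>\<bar>fst y\<bar> \<le> s\<close>, which turns \<open>2 \<bar>fst y\<bar> / s\<^sup>2\<close> into \<open>2 / s\<close>; the factor 4 is
  the bound for \<open>bump'\<close>. In time, one power of \<open>s\<^sup>2\<close> takes the place of \<open>s\<close>.
\<close>

lemma dkern_space_le:
  assumes s: "0 < s"
  shows "\<bar>dkern s y (axis j 1, 0)\<bar> \<le> 8 / s"
proof (cases "y \<in> cylinder 0 0 s")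
  case True
  have "\<bar>fst y \<bullet> axis j 1\<bar> \<le> norm (fst y) * norm (axis j 1 :: real ^ 'a)"
    by (rule Cauchy_Schwarz_ineq2)
  also have "\<dots> \<le> s" using True by (simp add: mem_cylinder_0)
  finally have a: "\<bar>- (2 * (fst y \<bullet> axis j 1) / s\<^sup>2)\<bar> \<le> 2 / s"
    using s by (simp add: abs_mult power2_eq_square divide_simps)
  have "\<bar>bump' (1 - (fst y \<bullet> fst y) / s\<^sup>2) * (- (2 * (fst y \<bullet> axis j 1) / s\<^sup>2)) * bump (1 - (snd y)\<^sup>2 / s ^ 4)\<bar>
      \<le> 4 * (2 / s) * 1"
    by (intro abs_mult_le_mult a) (simp_all add: bump'_nonneg bump'_le bump_nonneg bump_le_1)
  then show ?thesis by (simp add: dkern_def)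
qed (use s in \<open>simp add: dkern_eq_0\<close>)

lemma dkern_time_le:
  assumes s: "0 < s"
  shows "\<bar>dkern s y (0, 1)\<bar> \<le> 8 / s\<^sup>2"
proof (cases "y \<in> cylinder 0 0 s")
  case True
  then have "\<bar>snd y\<bar> \<le> s\<^sup>2" by (simp add: mem_cylinder_0)
  then have a: "\<bar>- (2 * (snd y * 1) / s ^ 4)\<bar> \<le> 2 / s\<^sup>2"
    using s by (simp add: abs_mult power2_eq_square power4_eq_xxxx divide_simps)
  have "\<bar>bump (1 - (fst y \<bullet> fst y) / s\<^sup>2) * (bump' (1 - (snd y)\<^sup>2 / s ^ 4) * (- (2 * (snd y * 1) / s ^ 4)))\<bar>
      \<le> 1 * (4 * (2 / s\<^sup>2))"
    by (intro abs_mult_le_mult a) (simp_all add: bump'_nonneg bump'_le bump_nonneg bump_le_1)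
  then show ?thesis by (simp add: dkern_def)
qed (use s in \<open>simp add: dkern_eq_0\<close>)

lemma kern_measurable [measurable]: "kern s \<in> borel_measurable borel"
  using smooth_imp_continuous[OF smooth_kern] by (rule borel_measurable_continuous_onI)

lemma dkern_measurable [measurable]: "(\<lambda>y. dkern s y e) \<in> borel_measurable borel"
proof -
  have "continuous_on UNIV (\<lambda>y. dkern s y e)"
    unfolding dkern_def divide_inverse
    by (intro continuous_intros continuous_on_compose2[OF smooth_imp_continuous[OF smooth_bump, of UNIV]]
        continuous_on_compose2[OF smooth_imp_continuous[OF smooth_bump', of UNIV]]) auto
  then show ?thesis by (rule borel_measurable_continuous_onI)
qed

lemma bounded_cylinder: "bounded (cylinder x0 t0 s)"
  unfolding cylinder_def by (intro bounded_Times) auto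

lemma open_cylinder: "open (cylinder x0 t0 s)"
  unfolding cylinder_def by (intro open_Times) auto

lemma cylinder_sets [measurable]: "cylinder x0 t0 s \<in> sets borel"
  using open_cylinder by (rule borel_open)

lemma kern_integrable: "0 < s \<Longrightarrow> integrable lborel (kern s :: (real ^ 'n) \<times> real \<Rightarrow> real)"
  by (rule integrable_bounded_support[where M = 1 and K = "cylinder 0 0 s"])
    (auto simp: kern_nonneg kern_le_1 bounded_cylinder kern_eq_0)

lemma kern_mass_pos: "0 < kern_mass TYPE('n::finite)"
proof -
  let ?k = "kern 1 :: (real ^ 'n) \<times> real \<Rightarrow> real"
  have i: "integrable lborel ?k" by (rule kern_integrable) simp
  have "(\<integral>y. ?k y \<partial>lborel) \<noteq> 0"
  proof
    assume "(\<integral>y. ?k y \<partial>lborel) = 0"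
    then have "AE y in lborel. ?k y = 0"
      using integral_nonneg_eq_0_iff_AE[OF i] by (simp add: kern_nonneg)
    then have "AE y in lborel. y \<notin> (cylinder 0 0 1 :: ((real ^ 'n) \<times> real) set)"
      by (rule AE_mp) (auto intro!: AE_I2 dest!: kern_pos[OF zero_less_one])
    then have "cylinder 0 0 1 \<in> null_sets (lborel :: ((real ^ 'n) \<times> real) measure)"
      by (subst AE_iff_null_sets) auto
    then have "negligible (cylinder 0 0 1 :: ((real ^ 'n) \<times> real) set)"
      unfolding negligible_iff_null_sets by (rule null_sets_completionI)
    moreover have "(0, 0) \<in> (cylinder 0 0 1 :: ((real ^ 'n) \<times> real) set)"
      by (simp add: mem_cylinder)
    ultimately show False
      using open_not_negligible[OF open_cylinder] by blast
  qed
  moreover have "0 \<le> (\<integral>y. ?k y \<partial>lborel)"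
    by (simp add: kern_nonneg)
  ultimately show ?thesis
    unfolding kern_mass_def by linarith
qed

text \<open>
  The Jacobian of the parabolic dilation is \<open>s ^ n\<close> from space and \<open>s\<^sup>2\<close> from time. The exponent
  \<open>n + 2\<close>, the parabolic dimension, governs all later scaling.
\<close>

lemma lborel_parabolic_dilation:
  assumes s: "0 < (s::real)"
  shows "(lborel :: ((real ^ 'n) \<times> real) measure) =
    density (distr lborel borel (\<lambda>y. (s *\<^sub>R fst y, s\<^sup>2 * snd y))) (\<lambda>_. ennreal (s ^ (CARD('n) + 2)))"
proof -
  define c :: "(real ^ 'n) \<times> real \<Rightarrow> real" where "c b = (if snd b = 0 then s else s\<^sup>2)" for b
  have T: "(0 + (\<Sum>j\<in>Basis. (c j * (y \<bullet> j)) *\<^sub>R j)) = (s *\<^sub>R fst y, s\<^sup>2 * snd y)"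
    for y :: "(real ^ 'n) \<times> real"
  proof -
    have "(\<Sum>j\<in>Basis. (c j * (y \<bullet> j)) *\<^sub>R j) =
        (\<Sum>i\<in>Basis. (s * (fst y \<bullet> i)) *\<^sub>R (i, 0)) + (0, s\<^sup>2 * snd y)"
      by (subst sum_Basis_prod_eq) (auto simp: c_def inner_prod_def intro!: sum.cong)
    moreover have "(\<Sum>i\<in>Basis. (s * (fst y \<bullet> i)) *\<^sub>R (i, 0::real)) = (s *\<^sub>R fst y, 0)"
    proof (rule prod_eqI)
      show "fst (\<Sum>i\<in>Basis. (s * (fst y \<bullet> i)) *\<^sub>R (i, 0::real)) = fst (s *\<^sub>R fst y, 0::real)"
        using euclidean_representation[of "fst y"]
        by (simp add: fst_sum flip: scaleR_scaleR scaleR_sum_right)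
    qed (simp add: snd_sum)
    ultimately show ?thesis by simp
  qed
  have "lborel = density (distr lborel borel (\<lambda>y. 0 + (\<Sum>j\<in>Basis. (c j * (y \<bullet> j)) *\<^sub>R j)))
      (\<lambda>_. ennreal (\<Prod>j\<in>Basis. \<bar>c j\<bar>))"
    by (rule lborel_affine_euclidean) (use s in \<open>auto simp: c_def\<close>)
  moreover have "(\<Prod>j\<in>Basis. \<bar>c j\<bar>) = s ^ (CARD('n) + 2)"
  proof -
    have "(\<Prod>j\<in>Basis. \<bar>c j\<bar>) =
        (\<Prod>j\<in>(\<lambda>u. (u, 0)) ` Basis. \<bar>c j\<bar>) * (\<Prod>j\<in>(\<lambda>u. (0, u)) ` Basis. \<bar>c j\<bar>)"
      unfolding Basis_prod_def by (rule prod.union_disjoint) auto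
    also have "\<dots> = (\<Prod>j\<in>(Basis :: (real^'n) set). s) * s\<^sup>2"
      using s by (subst (1 2) prod.reindex) (auto simp: inj_on_def c_def)
    also have "\<dots> = s ^ (CARD('n) + 2)" by (simp only: prod_constant power_add DIM_cart DIM_real mult_1_right)
    finally show ?thesis .
  qed
  ultimately show ?thesis by (simp only: T)
qed

lemma kern_scale: "0 < s \<Longrightarrow> kern s (s *\<^sub>R fst y, s\<^sup>2 * snd y) = kern 1 y"
  by (simp add: kern_def power_mult_distrib power2_eq_square power4_eq_xxxx)

lemma integral_kern:
  assumes s: "0 < s"
  shows "(\<integral>y. kern s (y :: (real ^ 'n::finite) \<times> real) \<partial>lborel) = kern_mass TYPE('n) * s ^ (CARD('n) + 2)"
proof -
  let ?T = "\<lambda>y :: (real ^ 'n) \<times> real. (s *\<^sub>R fst y, s\<^sup>2 * snd y)"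
  have [measurable]: "?T \<in> borel_measurable borel"
    by (intro borel_measurable_continuous_onI continuous_intros)
  have "(\<integral>y. kern s (y :: (real ^ 'n) \<times> real) \<partial>lborel) =
      (\<integral>y. kern s y \<partial>(density (distr lborel borel ?T) (\<lambda>_. ennreal (s ^ (CARD('n) + 2)))))"
    using lborel_parabolic_dilation[OF s, where 'n='n] by simp
  also have "\<dots> = (\<integral>y. s ^ (CARD('n) + 2) *\<^sub>R kern s y \<partial>(distr lborel borel ?T))"
    using s by (subst integral_density) auto
  also have "\<dots> = (\<integral>y. s ^ (CARD('n) + 2) *\<^sub>R kern s (?T y) \<partial>lborel)"
    by (rule integral_distr) auto
  also have "\<dots> = kern_mass TYPE('n) * s ^ (CARD('n) + 2)"
    using s by (simp add: kern_scale kern_mass_def)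
  finally show ?thesis .
qed

abbreviation "mollc s n \<equiv> kern_mass (n :: 'n::finite itself) * s ^ (CARD('n) + 2)"

lemma moll_mollifier: "0 < s \<Longrightarrow> mollifier (moll s :: (real ^ 'n::finite) \<times> real \<Rightarrow> real)"
  unfolding mollifier_def
proof (intro conjI)
  assume s: "0 < s"
  have p: "0 < mollc s TYPE('n)"
    using kern_mass_pos[where 'n='n] s by simp
  show "moll s \<in> borel_measurable (borel :: ((real ^ 'n::finite) \<times> real) measure)"
    unfolding moll_def[abs_def] by measurable
  show "\<forall>y :: (real ^ 'n::finite) \<times> real. 0 \<le> moll s y"
    using p by (simp add: moll_def kern_nonneg)
  show "\<exists>M. \<forall>y :: (real ^ 'n::finite) \<times> real. moll s y \<le> M"
    using p by (intro exI[of _ "1 / mollc s TYPE('n)"]) (simp add: moll_def kern_le_1 divide_right_mono)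
  have "(\<integral>y. moll s (y :: (real ^ 'n) \<times> real) \<partial>lborel) =
      (\<integral>y. kern s (y :: (real ^ 'n) \<times> real) \<partial>lborel) / mollc s TYPE('n)"
    unfolding moll_def by (rule integral_divide_zero)
  also have "\<dots> = 1"
    unfolding integral_kern[OF s] by (rule divide_self) (use p in linarith)
  finally show "(\<integral>y. moll s (y :: (real ^ 'n) \<times> real) \<partial>lborel) = 1" .
qed

lemma moll_has_derivative: "(moll s has_derivative dmoll s y) (at y)"
  unfolding moll_def[abs_def] dmoll_def[abs_def]
  unfolding divide_inverse by (rule has_derivative_mult_left[OF kern_has_derivative])

lemma smooth_moll: "smooth (moll s)"
  using smooth_mult[OF smooth_kern smooth_const] by (simp add: moll_def[abs_def] divide_inverse)

lemma moll_eq_0: "0 < s \<Longrightarrow> y \<notin> cylinder 0 0 s \<Longrightarrow> moll s y = 0"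
  by (simp add: moll_def kern_eq_0)

lemma dmoll_eq_0: "0 < s \<Longrightarrow> y \<notin> cylinder 0 0 s \<Longrightarrow> dmoll s y e = 0"
  by (simp add: dmoll_def dkern_eq_0)

lemma dmoll_measurable [measurable]: "(\<lambda>y. dmoll s y e) \<in> borel_measurable borel"
  unfolding dmoll_def by measurable

lemma moll_measurable [measurable]: "moll s \<in> borel_measurable borel"
  unfolding moll_def[abs_def] by measurable

section \<open>Weak equations and the energy identity\<close>

text \<open>
  \<open>U\<close> has the weak spatial gradient \<open>G\<close> and satisfies \<open>U\<^sub>t = div g\<close> in \<open>C\<close>. All three functions are
  extended by zero, so that they can be convolved with kernels on the whole space-time; the equations
  are then available at points whose distance to the complement of \<open>C\<close> exceeds the scale of the kernel.
\<close>

definition weak_pair ::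
  "((real ^ 'n) \<times> real) set \<Rightarrow> ((real ^ 'n) \<times> real \<Rightarrow> real) \<Rightarrow> ((real ^ 'n) \<times> real \<Rightarrow> real ^ 'n)
    \<Rightarrow> ((real ^ 'n) \<times> real \<Rightarrow> real ^ 'n) \<Rightarrow> bool"
  where "weak_pair C U G g \<longleftrightarrow>
    L2 U \<and> (\<forall>j. L2 (\<lambda>z. G z $ j)) \<and> (\<forall>j. L2 (\<lambda>z. g z $ j)) \<and>
    bounded C \<and> (\<forall>z. z \<notin> C \<longrightarrow> U z = 0 \<and> G z = 0 \<and> g z = 0) \<and>
    (\<forall>\<phi> :: (real ^ 'n) \<times> real \<Rightarrow> real. test_function C \<phi> \<longrightarrow>
      (\<forall>j. (\<integral>z. U z * frechet_derivative \<phi> (at z) (axis j 1, 0) \<partial>lborel) =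
            - (\<integral>z. G z $ j * \<phi> z \<partial>lborel)) \<and>
      (\<integral>z. U z * frechet_derivative \<phi> (at z) (0, 1) \<partial>lborel) =
        (\<Sum>j\<in>UNIV. \<integral>z. g z $ j * frechet_derivative \<phi> (at z) (axis j 1, 0) \<partial>lborel))"

lemma weak_pair_L2:
  assumes "weak_pair C U G g"
  shows "L2 U" "L2 (\<lambda>z. G z $ j)" "L2 (\<lambda>z. g z $ j)"
  using assms by (auto simp: weak_pair_def)

lemma weak_pair_zero:
  assumes "weak_pair C U G g" "z \<notin> C"
  shows "U z = 0" "G z = 0" "g z = 0"
  using assms unfolding weak_pair_def by blast+

lemma weak_pair_integrable:
  assumes "weak_pair C U G g"
  shows "integrable lborel U" "integrable lborel (\<lambda>z. G z $ j)" "integrable lborel (\<lambda>z. g z $ j)"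
proof -
  have "bounded C" using assms by (simp add: weak_pair_def)
  then show "integrable lborel U" "integrable lborel (\<lambda>z. G z $ j)" "integrable lborel (\<lambda>z. g z $ j)"
    using assms by (auto simp: weak_pair_def intro!: L2_bounded_support_integrable)
qed

lemma weak_pairD:
  assumes "weak_pair C U G g" "test_function C \<phi>" "\<And>z. (\<phi> has_derivative \<phi>' z) (at z)"
  shows "(\<integral>z. U z * \<phi>' z (axis j 1, 0) \<partial>lborel) = - (\<integral>z. G z $ j * \<phi> z \<partial>lborel)"
    and "(\<integral>z. U z * \<phi>' z (0, 1) \<partial>lborel) = (\<Sum>j\<in>UNIV. \<integral>z. g z $ j * \<phi>' z (axis j 1, 0) \<partial>lborel)"
proof -
  have e: "frechet_derivative \<phi> (at z) = \<phi>' z" for z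
    using frechet_derivative_at[OF assms(3)] by simp
  have "(\<forall>j. (\<integral>z. U z * frechet_derivative \<phi> (at z) (axis j 1, 0) \<partial>lborel) =
            - (\<integral>z. G z $ j * \<phi> z \<partial>lborel)) \<and>
      (\<integral>z. U z * frechet_derivative \<phi> (at z) (0, 1) \<partial>lborel) =
        (\<Sum>j\<in>UNIV. \<integral>z. g z $ j * frechet_derivative \<phi> (at z) (axis j 1, 0) \<partial>lborel)"
    using assms(1,2) unfolding weak_pair_def by blast
  then show "(\<integral>z. U z * \<phi>' z (axis j 1, 0) \<partial>lborel) = - (\<integral>z. G z $ j * \<phi> z \<partial>lborel)"
    and "(\<integral>z. U z * \<phi>' z (0, 1) \<partial>lborel) = (\<Sum>j\<in>UNIV. \<integral>z. g z $ j * \<phi>' z (axis j 1, 0) \<partial>lborel)"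
    unfolding e by blast+
qed

lemma smooth_linear_compose:
  fixes f :: "'a::euclidean_space \<Rightarrow> 'b::euclidean_space"
  assumes "smooth f"
  shows "smooth (\<lambda>w. f (z - w))"
proof -
  have "Ck k (\<lambda>w. f (z - w))" if "Ck k f" for k and f :: "'a \<Rightarrow> 'b"
    using that
  proof (induction k arbitrary: f)
    case 0
    then show ?case
      by (auto intro!: continuous_on_compose2[of UNIV f UNIV] continuous_intros)
  next
    case (Suc k)
    have lin: "linear (frechet_derivative f (at y))" for y
      using Ck_Suc_has_derivative[OF Suc(2)] has_derivative_linear by blast
    have "((\<lambda>w. f (z - w)) has_derivative (\<lambda>e. frechet_derivative f (at (z - w)) (- e))) (at w)" for w
      by (rule has_derivative_compose[where f = "\<lambda>w. z - w" and g = f, OF _ Ck_Suc_has_derivative[OF Suc(2)]])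
        (auto intro!: derivative_eq_intros)
    moreover have "Ck k (\<lambda>w. frechet_derivative f (at (z - w)) (- b))" if "b \<in> Basis" for b
    proof -
      have "Ck k (\<lambda>w. frechet_derivative f (at (z - w)) b)"
        using Suc(1)[of "\<lambda>y. frechet_derivative f (at y) b"] Suc(2) that by simp
      from Ck_bilinear[OF bounded_bilinear_scaleR Ck_const[of k "-1"] this] show ?thesis
        by (simp add: linear_neg[OF lin])
    qed
    ultimately show ?case by (rule Ck_SucI)
  qed
  then show ?thesis using assms by (simp add: smooth_def)
qed

lemma has_derivative_reflect:
  assumes "\<And>y. (f has_derivative f' y) (at y)"
  shows "((\<lambda>w. f (z - w)) has_derivative (\<lambda>e. - f' (z - w) e)) (at w)"
proof -
  have "((\<lambda>w. f (z - w)) has_derivative (\<lambda>e. f' (z - w) (- e))) (at w)"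
    by (rule has_derivative_compose[where f = "\<lambda>w. z - w" and g = f, OF _ assms]) (auto intro!: derivative_eq_intros)
  then show ?thesis
    by (simp add: linear_neg[OF has_derivative_linear[OF assms]])
qed

lemma closure_cylinder_subset: "0 < s \<Longrightarrow> closure (cylinder x0 t0 s) \<subseteq> cball x0 s \<times> {t0 - s\<^sup>2..t0 + s\<^sup>2}"
  unfolding cylinder_def closure_Times
  by (intro Sigma_mono) (auto simp: closure_greaterThanLessThan)

text \<open>
  Kernels centred at \<open>z\<close> and supported in a small cylinder are admissible in the weak equations.
\<close>

lemma test_function_reflect:
  fixes p :: "(real ^ 'n) \<times> real \<Rightarrow> real"
  assumes "0 < s" "closure (cylinder (fst z) (snd z) s) \<subseteq> C" "smooth p"
    and "\<And>y. y \<notin> cylinder 0 0 s \<Longrightarrow> p y = 0"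
  shows "test_function C (\<lambda>w. p (z - w))"
  unfolding test_function_def compactly_contained_def
proof (intro conjI)
  show "\<forall>k. Ck k (\<lambda>w. p (z - w))"
    using smooth_linear_compose[OF assms(3)] by (simp add: smooth_def)
  have "{w. p (z - w) \<noteq> 0} \<subseteq> cylinder (fst z) (snd z) s"
    using assms(4) mem_cylinder_diff by blast
  then have sub: "closure {w. p (z - w) \<noteq> 0} \<subseteq> closure (cylinder (fst z) (snd z) s)"
    by (rule closure_mono)
  then show "closure {w. p (z - w) \<noteq> 0} \<subseteq> C"
    using assms(2) by blast
  show "compact (closure {w. p (z - w) \<noteq> 0})"
    using bounded_subset[OF bounded_closure[OF bounded_cylinder] sub]
    by (simp only: compact_eq_bounded_closed closed_closure simp_thms)
qed

definition bm :: "('a::euclidean_space \<Rightarrow> real) \<Rightarrow> bool"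
  where "bm f \<longleftrightarrow> f \<in> borel_measurable borel \<and> (\<exists>M. \<forall>z. \<bar>f z\<bar> \<le> M)"

lemma bmI: "f \<in> borel_measurable borel \<Longrightarrow> (\<And>z. \<bar>f z\<bar> \<le> M) \<Longrightarrow> bm f"
  by (auto simp: bm_def)

lemma bm_const: "bm (\<lambda>z. c)"
  by (rule bmI[of _ "\<bar>c\<bar>"]) auto

lemma bm_mult: "bm f \<Longrightarrow> bm g \<Longrightarrow> bm (\<lambda>z. f z * g z)"
  unfolding bm_def by (auto intro!: borel_measurable_times) (blast intro: abs_mult_le_mult)

lemma bm_add: "bm f \<Longrightarrow> bm g \<Longrightarrow> bm (\<lambda>z. f z + g z)"
  unfolding bm_def by (auto intro!: borel_measurable_add) (blast intro: order_trans[OF abs_triangle_ineq] add_mono)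

lemma bm_integrable: "bm f \<Longrightarrow> bounded K \<Longrightarrow> (\<And>z. z \<notin> K \<Longrightarrow> f z = 0) \<Longrightarrow> integrable lborel f"
  unfolding bm_def by (blast intro: integrable_bounded_support)

lemma bm_conv:
  assumes U: "integrable lborel U" and p: "bm p"
  shows "bm (conv U p)"
proof -
  obtain M where M: "\<And>z. \<bar>p z\<bar> \<le> M" and [measurable]: "p \<in> borel_measurable borel"
    using p by (auto simp: bm_def)
  show ?thesis
  proof (rule bmI)
    show "conv U p \<in> borel_measurable borel"
      using U by (intro conv_measurable) auto
    fix z
    have i: "integrable lborel (\<lambda>w. U w * p (z - w))"
      by (rule integrable_mult_bounded[OF U _ M]) measurable
    have "\<bar>conv U p z\<bar> \<le> (\<integral>w. \<bar>U w * p (z - w)\<bar> \<partial>lborel)"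
      unfolding conv_def by (rule integral_abs_bound)
    also have "\<dots> \<le> (\<integral>w. \<bar>U w\<bar> * M \<partial>lborel)"
    proof (rule integral_mono)
      show "integrable lborel (\<lambda>w. \<bar>U w * p (z - w)\<bar>)" by (rule integrable_abs[OF i])
      show "integrable lborel (\<lambda>w. \<bar>U w\<bar> * M)" using U by simp
    qed (simp add: abs_mult mult_left_mono M)
    finally show "\<bar>conv U p z\<bar> \<le> (\<integral>w. \<bar>U w\<bar> * M \<partial>lborel)" .
  qed
qed

text \<open>
  All derivatives fall on the kernel, so that \<open>U\<close> need only be integrable.
\<close>

lemma conv_directional_derivative:
  assumes U: "integrable lborel U" and d: "\<And>y. (p has_derivative p' y) (at y)"
    and p: "bm p" and p': "bm (\<lambda>y. p' y e)"
  shows "((\<lambda>h. conv U p (z + h *\<^sub>R e)) has_real_derivative conv U (\<lambda>y. p' y e) z) (at 0)"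
proof -
  obtain M where M: "\<And>z. \<bar>p z\<bar> \<le> M" and [measurable]: "p \<in> borel_measurable borel"
    using p by (auto simp: bm_def)
  obtain M' where M': "\<And>z. \<bar>p' z e\<bar> \<le> M'" and [measurable]: "(\<lambda>y. p' y e) \<in> borel_measurable borel"
    using p' by (auto simp: bm_def)
  have "((\<lambda>h. \<integral>w. U w * p (z + h *\<^sub>R e - w) \<partial>lborel) has_real_derivative
      (\<integral>w. U w * p' (z + 0 *\<^sub>R e - w) e \<partial>lborel)) (at 0)"
  proof (rule has_real_derivative_integral[OF U zero_less_one, where M = M' and M' = M])
    show "((\<lambda>h. p (z + h *\<^sub>R e - w)) has_real_derivative p' (z + h *\<^sub>R e - w) e) (at h)" for h w
    proof -
      have "((\<lambda>h. p (z + h *\<^sub>R e - w)) has_derivative (\<lambda>t. p' (z + h *\<^sub>R e - w) (t *\<^sub>R e))) (at h)"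
        by (rule has_derivative_compose[where f = "\<lambda>h. z + h *\<^sub>R e - w" and g = p, OF _ d]) (auto intro!: derivative_eq_intros)
      then show ?thesis
        unfolding has_field_derivative_def
        by (simp add: linear_cmul[OF has_derivative_linear[OF d]] mult.commute[of _ "p' _ e"])
    qed
    show "(\<lambda>w. p' (z + 0 *\<^sub>R e - w) e) \<in> borel_measurable borel" by measurable
    show "(\<lambda>w. p (z + h *\<^sub>R e - w)) \<in> borel_measurable borel" for h by measurable
  qed (use M M' in auto)
  then show ?thesis by (simp add: conv_def)
qed

lemma moll_bm: "0 < s \<Longrightarrow> bm (moll s :: (real ^ 'n::finite) \<times> real \<Rightarrow> real)"
  using moll_mollifier[of s, where 'n='n] unfolding mollifier_def bm_def by auto

lemma mollc_pos: "0 < s \<Longrightarrow> 0 < mollc s TYPE('n::finite)"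
  using kern_mass_pos[where 'n='n] by simp

lemma dmoll_space_le:
  fixes y :: "(real ^ 'n::finite) \<times> real"
  assumes "0 < s"
  shows "\<bar>dmoll s y (axis j 1, 0)\<bar> \<le> 8 / s / mollc s TYPE('n)"
proof -
  have "\<bar>dmoll s y (axis j 1, 0)\<bar> = \<bar>dkern s y (axis j 1, 0)\<bar> / mollc s TYPE('n)"
    using mollc_pos[OF assms, where 'n='n] unfolding dmoll_def abs_divide by (simp only: abs_of_pos)
  also have "\<dots> \<le> 8 / s / mollc s TYPE('n)"
    using dkern_space_le[OF assms] mollc_pos[OF assms, where 'n='n] by (intro divide_right_mono) (simp_all only: less_imp_le)
  finally show ?thesis .
qed

lemma dmoll_time_le:
  fixes y :: "(real ^ 'n::finite) \<times> real"
  assumes "0 < s"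
  shows "\<bar>dmoll s y (0, 1)\<bar> \<le> 8 / s\<^sup>2 / mollc s TYPE('n)"
proof -
  have "\<bar>dmoll s y (0, 1)\<bar> = \<bar>dkern s y (0, 1)\<bar> / mollc s TYPE('n)"
    using mollc_pos[OF assms, where 'n='n] unfolding dmoll_def abs_divide by (simp only: abs_of_pos)
  also have "\<dots> \<le> 8 / s\<^sup>2 / mollc s TYPE('n)"
    using dkern_time_le[OF assms] mollc_pos[OF assms, where 'n='n] by (intro divide_right_mono) (simp_all only: less_imp_le)
  finally show ?thesis .
qed

lemma dmoll_bm:
  assumes "0 < s"
  shows "bm (\<lambda>y :: (real ^ 'n::finite) \<times> real. dmoll s y (axis j 1, 0))"
    and "bm (\<lambda>y :: (real ^ 'n::finite) \<times> real. dmoll s y (0, 1))"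
  using bmI[OF dmoll_measurable dmoll_space_le[OF assms]] bmI[OF dmoll_measurable dmoll_time_le[OF assms]] .

text \<open>
  Testing with \<open>w \<mapsto> moll s (z - w)\<close> turns the two weak equations into pointwise identities between
  convolutions; the reflection changes the sign of every first derivative.
\<close>

lemma weak_pair_conv:
  assumes w: "weak_pair C U G g" and s: "0 < s"
    and z: "closure (cylinder (fst z) (snd z) s) \<subseteq> C"
  shows "conv U (\<lambda>y. dmoll s y (axis j 1, 0)) z = conv (\<lambda>z. G z $ j) (moll s) z"
    and "conv U (\<lambda>y. dmoll s y (0, 1)) z = (\<Sum>j\<in>UNIV. conv (\<lambda>z. g z $ j) (\<lambda>y. dmoll s y (axis j 1, 0)) z)"
proof -
  have t: "test_function C (\<lambda>w. moll s (z - w))"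
    by (rule test_function_reflect[OF s z smooth_moll moll_eq_0[OF s]])
  note D = weak_pairD[OF w t has_derivative_reflect[OF moll_has_derivative]]
  show "conv U (\<lambda>y. dmoll s y (axis j 1, 0)) z = conv (\<lambda>z. G z $ j) (moll s) z"
    using D(1)[of j] by (simp add: conv_def)
  show "conv U (\<lambda>y. dmoll s y (0, 1)) z = (\<Sum>j\<in>UNIV. conv (\<lambda>z. g z $ j) (\<lambda>y. dmoll s y (axis j 1, 0)) z)"
    using D(2) by (simp add: conv_def sum_negf)
qed

lemma integral_directional_derivative_0':
  assumes "bm f" "bm f'" "bounded K" "\<And>z. z \<notin> K \<Longrightarrow> f z = 0"
    and "\<And>z. ((\<lambda>s. f (z + s *\<^sub>R e)) has_real_derivative f' z) (at 0)"
  shows "(\<integral>z. f' z \<partial>lborel) = 0"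
proof -
  obtain M where M: "f \<in> borel_measurable borel" "\<And>z. \<bar>f z\<bar> \<le> M"
    using assms(1) by (auto simp: bm_def)
  obtain M' where M': "f' \<in> borel_measurable borel" "\<And>z. \<bar>f' z\<bar> \<le> M'"
    using assms(2) by (auto simp: bm_def)
  show ?thesis
    by (rule integral_directional_derivative_0[OF M assms(3,4,5) M'(2,1)])
qed

text \<open>
  A cutoff function \<open>\<psi>\<close> with its time derivative and its partial derivatives in space, all bounded and
  zero off \<open>K\<close>. One order of differentiability suffices, as the cutoff multiplies functions that are
  already smooth.
\<close>

definition cutoff_in ::
  "((real ^ 'n) \<times> real) set \<Rightarrow> ((real ^ 'n) \<times> real \<Rightarrow> real) \<Rightarrow> ((real ^ 'n) \<times> real \<Rightarrow> real)
    \<Rightarrow> ('n \<Rightarrow> (real ^ 'n) \<times> real \<Rightarrow> real) \<Rightarrow> bool"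
  where "cutoff_in K \<psi> \<psi>t \<psi>x \<longleftrightarrow>
    bm \<psi> \<and> bm \<psi>t \<and> (\<forall>j. bm (\<psi>x j)) \<and>
    (\<forall>z. z \<notin> K \<longrightarrow> \<psi> z = 0 \<and> \<psi>t z = 0 \<and> (\<forall>j. \<psi>x j z = 0)) \<and>
    (\<forall>z. ((\<lambda>h. \<psi> (z + h *\<^sub>R (0, 1))) has_real_derivative \<psi>t z) (at 0)) \<and>
    (\<forall>z j. ((\<lambda>h. \<psi> (z + h *\<^sub>R (axis j 1, 0))) has_real_derivative \<psi>x j z) (at 0))"

text \<open>
  For the smooth function \<open>u = U * moll s\<close> the equation \<open>u\<^sub>t = div g\<^sub>s\<close> holds pointwise. Multiply it by
  \<open>u \<psi>\<close> and integrate by parts in time and in space. The time derivative occurs only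
  in \<open>u u\<^sub>t \<psi> = (u\<^sup>2 \<psi>)\<^sub>t / 2 - u\<^sup>2 \<psi>\<^sub>t / 2\<close>, and so disappears from the result.
\<close>

lemma energy_identity_mollified:
  fixes U :: "(real ^ 'n::finite) \<times> real \<Rightarrow> real"
  assumes w: "weak_pair C U G g" and s: "0 < s" and K: "bounded K"
    and room: "\<And>z. z \<in> K \<Longrightarrow> closure (cylinder (fst z) (snd z) s) \<subseteq> C"
    and \<psi>: "cutoff_in K \<psi> \<psi>t \<psi>x"
  defines "u \<equiv> conv U (moll s)" and "Gs \<equiv> \<lambda>j. conv (\<lambda>z. G z $ j) (moll s)"
    and "gs \<equiv> \<lambda>j. conv (\<lambda>z. g z $ j) (moll s)"
  shows "(\<integral>z. u z * u z * \<psi>t z \<partial>lborel) / 2 =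
    (\<Sum>j\<in>UNIV. (\<integral>z. gs j z * Gs j z * \<psi> z \<partial>lborel) + (\<integral>z. gs j z * u z * \<psi>x j z \<partial>lborel))"
proof -
  note I = weak_pair_integrable[OF w]
  note M = moll_bm[OF s, where 'n='n]
  define ut where "ut = conv U (\<lambda>y. dmoll s y (0, 1))"
  define ux where "ux j = conv U (\<lambda>y. dmoll s y (axis j 1, 0))" for j
  define gx where "gx j = conv (\<lambda>z. g z $ j) (\<lambda>y. dmoll s y (axis j 1, 0))" for j
  have b: "bm u" "bm (Gs j)" "bm (gs j)" "bm ut" "bm (ux j)" "bm (gx j)" for j
    unfolding u_def Gs_def gs_def ut_def ux_def gx_def by (intro bm_conv I M dmoll_bm s)+
  have p: "bm \<psi>" "bm \<psi>t" "bm (\<psi>x j)" for j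
    using \<psi> unfolding cutoff_in_def by blast+
  have p0: "\<psi> z = 0" "\<psi>t z = 0" "\<psi>x j z = 0" if "z \<notin> K" for z j
    using \<psi> that unfolding cutoff_in_def by blast+
  have pt: "((\<lambda>h. \<psi> (z + h *\<^sub>R (0, 1))) has_real_derivative \<psi>t z) (at 0)"
    and px: "((\<lambda>h. \<psi> (z + h *\<^sub>R (axis j 1, 0))) has_real_derivative \<psi>x j z) (at 0)" for z j
    using \<psi> unfolding cutoff_in_def by blast+
  have dut: "((\<lambda>h. u (z + h *\<^sub>R (0, 1))) has_real_derivative ut z) (at 0)"
    and dux: "((\<lambda>h. u (z + h *\<^sub>R (axis j 1, 0))) has_real_derivative ux j z) (at 0)"
    and dgx: "((\<lambda>h. gs j (z + h *\<^sub>R (axis j 1, 0))) has_real_derivative gx j z) (at 0)" for z j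
    unfolding u_def ut_def ux_def gs_def gx_def
    by (intro conv_directional_derivative I moll_has_derivative M dmoll_bm s)+
  have int: "integrable lborel f" if "bm f" "\<And>z. z \<notin> K \<Longrightarrow> f z = 0" for f
    by (rule bm_integrable[OF that(1) K that(2)])
  have i1: "integrable lborel (\<lambda>z. u z * ut z * \<psi> z)" "integrable lborel (\<lambda>z. u z * u z * \<psi>t z)"
     "integrable lborel (\<lambda>z. gx j z * u z * \<psi> z)" "integrable lborel (\<lambda>z. gs j z * ux j z * \<psi> z)"
     "integrable lborel (\<lambda>z. gs j z * u z * \<psi>x j z)" for j
    by (rule int; (intro bm_mult b p)?; simp add: p0)+
  \<comment> \<open>The integral of the time derivative of \<open>u\<^sup>2 \<psi>\<close> vanishes.\<close>
  have t0: "(\<integral>z. 2 * (u z * ut z * \<psi> z) + u z * u z * \<psi>t z \<partial>lborel) = 0"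
  proof (rule integral_directional_derivative_0'[OF _ _ K])
    show "bm (\<lambda>z. u z * u z * \<psi> z)" "bm (\<lambda>z. 2 * (u z * ut z * \<psi> z) + u z * u z * \<psi>t z)"
      by (intro bm_mult bm_add bm_const b p)+
    show "((\<lambda>h. u (z + h *\<^sub>R (0, 1)) * u (z + h *\<^sub>R (0, 1)) * \<psi> (z + h *\<^sub>R (0, 1)))
        has_real_derivative 2 * (u z * ut z * \<psi> z) + u z * u z * \<psi>t z) (at 0)" for z
      by (rule DERIV_cong[OF DERIV_mult[OF DERIV_mult[OF dut dut] pt]])
        (simp only: scaleR_zero_left add_0_right, simp add: algebra_simps)
  qed (simp add: p0)
  then have t1: "2 * (\<integral>z. u z * ut z * \<psi> z \<partial>lborel) + (\<integral>z. u z * u z * \<psi>t z \<partial>lborel) = 0"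
    using i1(1,2) by simp
  \<comment> \<open>The integral of the \<open>j\<close>-th derivative of \<open>g\<^sub>s u \<psi>\<close> vanishes.\<close>
  have x0: "(\<integral>z. gx j z * u z * \<psi> z + gs j z * ux j z * \<psi> z + gs j z * u z * \<psi>x j z \<partial>lborel) = 0" for j
  proof (rule integral_directional_derivative_0'[OF _ _ K])
    show "bm (\<lambda>z. gs j z * u z * \<psi> z)"
      "bm (\<lambda>z. gx j z * u z * \<psi> z + gs j z * ux j z * \<psi> z + gs j z * u z * \<psi>x j z)"
      by (intro bm_mult bm_add bm_const b p)+
    show "((\<lambda>h. gs j (z + h *\<^sub>R (axis j 1, 0)) * u (z + h *\<^sub>R (axis j 1, 0)) * \<psi> (z + h *\<^sub>R (axis j 1, 0)))
        has_real_derivative gx j z * u z * \<psi> z + gs j z * ux j z * \<psi> z + gs j z * u z * \<psi>x j z) (at 0)" for z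
      by (rule DERIV_cong[OF DERIV_mult[OF DERIV_mult[OF dgx dux] px]])
        (simp only: scaleR_zero_left add_0_right, simp add: algebra_simps)
  qed (simp add: p0)
  have x1: "(\<integral>z. gx j z * u z * \<psi> z \<partial>lborel) =
      - ((\<integral>z. gs j z * ux j z * \<psi> z \<partial>lborel) + (\<integral>z. gs j z * u z * \<psi>x j z \<partial>lborel))" for j
    using x0[of j] i1(3-5)[of j] by simp
  \<comment> \<open>Here the mollified equation \<open>u\<^sub>t = div g\<^sub>s\<close> enters. It is available on \<open>K\<close> only, which contains
    the support of \<open>\<psi>\<close>.\<close>
  have "u z * ut z * \<psi> z = (\<Sum>j\<in>UNIV. gx j z * u z * \<psi> z)" for z
    using weak_pair_conv(2)[OF w s room, of z] p0(1)[of z]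
    by (cases "z \<in> K") (simp_all add: ut_def gx_def sum_distrib_right mult.commute[of "u z"])
  then have "(\<integral>z. u z * ut z * \<psi> z \<partial>lborel) = (\<Sum>j\<in>UNIV. \<integral>z. gx j z * u z * \<psi> z \<partial>lborel)"
    using i1(3) by simp
  moreover have e: "gs j z * ux j z * \<psi> z = gs j z * Gs j z * \<psi> z" for j z
    using weak_pair_conv(1)[OF w s room, of z j] p0(1)[of z]
    by (cases "z \<in> K") (simp_all add: ux_def Gs_def)
  ultimately have "(\<integral>z. u z * ut z * \<psi> z \<partial>lborel) =
      - (\<Sum>j\<in>UNIV. (\<integral>z. gs j z * Gs j z * \<psi> z \<partial>lborel) + (\<integral>z. gs j z * u z * \<psi>x j z \<partial>lborel))"
    by (simp only: x1 e sum_negf)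
  with t1 show ?thesis by linarith
qed

text \<open>
  Products of two \<open>L\<^sup>2\<close> convergent sequences converge in \<open>L\<^sup>1\<close>, so a bounded weight may be inserted.
\<close>

lemma integral_mult_tendsto:
  fixes a b :: "nat \<Rightarrow> 'a::euclidean_space \<Rightarrow> real"
  assumes a: "\<And>n. L2 (a n)" "L2 a'" "(\<lambda>n. N2 (\<lambda>z. a n z - a' z)) \<longlonglongrightarrow> 0"
    and b: "\<And>n. L2 (b n)" "L2 b'" "(\<lambda>n. N2 (\<lambda>z. b n z - b' z)) \<longlonglongrightarrow> 0"
    and h: "bm h"
  shows "(\<lambda>n. \<integral>z. a n z * b n z * h z \<partial>lborel) \<longlonglongrightarrow> (\<integral>z. a' z * b' z * h z \<partial>lborel)"
proof -
  obtain M where M: "\<And>z. \<bar>h z\<bar> \<le> M" and hm: "h \<in> borel_measurable borel"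
    using h by (auto simp: bm_def)
  have M0: "0 \<le> M" using M[of 0] by linarith
  have int: "integrable lborel (\<lambda>z. f z * k z * h z)" if "L2 f" "L2 k" for f k
    by (rule integrable_mult_bounded[OF L2_mult_integrable[OF that] hm M])
  have est: "\<bar>\<integral>z. f z * k z * h z \<partial>lborel\<bar> \<le> M * (N2 f * N2 k)" if "L2 f" "L2 k" for f k
  proof -
    have "\<bar>\<integral>z. f z * k z * h z \<partial>lborel\<bar> \<le> (\<integral>z. \<bar>f z * k z * h z\<bar> \<partial>lborel)"
      by (rule integral_abs_bound)
    also have "\<dots> \<le> (\<integral>z. M * \<bar>f z * k z\<bar> \<partial>lborel)"
    proof (rule integral_mono)
      show "integrable lborel (\<lambda>z. \<bar>f z * k z * h z\<bar>)" by (rule integrable_abs[OF int[OF that]])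
      show "integrable lborel (\<lambda>z. M * \<bar>f z * k z\<bar>)" using L2_mult_integrable[OF that] by simp
      show "\<bar>f z * k z * h z\<bar> \<le> M * \<bar>f z * k z\<bar>" for z
        unfolding abs_mult[of "f z * k z"] mult.commute[of M] by (intro mult_left_mono M) simp
    qed
    also have "\<dots> \<le> M * (N2 f * N2 k)"
      using N2_cauchy_schwarz[OF that] M0 by (simp add: mult_left_mono)
    finally show ?thesis .
  qed
  let ?B = "\<lambda>n. M * (N2 (\<lambda>z. a n z - a' z) * N2 (\<lambda>z. b n z - b' z)) + M * (N2 (\<lambda>z. a n z - a' z) * N2 b')
      + M * (N2 a' * N2 (\<lambda>z. b n z - b' z))"
  have "(\<lambda>n. (\<integral>z. a n z * b n z * h z \<partial>lborel) - (\<integral>z. a' z * b' z * h z \<partial>lborel)) \<longlonglongrightarrow> 0"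
  proof (rule tendsto_rabs_zero_cancel, rule tendsto_sandwich[of "\<lambda>_. 0" _ _ ?B])
    have "?B \<longlonglongrightarrow> M * (0 * 0) + M * (0 * N2 b') + M * (N2 a' * 0)"
      by (intro tendsto_intros a b)
    then show "?B \<longlonglongrightarrow> 0" by simp
    show "\<forall>\<^sub>F n in sequentially. \<bar>(\<integral>z. a n z * b n z * h z \<partial>lborel) - (\<integral>z. a' z * b' z * h z \<partial>lborel)\<bar> \<le> ?B n"
    proof (rule always_eventually, rule allI)
      fix n
      let ?a = "\<lambda>z. a n z - a' z" and ?b = "\<lambda>z. b n z - b' z"
      have L: "L2 ?a" "L2 ?b" using L2_diff[OF a(1,2)] L2_diff[OF b(1,2)] by auto
      have "(\<integral>z. a n z * b n z * h z \<partial>lborel) - (\<integral>z. a' z * b' z * h z \<partial>lborel) =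
          (\<integral>z. a n z * b n z * h z - a' z * b' z * h z \<partial>lborel)"
        using int a b by (intro Bochner_Integration.integral_diff[symmetric]) auto
      also have "(\<lambda>z. a n z * b n z * h z - a' z * b' z * h z) =
          (\<lambda>z. (?a z * ?b z * h z + ?a z * b' z * h z) + a' z * ?b z * h z)"
        by (rule ext) (simp add: algebra_simps)
      also have "(\<integral>z. (?a z * ?b z * h z + ?a z * b' z * h z) + a' z * ?b z * h z \<partial>lborel) =
          (\<integral>z. ?a z * ?b z * h z \<partial>lborel) + (\<integral>z. ?a z * b' z * h z \<partial>lborel) + (\<integral>z. a' z * ?b z * h z \<partial>lborel)"
        using int[OF L] int[OF L(1) b(2)] int[OF a(2) L(2)]
        by (simp only: Bochner_Integration.integral_add Bochner_Integration.integrable_add)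
      finally show "\<bar>(\<integral>z. a n z * b n z * h z \<partial>lborel) - (\<integral>z. a' z * b' z * h z \<partial>lborel)\<bar> \<le> ?B n"
        using est[OF L] est[OF L(1) b(2)] est[OF a(2) L(2)] by linarith
    qed
  qed auto
  then show ?thesis by (rule LIM_zero_cancel)
qed

lemma moll_seq_tendsto:
  fixes U :: "(real ^ 'n::finite) \<times> real \<Rightarrow> real"
  assumes U: "L2 U" "bounded C" "\<And>z. z \<notin> C \<Longrightarrow> U z = 0"
    and s: "\<And>n. 0 < s n" "s \<longlonglongrightarrow> 0"
  shows "(\<lambda>n. N2 (\<lambda>z. conv U (moll (s n)) z - U z)) \<longlonglongrightarrow> 0"
proof -
  obtain R where R: "\<And>z. z \<in> C \<Longrightarrow> norm z \<le> R"
    using U(2) unfolding bounded_iff by blast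
  show ?thesis
  proof (rule conv_L2_tendsto[OF U(1)])
    show "U z = 0" if "z \<notin> cball 0 R" for z
      using R[of z] U(3)[of z] that by auto
    show "mollifier (moll (s n) :: (real ^ 'n) \<times> real \<Rightarrow> real)" for n
      by (rule moll_mollifier[OF s(1)])
    fix \<delta> :: real assume \<delta>: "0 < \<delta>"
    have "(\<lambda>n. s n + (s n)\<^sup>2) \<longlonglongrightarrow> 0 + 0\<^sup>2"
      by (intro tendsto_intros s)
    then have "\<forall>\<^sub>F n in sequentially. s n + (s n)\<^sup>2 < \<delta>"
      using \<delta> by (intro order_tendstoD(2)[where y = 0]) simp_all
    then show "\<forall>\<^sub>F n in sequentially. \<forall>y :: (real ^ 'n) \<times> real. \<delta> \<le> norm y \<longrightarrow> moll (s n) y = 0"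
    proof eventually_elim
      case (elim n)
      show ?case
      proof (intro allI impI)
        fix y :: "(real ^ 'n) \<times> real" assume "\<delta> \<le> norm y"
        moreover have "norm y \<le> norm (fst y) + norm (snd y)"
          using norm_Pair_le[of "fst y" "snd y"] by simp
        ultimately have "y \<notin> cylinder 0 0 (s n)"
          using elim by (auto simp: mem_cylinder_0)
        then show "moll (s n) y = 0" by (rule moll_eq_0[OF s(1)])
      qed
    qed
  qed
qed

text \<open>
  The mollified identity contains no derivative of mollified functions, only \<open>u\<close>, \<open>G\<^sub>s\<close> and \<open>g\<^sub>s\<close>,
  which converge in \<open>L\<^sup>2\<close> as the scale tends to zero.
\<close>

lemma energy_identity:
  fixes U :: "(real ^ 'n::finite) \<times> real \<Rightarrow> real"
  assumes w: "weak_pair C U G g" and K: "bounded K" and s0: "0 < s0"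
    and room: "\<And>z s. z \<in> K \<Longrightarrow> 0 < s \<Longrightarrow> s \<le> s0 \<Longrightarrow> closure (cylinder (fst z) (snd z) s) \<subseteq> C"
    and \<psi>: "cutoff_in K \<psi> \<psi>t \<psi>x"
  shows "(\<integral>z. U z * U z * \<psi>t z \<partial>lborel) / 2 =
    (\<Sum>j\<in>UNIV. (\<integral>z. g z $ j * G z $ j * \<psi> z \<partial>lborel) + (\<integral>z. g z $ j * U z * \<psi>x j z \<partial>lborel))"
proof -
  define s where "s n = s0 / real (Suc n)" for n
  have s: "0 < s n" "s n \<le> s0" for n
    using s0 by (auto simp: s_def field_simps)
  have sl: "s \<longlonglongrightarrow> 0"
    unfolding s_def by (rule LIMSEQ_Suc[OF lim_const_over_n])
  note z = weak_pair_zero[OF w]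
  have C: "bounded C" using w by (auto simp: weak_pair_def)
  note L = weak_pair_L2[OF w] and I = weak_pair_integrable[OF w]
  have m: "mollifier (moll (s n) :: (real ^ 'n) \<times> real \<Rightarrow> real)" for n
    by (rule moll_mollifier[OF s(1)])
  have tU: "(\<lambda>n. N2 (\<lambda>z. conv U (moll (s n)) z - U z)) \<longlonglongrightarrow> 0"
    and tG: "(\<lambda>n. N2 (\<lambda>z. conv (\<lambda>z. G z $ j) (moll (s n)) z - G z $ j)) \<longlonglongrightarrow> 0"
    and tg: "(\<lambda>n. N2 (\<lambda>z. conv (\<lambda>z. g z $ j) (moll (s n)) z - g z $ j)) \<longlonglongrightarrow> 0" for j
    by (rule moll_seq_tendsto[OF _ C _ s(1) sl]; simp add: L z)+
  have p: "bm \<psi>" "bm \<psi>t" "bm (\<psi>x j)" for j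
    using \<psi> unfolding cutoff_in_def by blast+
  note cL = conv_L2(1)[OF L(1) I(1) m] conv_L2(1)[OF L(2) I(2) m] conv_L2(1)[OF L(3) I(3) m]
  have eq: "(\<integral>z. conv U (moll (s n)) z * conv U (moll (s n)) z * \<psi>t z \<partial>lborel) / 2 =
    (\<Sum>j\<in>UNIV. (\<integral>z. conv (\<lambda>z. g z $ j) (moll (s n)) z * conv (\<lambda>z. G z $ j) (moll (s n)) z * \<psi> z \<partial>lborel)
      + (\<integral>z. conv (\<lambda>z. g z $ j) (moll (s n)) z * conv U (moll (s n)) z * \<psi>x j z \<partial>lborel))" for n
    by (rule energy_identity_mollified[OF w s(1) K _ \<psi>]) (rule room[OF _ s])
  have l: "(\<lambda>n. (\<integral>z. conv U (moll (s n)) z * conv U (moll (s n)) z * \<psi>t z \<partial>lborel) / 2) \<longlonglongrightarrow>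
      (\<integral>z. U z * U z * \<psi>t z \<partial>lborel) / 2"
    by (rule tendsto_divide[OF integral_mult_tendsto[OF cL(1) L(1) tU cL(1) L(1) tU p(2)] tendsto_const]) simp
  have r: "(\<lambda>n. \<Sum>j\<in>UNIV. (\<integral>z. conv (\<lambda>z. g z $ j) (moll (s n)) z * conv (\<lambda>z. G z $ j) (moll (s n)) z * \<psi> z \<partial>lborel)
      + (\<integral>z. conv (\<lambda>z. g z $ j) (moll (s n)) z * conv U (moll (s n)) z * \<psi>x j z \<partial>lborel)) \<longlonglongrightarrow>
      (\<Sum>j\<in>UNIV. (\<integral>z. g z $ j * G z $ j * \<psi> z \<partial>lborel) + (\<integral>z. g z $ j * U z * \<psi>x j z \<partial>lborel))"
    by (intro tendsto_sum tendsto_add integral_mult_tendsto[OF cL(3) L(3) tg cL(2) L(2) tG p(1)]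
        integral_mult_tendsto[OF cL(3) L(3) tg cL(1) L(1) tU p(3)])
  show ?thesis
    by (rule LIMSEQ_unique[OF l]) (unfold eq, rule r)
qed

section \<open>Dependence of the mollified function on the scale\<close>

text \<open>
  The derivative of \<open>moll s y\<close> with respect to \<open>s\<close>. By parabolic scaling it is
  \<open>-1/s\<close> times the divergence of the vector field \<open>(y\<^sub>x, 2 y\<^sub>t) moll s y\<close>: the summand with the parabolic dimension
  is the divergence of \<open>(y\<^sub>x, 2 y\<^sub>t)\<close>.
\<close>

definition smoll :: "real \<Rightarrow> (real ^ 'n::finite) \<times> real \<Rightarrow> real"
  where "smoll s y = - (dmoll s y (fst y, 0) + 2 * dmoll s y (0, snd y)
    + real (CARD('n) + 2) * moll s y) / s"

lemma moll_scale_deriv: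
  fixes y :: "(real ^ 'n::finite) \<times> real"
  assumes s: "0 < s"
  shows "((\<lambda>s. moll s y) has_real_derivative smoll s y) (at s)"
proof -
  let ?a = "1 - (fst y \<bullet> fst y) / s\<^sup>2" and ?b = "1 - (snd y)\<^sup>2 / s ^ 4"
  have 1: "((\<lambda>s. bump (1 - (fst y \<bullet> fst y) / s\<^sup>2)) has_real_derivative
      bump' ?a * (2 * (fst y \<bullet> fst y) / s ^ 3)) (at s)"
    by (rule DERIV_chain2[OF bump_deriv])
      (use s in \<open>auto intro!: derivative_eq_intros simp: field_simps power2_eq_square power3_eq_cube\<close>)
  have 2: "((\<lambda>s. bump (1 - (snd y)\<^sup>2 / s ^ 4)) has_real_derivative
      bump' ?b * (4 * (snd y)\<^sup>2 / s ^ 5)) (at s)"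
    by (rule DERIV_chain2[OF bump_deriv])
      (use s in \<open>auto intro!: derivative_eq_intros simp: field_simps power2_eq_square eval_nat_numeral\<close>)
  have k: "((\<lambda>s. kern s y) has_real_derivative
      - (dkern s y (fst y, 0) + 2 * dkern s y (0, snd y)) / s) (at s)"
    unfolding kern_def
    by (rule DERIV_cong[OF DERIV_mult[OF 1 2]])
      (use s in \<open>simp add: dkern_def field_simps power2_eq_square eval_nat_numeral\<close>)
  let ?c = "kern_mass TYPE('n)" and ?d = "CARD('n) + 2"
  have c: "?c \<noteq> 0" using kern_mass_pos[where 'n='n] by simp
  have p: "((\<lambda>s. ?c * s ^ ?d) has_real_derivative ?c * (real ?d * s ^ (?d - 1))) (at s)"
    by (rule DERIV_cmult[OF DERIV_cong[OF DERIV_pow]]) simp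
  have e: "s ^ ?d = s * s ^ (?d - 1)" by (simp flip: power_Suc)
  have n0: "?c * s ^ ?d \<noteq> 0" using c s by simp
  have al: "(- (A + 2 * B) / s * (c * (s * P)) - k * (c * (D * P))) / (c * (s * P) * (c * (s * P))) =
      - (A / (c * (s * P)) + 2 * (B / (c * (s * P))) + D * (k / (c * (s * P)))) / s"
    if "c \<noteq> 0" "P \<noteq> 0" for A B c P k D :: real
    using that s by (simp add: field_simps)
  show ?thesis
    unfolding moll_def
    by (rule DERIV_cong[OF DERIV_divide[OF k p n0]])
      (unfold smoll_def dmoll_def moll_def e, rule al, use c s in auto)
qed

lemma dkern_radial_le:
  assumes s: "0 < s"
  shows "\<bar>dkern s y (fst y, 0)\<bar> \<le> 8" "\<bar>dkern s y (0, snd y)\<bar> \<le> 8"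
proof -
  have "\<bar>dkern s y (fst y, 0)\<bar> \<le> 8 \<and> \<bar>dkern s y (0, snd y)\<bar> \<le> 8"
  proof (cases "y \<in> cylinder 0 0 s")
    case True
    then have "0 < 1 - (fst y \<bullet> fst y) / s\<^sup>2" "0 < 1 - (snd y)\<^sup>2 / s ^ 4"
      using kern_support_iff[OF s, of y] by auto
    moreover have "0 \<le> (fst y \<bullet> fst y) / s\<^sup>2" "0 \<le> (snd y * snd y) / s ^ 4"
      using s by simp_all
    ultimately have a: "\<bar>- (2 * (fst y \<bullet> fst y) / s\<^sup>2)\<bar> \<le> 2" "\<bar>- (2 * (snd y * snd y) / s ^ 4)\<bar> \<le> 2"
      unfolding power2_eq_square[of "snd y"] times_divide_eq_right[symmetric] by linarith+
    have "\<bar>bump' (1 - (fst y \<bullet> fst y) / s\<^sup>2) * (- (2 * (fst y \<bullet> fst y) / s\<^sup>2)) * bump (1 - (snd y)\<^sup>2 / s ^ 4)\<bar>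
        \<le> 4 * 2 * 1"
      by (intro abs_mult_le_mult a) (simp_all add: bump'_nonneg bump'_le bump_nonneg bump_le_1)
    moreover have "\<bar>bump (1 - (fst y \<bullet> fst y) / s\<^sup>2) * (bump' (1 - (snd y)\<^sup>2 / s ^ 4) * (- (2 * (snd y * snd y) / s ^ 4)))\<bar>
        \<le> 1 * (4 * 2)"
      by (intro abs_mult_le_mult a) (simp_all add: bump'_nonneg bump'_le bump_nonneg bump_le_1)
    ultimately show ?thesis by (simp add: dkern_def)
  qed (use s in \<open>simp add: dkern_eq_0\<close>)
  then show "\<bar>dkern s y (fst y, 0)\<bar> \<le> 8" "\<bar>dkern s y (0, snd y)\<bar> \<le> 8" by auto
qed

text \<open>
  Differentiation under the integral sign requires a bound; its size is immaterial.
\<close>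

lemma smoll_le:
  fixes y :: "(real ^ 'n::finite) \<times> real"
  assumes s: "0 < s"
  shows "\<bar>smoll s y\<bar> \<le> (real CARD('n) + 26) / (s * mollc s TYPE('n))"
proof -
  let ?m = "mollc s TYPE('n)"
  have m: "0 < ?m" by (rule mollc_pos[OF s])
  have "smoll s y = - (dkern s y (fst y, 0) + 2 * dkern s y (0, snd y) + real (CARD('n) + 2) * kern s y) / (s * ?m)"
  proof -
    have "- (A / M + 2 * (B / M) + D * (k / M)) / s = - (A + 2 * B + D * k) / (s * M)"
      if "M \<noteq> 0" for A B D k M :: real
      using that s by (simp add: field_simps)
    then show ?thesis
      unfolding smoll_def dmoll_def moll_def using m by (simp only: less_irrefl not_False_eq_True)
  qed
  also have "\<bar>\<dots>\<bar> = \<bar>dkern s y (fst y, 0) + 2 * dkern s y (0, snd y) + real (CARD('n) + 2) * kern s y\<bar> / (s * ?m)"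
    unfolding abs_divide using m s by (simp only: abs_minus_cancel abs_of_pos mult_pos_pos)
  also have "\<dots> \<le> (real CARD('n) + 26) / (s * ?m)"
  proof (rule divide_right_mono)
    have "\<bar>real (CARD('n) + 2) * kern s y\<bar> \<le> real (CARD('n) + 2) * 1"
      by (intro abs_mult_le_mult) (auto simp: kern_nonneg kern_le_1)
    then show "\<bar>dkern s y (fst y, 0) + 2 * dkern s y (0, snd y) + real (CARD('n) + 2) * kern s y\<bar>
        \<le> real CARD('n) + 26"
      using dkern_radial_le[OF s, of y] by simp
    show "0 \<le> s * ?m" using m s by simp
  qed
  finally show ?thesis .
qed

lemma smoll_measurable: "smoll s \<in> borel_measurable (borel :: ((real ^ 'n::finite) \<times> real) measure)"
proof -
  have 1: "continuous_on UNIV (\<lambda>y :: (real ^ 'n) \<times> real. dkern s y (fst y, 0))"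
    and 2: "continuous_on UNIV (\<lambda>y :: (real ^ 'n) \<times> real. dkern s y (0, snd y))"
    unfolding dkern_def divide_inverse
    by (intro continuous_intros continuous_on_compose2[OF smooth_imp_continuous[OF smooth_bump, of UNIV]]
        continuous_on_compose2[OF smooth_imp_continuous[OF smooth_bump', of UNIV]]; simp)+
  have "(\<lambda>y :: (real ^ 'n) \<times> real. dkern s y (fst y, 0)) \<in> borel_measurable borel"
    "(\<lambda>y :: (real ^ 'n) \<times> real. dkern s y (0, snd y)) \<in> borel_measurable borel"
    by (rule borel_measurable_continuous_onI[OF 1], rule borel_measurable_continuous_onI[OF 2])
  note [measurable] = this
  show ?thesis
    unfolding smoll_def[abs_def] dmoll_def by measurable
qed

lemma conv_scale_deriv:
  fixes U :: "(real ^ 'n::finite) \<times> real \<Rightarrow> real"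
  assumes U: "integrable lborel U" and s: "0 < s"
  shows "((\<lambda>s. conv U (moll s) z) has_real_derivative conv U (smoll s) z) (at s)"
  unfolding conv_def
proof (rule has_real_derivative_integral[OF U, where r = "s / 2"])
  fix s' :: real and w assume "\<bar>s' - s\<bar> < s / 2"
  then have s': "s / 2 < s'" "0 < s'" using s by linarith+
  show "((\<lambda>s. moll s (z - w)) has_real_derivative smoll s' (z - w)) (at s')"
    by (rule moll_scale_deriv[OF s'(2)])
  have m: "mollc (s/2) TYPE('n) \<le> mollc s' TYPE('n)"
    using s' s kern_mass_pos[where 'n='n] by (intro mult_left_mono power_mono) auto
  have m2: "0 < mollc (s/2) TYPE('n)"
    using s by (intro mollc_pos) simp
  have "\<bar>smoll s' (z - w)\<bar> \<le> (real CARD('n) + 26) / (s' * mollc s' TYPE('n))"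
    by (rule smoll_le[OF s'(2)])
  also have "\<dots> \<le> (real CARD('n) + 26) / (s / 2 * mollc (s/2) TYPE('n))"
  proof (rule divide_left_mono)
    show "s / 2 * mollc (s/2) TYPE('n) \<le> s' * mollc s' TYPE('n)"
      by (rule mult_mono[OF _ m]) (use s' s m2 in linarith)+
    show "0 < s' * mollc s' TYPE('n) * (s / 2 * mollc (s/2) TYPE('n))"
      using mult_pos_pos[OF mult_pos_pos[OF s'(2) mollc_pos[OF s'(2), where 'n='n]] mult_pos_pos[OF half_gt_zero[OF s] m2]] .
  qed simp
  finally show "\<bar>smoll s' (z - w)\<bar> \<le> (real CARD('n) + 26) / (s / 2 * mollc (s/2) TYPE('n))" .
  have "\<bar>moll s' (z - w)\<bar> = kern s' (z - w) / mollc s' TYPE('n)"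
    using mollc_pos[OF s'(2), where 'n='n] unfolding moll_def by (simp only: abs_divide abs_of_nonneg[OF kern_nonneg] abs_of_pos)
  also have "\<dots> \<le> 1 / mollc (s/2) TYPE('n)"
    by (intro frac_le kern_le_1 kern_nonneg m m2) simp
  finally show "\<bar>moll s' (z - w)\<bar> \<le> 1 / mollc (s/2) TYPE('n)" .
next
  note [measurable] = smoll_measurable[of s, where 'n='n]
  show "(\<lambda>w. smoll s (z - w)) \<in> borel_measurable borel" by measurable
  show "(\<lambda>w. moll s' (z - w)) \<in> borel_measurable borel" for s' by measurable
qed (use s in simp)

text \<open>
  The datum that controls the oscillation of \<open>U\<close>: its gradient together with the flux that
  replaces its time derivative.
\<close>

definition strength :: "((real ^ 'n::finite) \<times> real \<Rightarrow> real ^ 'n) \<Rightarrow> ((real ^ 'n) \<times> real \<Rightarrow> real ^ 'n)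
    \<Rightarrow> (real ^ 'n) \<times> real \<Rightarrow> real"
  where "strength G g z = (\<Sum>j\<in>UNIV. \<bar>G z $ j\<bar> + \<bar>g z $ j\<bar>)"

lemma indicator_reflect:
  assumes "S \<in> sets borel"
  shows "(\<lambda>w. indicator S (z - w) :: real) \<in> borel_measurable (borel :: 'a::euclidean_space measure)"
    and "\<bar>indicator S y :: real\<bar> \<le> 1"
proof -
  have "(\<lambda>w. z - w) \<in> borel_measurable borel" by measurable
  from measurable_compose[OF this borel_measurable_indicator[OF assms]]
  show "(\<lambda>w. indicator S (z - w) :: real) \<in> borel_measurable (borel :: 'a measure)" .
qed (simp add: indicator_def)

lemma abs_conv_le:
  assumes U: "integrable lborel U" and p: "p \<in> borel_measurable borel"
    and le: "\<And>y. \<bar>p y\<bar> \<le> M * indicator S y" and S: "S \<in> sets borel"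
  shows "\<bar>conv U p z\<bar> \<le> M * conv (\<lambda>w. \<bar>U w\<bar>) (indicator S) z"
proof -
  have M: "\<bar>p y\<bar> \<le> \<bar>M\<bar>" for y
    using le[of y] by (cases "y \<in> S") auto
  have [measurable]: "p \<in> borel_measurable borel" "S \<in> sets borel" by fact+
  have i1: "integrable lborel (\<lambda>w. U w * p (z - w))"
    by (rule integrable_mult_bounded[OF U _ M]) measurable
  have i2: "integrable lborel (\<lambda>w. \<bar>U w\<bar> * indicator S (z - w))"
    by (rule integrable_mult_bounded[OF integrable_abs[OF U] indicator_reflect[OF S]])
  have "\<bar>conv U p z\<bar> \<le> (\<integral>w. \<bar>U w * p (z - w)\<bar> \<partial>lborel)"
    unfolding conv_def by (rule integral_abs_bound)
  also have "\<dots> \<le> (\<integral>w. M * (\<bar>U w\<bar> * indicator S (z - w)) \<partial>lborel)"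
  proof (rule integral_mono)
    show "integrable lborel (\<lambda>w. \<bar>U w * p (z - w)\<bar>)" by (rule integrable_abs[OF i1])
    show "integrable lborel (\<lambda>w. M * (\<bar>U w\<bar> * indicator S (z - w)))" using i2 by simp
    show "\<bar>U w * p (z - w)\<bar> \<le> M * (\<bar>U w\<bar> * indicator S (z - w))" for w
      using mult_left_mono[OF le[of "z - w"], of "\<bar>U w\<bar>"] by (simp add: abs_mult algebra_simps)
  qed
  also have "\<dots> = M * conv (\<lambda>w. \<bar>U w\<bar>) (indicator S) z"
    by (simp add: conv_def)
  finally show ?thesis .
qed

lemma smooth_component: "smooth (\<lambda>y :: (real ^ 'n::finite) \<times> real. fst y $ j)"
  by (intro smooth_linear bounded_linear_compose[OF bounded_linear_vec_nth bounded_linear_fst])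

text \<open>
  Euler's relation: the radial derivative is the sum of the partial derivatives weighted by the coordinates.
\<close>

lemma dmoll_sum_space:
  fixes y :: "(real ^ 'n::finite) \<times> real"
  shows "(\<Sum>j\<in>UNIV. fst y $ j * dmoll s y (axis j 1, 0)) = dmoll s y (fst y, 0)"
proof -
  have lin: "linear (\<lambda>x. dmoll s y (x, 0))"
    using linear_compose[of "\<lambda>x. (x, 0)" "dmoll s y"] has_derivative_linear[OF moll_has_derivative[of s y]]
    by (simp add: o_def linear_iff)
  have "dmoll s y (fst y, 0) = dmoll s y (\<Sum>j\<in>UNIV. fst y $ j *\<^sub>R axis j 1, 0)"
    by (simp add: basis_expansion flip: scalar_mult_eq_scaleR)
  also have "\<dots> = (\<Sum>j\<in>UNIV. fst y $ j * dmoll s y (axis j 1, 0))"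
    by (simp only: linear_sum[OF lin] linear_cmul[OF lin] real_scaleR_def)
  finally show ?thesis by simp
qed

lemma dmoll_time: "dmoll s y (0, t) = t * dmoll s y (0, 1)"
  using linear_cmul[OF has_derivative_linear[OF moll_has_derivative[of s y]], of t "(0, 1)"] by simp

text \<open>
  The scale derivative of the kernel is a divergence, and this moves a derivative onto \<open>U\<close>. The spatial
  part of the divergence is tested against \<open>G\<close> with the kernels \<open>y\<^sub>j moll s y\<close>, of size \<open>s\<close>. The temporal part
  is converted by the equation into a spatial divergence tested against \<open>g\<close>, with the kernels
  \<open>y\<^sub>t \<partial>\<^sub>j moll s y\<close>, of size \<open>s\<^sup>2 / s = s\<close>. Both gain the factor \<open>s\<close> that cancels the \<open>1/s\<close> in front.
\<close>

lemma conv_smoll_le: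
  fixes U :: "(real ^ 'n::finite) \<times> real \<Rightarrow> real"
  assumes w: "weak_pair C U G g" and s: "0 < s"
    and z: "closure (cylinder (fst z) (snd z) s) \<subseteq> C"
  shows "\<bar>conv U (smoll s) z\<bar> \<le> 16 / mollc s TYPE('n) * conv (strength G g) (indicator (cylinder 0 0 s)) z"
proof -
  note I = weak_pair_integrable[OF w]
  let ?m = "mollc s TYPE('n)"
  have m: "0 < ?m" by (rule mollc_pos[OF s])
  let ?S = "cylinder 0 0 s :: ((real ^ 'n) \<times> real) set"
  \<comment> \<open>The kernels \<open>y\<^sub>j moll s y\<close> and \<open>y\<^sub>t moll s y\<close>, whose weighted divergence is the scale derivative.\<close>
  define p where "p j y = fst y $ j * moll s y" for j and y :: "(real ^ 'n) \<times> real"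
  define p0 where "p0 y = snd y * moll s y" for y :: "(real ^ 'n) \<times> real"
  define p' where "p' j y e = fst y $ j * dmoll s y e + fst e $ j * moll s y" for j and y e :: "(real ^ 'n) \<times> real"
  define p0' where "p0' y e = snd y * dmoll s y e + snd e * moll s y" for y e :: "(real ^ 'n) \<times> real"
  have dp: "(p j has_derivative p' j y) (at y)" for j y
    unfolding p_def[abs_def] p'_def[abs_def]
    by (rule has_derivative_mult[OF bounded_linear_imp_has_derivative moll_has_derivative])
      (rule bounded_linear_compose[OF bounded_linear_vec_nth bounded_linear_fst])
  have dp0: "(p0 has_derivative p0' y) (at y)" for y
    unfolding p0_def[abs_def] p0'_def[abs_def]
    by (rule has_derivative_mult[OF bounded_linear_imp_has_derivative moll_has_derivative])
      (rule bounded_linear_snd)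
  have t: "test_function C (\<lambda>w. p j (z - w))" for j
    by (rule test_function_reflect[OF s z])
      (unfold p_def[abs_def], intro smooth_mult smooth_component smooth_moll, simp add: moll_eq_0[OF s])
  have t0: "test_function C (\<lambda>w. p0 (z - w))"
    by (rule test_function_reflect[OF s z])
      (unfold p0_def[abs_def], intro smooth_mult smooth_snd smooth_moll, simp add: moll_eq_0[OF s])
  \<comment> \<open>The defining property of the weak gradient, and the equation, tested with these kernels.\<close>
  have c1: "conv U (\<lambda>y. p' j y (axis j 1, 0)) z = conv (\<lambda>z. G z $ j) (p j) z" for j
    using weak_pairD(1)[OF w t has_derivative_reflect[OF dp], of j j] by (simp add: conv_def)
  have c2: "conv U (\<lambda>y. p0' y (0, 1)) z = (\<Sum>j\<in>UNIV. conv (\<lambda>z. g z $ j) (\<lambda>y. p0' y (axis j 1, 0)) z)"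
    using weak_pairD(2)[OF w t0 has_derivative_reflect[OF dp0]] by (simp add: conv_def sum_negf)
  note b = moll_bm[OF s, where 'n='n] dmoll_bm[OF s, where 'n='n]
  have le_p: "\<bar>p j y\<bar> \<le> s / ?m * indicator ?S y" for j y
  proof (cases "y \<in> ?S")
    case True
    have "\<bar>fst y $ j\<bar> \<le> norm (fst y)" by (rule component_le_norm_cart)
    also have "\<dots> \<le> s" using True by (simp add: mem_cylinder_0)
    finally have "\<bar>fst y $ j * moll s y\<bar> \<le> s * (1 / ?m)"
      using m by (intro abs_mult_le_mult) (auto simp only: moll_def abs_divide abs_of_nonneg[OF kern_nonneg] abs_of_pos intro!: divide_right_mono kern_le_1)
    then show ?thesis using True by (simp add: p_def)
  qed (simp add: p_def moll_eq_0[OF s])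
  have le_p0: "\<bar>p0' y (axis j 1, 0)\<bar> \<le> 8 * s / ?m * indicator ?S y" for j y
  proof (cases "y \<in> ?S")
    case True
    then have "\<bar>snd y\<bar> \<le> s\<^sup>2" by (simp add: mem_cylinder_0)
    then have "\<bar>snd y * dmoll s y (axis j 1, 0)\<bar> \<le> s\<^sup>2 * (8 / s / ?m)"
      by (intro abs_mult_le_mult dmoll_space_le[OF s])
    also have "s\<^sup>2 * (8 / s / ?m) = 8 * s / ?m"
      using s by (simp add: power2_eq_square)
    finally show ?thesis using True by (simp add: p0'_def)
  qed (simp add: p0'_def dmoll_eq_0[OF s])
  have pm: "p j \<in> borel_measurable borel" for j
    unfolding p_def[abs_def]
    by (intro borel_measurable_times moll_measurable borel_measurable_continuous_onI smooth_imp_continuous smooth_component)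
  have sm: "(\<lambda>y. snd y) \<in> borel_measurable (borel :: ((real ^ 'n) \<times> real) measure)"
    by (intro borel_measurable_continuous_onI continuous_intros)
  have p0m: "(\<lambda>y. p0' y (axis j 1, 0)) \<in> borel_measurable borel" for j
    unfolding p0'_def using sm by simp measurable
  \<comment> \<open>The factor \<open>y\<^sub>j\<close> is unbounded, but it may be cut off outside the support of the kernel.\<close>
  have bp: "bm (\<lambda>y. p' j y (axis j 1, 0))" for j
  proof -
    have "bm (\<lambda>y. fst y $ j * indicator ?S y)"
    proof (rule bmI[where M = s])
      show "(\<lambda>y. fst y $ j * indicator ?S y) \<in> borel_measurable borel"
        by (rule borel_measurable_times[OF borel_measurable_continuous_onI[OF smooth_imp_continuous[OF smooth_component]]
              borel_measurable_indicator[OF cylinder_sets]])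
      show "\<bar>fst y $ j * indicator ?S y\<bar> \<le> s" for y
        using component_le_norm_cart[of "fst y" j] s by (cases "y \<in> ?S") (auto simp: mem_cylinder_0)
    qed
    then have "bm (\<lambda>y. fst y $ j * indicator ?S y * dmoll s y (axis j 1, 0) + 1 * moll s y)"
      by (rule bm_add[OF bm_mult[OF _ b(2)] bm_mult[OF bm_const b(1)]])
    moreover have "fst y $ j * indicator ?S y * dmoll s y (axis j 1, 0) + 1 * moll s y = p' j y (axis j 1, 0)" for y
      by (cases "y \<in> ?S") (simp_all add: p'_def dmoll_eq_0[OF s])
    ultimately show ?thesis by simp
  qed
  have bp0: "bm (\<lambda>y. p0' y (0, 1))"
  proof -
    have "bm (\<lambda>y. snd y * indicator ?S y)"
    proof (rule bmI[where M = "s\<^sup>2"])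
      show "(\<lambda>y. snd y * indicator ?S y) \<in> borel_measurable borel"
        by (rule borel_measurable_times[OF sm borel_measurable_indicator[OF cylinder_sets]])
      show "\<bar>snd y * indicator ?S y\<bar> \<le> s\<^sup>2" for y :: "(real ^ 'n) \<times> real"
        by (cases "y \<in> ?S") (auto simp: mem_cylinder_0)
    qed
    then have "bm (\<lambda>y. snd y * indicator ?S y * dmoll s y (0, 1) + 1 * moll s y)"
      by (rule bm_add[OF bm_mult[OF _ b(3)] bm_mult[OF bm_const b(1)]])
    moreover have "snd y * indicator ?S y * dmoll s y (0, 1) + 1 * moll s y = p0' y (0, 1)" for y
      by (cases "y \<in> ?S") (simp_all add: p0'_def dmoll_eq_0[OF s])
    ultimately show ?thesis by simp
  qed
  have ci: "integrable lborel (\<lambda>w. U w * q (z - w))" if "bm q" for q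
  proof -
    from that obtain M where [measurable]: "q \<in> borel_measurable borel" and M: "\<And>y. \<bar>q y\<bar> \<le> M"
      by (auto simp: bm_def)
    show ?thesis by (rule integrable_mult_bounded[OF I(1) _ M]) measurable
  qed
  have e: "smoll s y = - (1 / s) * ((\<Sum>j\<in>UNIV. p' j y (axis j 1, 0)) + 2 * p0' y (0, 1))" for y
  proof -
    have "(\<Sum>j\<in>UNIV. p' j y (axis j 1, 0)) = dmoll s y (fst y, 0) + real CARD('n) * moll s y"
      by (simp add: p'_def sum.distrib dmoll_sum_space)
    moreover have "p0' y (0, 1) = dmoll s y (0, snd y) + moll s y"
      unfolding p0'_def by (subst dmoll_time[of s y "snd y"]) simp
    ultimately show ?thesis
      using s by (simp add: smoll_def field_simps)
  qed
  have i1: "integrable lborel (\<lambda>w. U w * p' j (z - w) (axis j 1, 0))" for j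
    using ci[OF bp] .
  have i2: "integrable lborel (\<lambda>w. U w * p0' (z - w) (0, 1))"
    using ci[OF bp0] .
  have "conv U (smoll s) z = (\<integral>w. - (1 / s) * ((\<Sum>j\<in>UNIV. U w * p' j (z - w) (axis j 1, 0))
      + 2 * (U w * p0' (z - w) (0, 1))) \<partial>lborel)"
    unfolding conv_def e by (intro Bochner_Integration.integral_cong refl) (simp add: sum_distrib_left algebra_simps)
  also have "\<dots> = - (1 / s) * (\<integral>w. (\<Sum>j\<in>UNIV. U w * p' j (z - w) (axis j 1, 0))
      + 2 * (U w * p0' (z - w) (0, 1)) \<partial>lborel)"
    by (rule integral_mult_right_zero)
  also have "(\<integral>w. (\<Sum>j\<in>UNIV. U w * p' j (z - w) (axis j 1, 0)) + 2 * (U w * p0' (z - w) (0, 1)) \<partial>lborel) =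
      (\<Sum>j\<in>UNIV. conv U (\<lambda>y. p' j y (axis j 1, 0)) z) + 2 * conv U (\<lambda>y. p0' y (0, 1)) z"
    using i1 i2 by (simp add: conv_def)
  also have "\<dots> = (\<Sum>j\<in>UNIV. conv (\<lambda>z. G z $ j) (p j) z) + 2 * (\<Sum>j\<in>UNIV. conv (\<lambda>z. g z $ j) (\<lambda>y. p0' y (axis j 1, 0)) z)"
    by (simp only: c1 c2)
  finally have "\<bar>conv U (smoll s) z\<bar> = (1 / s) * \<bar>(\<Sum>j\<in>UNIV. conv (\<lambda>z. G z $ j) (p j) z)
      + 2 * (\<Sum>j\<in>UNIV. conv (\<lambda>z. g z $ j) (\<lambda>y. p0' y (axis j 1, 0)) z)\<bar>"
    using s by (simp add: abs_mult)
  also have "\<dots> \<le> (1 / s) * ((\<Sum>j\<in>UNIV. s / ?m * conv (\<lambda>z. \<bar>G z $ j\<bar>) (indicator ?S) z)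
      + 2 * (\<Sum>j\<in>UNIV. 8 * s / ?m * conv (\<lambda>z. \<bar>g z $ j\<bar>) (indicator ?S) z))"
  proof (rule mult_left_mono)
    have "\<bar>\<Sum>j\<in>UNIV. conv (\<lambda>z. G z $ j) (p j) z\<bar> \<le> (\<Sum>j\<in>UNIV. s / ?m * conv (\<lambda>z. \<bar>G z $ j\<bar>) (indicator ?S) z)"
      by (intro sum_norm_le[where 'a = real, unfolded real_norm_def] abs_conv_le I pm le_p) simp
    moreover have "\<bar>\<Sum>j\<in>UNIV. conv (\<lambda>z. g z $ j) (\<lambda>y. p0' y (axis j 1, 0)) z\<bar>
        \<le> (\<Sum>j\<in>UNIV. 8 * s / ?m * conv (\<lambda>z. \<bar>g z $ j\<bar>) (indicator ?S) z)"
      by (intro sum_norm_le[where 'a = real, unfolded real_norm_def] abs_conv_le I p0m le_p0) simp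
    ultimately show "\<bar>(\<Sum>j\<in>UNIV. conv (\<lambda>z. G z $ j) (p j) z)
        + 2 * (\<Sum>j\<in>UNIV. conv (\<lambda>z. g z $ j) (\<lambda>y. p0' y (axis j 1, 0)) z)\<bar> \<le>
      (\<Sum>j\<in>UNIV. s / ?m * conv (\<lambda>z. \<bar>G z $ j\<bar>) (indicator ?S) z)
        + 2 * (\<Sum>j\<in>UNIV. 8 * s / ?m * conv (\<lambda>z. \<bar>g z $ j\<bar>) (indicator ?S) z)"
      by linarith
  qed (use s in simp)
  also have "\<dots> = (1 / ?m) * (\<Sum>j\<in>UNIV. conv (\<lambda>z. \<bar>G z $ j\<bar>) (indicator ?S) z)
      + (16 / ?m) * (\<Sum>j\<in>UNIV. conv (\<lambda>z. \<bar>g z $ j\<bar>) (indicator ?S) z)"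
  proof -
    have "(1 / s) * (s / M * A + 2 * (8 * s / M * B)) = (1 / M) * A + (16 / M) * B" for M A B :: real
      using s by (simp add: distrib_left)
    then show ?thesis unfolding sum_distrib_left[symmetric] .
  qed
  also have "\<dots> \<le> (16 / ?m) * (\<Sum>j\<in>UNIV. conv (\<lambda>z. \<bar>G z $ j\<bar>) (indicator ?S) z)
      + (16 / ?m) * (\<Sum>j\<in>UNIV. conv (\<lambda>z. \<bar>g z $ j\<bar>) (indicator ?S) z)"
  proof (rule add_right_mono, rule mult_right_mono)
    show "1 / ?m \<le> 16 / ?m" using m by (intro divide_right_mono) simp_all
    show "0 \<le> (\<Sum>j\<in>UNIV. conv (\<lambda>z. \<bar>G z $ j\<bar>) (indicator ?S) z)"
      unfolding conv_def by (intro sum_nonneg integral_nonneg_AE AE_I2) simp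
  qed
  also have "\<dots> = 16 / ?m * conv (strength G g) (indicator ?S) z"
  proof -
    have i: "integrable lborel (\<lambda>w. \<bar>f w\<bar> * indicator ?S (z - w))" if "integrable lborel f" for f :: "(real ^ 'n) \<times> real \<Rightarrow> real"
      by (rule integrable_mult_bounded[OF integrable_abs[OF that] indicator_reflect[OF cylinder_sets]])
    have "conv (strength G g) (indicator ?S) z =
        (\<integral>w. (\<Sum>j\<in>UNIV. \<bar>G w $ j\<bar> * indicator ?S (z - w) + \<bar>g w $ j\<bar> * indicator ?S (z - w)) \<partial>lborel)"
      unfolding conv_def strength_def by (simp add: sum_distrib_right distrib_right)
    also have "\<dots> = (\<Sum>j\<in>UNIV. conv (\<lambda>z. \<bar>G z $ j\<bar>) (indicator ?S) z + conv (\<lambda>z. \<bar>g z $ j\<bar>) (indicator ?S) z)"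
      unfolding conv_def using i[OF I(2)] i[OF I(3)]
      by (simp only: Bochner_Integration.integral_sum Bochner_Integration.integral_add Bochner_Integration.integrable_add)
    finally show ?thesis
      by (simp add: sum.distrib distrib_left)
  qed
  finally show ?thesis .
qed

section \<open>Averages over parabolic cylinders\<close>

definition cyl_mass :: "'n::finite itself \<Rightarrow> real"
  where "cyl_mass _ = measure lborel (cylinder 0 0 1 :: ((real ^ 'n) \<times> real) set)"

text \<open>
  Convolution with \<open>cylavg s\<close> is averaging over the parabolic cylinder of radius \<open>s\<close>. Up to a constant this
  mollifier dominates the kernel \<open>moll s\<close>, and it is easier to estimate with.
\<close>

definition cylavg :: "real \<Rightarrow> (real ^ 'n::finite) \<times> real \<Rightarrow> real"
  where "cylavg s y = indicator (cylinder 0 0 s) y / (cyl_mass TYPE('n) * s ^ (CARD('n) + 2))"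

text \<open>
  Parabolic dilation reduces the volume of a cylinder to the one of radius 1.
\<close>

lemma integral_indicator_cylinder:
  assumes s: "0 < s"
  shows "(\<integral>y. indicator (cylinder 0 0 s) y \<partial>(lborel :: ((real ^ 'n::finite) \<times> real) measure)) =
    cyl_mass TYPE('n) * s ^ (CARD('n) + 2)"
proof -
  let ?T = "\<lambda>y :: (real ^ 'n) \<times> real. (s *\<^sub>R fst y, s\<^sup>2 * snd y)"
  let ?I = "\<lambda>s. indicator (cylinder 0 0 s) :: (real ^ 'n) \<times> real \<Rightarrow> real"
  have [measurable]: "?T \<in> borel_measurable borel"
    by (intro borel_measurable_continuous_onI continuous_intros)
  have [measurable]: "?I s \<in> borel_measurable borel" for s
    by (rule borel_measurable_indicator[OF cylinder_sets])
  have e: "?I s (?T y) = ?I 1 y" for y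
  proof -
    have "s * norm (fst y) < s \<longleftrightarrow> norm (fst y) < 1" "s\<^sup>2 * \<bar>snd y\<bar> < s\<^sup>2 \<longleftrightarrow> \<bar>snd y\<bar> < 1"
      using s by simp_all
    then show ?thesis
      using s by (simp add: indicator_def mem_cylinder_0 abs_mult)
  qed
  have "(\<integral>y. ?I s y \<partial>lborel) =
      (\<integral>y. ?I s y \<partial>(density (distr lborel borel ?T) (\<lambda>_. ennreal (s ^ (CARD('n) + 2)))))"
    using lborel_parabolic_dilation[OF s, where 'n='n] by simp
  also have "\<dots> = (\<integral>y. s ^ (CARD('n) + 2) *\<^sub>R ?I s y \<partial>(distr lborel borel ?T))"
    using s by (subst integral_density) auto
  also have "\<dots> = (\<integral>y. s ^ (CARD('n) + 2) *\<^sub>R ?I s (?T y) \<partial>lborel)"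
    by (rule integral_distr) auto
  also have "\<dots> = (\<integral>y. s ^ (CARD('n) + 2) *\<^sub>R ?I 1 y \<partial>lborel)"
    by (simp only: e)
  also have "\<dots> = s ^ (CARD('n) + 2) * (\<integral>y. ?I 1 y \<partial>lborel)"
    unfolding real_scaleR_def by (rule integral_mult_right_zero)
  also have "(\<integral>y. ?I 1 y \<partial>lborel) = cyl_mass TYPE('n)"
    by (simp add: cyl_mass_def)
  finally show ?thesis by (simp only: mult.commute)
qed

lemma cyl_mass_pos: "0 < cyl_mass TYPE('n::finite)"
proof -
  have "\<not> negligible (cylinder 0 0 1 :: ((real ^ 'n) \<times> real) set)"
    by (rule open_not_negligible[OF open_cylinder]) (auto simp: cylinder_def)
  then have "measure lebesgue (cylinder 0 0 1 :: ((real ^ 'n) \<times> real) set) \<noteq> 0"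
    using negligible_iff_measure0[of "cylinder 0 0 1 :: ((real ^ 'n) \<times> real) set"]
      lmeasurable_open[OF bounded_cylinder open_cylinder]
    by (auto simp: negligible_iff_measure)
  then show ?thesis
    by (simp add: cyl_mass_def zero_less_measure_iff)
qed

abbreviation "cylc s n \<equiv> cyl_mass (n :: 'n::finite itself) * s ^ (CARD('n) + 2)"

lemma cylc_pos: "0 < s \<Longrightarrow> 0 < cylc s TYPE('n::finite)"
  using cyl_mass_pos[where 'n='n] by simp

lemma cylavg_mollifier: "0 < s \<Longrightarrow> mollifier (cylavg s :: (real ^ 'n::finite) \<times> real \<Rightarrow> real)"
  unfolding mollifier_def
proof (intro conjI)
  assume s: "0 < s"
  have p: "0 < cylc s TYPE('n)" by (rule cylc_pos[OF s])
  show "cylavg s \<in> borel_measurable (borel :: ((real ^ 'n::finite) \<times> real) measure)"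
    unfolding cylavg_def[abs_def] by (intro borel_measurable_divide borel_measurable_indicator cylinder_sets borel_measurable_const)
  show "\<forall>y :: (real ^ 'n::finite) \<times> real. 0 \<le> cylavg s y"
    using p by (simp add: cylavg_def)
  show "\<exists>M. \<forall>y :: (real ^ 'n::finite) \<times> real. cylavg s y \<le> M"
    using p by (intro exI[of _ "1 / cylc s TYPE('n)"]) (simp add: cylavg_def indicator_def)
  have "(\<integral>y. cylavg s (y :: (real ^ 'n) \<times> real) \<partial>lborel) =
      (\<integral>y. indicator (cylinder 0 0 s) y \<partial>(lborel :: ((real ^ 'n) \<times> real) measure)) / cylc s TYPE('n)"
    unfolding cylavg_def by (rule integral_divide_zero)
  also have "\<dots> = 1"
    unfolding integral_indicator_cylinder[OF s] by (rule divide_self) (use p in linarith)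
  finally show "(\<integral>y. cylavg s (y :: (real ^ 'n) \<times> real) \<partial>lborel) = 1" .
qed

lemma conv_indicator_eq_cylavg:
  "0 < s \<Longrightarrow> conv H (indicator (cylinder 0 0 s)) z = cylc s TYPE('n::finite) * conv H (cylavg s) (z :: (real ^ 'n) \<times> real)"
proof -
  assume "0 < s"
  then have p: "cylc s TYPE('n) \<noteq> 0" using cylc_pos[of s, where 'n='n] by linarith
  have "conv H (cylavg s) z = (\<integral>w. H w * indicator (cylinder 0 0 s) (z - w) / cylc s TYPE('n) \<partial>lborel)"
    unfolding conv_def cylavg_def by simp
  also have "\<dots> = conv H (indicator (cylinder 0 0 s)) z / cylc s TYPE('n)"
    unfolding conv_def by (rule integral_divide_zero)
  finally have "conv H (cylavg s) z = conv H (indicator (cylinder 0 0 s)) z / cylc s TYPE('n)" .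
  from this[unfolded nonzero_eq_divide_eq[OF p]] show ?thesis by (simp only: mult.commute)
qed

lemma strength_L2:
  assumes w: "weak_pair C U G g"
  shows "L2 (strength G g)" "integrable lborel (strength G g)" "0 \<le> strength G g z" "z \<notin> C \<Longrightarrow> strength G g z = 0"
proof -
  have abs: "L2 (\<lambda>z. \<bar>f z\<bar>)" if "L2 f" for f :: "(real ^ 'a) \<times> real \<Rightarrow> real"
    using N2_mono(1)[OF that, of "\<lambda>z. \<bar>f z\<bar>"] L2_measurable[OF that] by simp
  have "L2 (\<lambda>z. \<Sum>j\<in>A. \<bar>G z $ j\<bar> + \<bar>g z $ j\<bar>)" if "finite A" for A
    using that
  proof (induction A rule: finite_induct)
    case empty
    show ?case by (simp add: L2_def)
  next
    case (insert j A)
    then show ?case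
      using L2_add[OF L2_add[OF abs[OF weak_pair_L2(2)[OF w]] abs[OF weak_pair_L2(3)[OF w]]] insert(3), of j j] by simp
  qed
  from this[of UNIV] show "L2 (strength G g)"
    by (simp add: strength_def[abs_def])
  show "integrable lborel (strength G g)"
    unfolding strength_def[abs_def] using weak_pair_integrable[OF w] by auto
  show "0 \<le> strength G g z" unfolding strength_def by (intro sum_nonneg) simp
  show "z \<notin> C \<Longrightarrow> strength G g z = 0"
    using weak_pair_zero[OF w] by (simp add: strength_def)
qed

text \<open>
  Integrate the bound for the scale derivative over \<open>[s/2, s]\<close>, enlarging every cylinder to the one of
  radius \<open>s\<close>. The factor \<open>2 ^ (n + 2)\<close> compares the normalising constants at \<open>s/2\<close> and \<open>s\<close>; the
  factor \<open>s\<close> is the length of the interval.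
\<close>

lemma scale_halving:
  fixes U :: "(real ^ 'n::finite) \<times> real \<Rightarrow> real"
  assumes w: "weak_pair C U G g" and s: "0 < s"
    and z: "closure (cylinder (fst z) (snd z) s) \<subseteq> C"
  shows "\<bar>conv U (moll s) z - conv U (moll (s / 2)) z\<bar> \<le>
    8 * 2 ^ (CARD('n) + 2) * (cyl_mass TYPE('n) / kern_mass TYPE('n)) * s * conv (strength G g) (cylavg s) z"
proof -
  note I = weak_pair_integrable[OF w]
  define H where "H = strength G g"
  note HH = strength_L2[OF w, folded H_def]
  let ?B = "16 / mollc (s/2) TYPE('n) * conv H (indicator (cylinder 0 0 s)) z"
  have bound: "norm (conv U (smoll t) z) \<le> ?B" if t: "t \<in> {s/2..s}" for t
  proof -
    have t0: "0 < t" using t s by auto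
    have sub: "cylinder x1 t1 t \<subseteq> cylinder x1 t1 s" for x1 :: "real ^ 'n" and t1
    proof -
      have "t\<^sup>2 \<le> s\<^sup>2" using t t0 by (intro power_mono) auto
      show ?thesis
      proof
        fix y assume "y \<in> cylinder x1 t1 t"
        then show "y \<in> cylinder x1 t1 s"
          unfolding mem_cylinder using t \<open>t\<^sup>2 \<le> s\<^sup>2\<close> by (meson atLeastAtMost_iff less_le_trans)
      qed
    qed
    have "\<bar>conv U (smoll t) z\<bar> \<le> 16 / mollc t TYPE('n) * conv H (indicator (cylinder 0 0 t)) z"
      unfolding H_def using closure_mono[OF sub] z by (intro conv_smoll_le[OF w t0]) blast
    also have "\<dots> \<le> ?B"
    proof (rule mult_mono)
      have "mollc (s/2) TYPE('n) \<le> mollc t TYPE('n)"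
        using t s kern_mass_pos[where 'n='n] by (intro mult_left_mono power_mono) auto
      moreover have "0 < mollc (s/2) TYPE('n)" using s by (intro mollc_pos) simp
      ultimately show "16 / mollc t TYPE('n) \<le> 16 / mollc (s/2) TYPE('n)"
        by (intro frac_le) simp_all
      show "0 \<le> 16 / mollc (s/2) TYPE('n)"
        using mollc_pos[of "s/2", where 'n='n] s by (intro divide_nonneg_nonneg) simp_all
      have i: "integrable lborel (\<lambda>w. H w * indicator (cylinder 0 0 t) (z - w))" for t
        by (rule integrable_mult_bounded[OF HH(2) indicator_reflect[OF cylinder_sets]])
      show "conv H (indicator (cylinder 0 0 t)) z \<le> conv H (indicator (cylinder 0 0 s)) z"
        unfolding conv_def
      proof (rule integral_mono[OF i i])
        show "H w * indicator (cylinder 0 0 t) (z - w) \<le> H w * indicator (cylinder 0 0 s) (z - w)" for w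
          using sub[of 0 0] HH(3)[of w] by (intro mult_left_mono) (auto simp: indicator_def)
      qed
      show "0 \<le> conv H (indicator (cylinder 0 0 t)) z"
        unfolding conv_def using HH(3) by (intro integral_nonneg_AE AE_I2) simp
    qed
    finally show ?thesis by simp
  qed
  have "norm (conv U (moll s) z - conv U (moll (s/2)) z) \<le> ?B * norm (s - s / 2)"
  proof (rule field_differentiable_bound[where S = "{s/2..s}" and f' = "\<lambda>t. conv U (smoll t) z"])
    show "((\<lambda>t. conv U (moll t) z) has_field_derivative conv U (smoll t) z) (at t within {s/2..s})"
      if "t \<in> {s/2..s}" for t
      by (rule has_field_derivative_at_within[OF conv_scale_deriv[OF I(1)]]) (use that s in simp)
    show "norm (conv U (smoll t) z) \<le> ?B" if "t \<in> {s/2..s}" for t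
      by (rule bound[OF that])
    show "convex {s/2..s}" by (rule convex_real_interval)
    show "s \<in> {s/2..s}" "s/2 \<in> {s/2..s}" using s by simp_all
  qed
  also have "\<dots> = 8 * 2 ^ (CARD('n) + 2) * (cyl_mass TYPE('n) / kern_mass TYPE('n)) * s * conv H (cylavg s) z"
  proof -
    have "16 / (k * (s / 2) ^ d) * (c * s ^ d * b) * (s / 2) = 8 * 2 ^ d * (c / k) * s * b" if "k > 0" for k c b :: real and d
      using that s by (simp add: power_divide)
    note * = this[OF kern_mass_pos[where 'n='n]]
    have n: "norm (s - s / 2) = s / 2" using s by simp
    show ?thesis
      unfolding conv_indicator_eq_cylavg[OF s] n by (rule *)
  qed
  finally show ?thesis by (simp add: H_def)
qed

section \<open>The gain of integrability\<close>

text \<open>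
  The graph of \<open>y powr q\<close> lies above its tangent at 1.
\<close>

lemma powr_bernoulli:
  assumes "1 < (q::real)" "0 \<le> y"
  shows "1 + q * (y - 1) \<le> y powr q"
proof -
  have "y * 1 \<le> y powr q / q + 1 powr (q / (q - 1)) / (q / (q - 1))"
    using assms by (intro Youngs_inequality) (auto simp: diff_divide_distrib)
  then have "q * y \<le> q * (y powr q / q + (q - 1) / q)"
    using assms by (intro mult_left_mono) simp_all
  also have "\<dots> = y powr q + (q - 1)"
    using assms by (simp add: distrib_left)
  finally show ?thesis by (simp add: right_diff_distrib)
qed

text \<open>
  Holder's inequality with weights, proved as Jensen's inequality: write \<open>a k = p k * (a k / p k)\<close>
  and use that the tangent to \<open>y powr q\<close> at \<open>y = 1\<close> lies below the graph.
\<close>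

lemma sum_powr_le:
  assumes q: "1 < (q::real)" and a: "\<And>k. 0 \<le> a k" and p: "\<And>k. 0 < p k" "(\<Sum>k<K. p k) \<le> (1::real)"
  shows "(\<Sum>k<(K::nat). a k) powr q \<le> (\<Sum>k<K. p k powr (1 - q) * a k powr q)"
proof (cases "(\<Sum>k<K. a k) = 0")
  case True
  then show ?thesis using q by (auto intro!: sum_nonneg)
next
  case False
  define S where "S = (\<Sum>k<K. a k)"
  have S: "0 < S" using False a unfolding S_def by (simp add: order_less_le sum_nonneg)
  have "1 \<le> (\<Sum>k<K. p k) + q * (1 - (\<Sum>k<K. p k))"
    using mult_right_mono[of 1 q "1 - (\<Sum>k<K. p k)"] p(2) q by simp
  also have "\<dots> = (\<Sum>k<K. p k + q * (a k / S - p k))"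
    using S by (simp add: sum.distrib sum_subtractf S_def flip: sum_distrib_left sum_divide_distrib)
  also have "\<dots> \<le> (\<Sum>k<K. p k powr (1 - q) * (a k / S) powr q)"
  proof (rule sum_mono)
    fix k
    have "p k * (1 + q * (a k / (p k * S) - 1)) \<le> p k * (a k / (p k * S)) powr q"
      using p(1)[of k] S a[of k] q by (intro mult_left_mono powr_bernoulli) auto
    also have "p k * (a k / (p k * S)) powr q = p k powr (1 - q) * (a k / S) powr q"
      using p(1)[of k] S a[of k] by (simp add: powr_divide powr_mult powr_diff field_simps)
    also have "p k * (1 + q * (a k / (p k * S) - 1)) = p k + q * (a k / S - p k)"
      using p(1)[of k] by (simp add: field_simps)
    finally show "p k + q * (a k / S - p k) \<le> p k powr (1 - q) * (a k / S) powr q" .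
  qed
  finally have "S powr q * 1 \<le> S powr q * (\<Sum>k<K. p k powr (1 - q) * (a k / S) powr q)"
    by (intro mult_left_mono) auto
  also have "\<dots> = (\<Sum>k<K. p k powr (1 - q) * a k powr q)"
    using S a by (simp add: sum_distrib_left powr_divide field_simps)
  finally show ?thesis by (simp add: S_def)
qed

text \<open>
  Averaging maps \<open>L\<^sup>2\<close> to \<open>L\<^sup>q\<close>. The square of an average is at most the average \<open>b\<close> of the square
  (Jensen), and \<open>b\<close> is at most \<open>(N2 H)\<^sup>2 / \<bar>Q\<bar>\<close>; interpolate by spending the power \<open>q/2 - 1\<close> of \<open>b\<close>
  on the uniform bound and integrating the remaining first power.
\<close>

lemma nn_integral_cylavg_powr_le:
  fixes H :: "(real ^ 'n::finite) \<times> real \<Rightarrow> real"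
  assumes H: "L2 H" "integrable lborel H" "\<And>z. 0 \<le> H z" and s: "0 < s" and q: "2 \<le> q"
  shows "(\<integral>\<^sup>+z. ennreal (conv H (cylavg s) z powr q) \<partial>lborel) \<le>
    ennreal (((N2 H)\<^sup>2 / cylc s TYPE('n)) powr (q / 2 - 1) * (N2 H)\<^sup>2)"
proof -
  note m = cylavg_mollifier[OF s, where 'n='n]
  let ?Y = "(N2 H)\<^sup>2 / cylc s TYPE('n)"
  have c: "0 < cylc s TYPE('n)" by (rule cylc_pos[OF s])
  have H2: "integrable lborel (\<lambda>z. (H z)\<^sup>2)" using H by (simp add: L2_def)
  have pw: "conv H (cylavg s) z powr q \<le> ?Y powr (q / 2 - 1) * conv (\<lambda>w. (H w)\<^sup>2) (cylavg s) z" for z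
  proof -
    let ?a = "conv H (cylavg s) z" and ?b = "conv (\<lambda>w. (H w)\<^sup>2) (cylavg s) z"
    have a0: "0 \<le> ?a" "0 \<le> ?b"
      unfolding conv_def using H(3) mollifierD(2)[OF m] by (intro integral_nonneg_AE AE_I2; simp)+
    have ab: "?a\<^sup>2 \<le> ?b" by (rule conv_square_le[OF H(1,2) m])
    have "?b \<le> (\<integral>w. (H w)\<^sup>2 / cylc s TYPE('n) \<partial>lborel)"
      unfolding conv_def
    proof (rule integral_mono)
      show "integrable lborel (\<lambda>w. (H w)\<^sup>2 * cylavg s (z - w))" by (rule conv_integrable[OF H2 m])
      show "integrable lborel (\<lambda>w. (H w)\<^sup>2 / cylc s TYPE('n))" using H2 by simp
      show "(H w)\<^sup>2 * cylavg s (z - w) \<le> (H w)\<^sup>2 / cylc s TYPE('n)" for w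
        using c by (auto simp: cylavg_def indicator_def)
    qed
    also have "\<dots> = ?Y" unfolding N2_square by (rule integral_divide_zero)
    finally have bY: "?b \<le> ?Y" .
    have "?a powr q = (?a\<^sup>2) powr (q / 2)"
      using a0 by (simp add: powr_powr flip: powr_numeral)
    also have "\<dots> \<le> ?b powr (q / 2)"
      using ab q by (intro powr_mono2) auto
    also have "\<dots> = ?b powr (q / 2 - 1) * ?b"
      using a0 by (cases "?b = 0") (simp_all add: powr_diff)
    also have "\<dots> \<le> ?Y powr (q / 2 - 1) * ?b"
      using bY a0 q by (intro mult_right_mono powr_mono2) auto
    finally show ?thesis .
  qed
  have "(\<integral>\<^sup>+z. ennreal (conv H (cylavg s) z powr q) \<partial>lborel) \<le>
      (\<integral>\<^sup>+z. ennreal (?Y powr (q / 2 - 1)) * ennreal (conv (\<lambda>w. (H w)\<^sup>2) (cylavg s) z) \<partial>lborel)"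
    using pw by (intro nn_integral_mono) (simp add: ennreal_leI flip: ennreal_mult')
  also have "\<dots> = ennreal (?Y powr (q / 2 - 1)) * (\<integral>\<^sup>+z. ennreal (conv (\<lambda>w. (H w)\<^sup>2) (cylavg s) z) \<partial>lborel)"
    using H(1) mollifierD(1)[OF m]
    by (intro nn_integral_cmult measurable_compose[OF _ measurable_ennreal]) (auto simp: L2_def intro!: conv_measurable)
  also have "(\<integral>\<^sup>+z. ennreal (conv (\<lambda>w. (H w)\<^sup>2) (cylavg s) z) \<partial>lborel) = (\<integral>\<^sup>+z. ennreal ((H z)\<^sup>2) \<partial>lborel)"
    by (rule nn_integral_conv[OF H2 _ m]) simp
  also have "\<dots> = ennreal ((N2 H)\<^sup>2)"
    unfolding N2_square by (rule nn_integral_eq_integral[OF H2]) simp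
  finally show ?thesis
    by (simp flip: ennreal_mult')
qed

lemma conv_moll_telescope:
  fixes U :: "(real ^ 'n::finite) \<times> real \<Rightarrow> real"
  assumes w: "weak_pair C U G g" and \<delta>: "0 < \<delta>"
    and z: "closure (cylinder (fst z) (snd z) \<delta>) \<subseteq> C"
  shows "\<bar>conv U (moll \<delta>) z - conv U (moll (\<delta> / 2 ^ m)) z\<bar> \<le>
    (\<Sum>k<m. 8 * 2 ^ (CARD('n) + 2) * (cyl_mass TYPE('n) / kern_mass TYPE('n)) * (\<delta> / 2 ^ k)
      * conv (strength G g) (cylavg (\<delta> / 2 ^ k)) z)"
proof (induction m)
  case (Suc m)
  have le: "\<delta> / 2 ^ m \<le> \<delta>" and s0: "0 < \<delta> / 2 ^ m"
    using \<delta> by (simp_all add: divide_le_eq)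
  have "(\<delta> / 2 ^ m)\<^sup>2 \<le> \<delta>\<^sup>2" using le s0 by (intro power_mono) simp_all
  then have "cylinder (fst z) (snd z) (\<delta> / 2 ^ m) \<subseteq> cylinder (fst z) (snd z) \<delta>"
    using le by (auto simp only: mem_cylinder subset_iff intro: less_le_trans)
  from closure_mono[OF this] z have "closure (cylinder (fst z) (snd z) (\<delta> / 2 ^ m)) \<subseteq> C"
    by blast
  from scale_halving[OF w s0 this] Suc show ?case
    by (simp add: mult.commute[of 2])
qed simp

text \<open>
  Telescope \<open>U * moll \<delta> - U\<close> over the scales \<open>s = \<delta> / 2 ^ k\<close>. By \<open>scale_halving\<close> and
  \<open>nn_integral_cylavg_powr_le\<close> the \<open>q\<close>-th power of the \<open>L\<^sup>q\<close> norm of the \<open>k\<close>-th term is of order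
  \<open>s powr \<gamma>\<close> with \<open>\<gamma> = q - (n + 2) (q/2 - 1)\<close>, which is positive exactly in the subcritical range
  \<open>q < 2 (1 + 2/n)\<close>. The geometric decay leaves room for the weights that are lost in \<open>sum_powr_le\<close>,
  and Fatou's lemma along a subsequence of scales completes the proof.
\<close>

lemma gain_of_integrability:
  fixes q :: real
  assumes q: "2 \<le> q" and \<gamma>: "0 < q - real (CARD('n::finite) + 2) * (q / 2 - 1)"
  shows "\<exists>K>0. \<forall>C (U :: (real ^ 'n) \<times> real \<Rightarrow> real) G g \<delta> D. weak_pair C U G g \<longrightarrow> 0 < \<delta> \<longrightarrow> D \<in> sets borel \<longrightarrow>
    (\<forall>z\<in>D. closure (cylinder (fst z) (snd z) \<delta>) \<subseteq> C) \<longrightarrow>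
    (\<integral>\<^sup>+z. ennreal (\<bar>U z - conv U (moll \<delta>) z\<bar> powr q) * indicator D z \<partial>lborel) \<le>
      ennreal (K * \<delta> powr (q - real (CARD('n) + 2) * (q / 2 - 1)) * ((N2 (strength G g))\<^sup>2) powr (q / 2))"
proof -
  define d where "d = CARD('n) + 2"
  define \<gamma> where "\<gamma> = q - real d * (q / 2 - 1)"
  have g0: "0 < \<gamma>" using \<gamma> by (simp add: \<gamma>_def d_def)
  define V where "V = cyl_mass TYPE('n)"
  have V: "0 < V" unfolding V_def by (rule cyl_mass_pos)
  define c1 where "c1 = 8 * 2 ^ d * (V / kern_mass TYPE('n))"
  have c1: "0 < c1" using V kern_mass_pos[where 'n='n] by (simp add: c1_def)
  \<comment> \<open>Half of the available decay \<open>2 powr (- \<gamma> k)\<close> is spent on the weights, the other half on the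
    convergence of the series. The choice of \<open>lam\<close> makes \<open>p k powr (1 - q)\<close> a multiple of \<open>x powr (- k)\<close>.\<close>
  define x :: real where "x = 2 powr (- \<gamma> / 2)"
  have x: "0 < x" "x < 1" using g0 powr_less_mono[of "- \<gamma> / 2" 0 2] by (simp_all add: x_def)
  define lam where "lam = x powr (1 / (q - 1))"
  have l: "0 < lam" "lam < 1"
  proof -
    show "0 < lam" using x by (simp add: lam_def)
    have "x powr (1 / (q - 1)) < 1 powr (1 / (q - 1))"
      using x q by (intro powr_less_mono2) simp_all
    then show "lam < 1" by (simp add: lam_def)
  qed
  define p where "p k = (1 - lam) * lam ^ k" for k :: nat
  have p0: "0 < p k" for k using l by (simp add: p_def)
  have p1: "(\<Sum>k<m. p k) \<le> 1" for m
  proof -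
    have "(\<Sum>k<m. p k) = 1 - lam ^ m"
      unfolding p_def by (simp add: one_diff_power_eq flip: sum_distrib_left)
    then show ?thesis using l by simp
  qed
  have pq: "p k powr (1 - q) = (1 - lam) powr (1 - q) / x ^ k" for k
  proof -
    have "(lam ^ k) powr (1 - q) = x powr (- real k)"
    proof -
      have "(lam ^ k) powr (1 - q) = x powr (1 / (q - 1) * real k * (1 - q))"
        using x l by (simp add: lam_def powr_powr flip: powr_realpow)
      also have "1 / (q - 1) * real k * (1 - q) = - real k"
        using q by (simp add: field_simps)
      finally show ?thesis .
    qed
    also have "\<dots> = 1 / x ^ k"
      using x by (simp add: powr_minus_divide powr_realpow)
    finally show ?thesis using l by (simp add: p_def powr_mult)
  qed
  define K where "K = (1 - lam) powr (1 - q) * c1 powr q * V powr (1 - q / 2) / (1 - x)"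
  have K: "0 < K" using l c1 V x by (simp add: K_def)
  show ?thesis
  proof (intro exI[of _ K] conjI K allI impI)
    fix C and U :: "(real ^ 'n) \<times> real \<Rightarrow> real" and G g \<delta> and D :: "((real ^ 'n) \<times> real) set"
    assume w: "weak_pair C U G g" and \<delta>: "0 < \<delta>" and D: "D \<in> sets borel"
      and z: "\<forall>z\<in>D. closure (cylinder (fst z) (snd z) \<delta>) \<subseteq> C"
    note I = weak_pair_integrable[OF w] and HH = strength_L2[OF w]
    define H where "H = strength G g"
    note HH = strength_L2[OF w, folded H_def]
    define Y where "Y = (N2 H)\<^sup>2"
    have Y0: "0 \<le> Y" by (simp add: Y_def)
    define B where "B = K * \<delta> powr \<gamma> * Y powr (q / 2)"
    let ?s = "\<lambda>k. \<delta> / 2 ^ k"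
    have s0: "0 < ?s k" for k using \<delta> by simp
    have Um: "U \<in> borel_measurable borel" using w by (simp add: weak_pair_def L2_def)
    have cm: "conv U (moll s) \<in> borel_measurable borel" for s
      by (rule conv_measurable[OF Um moll_measurable])
    have Am: "conv H (cylavg (?s k)) \<in> borel_measurable borel" for k
      by (rule conv_measurable[OF L2_measurable[OF HH(1)] mollifierD(1)[OF cylavg_mollifier[OF s0]]])
    have A0: "0 \<le> conv H (cylavg (?s k)) z" for k z
      unfolding conv_def
      by (intro integral_nonneg_AE AE_I2 mult_nonneg_nonneg HH(3) mollifierD(2)[OF cylavg_mollifier[OF s0]])
    \<comment> \<open>The telescoped difference obeys the final bound uniformly in the number \<open>m\<close> of scales.\<close>
    have fin: "(\<integral>\<^sup>+z. ennreal (\<bar>conv U (moll \<delta>) z - conv U (moll (?s m)) z\<bar> powr q) * indicator D z \<partial>lborel)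
        \<le> ennreal B" for m
    proof -
      let ?a = "\<lambda>k z. c1 * ?s k * conv H (cylavg (?s k)) z"
      have a0: "0 \<le> ?a k z" for k z using c1 \<delta> A0[of k z] by simp
      have "(\<integral>\<^sup>+z. ennreal (\<bar>conv U (moll \<delta>) z - conv U (moll (?s m)) z\<bar> powr q) * indicator D z \<partial>lborel)
          \<le> (\<integral>\<^sup>+z. (\<Sum>k<m. ennreal (p k powr (1 - q) * (c1 * ?s k) powr q) * ennreal (conv H (cylavg (?s k)) z powr q)) \<partial>lborel)"
      proof (rule nn_integral_mono)
        fix v :: "(real ^ 'n) \<times> real"
        show "ennreal (\<bar>conv U (moll \<delta>) v - conv U (moll (?s m)) v\<bar> powr q) * indicator D v
          \<le> (\<Sum>k<m. ennreal (p k powr (1 - q) * (c1 * ?s k) powr q) * ennreal (conv H (cylavg (?s k)) v powr q))"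
        proof (cases "v \<in> D")
          case True
          have "\<bar>conv U (moll \<delta>) v - conv U (moll (?s m)) v\<bar> \<le> (\<Sum>k<m. ?a k v)"
            using conv_moll_telescope[OF w \<delta>, of v m] z True by (simp add: c1_def V_def d_def H_def)
          then have "\<bar>conv U (moll \<delta>) v - conv U (moll (?s m)) v\<bar> powr q \<le> (\<Sum>k<m. ?a k v) powr q"
            using q by (intro powr_mono2) simp_all
          also have "\<dots> \<le> (\<Sum>k<m. p k powr (1 - q) * ?a k v powr q)"
            using q by (intro sum_powr_le a0 p0 p1) simp
          also have "\<dots> = (\<Sum>k<m. (p k powr (1 - q) * (c1 * ?s k) powr q) * (conv H (cylavg (?s k)) v powr q))"
          proof (intro sum.cong refl)
            fix k
            have "?a k v powr q = (c1 * ?s k) powr q * conv H (cylavg (?s k)) v powr q"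
              by (rule powr_mult; use c1 \<delta> A0[of k v] in simp)
            then show "p k powr (1 - q) * ?a k v powr q = p k powr (1 - q) * (c1 * ?s k) powr q * conv H (cylavg (?s k)) v powr q"
              by (simp only: mult.assoc)
          qed
          finally have "ennreal (\<bar>conv U (moll \<delta>) v - conv U (moll (?s m)) v\<bar> powr q) \<le>
              ennreal (\<Sum>k<m. (p k powr (1 - q) * (c1 * ?s k) powr q) * (conv H (cylavg (?s k)) v powr q))"
            by (rule ennreal_leI)
          then show ?thesis using True
            by (simp add: ennreal_mult flip: sum_ennreal)
        qed simp
      qed
      also have "\<dots> = (\<Sum>k<m. ennreal (p k powr (1 - q) * (c1 * ?s k) powr q) *
          (\<integral>\<^sup>+z. ennreal (conv H (cylavg (?s k)) z powr q) \<partial>lborel))"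
        using Am by (simp add: nn_integral_sum nn_integral_cmult)
      also have "\<dots> \<le> (\<Sum>k<m. ennreal (p k powr (1 - q) * (c1 * ?s k) powr q) *
          ennreal ((Y / (V * ?s k ^ d)) powr (q / 2 - 1) * Y))"
        using nn_integral_cylavg_powr_le[OF HH(1,2,3) s0 q]
        by (intro sum_mono mult_left_mono) (simp_all add: Y_def V_def d_def)
      also have "\<dots> = (\<Sum>k<m. ennreal ((1 - x) * B * x ^ k))"
      proof (intro sum.cong refl)
        fix k
        have "(Y / (V * ?s k ^ d)) powr (q / 2 - 1) * Y = V powr (1 - q / 2) * Y powr (q / 2) * ?s k powr (- real d * (q / 2 - 1))"
        proof (cases "Y = 0")
          case False
          have "(Y / (V * ?s k ^ d)) powr (q / 2 - 1) = Y powr (q / 2 - 1) / (V powr (q / 2 - 1) * ?s k powr (real d * (q / 2 - 1)))"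
          proof -
            have "(?s k ^ d) powr (q / 2 - 1) = ?s k powr (real d * (q / 2 - 1))"
              unfolding powr_realpow[OF s0[of k], symmetric] by (rule powr_powr)
            then show ?thesis by (simp only: powr_divide powr_mult)
          qed
          moreover have "V powr (1 - q / 2) = 1 / V powr (q / 2 - 1)"
            using powr_minus_divide[of V "q / 2 - 1"] by simp
          moreover have "?s k powr (- real d * (q / 2 - 1)) = 1 / ?s k powr (real d * (q / 2 - 1))"
            using powr_minus_divide[of "?s k" "real d * (q / 2 - 1)"] by simp
          moreover have "Y powr (q / 2 - 1) * Y = Y powr (q / 2)"
            using Y0 False by (simp add: powr_diff)
          ultimately show ?thesis by (simp add: field_simps)
        qed simp
        then have "p k powr (1 - q) * (c1 * ?s k) powr q * ((Y / (V * ?s k ^ d)) powr (q / 2 - 1) * Y) =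
            (1 - lam) powr (1 - q) / x ^ k * (c1 powr q * ?s k powr q) *
              (V powr (1 - q / 2) * Y powr (q / 2) * ?s k powr (- real d * (q / 2 - 1)))"
          by (simp only: pq powr_mult[of c1])
        also have "\<dots> = ((1 - x) * K * Y powr (q / 2)) / x ^ k * (?s k powr q * ?s k powr (- real d * (q / 2 - 1)))"
          using x by (simp add: K_def field_simps)
        also have "?s k powr q * ?s k powr (- real d * (q / 2 - 1)) = ?s k powr \<gamma>"
          by (simp add: \<gamma>_def flip: powr_add)
        also have "?s k powr \<gamma> = \<delta> powr \<gamma> * (x ^ k * x ^ k)"
        proof -
          have "?s k powr \<gamma> = \<delta> powr \<gamma> * 2 powr (- \<gamma> * real k)"
            using \<delta> by (simp add: powr_divide powr_powr powr_minus_divide mult.commute flip: powr_realpow)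
          also have "2 powr (- \<gamma> * real k) = x ^ k * x ^ k"
            using x by (simp add: x_def powr_powr flip: powr_realpow powr_add)
          finally show ?thesis .
        qed
        also have "((1 - x) * K * Y powr (q / 2)) / x ^ k * (\<delta> powr \<gamma> * (x ^ k * x ^ k)) = (1 - x) * B * x ^ k"
          using x by (simp add: B_def)
        finally have "p k powr (1 - q) * (c1 * ?s k) powr q * ((Y / (V * ?s k ^ d)) powr (q / 2 - 1) * Y) = (1 - x) * B * x ^ k" .
        then show "ennreal (p k powr (1 - q) * (c1 * ?s k) powr q) * ennreal ((Y / (V * ?s k ^ d)) powr (q / 2 - 1) * Y) =
            ennreal ((1 - x) * B * x ^ k)"
          by (simp flip: ennreal_mult')
      qed
      also have "\<dots> = ennreal (\<Sum>k<m. (1 - x) * B * x ^ k)"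
        using x K Y0 by (intro sum_ennreal) (simp add: B_def)
      also have "(\<Sum>k<m. (1 - x) * B * x ^ k) = B * (1 - x ^ m)"
        by (simp add: one_diff_power_eq mult.commute mult.left_commute flip: sum_distrib_left)
      also have "ennreal (B * (1 - x ^ m)) \<le> ennreal B"
        using x K Y0 by (intro ennreal_leI) (simp add: B_def mult_left_le)
      finally show ?thesis .
    qed
    have "?s \<longlonglongrightarrow> 0"
      by (rule LIMSEQ_divide_realpow_zero) simp
    have "bounded C" using w by (simp add: weak_pair_def)
    from moll_seq_tendsto[OF weak_pair_L2(1)[OF w] this weak_pair_zero(1)[OF w] s0 \<open>?s \<longlonglongrightarrow> 0\<close>]
    have t: "(\<lambda>n. N2 (\<lambda>z. conv U (moll (?s n)) z - U z)) \<longlonglongrightarrow> 0" by simp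
    obtain r :: "nat \<Rightarrow> nat" where ae: "AE v in lborel. (\<lambda>n. conv U (moll (?s (r n))) v - U v) \<longlonglongrightarrow> 0"
      using N2_tendsto_AE_subseq[OF L2_diff[OF conv_L2(1)[OF weak_pair_L2(1)[OF w] I(1) moll_mollifier[OF s0]] weak_pair_L2(1)[OF w]] t]
      by blast
    let ?f = "\<lambda>n v. ennreal (\<bar>conv U (moll \<delta>) v - conv U (moll (?s (r n))) v\<bar> powr q) * indicator D v"
    have "(\<integral>\<^sup>+v. ennreal (\<bar>U v - conv U (moll \<delta>) v\<bar> powr q) * indicator D v \<partial>lborel) \<le>
        (\<integral>\<^sup>+v. liminf (\<lambda>n. ?f n v) \<partial>lborel)"
    proof (rule nn_integral_mono_AE)
      from ae show "AE v in lborel. ennreal (\<bar>U v - conv U (moll \<delta>) v\<bar> powr q) * indicator D v \<le> liminf (\<lambda>n. ?f n v)"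
      proof eventually_elim
        case (elim v)
        have "(\<lambda>n. conv U (moll (?s (r n))) v) \<longlonglongrightarrow> U v"
          by (rule LIM_zero_cancel[OF elim])
        then have "(\<lambda>n. \<bar>conv U (moll \<delta>) v - conv U (moll (?s (r n))) v\<bar> powr q) \<longlonglongrightarrow> \<bar>conv U (moll \<delta>) v - U v\<bar> powr q"
          using q by (intro tendsto_powr' tendsto_rabs tendsto_diff tendsto_const) auto
        then have "(\<lambda>n. ennreal (\<bar>conv U (moll \<delta>) v - conv U (moll (?s (r n))) v\<bar> powr q)) \<longlonglongrightarrow>
            ennreal (\<bar>conv U (moll \<delta>) v - U v\<bar> powr q)"
          by (rule tendsto_ennrealI)
        then have "(\<lambda>n. ?f n v) \<longlonglongrightarrow> ennreal (\<bar>conv U (moll \<delta>) v - U v\<bar> powr q) * indicator D v"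
          by (cases "v \<in> D") simp_all
        from lim_imp_Liminf[OF trivial_limit_sequentially this] show ?case
          by (simp add: abs_minus_commute)
      qed
    qed
    also have "\<dots> \<le> liminf (\<lambda>n. \<integral>\<^sup>+v. ?f n v \<partial>lborel)"
    proof (rule nn_integral_liminf)
      show "?f n \<in> borel_measurable lborel" for n
        using cm D by measurable
    qed
    also have "\<dots> \<le> ennreal B"
      using fin by (intro Liminf_le) (simp_all add: always_eventually)
    finally show "(\<integral>\<^sup>+v. ennreal (\<bar>U v - conv U (moll \<delta>) v\<bar> powr q) * indicator D v \<partial>lborel) \<le>
      ennreal (K * \<delta> powr (q - real (CARD('n) + 2) * (q / 2 - 1)) * ((N2 (strength G g))\<^sup>2) powr (q / 2))"
      by (simp add: B_def Y_def H_def \<gamma>_def d_def)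
  qed
qed

lemma powr_add_le:
  assumes "1 \<le> (q::real)" "0 \<le> a" "0 \<le> b"
  shows "(a + b) powr q \<le> 2 powr q * (a powr q + b powr q)"
proof -
  have "(a + b) powr q \<le> (2 * max a b) powr q"
    using assms by (intro powr_mono2) auto
  also have "\<dots> = 2 powr q * max a b powr q"
    using assms by (simp add: powr_mult)
  also have "\<dots> \<le> 2 powr q * (a powr q + b powr q)"
    by (intro mult_left_mono) (auto simp: max_def)
  finally show ?thesis .
qed

text \<open>
  At the fixed scale \<open>\<delta>\<close> the mollified function is bounded pointwise by the \<open>L\<^sup>1\<close> norm of \<open>U\<close> over
  the volume of the kernel's support.
\<close>

lemma local_Lq_estimate:
  fixes q :: real
  assumes q: "2 \<le> q" and \<gamma>: "0 < q - real (CARD('n::finite) + 2) * (q / 2 - 1)"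
  shows "\<exists>K>0. \<forall>C (U :: (real ^ 'n) \<times> real \<Rightarrow> real) G g \<delta> D. weak_pair C U G g \<longrightarrow> 0 < \<delta> \<longrightarrow> D \<in> sets borel \<longrightarrow>
    bounded D \<longrightarrow> (\<forall>z\<in>D. closure (cylinder (fst z) (snd z) \<delta>) \<subseteq> C) \<longrightarrow>
    (\<integral>\<^sup>+z. ennreal (\<bar>U z\<bar> powr q) * indicator D z \<partial>lborel) \<le>
      ennreal (K * (\<delta> powr (q - real (CARD('n) + 2) * (q / 2 - 1)) * ((N2 (strength G g))\<^sup>2) powr (q / 2)
        + measure lborel D * ((\<integral>z. \<bar>U z\<bar> \<partial>lborel) / \<delta> ^ (CARD('n) + 2)) powr q))"
proof -
  obtain K where K: "0 < K" and gain: "\<And>C (U :: (real ^ 'n) \<times> real \<Rightarrow> real) G g \<delta> D. weak_pair C U G g \<Longrightarrow> 0 < \<delta> \<Longrightarrow> D \<in> sets borel \<Longrightarrow>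
    (\<forall>z\<in>D. closure (cylinder (fst z) (snd z) \<delta>) \<subseteq> C) \<Longrightarrow>
    (\<integral>\<^sup>+z. ennreal (\<bar>U z - conv U (moll \<delta>) z\<bar> powr q) * indicator D z \<partial>lborel) \<le>
      ennreal (K * \<delta> powr (q - real (CARD('n) + 2) * (q / 2 - 1)) * ((N2 (strength G g))\<^sup>2) powr (q / 2))"
    using gain_of_integrability[OF assms] by blast
  define c where "c = kern_mass TYPE('n)"
  have c: "0 < c" unfolding c_def by (rule kern_mass_pos)
  define K' where "K' = 2 powr q * (K + 1 / c powr q)"
  have K': "0 < K'" using K c by (simp add: K'_def add_pos_pos)
  show ?thesis
  proof (intro exI[of _ K'] conjI K' allI impI)
    fix C and U :: "(real ^ 'n) \<times> real \<Rightarrow> real" and G g \<delta> and D :: "((real ^ 'n) \<times> real) set"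
    assume w: "weak_pair C U G g" and \<delta>: "0 < \<delta>" and D: "D \<in> sets borel" and bD: "bounded D"
      and z: "\<forall>z\<in>D. closure (cylinder (fst z) (snd z) \<delta>) \<subseteq> C"
    have U: "integrable lborel U" by (rule weak_pair_integrable[OF w])
    have Um: "U \<in> borel_measurable borel" using w by (simp add: weak_pair_def L2_def)
    have cm: "conv U (moll \<delta>) \<in> borel_measurable borel"
      by (rule conv_measurable[OF Um moll_measurable])
    let ?X = "\<delta> powr (q - real (CARD('n) + 2) * (q / 2 - 1)) * ((N2 (strength G g))\<^sup>2) powr (q / 2)"
    define b where "b = (\<integral>z. \<bar>U z\<bar> \<partial>lborel) / (c * \<delta> ^ (CARD('n) + 2))"
    have b0: "0 \<le> b" using c \<delta> by (simp add: b_def)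
    \<comment> \<open>The kernel \<open>moll \<delta>\<close> is at most \<open>1 / (c \<delta> ^ (n + 2))\<close>.\<close>
    have sup: "\<bar>conv U (moll \<delta>) v\<bar> \<le> b" for v
    proof -
      have m: "0 < c * \<delta> ^ (CARD('n) + 2)" using c \<delta> by simp
      have i: "integrable lborel (\<lambda>w. U w * moll \<delta> (v - w))"
        by (rule conv_integrable[OF U moll_mollifier[OF \<delta>]])
      have "\<bar>conv U (moll \<delta>) v\<bar> \<le> (\<integral>w. \<bar>U w * moll \<delta> (v - w)\<bar> \<partial>lborel)"
        unfolding conv_def by (rule integral_abs_bound)
      also have "\<dots> \<le> (\<integral>w. \<bar>U w\<bar> / (c * \<delta> ^ (CARD('n) + 2)) \<partial>lborel)"
      proof (rule integral_mono)
        show "integrable lborel (\<lambda>w. \<bar>U w * moll \<delta> (v - w)\<bar>)" by (rule integrable_abs[OF i])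
        show "integrable lborel (\<lambda>w. \<bar>U w\<bar> / (c * \<delta> ^ (CARD('n) + 2)))" using U by simp
        fix w
        have "\<bar>moll \<delta> (v - w)\<bar> \<le> 1 / (c * \<delta> ^ (CARD('n) + 2))"
          unfolding moll_def c_def[symmetric] abs_divide using m
          by (simp only: abs_of_nonneg[OF kern_nonneg] abs_of_pos) (intro divide_right_mono kern_le_1, simp)
        then show "\<bar>U w * moll \<delta> (v - w)\<bar> \<le> \<bar>U w\<bar> / (c * \<delta> ^ (CARD('n) + 2))"
          using mult_left_mono[of _ _ "\<bar>U w\<bar>"] by (simp only: abs_mult) (metis abs_ge_zero mult.right_neutral times_divide_eq_right)
      qed
      also have "\<dots> = b" unfolding b_def by (rule integral_divide_zero)
      finally show ?thesis .
    qed
    have mD: "emeasure lborel D = ennreal (measure lborel D)"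
      using emeasure_bounded_finite[OF bD] by (intro emeasure_eq_ennreal_measure) auto
    have "(\<integral>\<^sup>+v. ennreal (\<bar>U v\<bar> powr q) * indicator D v \<partial>lborel) \<le>
        (\<integral>\<^sup>+v. ennreal (2 powr q) * (ennreal (\<bar>U v - conv U (moll \<delta>) v\<bar> powr q) * indicator D v)
          + ennreal (2 powr q * b powr q) * indicator D v \<partial>lborel)"
    proof (rule nn_integral_mono)
      fix v :: "(real ^ 'n) \<times> real"
      have "\<bar>U v\<bar> powr q \<le> (\<bar>U v - conv U (moll \<delta>) v\<bar> + b) powr q"
        using sup[of v] q by (intro powr_mono2) auto
      also have "\<dots> \<le> 2 powr q * (\<bar>U v - conv U (moll \<delta>) v\<bar> powr q + b powr q)"
        using q b0 by (intro powr_add_le) auto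
      finally have "ennreal (\<bar>U v\<bar> powr q) \<le> ennreal (2 powr q) * ennreal (\<bar>U v - conv U (moll \<delta>) v\<bar> powr q) + ennreal (2 powr q * b powr q)"
        by (simp add: distrib_left flip: ennreal_mult' ennreal_plus)
      then show "ennreal (\<bar>U v\<bar> powr q) * indicator D v \<le> ennreal (2 powr q) * (ennreal (\<bar>U v - conv U (moll \<delta>) v\<bar> powr q) * indicator D v)
          + ennreal (2 powr q * b powr q) * indicator D v"
        by (cases "v \<in> D") simp_all
    qed
    also have "\<dots> = ennreal (2 powr q) * (\<integral>\<^sup>+v. ennreal (\<bar>U v - conv U (moll \<delta>) v\<bar> powr q) * indicator D v \<partial>lborel)
        + ennreal (2 powr q * b powr q) * emeasure lborel D"
    proof -
      have m: "(\<lambda>v. ennreal (\<bar>U v - conv U (moll \<delta>) v\<bar> powr q) * indicator D v) \<in> borel_measurable lborel"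
        using Um cm D by measurable
      have m2: "(\<lambda>v. ennreal (2 powr q * b powr q) * indicator D v) \<in> borel_measurable lborel"
        using D by measurable
      have m3: "(\<lambda>v. ennreal (2 powr q) * (ennreal (\<bar>U v - conv U (moll \<delta>) v\<bar> powr q) * indicator D v)) \<in> borel_measurable lborel"
        using m by measurable
      show ?thesis
        using D by (simp add: nn_integral_add[OF m3 m2] nn_integral_cmult[OF m] nn_integral_cmult_indicator)
    qed
    also have "\<dots> \<le> ennreal (2 powr q) * ennreal (K * \<delta> powr (q - real (CARD('n) + 2) * (q / 2 - 1)) * ((N2 (strength G g))\<^sup>2) powr (q / 2))
        + ennreal (2 powr q * b powr q) * ennreal (measure lborel D)"
      unfolding mD by (intro add_right_mono mult_left_mono gain[OF w \<delta> D z]) simp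
    also have "\<dots> = ennreal (2 powr q * (K * ?X) + 2 powr q * b powr q * measure lborel D)"
      using K \<delta> by (simp add: mult.assoc flip: ennreal_mult' ennreal_plus)
    also have "\<dots> \<le> ennreal (K' * (?X + measure lborel D * ((\<integral>z. \<bar>U z\<bar> \<partial>lborel) / \<delta> ^ (CARD('n) + 2)) powr q))"
    proof (rule ennreal_leI)
      let ?Z = "((\<integral>z. \<bar>U z\<bar> \<partial>lborel) / \<delta> ^ (CARD('n) + 2)) powr q"
      have "b = (\<integral>z. \<bar>U z\<bar> \<partial>lborel) / \<delta> ^ (CARD('n) + 2) / c"
        by (simp add: b_def mult.commute)
      moreover have "0 \<le> (\<integral>z. \<bar>U z\<bar> \<partial>lborel) / \<delta> ^ (CARD('n) + 2)"
        using \<delta> by (intro divide_nonneg_nonneg) simp_all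
      ultimately have bq: "b powr q = ?Z / c powr q"
        using c powr_divide[of _ c q] by (simp only: less_imp_le)
      have a: "T * (K * X) + T * (Z / P) * M \<le> T * (K + 1 / P) * (X + M * Z)"
        if "0 \<le> T" "0 \<le> X" "0 \<le> Z" "0 < P" "0 \<le> M" for T X Z P M :: real
      proof -
        have "T * (K + 1 / P) * (X + M * Z) - (T * (K * X) + T * (Z / P) * M) = T * (K * (M * Z) + X / P)"
          by (simp add: algebra_simps)
        moreover have "0 \<le> T * (K * (M * Z) + X / P)"
          using that K by (intro mult_nonneg_nonneg add_nonneg_nonneg divide_nonneg_pos) auto
        ultimately have "0 \<le> T * (K + 1 / P) * (X + M * Z) - (T * (K * X) + T * (Z / P) * M)"
          by (simp only:)
        then show ?thesis by (simp only: diff_ge_0_iff_ge)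
      qed
      show "2 powr q * (K * ?X) + 2 powr q * b powr q * measure lborel D \<le> K' * (?X + measure lborel D * ?Z)"
        unfolding bq K'_def by (rule a) (use c in simp_all)
    qed
    finally show "(\<integral>\<^sup>+v. ennreal (\<bar>U v\<bar> powr q) * indicator D v \<partial>lborel) \<le>
      ennreal (K' * (?X + measure lborel D * ((\<integral>z. \<bar>U z\<bar> \<partial>lborel) / \<delta> ^ (CARD('n) + 2)) powr q))" .
  qed
qed

section \<open>Cutoff functions\<close>

definition sqp :: "real \<Rightarrow> real" where "sqp x = (max 0 x)\<^sup>2"

lemma sqp_deriv: "(sqp has_real_derivative 2 * max 0 x) (at x)"
proof -
  consider "x < 0" | "x = 0" | "0 < x" by linarith
  then show ?thesis
  proof cases
    case 1
    have "\<forall>\<^sub>F y in nhds x. sqp y = 0"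
      using eventually_nhds_in_open[of "{..<0}" x] 1
      by (auto elim!: eventually_mono simp: sqp_def)
    then show ?thesis
      using 1 DERIV_cong_ev[of x x sqp "\<lambda>_. 0" "2 * max 0 x" 0] by simp
  next
    case 2
    have "((\<lambda>h. max 0 h :: real) \<longlongrightarrow> max 0 0) (at 0)"
      by (intro tendsto_max tendsto_const tendsto_ident_at)
    then have "((\<lambda>h. max 0 h :: real) \<longlongrightarrow> 0) (at 0)" by simp
    moreover have "\<forall>\<^sub>F h in at 0. max 0 h = sqp h / (h::real)"
      by (auto simp: eventually_at_filter sqp_def max_def power2_eq_square)
    ultimately have "((\<lambda>h. sqp h / h) \<longlongrightarrow> 0) (at 0)"
      by (rule Lim_transform_eventually)
    then show ?thesis using 2 by (simp add: DERIV_def sqp_def)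
  next
    case 3
    have "((\<lambda>y. y\<^sup>2) has_real_derivative 2 * x) (at x)"
      by (auto intro!: derivative_eq_intros)
    moreover have "\<forall>\<^sub>F y in nhds x. sqp y = y\<^sup>2"
      using eventually_nhds_in_open[of "{0<..}" x] 3
      by (auto elim!: eventually_mono simp: sqp_def)
    ultimately show ?thesis
      using 3 DERIV_cong_ev[of x x sqp "\<lambda>y. y\<^sup>2" "2 * max 0 x" "2 * max 0 x"] by simp
  qed
qed

text \<open>
  A once continuously differentiable transition from 1 on \<open>x \<le> 0\<close> to 0 on \<open>x \<ge> 1\<close>, made of squared
  positive parts so that its derivative has an explicit bound.
\<close>

definition step :: "real \<Rightarrow> real" where "step x = sqp (1 - sqp x)"

definition step' :: "real \<Rightarrow> real" where "step' x = - (2 * max 0 (1 - sqp x) * (2 * max 0 x))"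

lemma step_deriv: "(step has_real_derivative step' x) (at x)"
  unfolding step_def[abs_def] step'_def
  by (rule DERIV_cong[OF DERIV_chain2[OF sqp_deriv DERIV_diff[OF DERIV_const sqp_deriv]]]) simp

lemma step_props:
  "x \<le> 0 \<Longrightarrow> step x = 1" "1 \<le> x \<Longrightarrow> step x = 0" "0 \<le> step x" "step x \<le> 1" "\<bar>step' x\<bar> \<le> 4"
  "1 \<le> x \<Longrightarrow> step' x = 0"
proof -
  have ge1: "1 \<le> sqp x" if "1 \<le> x" using that by (simp add: sqp_def)
  have s0: "0 \<le> sqp x" for x by (simp add: sqp_def)
  show "x \<le> 0 \<Longrightarrow> step x = 1" by (simp add: step_def sqp_def)
  show "1 \<le> x \<Longrightarrow> step x = 0" using ge1 by (simp add: step_def sqp_def[of "1 - sqp x"])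
  show z: "1 \<le> x \<Longrightarrow> step' x = 0" using ge1 by (simp add: step'_def)
  show "0 \<le> step x" by (simp add: step_def s0)
  have "(max 0 (1 - sqp x))\<^sup>2 \<le> 1\<^sup>2" using s0[of x] by (intro power_mono) auto
  then show "step x \<le> 1" by (simp add: step_def sqp_def[of "1 - sqp x"])
  show "\<bar>step' x\<bar> \<le> 4"
  proof (cases "1 \<le> x")
    case False
    have "\<bar>2 * max 0 (1 - sqp x)\<bar> \<le> 2" using s0[of x] by auto
    moreover have "\<bar>2 * max 0 x\<bar> \<le> 2" using False by auto
    ultimately have "\<bar>(2 * max 0 (1 - sqp x)) * (2 * max 0 x)\<bar> \<le> 2 * 2" by (rule abs_mult_le_mult)
    then show ?thesis unfolding step'_def abs_minus_cancel by simp
  qed (simp add: z)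
qed

lemma step_cont: "continuous_on UNIV step" "continuous_on UNIV step'"
proof -
  have "continuous_on UNIV sqp"
    unfolding sqp_def[abs_def] by (intro continuous_intros)
  then show "continuous_on UNIV step" "continuous_on UNIV step'"
    unfolding step_def[abs_def] step'_def[abs_def]
    by (auto intro!: continuous_intros continuous_on_compose2[of UNIV sqp UNIV])
qed

definition cutoff_between :: "real ^ 'n \<Rightarrow> real \<Rightarrow> real \<Rightarrow> real \<Rightarrow> ((real ^ 'n) \<times> real \<Rightarrow> real)
    \<Rightarrow> ((real ^ 'n) \<times> real \<Rightarrow> real) \<Rightarrow> ((real ^ 'n) \<times> real \<Rightarrow> real ^ 'n) \<Rightarrow> bool"
  where "cutoff_between x0 t0 r R \<phi> \<phi>t \<phi>x \<longleftrightarrow>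
    bm \<phi> \<and> bm \<phi>t \<and> (\<forall>j. bm (\<lambda>z. \<phi>x z $ j)) \<and>
    (\<forall>z. 0 \<le> \<phi> z \<and> \<phi> z \<le> 1) \<and> (\<forall>z\<in>cylinder x0 t0 r. \<phi> z = 1) \<and>
    (\<forall>z. z \<notin> cylinder x0 t0 R \<longrightarrow> \<phi> z = 0) \<and>
    (\<forall>z\<in>cylinder x0 t0 R. \<bar>\<phi>t z\<bar> \<le> 8 / (R - r)\<^sup>2 \<and> norm (\<phi>x z) \<le> 8 / (R - r)) \<and>
    (\<forall>z. ((\<lambda>h. \<phi> (z + h *\<^sub>R (0, 1))) has_real_derivative \<phi>t z) (at 0)) \<and>
    (\<forall>z j. ((\<lambda>h. \<phi> (z + h *\<^sub>R (axis j 1, 0))) has_real_derivative \<phi>x z $ j) (at 0))"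

text \<open>
  The cutoff is a product of a function of \<open>\<bar>x - x0\<bar>\<^sup>2\<close> and a function of \<open>(t - t0)\<^sup>2\<close>, so that no norm has
  to be differentiated at the centre.
\<close>

lemma cutoff_exists:
  fixes x0 :: "real ^ 'n::finite"
  assumes r: "0 < r" "r < R"
  shows "\<exists>\<phi> \<phi>t \<phi>x. cutoff_between x0 t0 r R \<phi> \<phi>t \<phi>x"
proof -
  \<comment> \<open>Both variables are affine in the squared distances; they are nonpositive on the inner
    cylinder, and outside the outer one at least one of them is at least 1.\<close>
  define a where "a z = ((fst z - x0) \<bullet> (fst z - x0) - r\<^sup>2) / (R\<^sup>2 - r\<^sup>2)" for z :: "(real ^ 'n) \<times> real"
  define b where "b z = ((snd z - t0)\<^sup>2 - r ^ 4) / (R ^ 4 - r ^ 4)" for z :: "(real ^ 'n) \<times> real"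
  have R2: "(R - r)\<^sup>2 \<le> R\<^sup>2 - r\<^sup>2" "R * (R - r) \<le> R\<^sup>2 - r\<^sup>2" "0 < R\<^sup>2 - r\<^sup>2"
  proof -
    have e: "R\<^sup>2 - r\<^sup>2 = (R - r) * (R + r)" by (simp add: power2_eq_square algebra_simps)
    show "(R - r)\<^sup>2 \<le> R\<^sup>2 - r\<^sup>2" unfolding e power2_eq_square[of "R - r"] using r by (intro mult_left_mono) auto

    show "R * (R - r) \<le> R\<^sup>2 - r\<^sup>2" unfolding e mult.commute[of R] using r by (intro mult_left_mono) auto
    show "0 < R\<^sup>2 - r\<^sup>2" unfolding e using r by simp
  qed
  have R4e: "R ^ 4 - r ^ 4 = (R\<^sup>2 - r\<^sup>2) * (R\<^sup>2 + r\<^sup>2)" by (simp add: power2_eq_square algebra_simps eval_nat_numeral)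
  have R4: "(R\<^sup>2 - r\<^sup>2) * R\<^sup>2 \<le> R ^ 4 - r ^ 4" "0 < R ^ 4 - r ^ 4"
  proof -
    show "(R\<^sup>2 - r\<^sup>2) * R\<^sup>2 \<le> R ^ 4 - r ^ 4" unfolding R4e using R2(3) by (intro mult_left_mono) auto
    have "0 < R\<^sup>2 + r\<^sup>2" using r by (simp add: add_pos_pos)
    then show "0 < R ^ 4 - r ^ 4" unfolding R4e using R2(3) by simp
  qed
  define \<phi> where "\<phi> z = step (a z) * step (b z)" for z
  define \<phi>t where "\<phi>t z = step (a z) * (step' (b z) * (2 * (snd z - t0) / (R ^ 4 - r ^ 4)))" for z
  define \<phi>x where "\<phi>x z = (step' (a z) * step (b z) * (2 / (R\<^sup>2 - r\<^sup>2))) *\<^sub>R (fst z - x0)" for z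
  have in_cyl: "z \<in> cylinder x0 t0 s \<longleftrightarrow> (fst z - x0) \<bullet> (fst z - x0) < s\<^sup>2 \<and> (snd z - t0)\<^sup>2 < s ^ 4" if "0 < s" for z s
  proof -
    have "norm (fst z - x0) < s \<longleftrightarrow> (norm (fst z - x0))\<^sup>2 < s\<^sup>2"
      using that by (metis abs_norm_cancel abs_of_pos abs_le_square_iff not_le)
    moreover have "\<bar>snd z - t0\<bar> < s\<^sup>2 \<longleftrightarrow> (snd z - t0)\<^sup>2 < (s\<^sup>2)\<^sup>2"
      by (metis abs_le_square_iff abs_of_nonneg not_le zero_le_power2)
    ultimately show ?thesis
      by (simp add: mem_cylinder dist_norm norm_minus_commute dot_square_norm)
  qed
  have R0: "0 < R" using r by simp
  have a1: "1 \<le> a z \<or> 1 \<le> b z" if "z \<notin> cylinder x0 t0 R" for z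
    using that in_cyl[OF R0, of z] R2(3) R4(2) by (auto simp: a_def b_def)
  have a0: "a z \<le> 0" "b z \<le> 0" if "z \<in> cylinder x0 t0 r" for z
    using that in_cyl[OF r(1), of z] R2(3) R4(2) by (auto simp: a_def b_def divide_nonpos_pos)
  have cont: "continuous_on UNIV \<phi>" "continuous_on UNIV \<phi>t" "continuous_on UNIV \<phi>x"
    unfolding \<phi>_def[abs_def] \<phi>t_def[abs_def] \<phi>x_def[abs_def] a_def b_def
    using R2(3) R4(2)
    by (auto intro!: continuous_intros continuous_on_compose2[OF step_cont(1)] continuous_on_compose2[OF step_cont(2)])
  have zero: "\<phi> z = 0" "\<phi>t z = 0" "\<phi>x z = 0" if "z \<notin> cylinder x0 t0 R" for z
  proof -
    show "\<phi> z = 0" using a1[OF that] step_props(2) by (auto simp: \<phi>_def)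
    show "\<phi>t z = 0" using a1[OF that] step_props(2,6) by (auto simp: \<phi>t_def)
    show "\<phi>x z = 0" using a1[OF that] step_props(2,6) by (auto simp: \<phi>x_def)
  qed
  have bt: "\<bar>\<phi>t z\<bar> \<le> 8 / (R - r)\<^sup>2" for z
  proof (cases "z \<in> cylinder x0 t0 R")
    case True
    have "\<bar>2 * (snd z - t0) / (R ^ 4 - r ^ 4)\<bar> \<le> 2 / (R - r)\<^sup>2"
    proof -
      have "\<bar>snd z - t0\<bar> \<le> R\<^sup>2" using True by (simp add: mem_cylinder)
      have "\<bar>2 * (snd z - t0) / (R ^ 4 - r ^ 4)\<bar> = 2 * \<bar>snd z - t0\<bar> / (R ^ 4 - r ^ 4)"
        unfolding abs_divide abs_mult using R4(2) by simp
      also have "\<dots> \<le> 2 * R\<^sup>2 / ((R\<^sup>2 - r\<^sup>2) * R\<^sup>2)"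
        using \<open>\<bar>snd z - t0\<bar> \<le> R\<^sup>2\<close> R4 R2(3) R0 by (intro frac_le) auto
      also have "\<dots> = 2 / (R\<^sup>2 - r\<^sup>2)" using R0 by simp
      also have "\<dots> \<le> 2 / (R - r)\<^sup>2"
        using R2 r by (intro divide_left_mono) auto
      finally show ?thesis .
    qed
    then have "\<bar>step (a z) * (step' (b z) * (2 * (snd z - t0) / (R ^ 4 - r ^ 4)))\<bar> \<le> 1 * (4 * (2 / (R - r)\<^sup>2))"
      by (intro abs_mult_le_mult step_props(5)) (simp_all add: step_props(3,4))
    then show ?thesis by (simp add: \<phi>t_def)
  qed (simp add: zero)
  have bx: "norm (\<phi>x z) \<le> 8 / (R - r)" for z
  proof (cases "z \<in> cylinder x0 t0 R")
    case True
    have "norm (\<phi>x z) = \<bar>step' (a z) * step (b z)\<bar> * (2 / (R\<^sup>2 - r\<^sup>2) * norm (fst z - x0))"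
      using R2(3) by (simp add: \<phi>x_def abs_mult)
    also have "\<dots> \<le> (4 * 1) * (2 / (R\<^sup>2 - r\<^sup>2) * R)"
    proof (intro mult_mono abs_mult_le_mult step_props(5))
      show "norm (fst z - x0) \<le> R" using True by (simp add: mem_cylinder dist_norm norm_minus_commute)
    qed (use R2(3) R0 step_props(3,4) in auto)
    also have "\<dots> \<le> (4 * 1) * (2 / (R * (R - r)) * R)"
      using R2 R0 r by (intro mult_left_mono mult_right_mono divide_left_mono) auto
    also have "\<dots> = 8 / (R - r)" using R0 by simp
    finally show ?thesis .
  qed (use r in \<open>simp add: zero\<close>)
  have bmI': "bm f" if "continuous_on UNIV f" "\<And>z. \<bar>f z\<bar> \<le> M" for f :: "(real ^ 'n) \<times> real \<Rightarrow> real" and M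
    by (rule bmI[OF borel_measurable_continuous_onI[OF that(1)] that(2)])
  have b01: "0 \<le> \<phi> z" "\<phi> z \<le> 1" for z
    unfolding \<phi>_def by (simp_all add: step_props mult_le_one)
  have db: "((\<lambda>h. b (z + h *\<^sub>R (0, 1))) has_real_derivative 2 * (snd z - t0) / (R ^ 4 - r ^ 4)) (at 0)"
    and dat: "((\<lambda>h. a (z + h *\<^sub>R (0, 1))) has_real_derivative 0) (at 0)" for z
    unfolding a_def b_def divide_inverse by (auto intro!: derivative_eq_intros)
  have da: "((\<lambda>h. a (z + h *\<^sub>R (axis j 1, 0))) has_real_derivative 2 * (fst z - x0) $ j / (R\<^sup>2 - r\<^sup>2)) (at 0)"
    and dbx: "((\<lambda>h. b (z + h *\<^sub>R (axis j 1, 0))) has_real_derivative 0) (at 0)" for z j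
  proof -
    have e: "a (z + h *\<^sub>R (axis j 1, 0)) = ((fst z - x0) \<bullet> (fst z - x0) + 2 * h * ((fst z - x0) $ j) + h * h - r\<^sup>2) / (R\<^sup>2 - r\<^sup>2)" for h
    proof -
      have "fst (z + h *\<^sub>R (axis j 1, 0)) - x0 = (fst z - x0) + h *\<^sub>R axis j 1" by simp
      then show ?thesis
        unfolding a_def by (simp add: inner_add_left inner_add_right inner_axis inner_axis' inner_commute algebra_simps)
    qed
    show "((\<lambda>h. a (z + h *\<^sub>R (axis j 1, 0))) has_real_derivative 2 * (fst z - x0) $ j / (R\<^sup>2 - r\<^sup>2)) (at 0)"
      unfolding e divide_inverse by (auto intro!: derivative_eq_intros)
    show "((\<lambda>h. b (z + h *\<^sub>R (axis j 1, 0))) has_real_derivative 0) (at 0)"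
      unfolding b_def by simp
  qed
  have st: "((\<lambda>h. \<phi> (z + h *\<^sub>R (0, 1))) has_real_derivative \<phi>t z) (at 0)" for z
    unfolding \<phi>_def
    by (rule DERIV_cong[OF DERIV_mult[OF DERIV_chain2[OF step_deriv dat] DERIV_chain2[OF step_deriv db]]])
      (simp only: scaleR_zero_left add_0_right \<phi>t_def, simp add: mult.commute)
  have sx: "((\<lambda>h. \<phi> (z + h *\<^sub>R (axis j 1, 0))) has_real_derivative \<phi>x z $ j) (at 0)" for z j
    unfolding \<phi>_def
    by (rule DERIV_cong[OF DERIV_mult[OF DERIV_chain2[OF step_deriv da] DERIV_chain2[OF step_deriv dbx]]])
      (simp only: scaleR_zero_left add_0_right \<phi>x_def, simp add: mult.commute mult.left_commute)
  show ?thesis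
  proof (rule exI[of _ \<phi>], rule exI[of _ \<phi>t], rule exI[of _ \<phi>x], unfold cutoff_between_def, intro conjI allI ballI impI)
    show "bm \<phi>" by (rule bmI'[OF cont(1), of 1]) (use b01 in simp)
    show "bm \<phi>t" by (rule bmI'[OF cont(2) bt])
    show "bm (\<lambda>z. \<phi>x z $ j)" for j
      by (rule bmI'[of _ "8 / (R - r)"])
        (use cont(3) bx in \<open>auto intro!: continuous_intros intro: order_trans[OF component_le_norm_cart]\<close>)
  qed (use b01 zero bt bx st sx a0 in \<open>auto simp: \<phi>_def step_props\<close>)
qed

section \<open>The Caccioppoli inequality\<close>

text \<open>
  The system in the form in which it is estimated. The vector field no longer occurs: \<open>g + F\<close> stands for
  \<open>\<A>(z, \<nabla>u)\<close>, and all that is kept of the structure conditions is their pointwise consequence for this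
  matrix field. The equation is \<open>v\<^sub>t = div g\<close>, row by row.
\<close>

definition parabolic_system ::
  "real \<Rightarrow> real \<Rightarrow> ((real ^ 'n::finite) \<times> real) set \<Rightarrow> ((real ^ 'n) \<times> real \<Rightarrow> real ^ 'N::finite) \<Rightarrow>
    ((real ^ 'n) \<times> real \<Rightarrow> real ^ 'n ^ 'N) \<Rightarrow> ((real ^ 'n) \<times> real \<Rightarrow> real ^ 'n ^ 'N) \<Rightarrow>
    ((real ^ 'n) \<times> real \<Rightarrow> real ^ 'n ^ 'N) \<Rightarrow> bool"
  where "parabolic_system \<nu> L C v G g F \<longleftrightarrow>
    (\<forall>i. weak_pair C (\<lambda>z. v z $ i) (\<lambda>z. G z $ i) (\<lambda>z. g z $ i)) \<and>
    (\<forall>i j. L2 (\<lambda>z. F z $ i $ j)) \<and> (\<forall>z. z \<notin> C \<longrightarrow> F z = 0) \<and>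
    (AE z in lborel. \<nu> * (norm (G z))\<^sup>2 \<le> (g z + F z) \<bullet> G z \<and> norm (g z + F z) \<le> L * norm (G z))"

lemma norm_vec_sq: "(norm (v :: real ^ 'n::finite))\<^sup>2 = (\<Sum>i\<in>UNIV. (v $ i)\<^sup>2)"
  unfolding power2_norm_eq_inner inner_vec_def by (simp add: power2_eq_square)

lemma norm_matrix_sq: "(norm (M :: real ^ 'n::finite ^ 'N::finite))\<^sup>2 = (\<Sum>i\<in>UNIV. \<Sum>j\<in>UNIV. (M $ i $ j)\<^sup>2)"
  unfolding power2_norm_eq_inner inner_vec_def by (simp add: power2_eq_square)

lemma matrix_pairing_le:
  fixes g :: "real ^ 'n::finite ^ 'N::finite" and v :: "real ^ 'N" and w :: "real ^ 'n"
  shows "\<bar>\<Sum>i\<in>UNIV. v $ i * (g $ i \<bullet> w)\<bar> \<le> norm g * norm v * norm w"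
proof -
  have "\<bar>\<Sum>i\<in>UNIV. v $ i * (g $ i \<bullet> w)\<bar> \<le> (\<Sum>i\<in>UNIV. \<bar>v $ i * (g $ i \<bullet> w)\<bar>)"
    by (rule sum_abs)
  also have "\<dots> \<le> (\<Sum>i\<in>UNIV. (\<bar>v $ i\<bar> * \<bar>norm (g $ i)\<bar>) * norm w)"
  proof (rule sum_mono)
    fix i
    have "\<bar>v $ i\<bar> * \<bar>g $ i \<bullet> w\<bar> \<le> \<bar>v $ i\<bar> * (norm (g $ i) * norm w)"
      by (intro mult_left_mono Cauchy_Schwarz_ineq2) simp
    then show "\<bar>v $ i * (g $ i \<bullet> w)\<bar> \<le> (\<bar>v $ i\<bar> * \<bar>norm (g $ i)\<bar>) * norm w"
      by (simp add: abs_mult mult.assoc)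
  qed
  also have "\<dots> = (\<Sum>i\<in>UNIV. \<bar>v $ i\<bar> * \<bar>norm (g $ i)\<bar>) * norm w"
    by (simp add: sum_distrib_right)
  also have "\<dots> \<le> (norm v * norm g) * norm w"
  proof (rule mult_right_mono)
    have "norm v = L2_set (\<lambda>i. v $ i) UNIV" by (simp add: norm_vec_def L2_set_def)
    moreover have "norm g = L2_set (\<lambda>i. norm (g $ i)) UNIV" by (rule norm_vec_def)
    ultimately show "(\<Sum>i\<in>UNIV. \<bar>v $ i\<bar> * \<bar>norm (g $ i)\<bar>) \<le> norm v * norm g"
      by (simp only: L2_set_mult_ineq)
  qed simp
  finally show ?thesis by (simp add: mult.commute)
qed

text \<open>
  The sum of the constants that Young's inequality produces in \<open>caccioppoli_pointwise\<close>.
\<close>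

definition caccioppoli_const :: "real \<Rightarrow> real \<Rightarrow> real"
  where "caccioppoli_const \<nu> L = 1 / \<nu> + 1 + 256 * L\<^sup>2 / \<nu> + 72"

text \<open>
  Ellipticity gives \<open>\<nu> \<bar>G\<bar>\<^sup>2 \<le> g \<bullet> G + F \<bullet> G\<close>. The terms with \<open>F \<bullet> G\<close> and with the derivative of the
  cutoff, where \<open>\<bar>g\<bar> \<le> L \<bar>G\<bar> + \<bar>F\<bar>\<close>, are split by Young's inequality, each using up
  \<open>\<nu>/4 \<phi>\<^sup>2 \<bar>G\<bar>\<^sup>2\<close>. Integrated, the terms with \<open>g\<close> and \<open>\<phi>\<^sub>t\<close> on the right cancel by the energy identity.
\<close>

lemma caccioppoli_pointwise:
  fixes g G F :: "real ^ 'n::finite ^ 'N::finite" and v :: "real ^ 'N" and w :: "real ^ 'n"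
  assumes \<nu>: "0 < \<nu>" and h: "0 < h" and \<phi>: "0 \<le> \<phi>" "\<phi> \<le> 1" and L: "0 < L"
    and w: "norm w \<le> 8 / h" and t: "\<bar>\<phi>t\<bar> \<le> 8 / h\<^sup>2"
    and ell: "\<nu> * (norm G)\<^sup>2 \<le> (g + F) \<bullet> G" and gr: "norm (g + F) \<le> L * norm G"
  shows "\<nu> / 2 * (\<phi>\<^sup>2 * (norm G)\<^sup>2) \<le> \<phi>\<^sup>2 * (g \<bullet> G) + 2 * \<phi> * (\<Sum>i\<in>UNIV. v $ i * (g $ i \<bullet> w))
    - (norm v)\<^sup>2 * (\<phi> * \<phi>t) + caccioppoli_const \<nu> L * ((norm F)\<^sup>2 + (norm v)\<^sup>2 / h\<^sup>2)"
proof -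
  \<comment> \<open>In these variables every error term below is a multiple of \<open>a\<^sup>2\<close>, \<open>b\<^sup>2\<close> or \<open>m\<^sup>2\<close>.\<close>
  define a b m where "a = \<phi> * norm G" and "b = norm F" and "m = norm v / h"
  have nn: "0 \<le> a" "0 \<le> b" "0 \<le> m" using \<phi> h by (auto simp: a_def b_def m_def)
  have g: "norm g \<le> L * norm G + b"
    using gr norm_triangle_ineq4[of "g + F" F] by (simp add: b_def)
  have young: "2 * x * y \<le> \<nu> / 4 * x\<^sup>2 + 4 / \<nu> * y\<^sup>2" for x y :: real
  proof -
    have "0 \<le> (\<nu> / 2 * x - 2 * y)\<^sup>2 / \<nu>" using \<nu> by simp
    also have "\<dots> = \<nu> / 4 * x\<^sup>2 + 4 / \<nu> * y\<^sup>2 - 2 * x * y"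
      using \<nu> by (simp add: field_simps power2_eq_square)
    finally show ?thesis by simp
  qed
  have 1: "\<bar>2 * \<phi> * (\<Sum>i\<in>UNIV. v $ i * (g $ i \<bullet> w))\<bar> \<le> \<nu> / 4 * a\<^sup>2 + 256 * L\<^sup>2 / \<nu> * m\<^sup>2 + b\<^sup>2 + 64 * m\<^sup>2"
  proof -
    have "\<bar>2 * \<phi> * (\<Sum>i\<in>UNIV. v $ i * (g $ i \<bullet> w))\<bar> = 2 * \<phi> * \<bar>\<Sum>i\<in>UNIV. v $ i * (g $ i \<bullet> w)\<bar>"
      using \<phi> by (simp add: abs_mult)
    also have "\<dots> \<le> 2 * \<phi> * (norm g * norm v * norm w)"
      using \<phi> by (intro mult_left_mono matrix_pairing_le) simp
    also have "\<dots> \<le> 2 * \<phi> * ((L * norm G + b) * norm v * (8 / h))"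
      using \<phi> g w nn L by (intro mult_left_mono mult_mono) auto
    also have "\<dots> = 2 * a * (8 * L * m) + \<phi> * (16 * b * m)"
      by (simp add: a_def m_def algebra_simps)
    also have "\<phi> * (16 * b * m) \<le> 1 * (16 * b * m)"
      using \<phi> nn by (intro mult_right_mono) simp_all
    also have "1 * (16 * b * m) \<le> b\<^sup>2 + 64 * m\<^sup>2"
      using zero_le_power2[of "b - 8 * m"] by (simp add: power2_diff power_mult_distrib)
    also have "2 * a * (8 * L * m) \<le> \<nu> / 4 * a\<^sup>2 + 4 / \<nu> * (8 * L * m)\<^sup>2" by (rule young)
    also have "4 / \<nu> * (8 * L * m)\<^sup>2 = 256 * L\<^sup>2 / \<nu> * m\<^sup>2" by (simp add: power_mult_distrib)
    finally show ?thesis by simp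
  qed
  have 2: "\<phi>\<^sup>2 * (F \<bullet> G) \<le> \<nu> / 4 * a\<^sup>2 + 1 / \<nu> * b\<^sup>2"
  proof -
    have "\<phi>\<^sup>2 * (F \<bullet> G) \<le> \<phi>\<^sup>2 * (norm F * norm G)"
      by (intro mult_left_mono norm_cauchy_schwarz) simp
    also have "\<dots> = \<phi> * (b * a)" by (simp add: a_def b_def power2_eq_square algebra_simps)
    also have "\<dots> \<le> 1 * (b * a)" using \<phi> nn by (intro mult_right_mono) simp_all
    also have "\<dots> = 2 * a * (b / 2)" by simp
    also have "\<dots> \<le> \<nu> / 4 * a\<^sup>2 + 4 / \<nu> * (b / 2)\<^sup>2" by (rule young)
    finally show ?thesis by (simp add: power_divide)
  qed
  have 3: "(norm v)\<^sup>2 * (\<phi> * \<phi>t) \<le> 8 * m\<^sup>2"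
  proof -
    have "\<phi> * \<phi>t \<le> 1 * (8 / h\<^sup>2)"
      using abs_mult_le_mult[of \<phi> 1 \<phi>t "8 / h\<^sup>2"] \<phi> t by simp
    from mult_left_mono[OF this, of "(norm v)\<^sup>2"] show ?thesis
      by (simp add: m_def power_divide mult.commute)
  qed
  have 4: "\<nu> * a\<^sup>2 \<le> \<phi>\<^sup>2 * (g \<bullet> G) + \<phi>\<^sup>2 * (F \<bullet> G)"
    using mult_left_mono[OF ell, of "\<phi>\<^sup>2"] by (simp add: a_def power_mult_distrib inner_add_left algebra_simps)
  have c: "(1 / \<nu> + 1) * b\<^sup>2 + (256 * L\<^sup>2 / \<nu> + 72) * m\<^sup>2 \<le> caccioppoli_const \<nu> L * (b\<^sup>2 + m\<^sup>2)"
  proof -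
    have "(1 / \<nu> + 1) * b\<^sup>2 \<le> caccioppoli_const \<nu> L * b\<^sup>2" "(256 * L\<^sup>2 / \<nu> + 72) * m\<^sup>2 \<le> caccioppoli_const \<nu> L * m\<^sup>2"
      using \<nu> by (auto intro!: mult_right_mono simp: caccioppoli_const_def)
    then show ?thesis by (simp add: distrib_left)
  qed
  have "\<nu> / 2 * a\<^sup>2 \<le> \<phi>\<^sup>2 * (g \<bullet> G) + 2 * \<phi> * (\<Sum>i\<in>UNIV. v $ i * (g $ i \<bullet> w))
    - (norm v)\<^sup>2 * (\<phi> * \<phi>t) + ((1 / \<nu> + 1) * b\<^sup>2 + (256 * L\<^sup>2 / \<nu> + 72) * m\<^sup>2)"
    using abs_le_D2[OF 1] 2 3 4 by (simp add: distrib_right)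
  also have "\<dots> \<le> \<phi>\<^sup>2 * (g \<bullet> G) + 2 * \<phi> * (\<Sum>i\<in>UNIV. v $ i * (g $ i \<bullet> w))
    - (norm v)\<^sup>2 * (\<phi> * \<phi>t) + caccioppoli_const \<nu> L * (b\<^sup>2 + m\<^sup>2)"
    using c by linarith
  finally show ?thesis by (simp add: a_def b_def m_def power_mult_distrib power_divide)
qed

abbreviation integ :: "'a::euclidean_space set \<Rightarrow> ('a \<Rightarrow> real) \<Rightarrow> real"
  where "integ Q f \<equiv> (\<integral>z. f z * indicator Q z \<partial>lborel)"

lemma system_integrable:
  assumes "parabolic_system \<nu> L C v G g F"
  shows "integrable lborel (\<lambda>z. (norm (v z))\<^sup>2)" "integrable lborel (\<lambda>z. (norm (G z))\<^sup>2)"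
    "integrable lborel (\<lambda>z. (norm (g z))\<^sup>2)" "integrable lborel (\<lambda>z. (norm (F z))\<^sup>2)"
proof -
  have w: "weak_pair C (\<lambda>z. v z $ i) (\<lambda>z. G z $ i) (\<lambda>z. g z $ i)" and F: "L2 (\<lambda>z. F z $ i $ j)" for i j
    using assms by (auto simp: parabolic_system_def)
  show "integrable lborel (\<lambda>z. (norm (v z))\<^sup>2)" "integrable lborel (\<lambda>z. (norm (G z))\<^sup>2)"
    "integrable lborel (\<lambda>z. (norm (g z))\<^sup>2)" "integrable lborel (\<lambda>z. (norm (F z))\<^sup>2)"
    unfolding norm_matrix_sq norm_vec_sq
    using weak_pair_L2[OF w] F by (auto simp: L2_def)
qed

text \<open>
  The triangle inequality, with \<open>r\<^sup>2 + s\<^sup>2 \<le> (r + s)\<^sup>2\<close> in the time direction.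
\<close>

lemma closure_cylinder_shift:
  assumes z: "z \<in> cylinder x0 t0 r" and s: "0 < s" "r + s \<le> R" and r: "0 < r"
  shows "closure (cylinder (fst z) (snd z) s) \<subseteq> cylinder x0 t0 R"
proof
  fix y assume "y \<in> closure (cylinder (fst z) (snd z) s)"
  then have "y \<in> cball (fst z) s \<times> {snd z - s\<^sup>2..snd z + s\<^sup>2}"
    using closure_cylinder_subset[OF s(1)] by blast
  then have y: "dist (fst z) (fst y) \<le> s" "\<bar>snd y - snd z\<bar> \<le> s\<^sup>2" by (auto simp: mem_Times_iff abs_le_iff)
  have z': "dist x0 (fst z) < r" "\<bar>snd z - t0\<bar> < r\<^sup>2" using z by (auto simp: mem_cylinder)
  have "dist x0 (fst y) \<le> dist x0 (fst z) + dist (fst z) (fst y)" by (rule dist_triangle)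
  then have "dist x0 (fst y) < R" using y z' s by linarith
  moreover have "r\<^sup>2 + s\<^sup>2 \<le> R\<^sup>2"
  proof -
    have "r\<^sup>2 + s\<^sup>2 \<le> (r + s)\<^sup>2" using r s by (simp add: power2_sum)
    also have "\<dots> \<le> R\<^sup>2" using r s by (intro power_mono) auto
    finally show ?thesis .
  qed
  then have "\<bar>snd y - t0\<bar> < R\<^sup>2" using y z' by linarith
  ultimately show "y \<in> cylinder x0 t0 R" by (simp add: mem_cylinder)
qed

lemma bm_power2: "bm f \<Longrightarrow> bm (\<lambda>z. (f z)\<^sup>2)"
  unfolding power2_eq_square by (rule bm_mult)

text \<open>
  The energy identity for each component with the weight \<open>\<phi>\<^sup>2\<close>, summed over the components, makes the
  integrals of the first terms on the right of \<open>caccioppoli_pointwise\<close> cancel.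
\<close>

lemma caccioppoli:
  assumes sys: "parabolic_system \<nu> L (cylinder x0 t0 R0) v G g F"
    and \<nu>: "0 < \<nu>" and L: "0 < L" and r: "0 < r" "r < R" "R < R0"
  shows "\<nu> / 2 * integ (cylinder x0 t0 r) (\<lambda>z. (norm (G z))\<^sup>2) \<le> caccioppoli_const \<nu> L *
    (integ (cylinder x0 t0 R) (\<lambda>z. (norm (F z))\<^sup>2) + integ (cylinder x0 t0 R) (\<lambda>z. (norm (v z))\<^sup>2) / (R - r)\<^sup>2)"
proof -
  let ?C = "cylinder x0 t0 R0" and ?K = "cylinder x0 t0 R" and ?Q = "cylinder x0 t0 r"
  define c where "c = caccioppoli_const \<nu> L"
  have w: "weak_pair ?C (\<lambda>z. v z $ i) (\<lambda>z. G z $ i) (\<lambda>z. g z $ i)" for i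
    using sys by (simp add: parabolic_system_def)
  note W = weak_pair_L2[OF w]
  obtain \<phi> \<phi>t \<phi>x where cb: "cutoff_between x0 t0 r R \<phi> \<phi>t \<phi>x"
    using cutoff_exists[OF r(1,2)] by blast
  have bm: "bm \<phi>" "bm \<phi>t" "bm (\<lambda>z. \<phi>x z $ j)"
    and b01: "0 \<le> \<phi> z" "\<phi> z \<le> 1" and one: "z \<in> ?Q \<Longrightarrow> \<phi> z = 1"
    and zero: "z \<notin> ?K \<Longrightarrow> \<phi> z = 0"
    and bd: "z \<in> ?K \<Longrightarrow> \<bar>\<phi>t z\<bar> \<le> 8 / (R - r)\<^sup>2" "z \<in> ?K \<Longrightarrow> norm (\<phi>x z) \<le> 8 / (R - r)"
    and dt: "((\<lambda>h. \<phi> (z + h *\<^sub>R (0, 1))) has_real_derivative \<phi>t z) (at 0)"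
    and dx: "((\<lambda>h. \<phi> (z + h *\<^sub>R (axis j 1, 0))) has_real_derivative \<phi>x z $ j) (at 0)" for z j
    using cb unfolding cutoff_between_def by blast+
  let ?\<psi> = "\<lambda>z. (\<phi> z)\<^sup>2" and ?\<psi>t = "\<lambda>z. 2 * (\<phi> z * \<phi>t z)" and ?\<psi>x = "\<lambda>j z. 2 * (\<phi> z * \<phi>x z $ j)"
  have bmt: "bm ?\<psi>" "bm ?\<psi>t" "bm (?\<psi>x j)" for j
    by (intro bm_power2 bm_mult bm_const bm)+
  have cut: "cutoff_in ?K ?\<psi> ?\<psi>t ?\<psi>x"
    unfolding cutoff_in_def
  proof (intro conjI allI impI)
    show "((\<lambda>h. (\<phi> (z + h *\<^sub>R (0, 1)))\<^sup>2) has_real_derivative ?\<psi>t z) (at 0)" for z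
      by (rule DERIV_cong[OF DERIV_power[OF dt]]) (simp only: scaleR_zero_left add_0_right, simp)
    show "((\<lambda>h. (\<phi> (z + h *\<^sub>R (axis j 1, 0)))\<^sup>2) has_real_derivative ?\<psi>x j z) (at 0)" for z j
      by (rule DERIV_cong[OF DERIV_power[OF dx]]) (simp only: scaleR_zero_left add_0_right, simp)
  qed (use bmt zero in auto)
  have room: "closure (cylinder (fst z) (snd z) s) \<subseteq> ?C" if "z \<in> ?K" "0 < s" "s \<le> R0 - R" for z s
    by (rule closure_cylinder_shift[OF that(1,2)]) (use that r in auto)
  have gap: "0 < R0 - R" using r by simp
  have E: "(\<integral>z. v z $ i * v z $ i * ?\<psi>t z \<partial>lborel) / 2 =
    (\<Sum>j\<in>UNIV. (\<integral>z. g z $ i $ j * G z $ i $ j * ?\<psi> z \<partial>lborel) + (\<integral>z. g z $ i $ j * v z $ i * ?\<psi>x j z \<partial>lborel))" for i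
    by (rule energy_identity[OF w bounded_cylinder gap room cut])
  have intb: "integrable lborel (\<lambda>z. a z * b z * h z)" if ab: "L2 a" "L2 b" and hb: "bm h" for a b h :: "(real ^ 'a) \<times> real \<Rightarrow> real"
  proof -
    obtain M where "h \<in> borel_measurable borel" "\<And>z. \<bar>h z\<bar> \<le> M" using hb by (auto simp: bm_def)
    then show ?thesis by (rule integrable_mult_bounded[OF L2_mult_integrable[OF ab]])
  qed
  have i1: "integrable lborel (\<lambda>z. v z $ i * v z $ i * ?\<psi>t z)"
    and i2: "integrable lborel (\<lambda>z. g z $ i $ j * G z $ i $ j * ?\<psi> z)"
    and i3: "integrable lborel (\<lambda>z. g z $ i $ j * v z $ i * ?\<psi>x j z)" for i j
    by (intro intb W bmt)+
  define T where "T z = (\<Sum>i\<in>UNIV. v z $ i * v z $ i * ?\<psi>t z)" for z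
  define P where "P z = (\<Sum>i\<in>UNIV. \<Sum>j\<in>UNIV. g z $ i $ j * G z $ i $ j * ?\<psi> z + g z $ i $ j * v z $ i * ?\<psi>x j z)" for z
  have iT: "integrable lborel T" unfolding T_def[abs_def] by (intro Bochner_Integration.integrable_sum i1)
  have iP: "integrable lborel P" unfolding P_def[abs_def]
    by (intro Bochner_Integration.integrable_sum Bochner_Integration.integrable_add i2 i3)
  have eqn: "(\<integral>z. T z \<partial>lborel) / 2 = (\<integral>z. P z \<partial>lborel)"
  proof -
    have "(\<integral>z. T z \<partial>lborel) / 2 = (\<Sum>i\<in>UNIV. (\<integral>z. v z $ i * v z $ i * ?\<psi>t z \<partial>lborel) / 2)"
      unfolding T_def[abs_def] by (subst Bochner_Integration.integral_sum[OF i1]) (simp add: sum_divide_distrib)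
    also have "\<dots> = (\<Sum>i\<in>UNIV. \<Sum>j\<in>UNIV. (\<integral>z. g z $ i $ j * G z $ i $ j * ?\<psi> z \<partial>lborel) + (\<integral>z. g z $ i $ j * v z $ i * ?\<psi>x j z \<partial>lborel))"
      by (simp only: E)
    also have "\<dots> = (\<integral>z. P z \<partial>lborel)"
      unfolding P_def[abs_def] using i2 i3
      by (simp only: Bochner_Integration.integral_sum Bochner_Integration.integral_add
          Bochner_Integration.integrable_sum Bochner_Integration.integrable_add)
    finally show ?thesis .
  qed
  note S = system_integrable[OF sys]
  have iF: "integrable lborel (\<lambda>z. (norm (F z))\<^sup>2 * indicator ?K z)"
    and iv: "integrable lborel (\<lambda>z. (norm (v z))\<^sup>2 * indicator ?K z)"
    and iG: "integrable lborel (\<lambda>z. (norm (G z))\<^sup>2 * indicator ?Q z)"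
    using S by (auto intro!: integrable_real_mult_indicator)
  have "AE z in lborel. \<nu> / 2 * ((norm (G z))\<^sup>2 * indicator ?Q z) \<le>
    P z - T z / 2 + c * ((norm (F z))\<^sup>2 * indicator ?K z + (norm (v z))\<^sup>2 * indicator ?K z / (R - r)\<^sup>2)"
  proof -
    have "AE z in lborel. \<nu> * (norm (G z))\<^sup>2 \<le> (g z + F z) \<bullet> G z \<and> norm (g z + F z) \<le> L * norm (G z)"
      using sys by (simp add: parabolic_system_def)
    then show ?thesis
    proof eventually_elim
      case (elim z)
      have Pz: "P z = (\<phi> z)\<^sup>2 * (g z \<bullet> G z) + 2 * \<phi> z * (\<Sum>i\<in>UNIV. v z $ i * (g z $ i \<bullet> \<phi>x z))"
        unfolding P_def inner_vec_def inner_real_def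
        by (simp add: sum.distrib sum_distrib_left sum_distrib_right algebra_simps)
      have Tz: "T z / 2 = (norm (v z))\<^sup>2 * (\<phi> z * \<phi>t z)"
        unfolding T_def norm_vec_sq by (simp add: power2_eq_square flip: sum_distrib_right)
      show ?case
      proof (cases "z \<in> ?K")
        case True
        have "\<nu> / 2 * ((norm (G z))\<^sup>2 * indicator ?Q z) \<le> \<nu> / 2 * ((\<phi> z)\<^sup>2 * (norm (G z))\<^sup>2)"
          using one[of z] \<nu> by (cases "z \<in> ?Q") simp_all
        also have "\<dots> \<le> P z - T z / 2 + c * ((norm (F z))\<^sup>2 + (norm (v z))\<^sup>2 / (R - r)\<^sup>2)"
          unfolding Pz Tz c_def
          by (rule caccioppoli_pointwise) (use \<nu> L r b01 bd[OF True] elim in auto)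
        finally show ?thesis using True by simp
      next
        case False
        then have "z \<notin> ?Q" using one[of z] zero[of z] by auto
        then show ?thesis using False zero[OF False] Pz Tz by simp
      qed
    qed
  qed
  then have "(\<integral>z. \<nu> / 2 * ((norm (G z))\<^sup>2 * indicator ?Q z) \<partial>lborel) \<le>
    (\<integral>z. P z - T z / 2 + c * ((norm (F z))\<^sup>2 * indicator ?K z + (norm (v z))\<^sup>2 * indicator ?K z / (R - r)\<^sup>2) \<partial>lborel)"
    using iG iP iT iF iv by (intro integral_mono_AE) auto
  also have "\<dots> = (\<integral>z. P z \<partial>lborel) - (\<integral>z. T z \<partial>lborel) / 2 + c * (integ ?K (\<lambda>z. (norm (F z))\<^sup>2) + integ ?K (\<lambda>z. (norm (v z))\<^sup>2) / (R - r)\<^sup>2)"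
    using iP iT iF iv by simp
  also have "\<dots> = c * (integ ?K (\<lambda>z. (norm (F z))\<^sup>2) + integ ?K (\<lambda>z. (norm (v z))\<^sup>2) / (R - r)\<^sup>2)"
    using eqn by simp
  finally show ?thesis by (simp add: c_def)
qed

section \<open>Local estimates for systems\<close>

text \<open>
  The closed support of a test function stays inside \<open>C\<close>, so the function vanishes in a
  neighbourhood of every point off \<open>C\<close>, and so do its derivatives.
\<close>

lemma test_function_outside:
  assumes t: "test_function C \<phi>" and z: "z \<notin> C"
  shows "\<phi> z = 0" "frechet_derivative \<phi> (at z) e = 0"
proof -
  let ?S = "closure {x. \<phi> x \<noteq> 0}"
  have zS: "z \<in> - ?S" using t z by (auto simp: test_function_def compactly_contained_def)
  have 0: "\<phi> x = 0" if "x \<in> - ?S" for x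
    using that closure_subset[of "{x. \<phi> x \<noteq> 0}"] by auto
  then show "\<phi> z = 0" using zS by blast
  have o: "open (- ?S)" by (rule open_Compl[OF closed_closure])
  have "(\<phi> has_derivative (\<lambda>e. 0)) (at z)"
    by (rule has_derivative_transform_within_open[OF has_derivative_const[of 0 "at z"] o zS]) (rule 0[symmetric])
  from frechet_derivative_at[OF this] show "frechet_derivative \<phi> (at z) e = 0"
    by (rule fun_cong[symmetric])
qed

lemma test_function_mono: "test_function C' \<phi> \<Longrightarrow> C' \<subseteq> C \<Longrightarrow> test_function C \<phi>"
  by (auto simp: test_function_def compactly_contained_def)

text \<open>
  Test functions for the smaller set do not see the truncation. Restricting first makes the \<open>L\<^sup>2\<close> norm of
  the strength an integral over the smaller cylinder only.
\<close>

lemma weak_pair_restrict: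
  assumes w: "weak_pair C U G g" and C': "C' \<subseteq> C" "C' \<in> sets borel"
  shows "weak_pair C' (\<lambda>z. indicator C' z * U z) (\<lambda>z. indicator C' z *\<^sub>R G z) (\<lambda>z. indicator C' z *\<^sub>R g z)"
  unfolding weak_pair_def
proof (intro conjI allI impI)
  have ind: "(indicator C' :: _ \<Rightarrow> real) \<in> borel_measurable borel" "\<bar>indicator C' z :: real\<bar> \<le> 1" for z
    using C' by (auto intro: borel_measurable_indicator simp: indicator_def)
  have L: "L2 (\<lambda>z. indicator C' z * f z)" if "L2 f" for f
    by (rule L2_bounded_mult[OF that ind])
  show "L2 (\<lambda>z. indicator C' z * U z)" by (rule L[OF weak_pair_L2(1)[OF w]])
  show "L2 (\<lambda>z. (indicator C' z *\<^sub>R G z) $ j)" "L2 (\<lambda>z. (indicator C' z *\<^sub>R g z) $ j)" for j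
    using L[OF weak_pair_L2(2)[OF w]] L[OF weak_pair_L2(3)[OF w]] by simp_all
  show "bounded C'" using w C' by (auto simp: weak_pair_def intro: bounded_subset)
  fix \<phi> :: "(real ^ 'a) \<times> real \<Rightarrow> real"
  assume t: "test_function C' \<phi>"
  note o = test_function_outside[OF t]
  have w': "(\<integral>z. U z * frechet_derivative \<phi> (at z) (axis j 1, 0) \<partial>lborel) = - (\<integral>z. G z $ j * \<phi> z \<partial>lborel)"
    "(\<integral>z. U z * frechet_derivative \<phi> (at z) (0, 1) \<partial>lborel) =
        (\<Sum>j\<in>UNIV. \<integral>z. g z $ j * frechet_derivative \<phi> (at z) (axis j 1, 0) \<partial>lborel)" for j
    using w test_function_mono[OF t C'(1)] unfolding weak_pair_def by blast+
  have e: "indicator C' z * U z * frechet_derivative \<phi> (at z) e = U z * frechet_derivative \<phi> (at z) e"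
    "(indicator C' z *\<^sub>R G z) $ j * \<phi> z = G z $ j * \<phi> z"
    "(indicator C' z *\<^sub>R g z) $ j * frechet_derivative \<phi> (at z) e = g z $ j * frechet_derivative \<phi> (at z) e" for z e j
    using o[of z] by (cases "z \<in> C'"; simp)+
  show "(\<integral>z. indicator C' z * U z * frechet_derivative \<phi> (at z) (axis j 1, 0) \<partial>lborel) =
      - (\<integral>z. (indicator C' z *\<^sub>R G z) $ j * \<phi> z \<partial>lborel)" for j
    unfolding e by (rule w')
  show "(\<integral>z. indicator C' z * U z * frechet_derivative \<phi> (at z) (0, 1) \<partial>lborel) =
        (\<Sum>j\<in>UNIV. \<integral>z. (indicator C' z *\<^sub>R g z) $ j * frechet_derivative \<phi> (at z) (axis j 1, 0) \<partial>lborel)"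
    unfolding e by (rule w')
qed simp_all

lemma strength_sq_le:
  fixes G g :: "(real ^ 'n::finite) \<times> real \<Rightarrow> real ^ 'n"
  shows "(strength G g z)\<^sup>2 \<le> 2 * real CARD('n) * ((norm (G z))\<^sup>2 + (norm (g z))\<^sup>2)"
proof -
  have "(strength G g z)\<^sup>2 \<le> (\<Sum>j\<in>UNIV. (\<bar>G z $ j\<bar> + \<bar>g z $ j\<bar>)\<^sup>2) * real CARD('n)"
    unfolding strength_def by (rule sum_squared_le_sum_of_squares)
  also have "(\<Sum>j\<in>UNIV. (\<bar>G z $ j\<bar> + \<bar>g z $ j\<bar>)\<^sup>2) \<le> (\<Sum>j\<in>UNIV. 2 * ((G z $ j)\<^sup>2 + (g z $ j)\<^sup>2))"
  proof (rule sum_mono)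
    fix j
    show "(\<bar>G z $ j\<bar> + \<bar>g z $ j\<bar>)\<^sup>2 \<le> 2 * ((G z $ j)\<^sup>2 + (g z $ j)\<^sup>2)"
      using sum_squares_bound[of "\<bar>G z $ j\<bar>" "\<bar>g z $ j\<bar>"] by (simp add: power2_sum)
  qed
  also have "\<dots> = 2 * ((norm (G z))\<^sup>2 + (norm (g z))\<^sup>2)"
    unfolding norm_vec_sq by (simp add: sum.distrib sum_distrib_left)
  finally show ?thesis by (simp add: algebra_simps)
qed

lemma row_sq_le: "(norm (M $ i))\<^sup>2 \<le> (norm (M :: real ^ 'n::finite ^ 'N::finite))\<^sup>2"
  using Finite_Cartesian_Product.norm_nth_le[of M i] by (intro power_mono) auto

text \<open>
  \<open>local_Lq_estimate\<close> for one component, restricted to the cylinder of radius \<open>r + \<delta>\<close>, which contains the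
  supports of all kernels of scale at most \<open>\<delta>\<close> that are centred in the cylinder of radius \<open>r\<close>.
\<close>

lemma system_component_estimate:
  fixes q :: real
  assumes q: "2 \<le> q" and \<gamma>: "0 < q - real (CARD('n::finite) + 2) * (q / 2 - 1)"
  shows "\<exists>K>0. \<forall>\<nu> L x0 t0 R0 (v :: (real ^ 'n) \<times> real \<Rightarrow> real ^ 'N::finite) G g F r \<delta> i.
    parabolic_system \<nu> L (cylinder x0 t0 R0) v G g F \<longrightarrow> 0 < r \<longrightarrow> 0 < \<delta> \<longrightarrow> r + \<delta> \<le> R0 \<longrightarrow>
    (\<integral>\<^sup>+z. ennreal (\<bar>v z $ i\<bar> powr q) * indicator (cylinder x0 t0 r) z \<partial>lborel) \<le>
      ennreal (K * (\<delta> powr (q - real (CARD('n) + 2) * (q / 2 - 1)) *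
        (integ (cylinder x0 t0 (r + \<delta>)) (\<lambda>z. (norm (G z))\<^sup>2) + integ (cylinder x0 t0 (r + \<delta>)) (\<lambda>z. (norm (g z))\<^sup>2)) powr (q / 2)
        + measure lborel (cylinder x0 t0 r) * ((\<integral>z. norm (v z) \<partial>lborel) / \<delta> ^ (CARD('n) + 2)) powr q))"
proof -
  let ?\<gamma> = "q - real (CARD('n) + 2) * (q / 2 - 1)"
  obtain K where K: "0 < K" and est: "\<And>C (U :: (real ^ 'n) \<times> real \<Rightarrow> real) G g \<delta> D. weak_pair C U G g \<Longrightarrow> 0 < \<delta> \<Longrightarrow> D \<in> sets borel \<Longrightarrow>
    bounded D \<Longrightarrow> (\<forall>z\<in>D. closure (cylinder (fst z) (snd z) \<delta>) \<subseteq> C) \<Longrightarrow>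
    (\<integral>\<^sup>+z. ennreal (\<bar>U z\<bar> powr q) * indicator D z \<partial>lborel) \<le>
      ennreal (K * (\<delta> powr ?\<gamma> * ((N2 (strength G g))\<^sup>2) powr (q / 2)
        + measure lborel D * ((\<integral>z. \<bar>U z\<bar> \<partial>lborel) / \<delta> ^ (CARD('n) + 2)) powr q))"
    using local_Lq_estimate[OF assms] by blast
  define m where "m = (2 * real CARD('n)) powr (q / 2)"
  have m1: "1 \<le> m" unfolding m_def using q zero_less_card_finite[where 'a='n] by (intro ge_one_powr_ge_zero) linarith+
  show ?thesis
  proof (intro exI[of _ "K * m"] conjI allI impI)
    show "0 < K * m" using K m1 by simp
    fix \<nu> L x0 t0 R0 and v :: "(real ^ 'n) \<times> real \<Rightarrow> real ^ 'N" and G g F r \<delta> i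
    assume sys: "parabolic_system \<nu> L (cylinder x0 t0 R0) v G g F" and r: "0 < r" "0 < \<delta>" "r + \<delta> \<le> R0"
    let ?C = "cylinder x0 t0 R0" and ?C' = "cylinder x0 t0 (r + \<delta>)" and ?D = "cylinder x0 t0 r"
    have cyl_mono: "cylinder x0 t0 a \<subseteq> cylinder x0 t0 b" if "0 < a" "a \<le> b" for a b
    proof
      fix y assume "y \<in> cylinder x0 t0 a"
      moreover have "a\<^sup>2 \<le> b\<^sup>2" using that by (intro power_mono) auto
      ultimately show "y \<in> cylinder x0 t0 b"
        unfolding mem_cylinder using that by linarith
    qed
    have sub: "?C' \<subseteq> ?C" "?D \<subseteq> ?C'"
      using cyl_mono[of "r + \<delta>" R0] cyl_mono[of r "r + \<delta>"] r by simp_all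
    define U where "U z = v z $ i" for z
    have w: "weak_pair ?C U (\<lambda>z. G z $ i) (\<lambda>z. g z $ i)"
      using sys by (simp add: parabolic_system_def U_def[abs_def])
    have w': "weak_pair ?C' (\<lambda>z. indicator ?C' z * U z) (\<lambda>z. indicator ?C' z *\<^sub>R G z $ i) (\<lambda>z. indicator ?C' z *\<^sub>R g z $ i)"
      by (rule weak_pair_restrict[OF w sub(1) cylinder_sets])
    let ?H = "strength (\<lambda>z. indicator ?C' z *\<^sub>R G z $ i) (\<lambda>z. indicator ?C' z *\<^sub>R g z $ i)"
    note S = system_integrable[OF sys]
    have iG: "integrable lborel (\<lambda>z. (norm (G z))\<^sup>2 * indicator ?C' z)"
      and ig: "integrable lborel (\<lambda>z. (norm (g z))\<^sup>2 * indicator ?C' z)"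
      using S by (auto intro!: integrable_real_mult_indicator)
    let ?X = "integ ?C' (\<lambda>z. (norm (G z))\<^sup>2) + integ ?C' (\<lambda>z. (norm (g z))\<^sup>2)"
    have X0: "0 \<le> ?X" by (intro add_nonneg_nonneg integral_nonneg_AE AE_I2) simp_all
    have "(N2 ?H)\<^sup>2 \<le> (\<integral>z. 2 * real CARD('n) * ((norm (G z))\<^sup>2 * indicator ?C' z + (norm (g z))\<^sup>2 * indicator ?C' z) \<partial>lborel)"
      unfolding N2_square
    proof (rule integral_mono)
      show "integrable lborel (\<lambda>z. (?H z)\<^sup>2)" using strength_L2(1)[OF w'] by (simp add: L2_def)
      show "integrable lborel (\<lambda>z. 2 * real CARD('n) * ((norm (G z))\<^sup>2 * indicator ?C' z + (norm (g z))\<^sup>2 * indicator ?C' z))"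
        using iG ig by simp
      fix z
      have "(?H z)\<^sup>2 \<le> 2 * real CARD('n) * ((norm (indicator ?C' z *\<^sub>R G z $ i))\<^sup>2 + (norm (indicator ?C' z *\<^sub>R g z $ i))\<^sup>2)"
        by (rule strength_sq_le)
      also have "\<dots> \<le> 2 * real CARD('n) * ((norm (G z))\<^sup>2 * indicator ?C' z + (norm (g z))\<^sup>2 * indicator ?C' z)"
        using row_sq_le[of "G z" i] row_sq_le[of "g z" i]
        by (intro mult_left_mono add_mono) (auto simp: indicator_def)
      finally show "(?H z)\<^sup>2 \<le> 2 * real CARD('n) * ((norm (G z))\<^sup>2 * indicator ?C' z + (norm (g z))\<^sup>2 * indicator ?C' z)" .
    qed
    also have "\<dots> = 2 * real CARD('n) * ?X"
      using iG ig by simp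
    finally have N: "((N2 ?H)\<^sup>2) powr (q / 2) \<le> m * ?X powr (q / 2)"
      unfolding m_def powr_mult[symmetric] using q by (intro powr_mono2) auto
    have vm: "(\<integral>z. \<bar>indicator ?C' z * U z\<bar> \<partial>lborel) \<le> (\<integral>z. norm (v z) \<partial>lborel)"
    proof (rule integral_mono)
      show "integrable lborel (\<lambda>z. \<bar>indicator ?C' z * U z\<bar>)"
        by (rule integrable_abs[OF weak_pair_integrable(1)[OF w']])
      have "\<forall>i. integrable lborel (\<lambda>z. v z $ i)"
        using sys by (auto simp: parabolic_system_def intro: weak_pair_integrable(1))
      then show "integrable lborel (\<lambda>z. norm (v z))"
      proof -
        assume a: "\<forall>i. integrable lborel (\<lambda>z. v z $ i)"
        have "integrable lborel (\<lambda>z. \<Sum>i\<in>UNIV. v z $ i *\<^sub>R (axis i 1 :: real ^ 'N))"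
          using a by (intro Bochner_Integration.integrable_sum integrable_scaleR_left) auto
        then have "integrable lborel v"
          by (simp add: basis_expansion flip: scalar_mult_eq_scaleR)
        then show ?thesis by (rule integrable_norm)
      qed
      show "\<bar>indicator ?C' z * U z\<bar> \<le> norm (v z)" for z
        using component_le_norm_cart[of "v z" i] by (simp add: U_def indicator_def)
    qed
    have "(\<integral>\<^sup>+z. ennreal (\<bar>v z $ i\<bar> powr q) * indicator ?D z \<partial>lborel) =
        (\<integral>\<^sup>+z. ennreal (\<bar>indicator ?C' z * U z\<bar> powr q) * indicator ?D z \<partial>lborel)"
    proof (rule nn_integral_cong)
      show "ennreal (\<bar>v z $ i\<bar> powr q) * indicator ?D z = ennreal (\<bar>indicator ?C' z * U z\<bar> powr q) * indicator ?D z" for z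
        using subsetD[OF sub(2), of z] by (cases "z \<in> ?D") (simp_all add: U_def)
    qed
    also have "\<dots> \<le> ennreal (K * (\<delta> powr ?\<gamma> * ((N2 ?H)\<^sup>2) powr (q / 2)
        + measure lborel ?D * ((\<integral>z. \<bar>indicator ?C' z * U z\<bar> \<partial>lborel) / \<delta> ^ (CARD('n) + 2)) powr q))"
      by (rule est[OF w' r(2) cylinder_sets bounded_cylinder])
        (use closure_cylinder_shift[OF _ r(2) order_refl r(1)] in blast)
    also have "\<dots> \<le> ennreal (K * m * (\<delta> powr ?\<gamma> * ?X powr (q / 2)
        + measure lborel ?D * ((\<integral>z. norm (v z) \<partial>lborel) / \<delta> ^ (CARD('n) + 2)) powr q))"
    proof (rule ennreal_leI)
      have a: "\<delta> powr ?\<gamma> * ((N2 ?H)\<^sup>2) powr (q / 2) \<le> m * (\<delta> powr ?\<gamma> * ?X powr (q / 2))"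
        using mult_left_mono[OF N, of "\<delta> powr ?\<gamma>"] by (simp only: mult.left_commute powr_ge_zero)
      let ?Z = "((\<integral>z. norm (v z) \<partial>lborel) / \<delta> ^ (CARD('n) + 2)) powr q"
      have "((\<integral>z. \<bar>indicator ?C' z * U z\<bar> \<partial>lborel) / \<delta> ^ (CARD('n) + 2)) powr q \<le> ?Z"
        using q r vm by (intro powr_mono2 divide_right_mono divide_nonneg_nonneg) simp_all
      then have "measure lborel ?D * ((\<integral>z. \<bar>indicator ?C' z * U z\<bar> \<partial>lborel) / \<delta> ^ (CARD('n) + 2)) powr q \<le> 1 * (measure lborel ?D * ?Z)"
        by (simp only: mult_1_left) (rule mult_left_mono, simp_all)
      also have "\<dots> \<le> m * (measure lborel ?D * ?Z)"
        using m1 by (intro mult_right_mono) simp_all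
      finally have b: "measure lborel ?D * ((\<integral>z. \<bar>indicator ?C' z * U z\<bar> \<partial>lborel) / \<delta> ^ (CARD('n) + 2)) powr q \<le> m * (measure lborel ?D * ?Z)" .
      show "K * (\<delta> powr ?\<gamma> * ((N2 ?H)\<^sup>2) powr (q / 2)
          + measure lborel ?D * ((\<integral>z. \<bar>indicator ?C' z * U z\<bar> \<partial>lborel) / \<delta> ^ (CARD('n) + 2)) powr q)
        \<le> K * m * (\<delta> powr ?\<gamma> * ?X powr (q / 2) + measure lborel ?D * ?Z)"
        unfolding mult.assoc[of K m] distrib_left[of m] using K a b by (intro mult_left_mono add_mono) simp_all
    qed
    finally show "(\<integral>\<^sup>+z. ennreal (\<bar>v z $ i\<bar> powr q) * indicator ?D z \<partial>lborel) \<le>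
      ennreal (K * m * (\<delta> powr ?\<gamma> * ?X powr (q / 2)
        + measure lborel ?D * ((\<integral>z. norm (v z) \<partial>lborel) / \<delta> ^ (CARD('n) + 2)) powr q))" .
  qed
qed

definition data_const :: "real \<Rightarrow> real \<Rightarrow> real"
  where "data_const \<nu> L = (1 + 2 * L\<^sup>2) * (2 * caccioppoli_const \<nu> L / \<nu>) + 2"

lemma integ_mono_set:
  assumes "integrable lborel f" "\<And>z. 0 \<le> f z" "A \<subseteq> B" "A \<in> sets borel" "B \<in> sets borel"
  shows "integ A f \<le> integ B f"
proof (rule integral_mono)
  show "integrable lborel (\<lambda>z. f z * indicator A z)" "integrable lborel (\<lambda>z. f z * indicator B z)"
    using assms by (auto intro!: integrable_real_mult_indicator)
  show "f z * indicator A z \<le> f z * indicator B z" for z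
    using assms(2)[of z] assms(3) by (auto simp: indicator_def)
qed

text \<open>
  The flux is controlled by gradient and data through the growth condition, and the gradient by the
  Caccioppoli inequality.
\<close>

lemma system_data_bound:
  assumes sys: "parabolic_system \<nu> L (cylinder x0 t0 R0) v G g F"
    and \<nu>: "0 < \<nu>" and L: "0 < L" and r: "0 < r" "r < R" "R < R0"
  shows "integ (cylinder x0 t0 r) (\<lambda>z. (norm (G z))\<^sup>2) + integ (cylinder x0 t0 r) (\<lambda>z. (norm (g z))\<^sup>2) \<le>
    data_const \<nu> L * ((\<integral>z. (norm (F z))\<^sup>2 \<partial>lborel) + integ (cylinder x0 t0 R) (\<lambda>z. (norm (v z))\<^sup>2) / (R - r)\<^sup>2)"
proof -
  let ?r = "cylinder x0 t0 r" and ?R = "cylinder x0 t0 R"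
  note S = system_integrable[OF sys]
  have i: "integrable lborel (\<lambda>z. f z * indicator ?r z)" if "integrable lborel f" for f :: "(real ^ 'a) \<times> real \<Rightarrow> real"
    using that by (intro integrable_real_mult_indicator) auto
  define X Y Fr FF VV where "X = integ ?r (\<lambda>z. (norm (G z))\<^sup>2)" and "Y = integ ?r (\<lambda>z. (norm (g z))\<^sup>2)"
    and "Fr = integ ?r (\<lambda>z. (norm (F z))\<^sup>2)" and "FF = (\<integral>z. (norm (F z))\<^sup>2 \<partial>lborel)"
    and "VV = integ ?R (\<lambda>z. (norm (v z))\<^sup>2) / (R - r)\<^sup>2"
  have le: "integ A (\<lambda>z. (norm (F z))\<^sup>2) \<le> FF" if "A \<in> sets borel" for A
    using integ_mono_set[OF S(4), of A UNIV] that by (simp add: FF_def)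
  have V0: "0 \<le> VV" "0 \<le> FF" unfolding VV_def FF_def by simp_all
  have "\<nu> / 2 * X \<le> caccioppoli_const \<nu> L * (integ ?R (\<lambda>z. (norm (F z))\<^sup>2) + VV)"
    unfolding X_def VV_def by (rule caccioppoli[OF sys \<nu> L r])
  also have "\<dots> \<le> caccioppoli_const \<nu> L * (FF + VV)"
    using le[OF cylinder_sets, of x0 t0 R] \<nu> by (intro mult_left_mono) (auto simp: caccioppoli_const_def)
  finally have X: "X \<le> 2 * caccioppoli_const \<nu> L / \<nu> * (FF + VV)"
    using \<nu> by (simp add: field_simps)
  have "Y \<le> (\<integral>z. 2 * L\<^sup>2 * ((norm (G z))\<^sup>2 * indicator ?r z) + 2 * ((norm (F z))\<^sup>2 * indicator ?r z) \<partial>lborel)"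
    unfolding Y_def
  proof (rule integral_mono_AE)
    show "integrable lborel (\<lambda>z. (norm (g z))\<^sup>2 * indicator ?r z)" by (rule i[OF S(3)])
    show "integrable lborel (\<lambda>z. 2 * L\<^sup>2 * ((norm (G z))\<^sup>2 * indicator ?r z) + 2 * ((norm (F z))\<^sup>2 * indicator ?r z))"
      using i[OF S(2)] i[OF S(4)] by simp
    have "AE z in lborel. norm (g z + F z) \<le> L * norm (G z)"
      using sys by (auto simp: parabolic_system_def elim: eventually_mono)
    then show "AE z in lborel. (norm (g z))\<^sup>2 * indicator ?r z \<le> 2 * L\<^sup>2 * ((norm (G z))\<^sup>2 * indicator ?r z) + 2 * ((norm (F z))\<^sup>2 * indicator ?r z)"
    proof eventually_elim
      case (elim z)
      have "norm (g z) \<le> L * norm (G z) + norm (F z)"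
        using elim norm_triangle_ineq4[of "g z + F z" "F z"] by simp
      then have "(norm (g z))\<^sup>2 \<le> (L * norm (G z) + norm (F z))\<^sup>2" by (intro power_mono) simp_all
      also have "\<dots> \<le> 2 * (L * norm (G z))\<^sup>2 + 2 * (norm (F z))\<^sup>2"
        using sum_squares_bound[of "L * norm (G z)" "norm (F z)"] by (simp add: power2_sum)
      finally show ?case by (cases "z \<in> ?r") (simp_all add: power_mult_distrib)
    qed
  qed
  also have "\<dots> = 2 * L\<^sup>2 * X + 2 * Fr"
    using i[OF S(2)] i[OF S(4)] by (simp add: X_def Fr_def)
  finally have "Y \<le> 2 * L\<^sup>2 * X + 2 * Fr" .
  moreover have "Fr \<le> FF" unfolding Fr_def by (rule le[OF cylinder_sets])
  ultimately have "X + Y \<le> (1 + 2 * L\<^sup>2) * X + 2 * FF" by (simp add: distrib_right)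
  also have "\<dots> \<le> (1 + 2 * L\<^sup>2) * (2 * caccioppoli_const \<nu> L / \<nu> * (FF + VV)) + 2 * (FF + VV)"
    using X V0 by (intro add_mono mult_left_mono) auto
  also have "\<dots> = data_const \<nu> L * (FF + VV)"
    unfolding data_const_def by (simp only: distrib_right mult.assoc)
  finally show ?thesis by (simp add: X_def Y_def FF_def VV_def)
qed

section \<open>From L1 to L2 by absorption\<close>

text \<open>
  Iterating the hypothesis \<open>m\<close> times gives \<open>\<Phi> 0 \<le> \<kappa> ^ m \<Phi> m + B * (\<Sum>j<m. (\<kappa> M) ^ j)\<close>. Since \<open>\<kappa> M \<le> 1/2\<close>
  the sum is at most 2, and the a priori bound \<open>A\<close> makes the first term vanish in the limit without
  leaving a trace in the result.
\<close>

lemma absorbing_iteration: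
  fixes \<Phi> :: "nat \<Rightarrow> real"
  assumes step: "\<And>k. \<Phi> k \<le> \<kappa> * \<Phi> (Suc k) + B * M ^ k"
    and k: "0 \<le> \<kappa>" "\<kappa> \<le> 1 / 2" "\<kappa> * M \<le> 1 / 2" "0 \<le> M" "0 \<le> B" and bd: "\<And>k. \<Phi> k \<le> A" "0 \<le> A"
  shows "\<Phi> 0 \<le> 2 * B"
proof -
  have "\<Phi> 0 \<le> \<kappa> ^ m * \<Phi> m + (\<Sum>j<m. B * (\<kappa> * M) ^ j)" for m
  proof (induction m)
    case (Suc m)
    have "\<kappa> ^ m * \<Phi> m \<le> \<kappa> ^ m * (\<kappa> * \<Phi> (Suc m) + B * M ^ m)"
      using k step by (intro mult_left_mono) auto
    then show ?case using Suc by (simp add: power_mult_distrib algebra_simps)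
  qed simp
  moreover have "\<kappa> ^ m * \<Phi> m \<le> A * (1 / 2) ^ m" for m
  proof -
    have "\<kappa> ^ m * \<Phi> m \<le> \<kappa> ^ m * A" using k bd by (intro mult_left_mono) auto
    also have "\<dots> \<le> (1 / 2) ^ m * A" using k bd by (intro mult_right_mono power_mono) auto
    finally show ?thesis by (simp add: mult.commute)
  qed
  moreover have "(\<Sum>j<m. B * (\<kappa> * M) ^ j) \<le> 2 * B" for m
  proof -
    have "(\<Sum>j<m. B * (\<kappa> * M) ^ j) \<le> (\<Sum>j<m. B * (1 / 2) ^ j)"
      using k by (intro sum_mono mult_left_mono power_mono) auto
    also have "\<dots> = B * (2 * (1 - (1 / 2) ^ m))"
      using one_diff_power_eq[of "1/2::real" m] by (simp flip: sum_distrib_left)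
    also have "\<dots> \<le> B * 2" using k by (intro mult_left_mono) auto
    finally show ?thesis by simp
  qed
  ultimately have "\<Phi> 0 \<le> A * (1 / 2) ^ m + 2 * B" for m
    by (meson add_mono order_trans)
  moreover have "(\<lambda>m. A * (1 / 2) ^ m + 2 * B) \<longlonglongrightarrow> A * 0 + 2 * B"
    by (intro tendsto_intros LIMSEQ_realpow_zero) auto
  ultimately have "\<Phi> 0 \<le> A * 0 + 2 * B"
    by (intro LIMSEQ_le_const) auto
  then show ?thesis by simp
qed

lemma measure_cylinder:
  assumes "0 < r"
  shows "measure lborel (cylinder x0 t0 r :: ((real ^ 'n::finite) \<times> real) set) = cyl_mass TYPE('n) * r ^ (CARD('n) + 2)"
proof -
  have e: "indicator (cylinder x0 t0 r) w = (indicator (cylinder 0 0 r) ((x0, t0) - w) :: real)" for w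
    using mem_cylinder_diff[of w "(x0, t0)" r] by (simp add: indicator_def)
  have "measure lborel (cylinder x0 t0 r) = (\<integral>w. indicator (cylinder x0 t0 r) w \<partial>lborel)"
    by simp
  also have "\<dots> = (\<integral>w. indicator (cylinder 0 0 r) ((x0, t0) - w) \<partial>lborel)"
    unfolding e ..
  also have "\<dots> = (\<integral>w. indicator (cylinder 0 0 r) (w :: (real ^ 'n) \<times> real) \<partial>lborel)"
    by (rule integral_reflect[OF borel_measurable_indicator[OF cylinder_sets]])
  finally show ?thesis
    by (simp only: integral_indicator_cylinder[OF assms])
qed

lemma cylinder_mono: "0 < a \<Longrightarrow> a \<le> b \<Longrightarrow> cylinder x0 t0 a \<subseteq> cylinder x0 t0 b"
proof
  fix y assume a: "0 < a" "a \<le> b" and "y \<in> cylinder x0 t0 a"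
  moreover have "a\<^sup>2 \<le> b\<^sup>2" using a by (intro power_mono) auto
  ultimately show "y \<in> cylinder x0 t0 b"
    unfolding mem_cylinder by linarith
qed

text \<open>
  The gain of integrability with \<open>q = 2\<close>, where \<open>\<gamma> = 2\<close>, on the inner layer of width \<open>\<delta>\<close>, followed by the
  Caccioppoli inequality on the outer layer of width \<open>h\<close>. The factor \<open>\<delta>\<^sup>2 / h\<^sup>2\<close> in front of the
  norm on the larger cylinder is at our disposal.
\<close>

lemma system_L2_step:
  assumes \<nu>: "0 < \<nu>" and L: "0 < L"
  shows "\<exists>K>0. \<forall>x0 t0 R0 (v :: (real ^ 'n::finite) \<times> real \<Rightarrow> real ^ 'N::finite) G g F r \<delta> h.
    parabolic_system \<nu> L (cylinder x0 t0 R0) v G g F \<longrightarrow> 0 < r \<longrightarrow> 0 < \<delta> \<longrightarrow> 0 < h \<longrightarrow> r + \<delta> + h < R0 \<longrightarrow>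
    integ (cylinder x0 t0 r) (\<lambda>z. (norm (v z))\<^sup>2) \<le>
      K * (\<delta>\<^sup>2 / h\<^sup>2 * integ (cylinder x0 t0 (r + \<delta> + h)) (\<lambda>z. (norm (v z))\<^sup>2)
        + \<delta>\<^sup>2 * (\<integral>z. (norm (F z))\<^sup>2 \<partial>lborel)
        + r ^ (CARD('n) + 2) * ((\<integral>z. norm (v z) \<partial>lborel) / \<delta> ^ (CARD('n) + 2))\<^sup>2)"
proof -
  have "\<exists>K>0. \<forall>\<nu> L x0 t0 R0 (v :: (real ^ 'n) \<times> real \<Rightarrow> real ^ 'N) G g F r \<delta> i.
    parabolic_system \<nu> L (cylinder x0 t0 R0) v G g F \<longrightarrow> 0 < r \<longrightarrow> 0 < \<delta> \<longrightarrow> r + \<delta> \<le> R0 \<longrightarrow>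
    (\<integral>\<^sup>+z. ennreal (\<bar>v z $ i\<bar> powr 2) * indicator (cylinder x0 t0 r) z \<partial>lborel) \<le>
      ennreal (K * (\<delta> powr (2 - real (CARD('n) + 2) * (2 / 2 - 1)) *
        (integ (cylinder x0 t0 (r + \<delta>)) (\<lambda>z. (norm (G z))\<^sup>2) + integ (cylinder x0 t0 (r + \<delta>)) (\<lambda>z. (norm (g z))\<^sup>2)) powr (2 / 2)
        + measure lborel (cylinder x0 t0 r) * ((\<integral>z. norm (v z) \<partial>lborel) / \<delta> ^ (CARD('n) + 2)) powr 2))" (is "\<exists>K. ?P K")
    by (rule system_component_estimate) simp_all
  then obtain K where K': "?P K" by (rule exE)
  note K = K'[THEN conjunct1] and est = K'[THEN conjunct2, rule_format]
  define M where "M = data_const \<nu> L"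
  define V where "V = cyl_mass TYPE('n)"
  have M: "0 < M" using \<nu> by (auto simp: M_def data_const_def caccioppoli_const_def intro!: add_nonneg_pos)
  have V: "0 < V" unfolding V_def by (rule cyl_mass_pos)
  define K' where "K' = real CARD('N) * K * (M + V)"
  have K': "0 < K'" unfolding K'_def using K M V by simp
  show ?thesis
  proof (intro exI[of _ K'] conjI K' allI impI)
    fix x0 t0 R0 and v :: "(real ^ 'n) \<times> real \<Rightarrow> real ^ 'N" and G g F r \<delta> h
    assume sys: "parabolic_system \<nu> L (cylinder x0 t0 R0) v G g F" and r: "0 < r" "0 < \<delta>" "0 < h" "r + \<delta> + h < R0"
    let ?D = "cylinder x0 t0 r" and ?C' = "cylinder x0 t0 (r + \<delta>)"
    define X where "X = integ ?C' (\<lambda>z. (norm (G z))\<^sup>2) + integ ?C' (\<lambda>z. (norm (g z))\<^sup>2)"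
    define FF where "FF = (\<integral>z. (norm (F z))\<^sup>2 \<partial>lborel)"
    define VV where "VV = integ (cylinder x0 t0 (r + \<delta> + h)) (\<lambda>z. (norm (v z))\<^sup>2)"
    define W where "W = ((\<integral>z. norm (v z) \<partial>lborel) / \<delta> ^ (CARD('n) + 2))\<^sup>2"
    have nn: "0 \<le> X" "0 \<le> FF" "0 \<le> VV" "0 \<le> W"
      unfolding X_def FF_def VV_def W_def by simp_all
    have w0: "0 \<le> (\<integral>z. norm (v z) \<partial>lborel) / \<delta> ^ (CARD('n) + 2)" using r by simp
    have X: "X \<le> M * (FF + VV / h\<^sup>2)"
      using system_data_bound[OF sys \<nu> L, of "r + \<delta>" "r + \<delta> + h"] r by (simp add: X_def M_def FF_def VV_def)
    note S = system_integrable[OF sys]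
    have comp: "(\<integral>z. (v z $ i)\<^sup>2 * indicator ?D z \<partial>lborel) \<le> K * (\<delta>\<^sup>2 * X + V * r ^ (CARD('n) + 2) * W)"
      and ci: "integrable lborel (\<lambda>z. (v z $ i)\<^sup>2 * indicator ?D z)" for i
    proof -
      have "L2 (\<lambda>z. v z $ i)" using sys by (auto simp: parabolic_system_def intro: weak_pair_L2(1))
      then show int: "integrable lborel (\<lambda>z. (v z $ i)\<^sup>2 * indicator ?D z)"
        by (intro integrable_real_mult_indicator) (auto simp: L2_def)
      have "ennreal (\<integral>z. (v z $ i)\<^sup>2 * indicator ?D z \<partial>lborel) = (\<integral>\<^sup>+z. ennreal ((v z $ i)\<^sup>2 * indicator ?D z) \<partial>lborel)"
        by (rule nn_integral_eq_integral[OF int, symmetric]) simp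
      also have "\<dots> = (\<integral>\<^sup>+z. ennreal (\<bar>v z $ i\<bar> powr 2) * indicator ?D z \<partial>lborel)"
        by (rule nn_integral_cong) (simp add: indicator_def)
      also have "\<dots> \<le> ennreal (K * (\<delta> powr (2 - real (CARD('n) + 2) * (2 / 2 - 1)) * X powr (2 / 2)
        + measure lborel ?D * ((\<integral>z. norm (v z) \<partial>lborel) / \<delta> ^ (CARD('n) + 2)) powr 2))"
        unfolding X_def by (rule est[OF sys r(1,2)]) (use r in simp)
      also have "K * (\<delta> powr (2 - real (CARD('n) + 2) * (2 / 2 - 1)) * X powr (2 / 2)
        + measure lborel ?D * ((\<integral>z. norm (v z) \<partial>lborel) / \<delta> ^ (CARD('n) + 2)) powr 2) = K * (\<delta>\<^sup>2 * X + V * r ^ (CARD('n) + 2) * W)"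
      proof -
        have "\<delta> powr (2 - real (CARD('n) + 2) * (2 / 2 - 1)) = \<delta>\<^sup>2" using r by simp
        moreover have "X powr (2 / 2) = X" using nn by simp
        moreover have "((\<integral>z. norm (v z) \<partial>lborel) / \<delta> ^ (CARD('n) + 2)) powr 2 = W"
          unfolding W_def using w0 by (rule powr_numeral)
        ultimately show ?thesis by (simp only: measure_cylinder[OF r(1)] V_def)
      qed
      finally show "(\<integral>z. (v z $ i)\<^sup>2 * indicator ?D z \<partial>lborel) \<le> K * (\<delta>\<^sup>2 * X + V * r ^ (CARD('n) + 2) * W)"
        using K nn V r by (subst (asm) ennreal_le_iff) simp_all
    qed
    have "integ ?D (\<lambda>z. (norm (v z))\<^sup>2) = (\<integral>z. (\<Sum>i\<in>UNIV. (v z $ i)\<^sup>2 * indicator ?D z) \<partial>lborel)"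
      unfolding norm_vec_sq sum_distrib_right ..
    also have "\<dots> = (\<Sum>i\<in>UNIV. (\<integral>z. (v z $ i)\<^sup>2 * indicator ?D z \<partial>lborel))"
      by (rule Bochner_Integration.integral_sum[OF ci])
    also have "\<dots> \<le> (\<Sum>i\<in>(UNIV :: 'N set). K * (\<delta>\<^sup>2 * X + V * r ^ (CARD('n) + 2) * W))"
      by (intro sum_mono comp)
    also have "\<dots> = real CARD('N) * K * (\<delta>\<^sup>2 * X + V * (r ^ (CARD('n) + 2) * W))"
      by (simp add: mult.assoc)
    also have "\<dots> \<le> real CARD('N) * K * ((M + V) * (\<delta>\<^sup>2 / h\<^sup>2 * VV + \<delta>\<^sup>2 * FF + r ^ (CARD('n) + 2) * W))"
    proof (rule mult_left_mono)
      have rW: "0 \<le> r ^ (CARD('n) + 2) * W" using nn r by simp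
      have a: "\<delta>\<^sup>2 * X \<le> M * (\<delta>\<^sup>2 / h\<^sup>2 * VV + \<delta>\<^sup>2 * FF)"
        using mult_left_mono[OF X, of "\<delta>\<^sup>2"] by (simp add: algebra_simps)
      have b: "0 \<le> \<delta>\<^sup>2 / h\<^sup>2 * VV + \<delta>\<^sup>2 * FF" using nn by simp
      have c: "M * A + V * B \<le> (M + V) * (A + B)" if "0 \<le> A" "0 \<le> B" for A B
        using that M V by (simp add: distrib_left distrib_right)
      show "\<delta>\<^sup>2 * X + V * (r ^ (CARD('n) + 2) * W) \<le> (M + V) * (\<delta>\<^sup>2 / h\<^sup>2 * VV + \<delta>\<^sup>2 * FF + r ^ (CARD('n) + 2) * W)"
        using a c[OF b rW] by linarith
    qed (use K in simp)
    finally show "integ ?D (\<lambda>z. (norm (v z))\<^sup>2) \<le>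
      K' * (\<delta>\<^sup>2 / h\<^sup>2 * integ (cylinder x0 t0 (r + \<delta> + h)) (\<lambda>z. (norm (v z))\<^sup>2)
        + \<delta>\<^sup>2 * (\<integral>z. (norm (F z))\<^sup>2 \<partial>lborel)
        + r ^ (CARD('n) + 2) * ((\<integral>z. norm (v z) \<partial>lborel) / \<delta> ^ (CARD('n) + 2))\<^sup>2)"
      by (simp only: K'_def VV_def FF_def W_def mult.assoc)
  qed
qed

text \<open>
  Absorption with \<open>\<delta> = \<epsilon> h\<close> on cylinders whose radii increase from \<open>3/2 \<rho>\<close> to \<open>2 \<rho>\<close>. The widths shrink
  like \<open>2 ^ (-k)\<close>, so the factor \<open>\<delta> ^ (-2 (n + 2))\<close> of the \<open>L\<^sup>1\<close> term grows like \<open>4 ^ ((n + 2) k)\<close>; \<open>\<epsilon>\<close> is chosen to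
  beat this growth. The number \<open>\<Psi>\<close> measures data and solution in scale-invariant units, so that a single
  constant serves all radii.
\<close>

lemma system_L2_estimate:
  assumes \<nu>: "0 < \<nu>" and L: "0 < L"
  shows "\<exists>K>0. \<forall>x0 t0 \<rho> (v :: (real ^ 'n::finite) \<times> real \<Rightarrow> real ^ 'N::finite) G g F \<Psi>.
    parabolic_system \<nu> L (cylinder x0 t0 (2 * \<rho>)) v G g F \<longrightarrow> 0 < \<rho> \<longrightarrow> 0 \<le> \<Psi> \<longrightarrow>
    \<rho>\<^sup>2 * (\<integral>z. (norm (F z))\<^sup>2 \<partial>lborel) \<le> \<rho> ^ (CARD('n) + 2) * \<Psi>\<^sup>2 \<longrightarrow>
    (\<integral>z. norm (v z) \<partial>lborel) \<le> \<rho> ^ (CARD('n) + 2) * \<Psi> \<longrightarrow>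
    integ (cylinder x0 t0 (3 / 2 * \<rho>)) (\<lambda>z. (norm (v z))\<^sup>2) \<le> K * (\<rho> ^ (CARD('n) + 2) * \<Psi>\<^sup>2)"
proof -
  let ?d = "CARD('n) + 2"
  have "\<exists>K>0. \<forall>x0 t0 R0 (v :: (real ^ 'n) \<times> real \<Rightarrow> real ^ 'N) G g F r \<delta> h.
    parabolic_system \<nu> L (cylinder x0 t0 R0) v G g F \<longrightarrow> 0 < r \<longrightarrow> 0 < \<delta> \<longrightarrow> 0 < h \<longrightarrow> r + \<delta> + h < R0 \<longrightarrow>
    integ (cylinder x0 t0 r) (\<lambda>z. (norm (v z))\<^sup>2) \<le>
      K * (\<delta>\<^sup>2 / h\<^sup>2 * integ (cylinder x0 t0 (r + \<delta> + h)) (\<lambda>z. (norm (v z))\<^sup>2)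
        + \<delta>\<^sup>2 * (\<integral>z. (norm (F z))\<^sup>2 \<partial>lborel)
        + r ^ ?d * ((\<integral>z. norm (v z) \<partial>lborel) / \<delta> ^ ?d)\<^sup>2)" (is "\<exists>K. ?P K")
    by (rule system_L2_step[OF assms])
  then obtain K where K': "?P K" by (rule exE)
  note K = K'[THEN conjunct1] and step = K'[THEN conjunct2, rule_format]
  \<comment> \<open>The growth rate of the \<open>L\<^sup>1\<close> term along the iteration.\<close>
  define M :: real where "M = 4 ^ ?d"
  have M: "1 \<le> M" unfolding M_def by (rule one_le_power) simp
  \<comment> \<open>Chosen such that \<open>\<kappa> M \<le> 1/2\<close> in \<open>absorbing_iteration\<close>.\<close>
  define \<epsilon> where "\<epsilon> = sqrt (min 1 (1 / (2 * (K * M))))"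
  define \<kappa> where "\<kappa> = K * \<epsilon>\<^sup>2"
  have KM: "0 < K * M" using K M by simp
  have e2: "\<epsilon>\<^sup>2 = min 1 (1 / (2 * (K * M)))" unfolding \<epsilon>_def using KM by simp
  have \<epsilon>: "0 < \<epsilon>" "\<epsilon> \<le> 1" unfolding \<epsilon>_def using KM by (simp_all add: real_sqrt_le_1_iff)
  have \<kappa>: "0 \<le> \<kappa>" "\<kappa> * M \<le> 1 / 2" "\<kappa> \<le> 1 / 2"
  proof -
    show k0: "0 \<le> \<kappa>" using K by (simp add: \<kappa>_def)
    have "\<kappa> * M = K * M * \<epsilon>\<^sup>2" by (simp add: \<kappa>_def)
    also have "\<dots> \<le> K * M * (1 / (2 * (K * M)))"
      unfolding e2 using KM by (intro mult_left_mono) (simp_all only: min.cobounded2 less_imp_le)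
    also have "\<dots> = 1 / 2" using K M by simp
    finally show *: "\<kappa> * M \<le> 1 / 2" .
    have "\<kappa> * 1 \<le> \<kappa> * M" using k0 M by (intro mult_left_mono)
    with * show "\<kappa> \<le> 1 / 2" by simp
  qed
  define K' where "K' = K * (1 + 2 ^ ?d * ((8 / \<epsilon>) ^ ?d)\<^sup>2)"
  have K': "0 < K'" unfolding K'_def using K \<epsilon> by (intro mult_pos_pos add_pos_nonneg) simp_all
  show ?thesis
  proof (intro exI[of _ "2 * K'"] conjI allI impI)
    show "0 < 2 * K'" using K' by simp
    fix x0 t0 \<rho> and v :: "(real ^ 'n) \<times> real \<Rightarrow> real ^ 'N" and G g F \<Psi>
    assume sys: "parabolic_system \<nu> L (cylinder x0 t0 (2 * \<rho>)) v G g F" and \<rho>: "0 < \<rho>" and \<Psi>: "0 \<le> \<Psi>"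
      and Fb: "\<rho>\<^sup>2 * (\<integral>z. (norm (F z))\<^sup>2 \<partial>lborel) \<le> \<rho> ^ ?d * \<Psi>\<^sup>2"
      and vb: "(\<integral>z. norm (v z) \<partial>lborel) \<le> \<rho> ^ ?d * \<Psi>"
    \<comment> \<open>The radii start at \<open>3/2 \<rho>\<close> and stay below \<open>2 \<rho>\<close>; the gap between consecutive radii is divided
      in the ratio \<open>\<epsilon> : 1\<close>.\<close>
    define r where "r k = \<rho> * (2 - (1 / 2) ^ Suc k)" for k :: nat
    define gap where "gap k = \<rho> * (1 / 2) ^ (k + 2)" for k :: nat
    define \<delta> where "\<delta> k = \<epsilon> / (1 + \<epsilon>) * gap k" for k
    define h where "h k = 1 / (1 + \<epsilon>) * gap k" for k
    define \<Phi> where "\<Phi> k = integ (cylinder x0 t0 (r k)) (\<lambda>z. (norm (v z))\<^sup>2)" for k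
    define B where "B = K' * (\<rho> ^ ?d * \<Psi>\<^sup>2)"
    have l: "0 < gap k" "gap k \<le> \<rho>" for k
      using \<rho> power_le_one[of "1/2::real" "k+2"] by (simp_all only: gap_def) (simp_all add: mult_left_le)
    have d: "0 < \<delta> k" "0 < h k" "\<delta> k + h k = gap k" "\<delta> k = \<epsilon> * h k" "\<delta> k \<le> gap k" "\<epsilon> / 2 * gap k \<le> \<delta> k" for k
    proof -
      show "0 < \<delta> k" "0 < h k" using l[of k] \<epsilon> by (simp_all add: \<delta>_def h_def)
      have "\<delta> k + h k = (\<epsilon> / (1 + \<epsilon>) + 1 / (1 + \<epsilon>)) * gap k" by (simp only: \<delta>_def h_def distrib_right)
      also have "\<epsilon> / (1 + \<epsilon>) + 1 / (1 + \<epsilon>) = 1" using \<epsilon> by (simp add: add_divide_distrib[symmetric])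
      finally show e: "\<delta> k + h k = gap k" by simp
      show "\<delta> k = \<epsilon> * h k" by (simp add: \<delta>_def h_def)
      show "\<delta> k \<le> gap k" using e \<open>0 < h k\<close> by linarith
      show "\<epsilon> / 2 * gap k \<le> \<delta> k"
        unfolding \<delta>_def using \<epsilon> l[of k] by (intro mult_right_mono divide_left_mono) simp_all
    qed
    have rk: "0 < r k" "r k \<le> 2 * \<rho>" "r k + \<delta> k + h k = r (Suc k)" "r (Suc k) < 2 * \<rho>" for k
    proof -
      have "(1 / 2 :: real) ^ Suc k \<le> 1" by (rule power_le_one) simp_all
      then show "0 < r k" unfolding r_def using \<rho> by (intro mult_pos_pos) linarith+
      show "r k \<le> 2 * \<rho>" unfolding r_def using \<rho> by simp
      show "r (Suc k) < 2 * \<rho>" unfolding r_def using \<rho> by simp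
      have "r k + gap k = r (Suc k)" unfolding r_def gap_def by (simp add: algebra_simps)
      then show "r k + \<delta> k + h k = r (Suc k)" using d(3)[of k] by linarith
    qed
    define v1 where "v1 = (\<integral>z. norm (v z) \<partial>lborel)"
    have v1: "0 \<le> v1" "v1 \<le> \<rho> ^ ?d * \<Psi>" using vb by (simp_all add: v1_def)
    have st: "\<Phi> k \<le> \<kappa> * \<Phi> (Suc k) + B * M ^ k" for k
    proof -
      have "\<Phi> k \<le> K * ((\<delta> k)\<^sup>2 / (h k)\<^sup>2 * \<Phi> (Suc k) + (\<delta> k)\<^sup>2 * (\<integral>z. (norm (F z))\<^sup>2 \<partial>lborel)
          + r k ^ ?d * (v1 / \<delta> k ^ ?d)\<^sup>2)"
        using step[OF sys rk(1) d(1,2), of k k k] rk(3,4)[of k] by (simp add: \<Phi>_def v1_def)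
      also have "\<dots> \<le> K * (\<epsilon>\<^sup>2 * \<Phi> (Suc k) + \<rho> ^ ?d * \<Psi>\<^sup>2 * M ^ k + 2 ^ ?d * ((8 / \<epsilon>) ^ ?d)\<^sup>2 * (\<rho> ^ ?d * \<Psi>\<^sup>2 * M ^ k))"
      proof (intro mult_left_mono add_mono)
        show "(\<delta> k)\<^sup>2 / (h k)\<^sup>2 * \<Phi> (Suc k) \<le> \<epsilon>\<^sup>2 * \<Phi> (Suc k)"
          using d(2)[of k] by (simp add: d(4) power_mult_distrib)
        have "(\<delta> k)\<^sup>2 \<le> \<rho>\<^sup>2"
          using d(1,5)[of k] l(2)[of k] by (intro power_mono) linarith+
        then have "(\<delta> k)\<^sup>2 * (\<integral>z. (norm (F z))\<^sup>2 \<partial>lborel) \<le> \<rho>\<^sup>2 * (\<integral>z. (norm (F z))\<^sup>2 \<partial>lborel)"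
          by (intro mult_right_mono) simp_all
        also have "\<dots> \<le> \<rho> ^ ?d * \<Psi>\<^sup>2 * 1" using Fb by simp
        also have "\<dots> \<le> \<rho> ^ ?d * \<Psi>\<^sup>2 * M ^ k"
          using \<rho> M by (intro mult_left_mono one_le_power) simp_all
        finally show "(\<delta> k)\<^sup>2 * (\<integral>z. (norm (F z))\<^sup>2 \<partial>lborel) \<le> \<rho> ^ ?d * \<Psi>\<^sup>2 * M ^ k" .
        have low: "\<epsilon> / 8 * \<rho> * (1 / 2) ^ k \<le> \<delta> k"
          using d(6)[of k] by (simp add: gap_def power_add power2_eq_square)
        have low0: "0 < \<epsilon> / 8 * \<rho> * (1 / 2) ^ k" using \<epsilon> \<rho> by simp
        have "v1 / \<delta> k ^ ?d \<le> \<rho> ^ ?d * \<Psi> / (\<epsilon> / 8 * \<rho> * (1 / 2) ^ k) ^ ?d"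
          using v1 low low0 \<rho> \<Psi> by (intro frac_le power_mono zero_less_power) auto
        also have "(\<epsilon> / 8 * \<rho> * (1 / 2) ^ k) ^ ?d = \<rho> ^ ?d * ((\<epsilon> / 8) ^ ?d * ((1 / 2) ^ k) ^ ?d)"
          by (simp only: power_mult_distrib mult_ac)
        also have "\<rho> ^ ?d * \<Psi> / (\<rho> ^ ?d * ((\<epsilon> / 8) ^ ?d * ((1 / 2) ^ k) ^ ?d)) = (8 / \<epsilon>) ^ ?d * \<Psi> * (2 ^ k) ^ ?d"
        proof -
          have "\<rho> ^ ?d \<noteq> 0" using \<rho> by simp
          moreover have "A * P / (A * (1 / E * (1 / T))) = E * P * T" if "A \<noteq> 0" for A P E T :: real
            using that by simp
          moreover have "(\<epsilon> / 8) ^ ?d = 1 / (8 / \<epsilon>) ^ ?d" by (simp only: power_divide divide_divide_eq_right mult_1_left divide_divide_eq_left)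
          moreover have "((1 / 2 :: real) ^ k) ^ ?d = 1 / (2 ^ k) ^ ?d" by (simp only: power_divide power_one)
          ultimately show ?thesis by presburger
        qed
        finally have le: "v1 / \<delta> k ^ ?d \<le> (8 / \<epsilon>) ^ ?d * \<Psi> * (2 ^ k) ^ ?d" .
        have "(v1 / \<delta> k ^ ?d)\<^sup>2 \<le> ((8 / \<epsilon>) ^ ?d * \<Psi> * (2 ^ k) ^ ?d)\<^sup>2"
          using le v1(1) d(1)[of k] by (intro power_mono) simp_all
        also have "\<dots> = ((8 / \<epsilon>) ^ ?d)\<^sup>2 * \<Psi>\<^sup>2 * M ^ k"
        proof -
          have "((2 ^ k) ^ ?d)\<^sup>2 = (M ^ k :: real)"
          proof -
            have "((2 ^ k) ^ ?d)\<^sup>2 = ((2::real)\<^sup>2) ^ (k * ?d)" by (simp only: power_mult[symmetric] mult_ac)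
            also have "(2::real)\<^sup>2 = 4" by simp
            also have "(4::real) ^ (k * ?d) = M ^ k" by (simp only: M_def power_mult[symmetric] mult_ac)
            finally show ?thesis .
          qed
          then show ?thesis by (simp only: power_mult_distrib)
        qed
        finally have a: "(v1 / \<delta> k ^ ?d)\<^sup>2 \<le> ((8 / \<epsilon>) ^ ?d)\<^sup>2 * \<Psi>\<^sup>2 * M ^ k" .
        have "r k ^ ?d \<le> (2 * \<rho>) ^ ?d" using rk[of k] by (intro power_mono) simp_all
        then have "r k ^ ?d * (v1 / \<delta> k ^ ?d)\<^sup>2 \<le> (2 * \<rho>) ^ ?d * (((8 / \<epsilon>) ^ ?d)\<^sup>2 * \<Psi>\<^sup>2 * M ^ k)"
          using a \<rho> by (intro mult_mono) simp_all
        also have "\<dots> = 2 ^ ?d * ((8 / \<epsilon>) ^ ?d)\<^sup>2 * (\<rho> ^ ?d * \<Psi>\<^sup>2 * M ^ k)"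
          by (simp only: power_mult_distrib mult_ac)
        finally show "r k ^ ?d * (v1 / \<delta> k ^ ?d)\<^sup>2 \<le> 2 ^ ?d * ((8 / \<epsilon>) ^ ?d)\<^sup>2 * (\<rho> ^ ?d * \<Psi>\<^sup>2 * M ^ k)" .
      qed (use K in simp)
      also have "\<dots> = \<kappa> * \<Phi> (Suc k) + B * M ^ k"
      proof -
        have "K * (e * P + R * T + Q * (R * T)) = K * e * P + K * (1 + Q) * R * T" for e P R T Q :: real
          by (simp add: algebra_simps)
        note * = this
        show ?thesis unfolding \<kappa>_def B_def K'_def by (rule *)
      qed
      finally show ?thesis .
    qed
    note S = system_integrable[OF sys]
    have "\<Phi> 0 \<le> 2 * B"
    proof (rule absorbing_iteration[OF st \<kappa>(1,3,2)])
      show "0 \<le> M" using M by linarith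
      show "0 \<le> B" unfolding B_def using K' \<rho> by (intro mult_nonneg_nonneg) simp_all
      show "0 \<le> (\<integral>z. (norm (v z))\<^sup>2 \<partial>lborel)" by simp
      show "\<Phi> k \<le> (\<integral>z. (norm (v z))\<^sup>2 \<partial>lborel)" for k
        using integ_mono_set[OF S(1), of "cylinder x0 t0 (r k)" UNIV] by (simp add: \<Phi>_def)
    qed
    moreover have "r 0 = 3 / 2 * \<rho>" by (simp add: r_def)
    ultimately show "integ (cylinder x0 t0 (3 / 2 * \<rho>)) (\<lambda>z. (norm (v z))\<^sup>2) \<le> 2 * K' * (\<rho> ^ ?d * \<Psi>\<^sup>2)"
      by (simp only: \<Phi>_def B_def mult.assoc)
  qed
qed

section \<open>The Lq bound for systems\<close>

text \<open>
  The gain of integrability from radius \<open>\<rho>\<close> to \<open>5/4 \<rho>\<close>, the Caccioppoli inequality from \<open>5/4 \<rho>\<close> to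
  \<open>3/2 \<rho>\<close>, and \<open>system_L2_estimate\<close> on the latter cylinder. The powers of \<open>\<rho>\<close> combine to \<open>\<rho> ^ (n + 2)\<close>.
\<close>

lemma system_Lq_estimate:
  fixes q :: real
  assumes \<nu>: "0 < \<nu>" and L: "0 < L" and q: "2 \<le> q" and \<gamma>: "0 < q - real (CARD('n::finite) + 2) * (q / 2 - 1)"
  shows "\<exists>K>0. \<forall>x0 t0 \<rho> (v :: (real ^ 'n) \<times> real \<Rightarrow> real ^ 'N::finite) G g F \<Psi> i.
    parabolic_system \<nu> L (cylinder x0 t0 (2 * \<rho>)) v G g F \<longrightarrow> 0 < \<rho> \<longrightarrow> 0 \<le> \<Psi> \<longrightarrow>
    \<rho>\<^sup>2 * (\<integral>z. (norm (F z))\<^sup>2 \<partial>lborel) \<le> \<rho> ^ (CARD('n) + 2) * \<Psi>\<^sup>2 \<longrightarrow>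
    (\<integral>z. norm (v z) \<partial>lborel) \<le> \<rho> ^ (CARD('n) + 2) * \<Psi> \<longrightarrow>
    (\<integral>\<^sup>+z. ennreal (\<bar>v z $ i\<bar> powr q) * indicator (cylinder x0 t0 \<rho>) z \<partial>lborel) \<le>
      ennreal (K * (\<rho> ^ (CARD('n) + 2) * \<Psi> powr q))"
proof -
  let ?d = "CARD('n) + 2"
  let ?\<gamma> = "q - real ?d * (q / 2 - 1)"
  have "\<exists>K>0. \<forall>\<nu> L x0 t0 R0 (v :: (real ^ 'n) \<times> real \<Rightarrow> real ^ 'N) G g F r \<delta> i.
    parabolic_system \<nu> L (cylinder x0 t0 R0) v G g F \<longrightarrow> 0 < r \<longrightarrow> 0 < \<delta> \<longrightarrow> r + \<delta> \<le> R0 \<longrightarrow>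
    (\<integral>\<^sup>+z. ennreal (\<bar>v z $ i\<bar> powr q) * indicator (cylinder x0 t0 r) z \<partial>lborel) \<le>
      ennreal (K * (\<delta> powr ?\<gamma> *
        (integ (cylinder x0 t0 (r + \<delta>)) (\<lambda>z. (norm (G z))\<^sup>2) + integ (cylinder x0 t0 (r + \<delta>)) (\<lambda>z. (norm (g z))\<^sup>2)) powr (q / 2)
        + measure lborel (cylinder x0 t0 r) * ((\<integral>z. norm (v z) \<partial>lborel) / \<delta> ^ ?d) powr q))" (is "\<exists>K. ?P K")
    by (rule system_component_estimate[OF q \<gamma>])
  then obtain K1 where K1': "?P K1" by (rule exE)
  note K1 = K1'[THEN conjunct1] and est = K1'[THEN conjunct2, rule_format]
  have "\<exists>K>0. \<forall>x0 t0 \<rho> (v :: (real ^ 'n) \<times> real \<Rightarrow> real ^ 'N) G g F \<Psi>.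
    parabolic_system \<nu> L (cylinder x0 t0 (2 * \<rho>)) v G g F \<longrightarrow> 0 < \<rho> \<longrightarrow> 0 \<le> \<Psi> \<longrightarrow>
    \<rho>\<^sup>2 * (\<integral>z. (norm (F z))\<^sup>2 \<partial>lborel) \<le> \<rho> ^ ?d * \<Psi>\<^sup>2 \<longrightarrow>
    (\<integral>z. norm (v z) \<partial>lborel) \<le> \<rho> ^ ?d * \<Psi> \<longrightarrow>
    integ (cylinder x0 t0 (3 / 2 * \<rho>)) (\<lambda>z. (norm (v z))\<^sup>2) \<le> K * (\<rho> ^ ?d * \<Psi>\<^sup>2)" (is "\<exists>K. ?P2 K")
    by (rule system_L2_estimate[OF \<nu> L])
  then obtain K2 where K2': "?P2 K2" by (rule exE)
  note K2 = K2'[THEN conjunct1] and est2 = K2'[THEN conjunct2, rule_format]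
  define M where "M = data_const \<nu> L"
  have M: "0 < M" using \<nu> by (auto simp: M_def data_const_def caccioppoli_const_def intro!: add_nonneg_pos)
  define V where "V = cyl_mass TYPE('n)"
  have V: "0 < V" unfolding V_def by (rule cyl_mass_pos)
  define A where "A = M * (1 + 16 * K2)"
  have A: "0 < A" unfolding A_def using M K2 by simp
  define a b where "a = (1 / 4) powr ?\<gamma> * A powr (q / 2)" and "b = V * (4 ^ ?d) powr q"
  have ab: "0 < a" "0 < b" unfolding a_def b_def using A V by simp_all
  show ?thesis
  proof (intro exI[of _ "K1 * (a + b)"] conjI allI impI)
    show "0 < K1 * (a + b)" using K1 ab by simp
    fix x0 t0 \<rho> and v :: "(real ^ 'n) \<times> real \<Rightarrow> real ^ 'N" and G g F \<Psi> i
    assume sys: "parabolic_system \<nu> L (cylinder x0 t0 (2 * \<rho>)) v G g F" and \<rho>: "0 < \<rho>" and \<Psi>: "0 \<le> \<Psi>"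
      and Fb: "\<rho>\<^sup>2 * (\<integral>z. (norm (F z))\<^sup>2 \<partial>lborel) \<le> \<rho> ^ ?d * \<Psi>\<^sup>2"
      and vb: "(\<integral>z. norm (v z) \<partial>lborel) \<le> \<rho> ^ ?d * \<Psi>"
    let ?r = "\<rho> + \<rho> / 4"
    define X where "X = integ (cylinder x0 t0 ?r) (\<lambda>z. (norm (G z))\<^sup>2) + integ (cylinder x0 t0 ?r) (\<lambda>z. (norm (g z))\<^sup>2)"
    define v1 where "v1 = (\<integral>z. norm (v z) \<partial>lborel)"
    have v1: "0 \<le> v1" "v1 \<le> \<rho> ^ ?d * \<Psi>" using vb by (simp_all add: v1_def)
    have X0: "0 \<le> X" unfolding X_def by simp
    define FF VV where "FF = (\<integral>z. (norm (F z))\<^sup>2 \<partial>lborel)" and "VV = integ (cylinder x0 t0 (3 / 2 * \<rho>)) (\<lambda>z. (norm (v z))\<^sup>2)"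
    have "X \<le> M * (FF + VV / (3 / 2 * \<rho> - ?r)\<^sup>2)"
      unfolding X_def M_def FF_def VV_def using \<rho> by (intro system_data_bound[OF sys \<nu> L]) simp_all
    also have "(3 / 2 * \<rho> - ?r)\<^sup>2 = \<rho>\<^sup>2 / 16" by (simp add: power2_eq_square field_simps)
    finally have X1: "X \<le> M * (FF + VV / (\<rho>\<^sup>2 / 16))" .
    have "\<rho>\<^sup>2 * X \<le> \<rho>\<^sup>2 * (M * (FF + VV / (\<rho>\<^sup>2 / 16)))"
      using X1 by (rule mult_left_mono) simp
    also have "\<dots> = M * (\<rho>\<^sup>2 * FF + 16 * VV)"
      using \<rho> by (simp add: field_simps)
    also have "\<dots> \<le> M * (\<rho> ^ ?d * \<Psi>\<^sup>2 + 16 * (K2 * (\<rho> ^ ?d * \<Psi>\<^sup>2)))"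
      using est2[OF sys \<rho> \<Psi> Fb vb] Fb M unfolding FF_def VV_def by (intro mult_left_mono add_mono) simp_all
    also have "\<dots> = A * (\<rho> ^ ?d * \<Psi>\<^sup>2)" by (simp add: A_def algebra_simps)
    \<comment> \<open>Up to the factor \<open>\<rho>\<^sup>2\<close>, the energy is bounded by the same quantity as the \<open>L\<^sup>2\<close> norm of \<open>v\<close>.\<close>
    finally have rX: "\<rho>\<^sup>2 * X \<le> A * (\<rho> ^ ?d * \<Psi>\<^sup>2)" .
    have r2: "0 < \<rho>\<^sup>2" using \<rho> by simp
    have "X \<le> A * (\<rho> ^ ?d * \<Psi>\<^sup>2) / \<rho>\<^sup>2"
      unfolding pos_le_divide_eq[OF r2] using rX by (simp only: mult.commute[of X])
    also have "\<dots> = A * (\<rho> powr (real ?d - 2) * \<Psi>\<^sup>2)"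
    proof -
      have "\<rho> powr 2 = \<rho>\<^sup>2" using \<rho> by simp
      then have "\<rho> powr (real ?d - 2) = \<rho> ^ ?d / \<rho>\<^sup>2"
        by (simp only: powr_diff powr_realpow[OF \<rho>])
      then show ?thesis by (simp only: times_divide_eq_left times_divide_eq_right)
    qed
    finally have X: "X \<le> A * (\<rho> powr (real ?d - 2) * \<Psi>\<^sup>2)" .
    have pd: "\<rho> ^ ?d = \<rho> powr real ?d" using \<rho> by (rule powr_realpow[symmetric])
    have Psq: "(\<Psi>\<^sup>2) powr (q / 2) = \<Psi> powr q"
      using \<Psi> by (simp add: powr_powr flip: powr_numeral)
    have "(\<rho> / 4) powr ?\<gamma> * X powr (q / 2) \<le> (\<rho> / 4) powr ?\<gamma> * (A * (\<rho> powr (real ?d - 2) * \<Psi>\<^sup>2)) powr (q / 2)"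
      using X X0 q by (intro mult_left_mono powr_mono2) simp_all
    also have "\<dots> = a * (\<rho> powr ?\<gamma> * \<rho> powr ((real ?d - 2) * (q / 2))) * \<Psi> powr q"
    proof -
      have "(\<rho> / 4) powr ?\<gamma> = \<rho> powr ?\<gamma> * (1 / 4) powr ?\<gamma>"
        unfolding powr_mult[symmetric] by simp
      then show ?thesis unfolding a_def powr_mult powr_powr Psq by (simp only: mult_ac)
    qed
    also have "\<rho> powr ?\<gamma> * \<rho> powr ((real ?d - 2) * (q / 2)) = \<rho> ^ ?d"
    proof -
      have "?\<gamma> + (real ?d - 2) * (q / 2) = real ?d" by (simp add: field_simps)
      then show ?thesis unfolding pd powr_add[symmetric] by (simp only:)
    qed
    finally have t1: "(\<rho> / 4) powr ?\<gamma> * X powr (q / 2) \<le> a * \<rho> ^ ?d * \<Psi> powr q" .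
    have "v1 / (\<rho> / 4) ^ ?d \<le> \<rho> ^ ?d * \<Psi> / (\<rho> / 4) ^ ?d"
      using v1 \<rho> by (intro divide_right_mono) simp_all
    also have "\<dots> = 4 ^ ?d * \<Psi>"
    proof -
      have "\<rho> ^ ?d \<noteq> 0" using \<rho> by simp
      then show ?thesis unfolding power_divide by (simp only: divide_divide_eq_right mult_ac nonzero_mult_div_cancel_left times_divide_eq_left) simp
    qed
    finally have "v1 / (\<rho> / 4) ^ ?d \<le> 4 ^ ?d * \<Psi>" .
    moreover have "0 \<le> v1 / (\<rho> / 4) ^ ?d" using v1 \<rho> by simp
    ultimately have "(v1 / (\<rho> / 4) ^ ?d) powr q \<le> (4 ^ ?d * \<Psi>) powr q"
      using q by (intro powr_mono2) simp_all
    then have "measure lborel (cylinder x0 t0 \<rho>) * (v1 / (\<rho> / 4) ^ ?d) powr q \<le> V * \<rho> ^ ?d * (4 ^ ?d * \<Psi>) powr q"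
      unfolding measure_cylinder[OF \<rho>] V_def[symmetric] using V \<rho> by (intro mult_left_mono) simp_all
    also have "\<dots> = b * \<rho> ^ ?d * \<Psi> powr q"
      unfolding b_def powr_mult by (simp only: mult_ac)
    finally have t2: "measure lborel (cylinder x0 t0 \<rho>) * (v1 / (\<rho> / 4) ^ ?d) powr q \<le> b * \<rho> ^ ?d * \<Psi> powr q" .
    have "(\<integral>\<^sup>+z. ennreal (\<bar>v z $ i\<bar> powr q) * indicator (cylinder x0 t0 \<rho>) z \<partial>lborel) \<le>
      ennreal (K1 * ((\<rho> / 4) powr ?\<gamma> * X powr (q / 2) + measure lborel (cylinder x0 t0 \<rho>) * (v1 / (\<rho> / 4) ^ ?d) powr q))"
      unfolding X_def v1_def using \<rho> by (intro est[OF sys \<rho>]) simp_all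
    also have "\<dots> \<le> ennreal (K1 * (a * \<rho> ^ ?d * \<Psi> powr q + b * \<rho> ^ ?d * \<Psi> powr q))"
      using t1 t2 K1 by (intro ennreal_leI mult_left_mono add_mono) simp_all
    also have "K1 * (a * \<rho> ^ ?d * \<Psi> powr q + b * \<rho> ^ ?d * \<Psi> powr q) = K1 * (a + b) * (\<rho> ^ ?d * \<Psi> powr q)"
      by (simp only: distrib_left distrib_right mult.assoc)
    finally show "(\<integral>\<^sup>+z. ennreal (\<bar>v z $ i\<bar> powr q) * indicator (cylinder x0 t0 \<rho>) z \<partial>lborel) \<le>
      ennreal (K1 * (a + b) * (\<rho> ^ ?d * \<Psi> powr q))" .
  qed
qed

section \<open>Borel representatives\<close>

lemma lebesgue_on_iff:
  fixes f :: "'a::euclidean_space \<Rightarrow> 'b::real_normed_vector"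
  assumes "S \<in> sets lebesgue"
  shows "f \<in> borel_measurable (lebesgue_on S) \<longleftrightarrow> (\<lambda>x. indicator S x *\<^sub>R f x) \<in> borel_measurable lebesgue"
  using assms by (intro borel_measurable_restrict_space_iff) simp

text \<open>
  Integrals over the completed measure are computed with any Borel representative.
\<close>

lemma integral_lebesgue_eq:
  fixes f f' :: "'a::euclidean_space \<Rightarrow> 'b::{banach, second_countable_topology}"
  assumes f': "f' \<in> borel_measurable borel" and ae: "AE z in lborel. f z = f' z"
  shows "f \<in> borel_measurable lebesgue" "integrable lebesgue f \<longleftrightarrow> integrable lborel f'"
    "(\<integral>z. f z \<partial>lebesgue) = (\<integral>z. f' z \<partial>lborel)"
proof -
  have ae': "AE z in lebesgue. f z = f' z" by (rule AE_completion[OF ae])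
  have f'm: "f' \<in> borel_measurable lebesgue" using f' by (auto intro: measurable_completion)
  show fm: "f \<in> borel_measurable lebesgue"
  proof (rule measurableI)
    fix A :: "'b set" assume "A \<in> sets borel"
    then have A: "f' -` A \<inter> space lebesgue \<in> sets lebesgue" by (rule measurable_sets[OF f'm])
    have "AE x in lebesgue. x \<in> f' -` A \<inter> space lebesgue \<longleftrightarrow> x \<in> f -` A \<inter> space lebesgue"
      using ae' by eventually_elim simp
    then show "f -` A \<inter> space lebesgue \<in> sets lebesgue"
      by (rule completion.in_sets_AE[OF _ A]) simp
  qed simp
  have "integrable lebesgue f \<longleftrightarrow> integrable lebesgue f'"
    by (rule integrable_cong_AE[OF fm f'm ae'])
  then show "integrable lebesgue f \<longleftrightarrow> integrable lborel f'"
    using f' by (simp add: integrable_completion)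
  have "(\<integral>z. f z \<partial>lebesgue) = (\<integral>z. f' z \<partial>lebesgue)"
    by (rule integral_cong_AE[OF fm f'm ae'])
  then show "(\<integral>z. f z \<partial>lebesgue) = (\<integral>z. f' z \<partial>lborel)"
    using f' by (simp add: integral_completion)
qed

text \<open>
  A function that is Lebesgue measurable on \<open>S\<close> has a Borel representative. It is set to zero
  off \<open>S\<close>, as required by \<open>weak_pair\<close>.
\<close>

lemma real_representative:
  fixes f :: "'a::euclidean_space \<Rightarrow> real"
  assumes S: "S \<in> sets borel" and f: "f \<in> borel_measurable (lebesgue_on S)"
    and i: "set_integrable lebesgue S (\<lambda>z. (f z)\<^sup>2)"
  shows "\<exists>f'. L2 f' \<and> (\<forall>z. z \<notin> S \<longrightarrow> f' z = 0) \<and> (AE z in lborel. z \<in> S \<longrightarrow> f' z = f z)"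
proof -
  have "S \<in> sets lebesgue" using S by simp
  then have "(\<lambda>x. indicator S x *\<^sub>R f x) \<in> borel_measurable lebesgue"
    using f by (simp only: lebesgue_on_iff)
  from completion_ex_borel_measurable_real[OF this] obtain h where
    h: "h \<in> borel_measurable borel" and ae: "AE z in lborel. indicator S z *\<^sub>R f z = h z"
    by auto
  define f' where "f' z = indicator S z * h z" for z
  have m: "f' \<in> borel_measurable borel"
    unfolding f'_def[abs_def] by (rule borel_measurable_times[OF borel_measurable_indicator[OF S] h])
  have m2: "(\<lambda>z. (f' z)\<^sup>2) \<in> borel_measurable borel" using m by measurable
  have ae2: "AE z in lborel. indicator S z *\<^sub>R (f z)\<^sup>2 = (f' z)\<^sup>2"
    using ae by eventually_elim (auto simp: f'_def indicator_def)
  have "integrable lborel (\<lambda>z. (f' z)\<^sup>2)"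
    using i integral_lebesgue_eq(2)[OF m2 ae2] by (simp add: set_integrable_def)
  then have "L2 f'" using m by (simp add: L2_def)
  moreover have "AE z in lborel. z \<in> S \<longrightarrow> f' z = f z"
    using ae by eventually_elim (auto simp: f'_def)
  ultimately show ?thesis
    by (intro exI[of _ f']) (simp add: f'_def)
qed

lemma lebesgue_on_component:
  fixes f :: "'a::euclidean_space \<Rightarrow> 'b::real_normed_vector ^ 'm::finite"
  assumes "S \<in> sets lebesgue" "f \<in> borel_measurable (lebesgue_on S)"
  shows "(\<lambda>z. f z $ i) \<in> borel_measurable (lebesgue_on S)"
  using assms(2) by (rule measurable_compose) (auto intro!: borel_measurable_continuous_onI continuous_intros)

lemma set_integrable_component_sq:
  fixes f :: "'a::euclidean_space \<Rightarrow> 'b::euclidean_space" and h :: "'a \<Rightarrow> 'c::euclidean_space"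
  assumes S: "S \<in> sets lebesgue" and h: "h \<in> borel_measurable (lebesgue_on S)"
    and i: "set_integrable lebesgue S (\<lambda>z. (norm (f z))\<^sup>2)" and le: "\<And>z. norm (h z) \<le> norm (f z)"
  shows "set_integrable lebesgue S (\<lambda>z. (norm (h z))\<^sup>2)"
proof (rule set_integrable_bound[OF i])
  have "(\<lambda>z. (norm (h z))\<^sup>2) \<in> borel_measurable (lebesgue_on S)" using h by measurable
  then show "set_borel_measurable lebesgue S (\<lambda>z. (norm (h z))\<^sup>2)"
    unfolding set_borel_measurable_def using S by (simp only: lebesgue_on_iff)
  show "AE z in lebesgue. z \<in> S \<longrightarrow> norm ((norm (h z))\<^sup>2) \<le> norm ((norm (f z))\<^sup>2)"
    using le by (auto intro!: AE_I2 power_mono)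
qed

lemma vec_representative:
  fixes f :: "'a::euclidean_space \<Rightarrow> real ^ 'm::finite"
  assumes S: "S \<in> sets borel" and f: "f \<in> borel_measurable (lebesgue_on S)"
    and i: "set_integrable lebesgue S (\<lambda>z. (norm (f z))\<^sup>2)"
  shows "\<exists>f'. (\<forall>i. L2 (\<lambda>z. f' z $ i)) \<and> (\<forall>z. z \<notin> S \<longrightarrow> f' z = 0) \<and> (AE z in lborel. z \<in> S \<longrightarrow> f' z = f z)"
proof -
  have SL: "S \<in> sets lebesgue" using S by simp
  have "\<exists>f'. L2 f' \<and> (\<forall>z. z \<notin> S \<longrightarrow> f' z = 0) \<and> (AE z in lborel. z \<in> S \<longrightarrow> f' z = f z $ i)" for i
  proof (rule real_representative[OF S])
    show m: "(\<lambda>z. f z $ i) \<in> borel_measurable (lebesgue_on S)" by (rule lebesgue_on_component[OF SL f])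
    show "set_integrable lebesgue S (\<lambda>z. (f z $ i)\<^sup>2)"
      using set_integrable_component_sq[OF SL m i] component_le_norm_cart[of "f _" i] by simp
  qed
  then have "\<exists>h. \<forall>i. L2 (h i) \<and> (\<forall>z. z \<notin> S \<longrightarrow> h i z = 0) \<and> (AE z in lborel. z \<in> S \<longrightarrow> h i z = f z $ i)"
    by (intro choice allI)
  then obtain h where hh: "\<forall>i. L2 (h i) \<and> (\<forall>z. z \<notin> S \<longrightarrow> h i z = 0) \<and> (AE z in lborel. z \<in> S \<longrightarrow> h i z = f z $ i)"
    by (rule exE)
  have h: "L2 (h i)" "z \<notin> S \<Longrightarrow> h i z = 0" "AE z in lborel. z \<in> S \<longrightarrow> h i z = f z $ i" for i z
    using spec[OF hh, of i] by blast+
  have "AE z in lborel. \<forall>i. z \<in> S \<longrightarrow> h i z = f z $ i"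
    by (subst AE_all_countable) (rule allI, rule h(3))
  then have "AE z in lborel. z \<in> S \<longrightarrow> (\<chi> i. h i z) = f z"
    by eventually_elim (simp add: vec_eq_iff)
  then show ?thesis
    using h(1,2) by (intro exI[of _ "\<lambda>z. \<chi> i. h i z"]) (simp add: vec_eq_iff)
qed

lemma matrix_representative:
  fixes f :: "'a::euclidean_space \<Rightarrow> real ^ 'n::finite ^ 'm::finite"
  assumes S: "S \<in> sets borel" and f: "f \<in> borel_measurable (lebesgue_on S)"
    and i: "set_integrable lebesgue S (\<lambda>z. (norm (f z))\<^sup>2)"
  shows "\<exists>f'. (\<forall>i j. L2 (\<lambda>z. f' z $ i $ j)) \<and> (\<forall>z. z \<notin> S \<longrightarrow> f' z = 0) \<and> (AE z in lborel. z \<in> S \<longrightarrow> f' z = f z)"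
proof -
  have SL: "S \<in> sets lebesgue" using S by simp
  have "\<exists>f'. (\<forall>j. L2 (\<lambda>z. f' z $ j)) \<and> (\<forall>z. z \<notin> S \<longrightarrow> f' z = 0) \<and> (AE z in lborel. z \<in> S \<longrightarrow> f' z = f z $ i)" for i
  proof (rule vec_representative[OF S])
    show m: "(\<lambda>z. f z $ i) \<in> borel_measurable (lebesgue_on S)" by (rule lebesgue_on_component[OF SL f])
    show "set_integrable lebesgue S (\<lambda>z. (norm (f z $ i))\<^sup>2)"
      by (rule set_integrable_component_sq[OF SL m i Finite_Cartesian_Product.norm_nth_le])
  qed
  then have "\<exists>h. \<forall>i. (\<forall>j. L2 (\<lambda>z. h i z $ j)) \<and> (\<forall>z. z \<notin> S \<longrightarrow> h i z = 0) \<and> (AE z in lborel. z \<in> S \<longrightarrow> h i z = f z $ i)"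
    by (intro choice allI)
  then obtain h where hh: "\<forall>i. (\<forall>j. L2 (\<lambda>z. h i z $ j)) \<and> (\<forall>z. z \<notin> S \<longrightarrow> h i z = 0) \<and> (AE z in lborel. z \<in> S \<longrightarrow> h i z = f z $ i)"
    by (rule exE)
  have h: "L2 (\<lambda>z. h i z $ j)" "z \<notin> S \<Longrightarrow> h i z = 0" "AE z in lborel. z \<in> S \<longrightarrow> h i z = f z $ i" for i j z
    using spec[OF hh, of i] by blast+
  have "AE z in lborel. \<forall>i. z \<in> S \<longrightarrow> h i z = f z $ i"
    by (subst AE_all_countable) (rule allI, rule h(3))
  then have "AE z in lborel. z \<in> S \<longrightarrow> (\<chi> i. h i z) = f z"
    by eventually_elim (simp add: vec_eq_iff)
  then show ?thesis
    using h(1,2) by (intro exI[of _ "\<lambda>z. \<chi> i. h i z"]) (simp add: vec_eq_iff)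
qed

lemma AE_lebesgue_on_iff:
  "S \<in> sets lebesgue \<Longrightarrow> (AE z in lebesgue_on S. P z) \<longleftrightarrow> (AE z in lborel. z \<in> S \<longrightarrow> P z)"
  by (subst AE_restrict_space_iff) (simp_all add: AE_completion_iff)

section \<open>Composition with Caratheodory functions\<close>

text \<open>
  For a simple function \<open>f\<close> the composition is measurable piece by piece, and continuity in the second
  variable carries this over to pointwise limits. Redefining \<open>\<A>\<close> as zero on the exceptional set makes the
  continuity hold everywhere.
\<close>

lemma caratheodory_measurable:
  fixes \<A> :: "'z::euclidean_space \<Rightarrow> 'a::euclidean_space \<Rightarrow> 'a"
  assumes c: "caratheodory D \<A>" and D: "D \<in> sets lebesgue" and f: "f \<in> borel_measurable (lebesgue_on D)"
  shows "\<exists>g. g \<in> borel_measurable (lebesgue_on D) \<and> (AE z in lborel. z \<in> D \<longrightarrow> g z = \<A> z (f z))"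
proof -
  have Am: "(\<lambda>z. \<A> z \<xi>) \<in> borel_measurable (lebesgue_on D)" for \<xi>
    using c by (simp add: caratheodory_def)
  have "AE z in lebesgue_on D. continuous_on UNIV (\<A> z)"
    using c by (simp add: caratheodory_def)
  then obtain N where N: "{z \<in> space (lebesgue_on D). \<not> continuous_on UNIV (\<A> z)} \<subseteq> N" "N \<in> null_sets (lebesgue_on D)"
    unfolding eventually_ae_filter by auto
  define B where "B z \<xi> = (if z \<in> N then 0 else \<A> z \<xi>)" for z \<xi>
  have Bm: "(\<lambda>z. B z \<xi>) \<in> borel_measurable (lebesgue_on D)" for \<xi>
    unfolding B_def using N(2) Am by (intro measurable_If_set) auto
  have Bc: "continuous_on UNIV (B z)" if "z \<in> space (lebesgue_on D)" for z
    using N(1) that by (cases "z \<in> N") (auto simp: B_def[abs_def])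
  obtain s where s: "\<And>i. simple_function (lebesgue_on D) (s i)"
    and lim: "\<And>z. z \<in> space (lebesgue_on D) \<Longrightarrow> (\<lambda>i. s i z) \<longlonglongrightarrow> f z"
    using borel_measurable_implies_sequence_metric[OF f, of 0] by blast
  \<comment> \<open>A simple function takes finitely many values, so the composition is a finite case distinction.\<close>
  have Bs: "(\<lambda>z. B z (s i z)) \<in> borel_measurable (lebesgue_on D)" for i
  proof (rule measurable_compose_countable'[where f = "\<lambda>\<xi> z. B z \<xi>" and g = "s i" and I = "s i ` space (lebesgue_on D)"])
    show "countable (s i ` space (lebesgue_on D))"
      using simple_functionD(1)[OF s] by (rule countable_finite)
    show "s i \<in> measurable (lebesgue_on D) (count_space (s i ` space (lebesgue_on D)))"
      using simple_functionD[OF s[of i]] by (auto simp: measurable_count_space_eq2)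
  qed (rule Bm)
  have "(\<lambda>z. B z (f z)) \<in> borel_measurable (lebesgue_on D)"
  proof (rule borel_measurable_LIMSEQ_metric[OF Bs])
    fix z assume z: "z \<in> space (lebesgue_on D)"
    show "(\<lambda>i. B z (s i z)) \<longlonglongrightarrow> B z (f z)"
      by (rule continuous_on_tendsto_compose[OF Bc[OF z] lim[OF z]]) simp_all
  qed
  moreover have "AE z in lebesgue_on D. B z (f z) = \<A> z (f z)"
    using AE_not_in[OF N(2)] by eventually_elim (simp add: B_def)
  ultimately show ?thesis
    unfolding AE_lebesgue_on_iff[OF D] by (intro exI[of _ "\<lambda>z. B z (f z)"] conjI)
qed

section \<open>Time slices of test functions\<close>

lemma Ck_slice:
  fixes f :: "'a::euclidean_space \<times> real \<Rightarrow> real"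
  shows "Ck k f \<Longrightarrow> Ck k (\<lambda>x. f (x, t))"
proof (induction k arbitrary: f)
  case 0
  then show ?case
    by (auto intro!: continuous_on_compose2[of UNIV f UNIV] continuous_intros)
next
  case (Suc k)
  have d: "((\<lambda>x. f (x, t)) has_derivative (\<lambda>e. frechet_derivative f (at (x, t)) (e, 0))) (at x)" for x
    by (rule has_derivative_compose[where f = "\<lambda>x. (x, t)" and g = f, OF _ Ck_Suc_has_derivative[OF Suc(2)]])
      (auto intro!: derivative_eq_intros)
  show ?case
  proof (rule Ck_SucI[OF d])
    fix b :: 'a assume "b \<in> Basis"
    then have "(b, 0) \<in> (Basis :: ('a \<times> real) set)" by (simp add: Basis_prod_def)
    then have "Ck k (\<lambda>z. frechet_derivative f (at z) (b, 0))" using Suc(2) by simp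
    then show "Ck k (\<lambda>x. frechet_derivative f (at (x, t)) (b, 0))" by (rule Suc(1))
  qed
qed

text \<open>
  The support of a slice lies in the projection of a compact subset of \<open>A \<times> I\<close>, hence in a compact subset
  of \<open>A\<close>.
\<close>

lemma test_function_slice:
  fixes \<phi> :: "(real ^ 'n::finite) \<times> real \<Rightarrow> real"
  assumes t: "test_function (A \<times> I) \<phi>"
  shows "test_function A (\<lambda>x. \<phi> (x, t))"
    and "frechet_derivative (\<lambda>x. \<phi> (x, t)) (at x) e = frechet_derivative \<phi> (at (x, t)) (e, 0)"
proof -
  have sm: "Ck k \<phi>" for k using t by (simp add: test_function_def)
  let ?S = "closure {z. \<phi> z \<noteq> 0}"
  have S: "compact ?S" "?S \<subseteq> A \<times> I" using t by (auto simp: test_function_def compactly_contained_def)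
  have "{x. \<phi> (x, t) \<noteq> 0} \<subseteq> fst ` ?S"
    using closure_subset[of "{z. \<phi> z \<noteq> 0}"] by (force simp: image_iff)
  moreover have cpt: "compact (fst ` ?S)"
    by (rule compact_continuous_image[OF continuous_on_fst[OF continuous_on_id] S(1)])
  ultimately have sub: "closure {x. \<phi> (x, t) \<noteq> 0} \<subseteq> fst ` ?S"
    by (intro closure_minimal compact_imp_closed)
  have "fst ` ?S \<subseteq> A" using S(2) by (auto simp: mem_Times_iff subset_iff)
  with sub have "closure {x. \<phi> (x, t) \<noteq> 0} \<subseteq> A" by blast
  moreover have "compact (closure {x. \<phi> (x, t) \<noteq> 0})"
    using bounded_subset[OF compact_imp_bounded[OF cpt] sub] by (simp only: compact_eq_bounded_closed closed_closure simp_thms)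
  ultimately show "test_function A (\<lambda>x. \<phi> (x, t))"
    using Ck_slice[OF sm] by (simp only: test_function_def compactly_contained_def) blast
  have "((\<lambda>x. \<phi> (x, t)) has_derivative (\<lambda>e. frechet_derivative \<phi> (at (x, t)) (e, 0))) (at x)"
    by (rule has_derivative_compose[where f = "\<lambda>x. (x, t)" and g = \<phi>, OF _ smooth_has_derivative])
      (use sm in \<open>auto intro!: derivative_eq_intros simp: smooth_def\<close>)
  from frechet_derivative_at[OF this] show "frechet_derivative (\<lambda>x. \<phi> (x, t)) (at x) e = frechet_derivative \<phi> (at (x, t)) (e, 0)"
    by (rule fun_cong[symmetric])
qed

section \<open>From weak solutions to parabolic systems\<close>

lemma test_function_bm:
  assumes t: "test_function C \<phi>" and e: "e \<in> Basis"
  shows "bm \<phi>" "bm (\<lambda>z. frechet_derivative \<phi> (at z) e)"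
proof -
  let ?K = "closure {z. \<phi> z \<noteq> 0}"
  have K: "compact ?K" using t by (simp add: test_function_def compactly_contained_def)
  have sm: "Ck k \<phi>" for k using t by (simp add: test_function_def)
  have c1: "continuous_on UNIV \<phi>" using sm[of 0] by simp
  have c2: "continuous_on UNIV (\<lambda>z. frechet_derivative \<phi> (at z) e)" using sm[of 1] e by simp
  have t': "test_function ?K \<phi>" using sm K by (simp add: test_function_def compactly_contained_def)
  have gen: "bm f" if f: "continuous_on UNIV f" and z: "\<And>z. z \<notin> ?K \<Longrightarrow> f z = 0" for f :: "'a \<Rightarrow> real"
  proof -
    have "bounded (f ` ?K)"
      by (rule compact_imp_bounded[OF compact_continuous_image[OF continuous_on_subset[OF f] K]]) simp
    then obtain M where M: "\<forall>y\<in>f ` ?K. norm y \<le> M" unfolding bounded_iff by blast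
    show ?thesis
    proof (rule bmI[OF borel_measurable_continuous_onI[OF f], of "\<bar>M\<bar>"])
      fix z show "\<bar>f z\<bar> \<le> \<bar>M\<bar>"
      proof (cases "z \<in> ?K")
        case True
        then have "norm (f z) \<le> M" using M by blast
        then show ?thesis by simp
      next
        case False
        then show ?thesis using z[of z] by simp
      qed
    qed
  qed
  show "bm \<phi>" by (rule gen[OF c1 test_function_outside(1)[OF t']])
  show "bm (\<lambda>z. frechet_derivative \<phi> (at z) e)" by (rule gen[OF c2 test_function_outside(2)[OF t']])
qed

lemma test_function_integral_derivative_0:
  fixes \<phi> :: "'a::euclidean_space \<Rightarrow> real"
  assumes t: "test_function C \<phi>" and e: "e \<in> Basis"
  shows "(\<integral>z. frechet_derivative \<phi> (at z) e \<partial>lborel) = 0"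
proof (rule integral_directional_derivative_0'[OF test_function_bm[OF t e], of "closure {z. \<phi> z \<noteq> 0}"])
  show "bounded (closure {z. \<phi> z \<noteq> 0})"
    using t by (auto simp: test_function_def compactly_contained_def intro: compact_imp_bounded)
  show "\<phi> z = 0" if "z \<notin> closure {z. \<phi> z \<noteq> 0}" for z
    using that closure_subset[of "{z. \<phi> z \<noteq> 0}"] by auto
  fix z
  have d: "(\<phi> has_derivative frechet_derivative \<phi> (at z)) (at z)" for z
    using t by (intro smooth_has_derivative) (simp add: test_function_def smooth_def)
  have "((\<lambda>s. \<phi> (z + s *\<^sub>R e)) has_derivative (\<lambda>s. frechet_derivative \<phi> (at (z + 0 *\<^sub>R e)) (s *\<^sub>R e))) (at 0)"
    by (rule has_derivative_compose[where f = "\<lambda>s. z + s *\<^sub>R e" and g = \<phi>, OF _ d]) (auto intro!: derivative_eq_intros)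
  then show "((\<lambda>s. \<phi> (z + s *\<^sub>R e)) has_real_derivative frechet_derivative \<phi> (at z) e) (at 0)"
    unfolding has_field_derivative_def
    by (simp add: linear_cmul[OF has_derivative_linear[OF d]] mult.commute[of _ "frechet_derivative \<phi> (at z) e"])
qed

text \<open>
  Constants solve both equations, because derivatives of test functions have integral zero. Subtracting
  the constant only on \<open>C\<close> keeps the function zero outside.
\<close>

lemma weak_pair_sub_const:
  fixes U :: "(real ^ 'n::finite) \<times> real \<Rightarrow> real"
  assumes w: "weak_pair C U G g" and C: "C \<in> sets borel"
  shows "weak_pair C (\<lambda>z. U z - c * indicator C z) G g"
proof -
  have b: "bounded C" using w by (simp add: weak_pair_def)
  have cL: "L2 (\<lambda>z. c * indicator C z :: real)"
  proof (rule L2_bounded_support[OF _ _ b, where M = "\<bar>c\<bar>"])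
    show "(\<lambda>z. c * indicator C z) \<in> borel_measurable borel"
      by (rule borel_measurable_times[OF borel_measurable_const borel_measurable_indicator[OF C]])
  qed (simp_all add: indicator_def)
  have L: "L2 (\<lambda>z. U z - c * indicator C z)" by (rule L2_diff[OF weak_pair_L2(1)[OF w] cL])
  have e: "(\<integral>z. (U z - c * indicator C z) * frechet_derivative \<phi> (at z) e \<partial>lborel) =
      (\<integral>z. U z * frechet_derivative \<phi> (at z) e \<partial>lborel)" if t: "test_function C \<phi>" and e: "e \<in> Basis"
    for \<phi> :: "(real ^ 'n) \<times> real \<Rightarrow> real" and e
  proof -
    obtain M where M: "(\<lambda>z. frechet_derivative \<phi> (at z) e) \<in> borel_measurable borel"
        "\<And>z. \<bar>frechet_derivative \<phi> (at z) e\<bar> \<le> M"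
      using test_function_bm(2)[OF t e] unfolding bm_def by blast
    have i1: "integrable lborel (\<lambda>z. U z * frechet_derivative \<phi> (at z) e)"
      by (rule integrable_mult_bounded[OF weak_pair_integrable(1)[OF w] M])
    have K: "bounded (closure {z. \<phi> z \<noteq> 0})"
      using t by (auto simp: test_function_def compactly_contained_def intro: compact_imp_bounded)
    have t': "test_function (closure {z. \<phi> z \<noteq> 0}) \<phi>"
      using t by (simp add: test_function_def compactly_contained_def)
    have i2: "integrable lborel (\<lambda>z. frechet_derivative \<phi> (at z) e)"
      by (rule bm_integrable[OF test_function_bm(2)[OF t e] K test_function_outside(2)[OF t']])
    have "(U z - c * indicator C z) * frechet_derivative \<phi> (at z) e =
        U z * frechet_derivative \<phi> (at z) e - c * frechet_derivative \<phi> (at z) e" for z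
      using test_function_outside(2)[OF t, of z e] by (cases "z \<in> C") (simp_all add: left_diff_distrib)
    then show ?thesis
      using i1 i2 test_function_integral_derivative_0[OF t e] by simp
  qed
  have B: "(axis j 1, 0) \<in> (Basis :: ((real ^ 'n) \<times> real) set)" "(0, 1) \<in> (Basis :: ((real ^ 'n) \<times> real) set)" for j
    by (auto simp: Basis_prod_def axis_in_Basis_iff)
  show ?thesis
    unfolding weak_pair_def
  proof (intro conjI allI impI L b)
    show "L2 (\<lambda>z. G z $ j)" "L2 (\<lambda>z. g z $ j)" for j using weak_pair_L2[OF w] by auto
    show "U z - c * indicator C z = 0" "G z = 0" "g z = 0" if "z \<notin> C" for z
      using weak_pair_zero[OF w that] that by auto
    fix \<phi> :: "(real ^ 'n) \<times> real \<Rightarrow> real" assume t: "test_function C \<phi>"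
    show "(\<integral>z. (U z - c * indicator C z) * frechet_derivative \<phi> (at z) (axis j 1, 0) \<partial>lborel) = - (\<integral>z. G z $ j * \<phi> z \<partial>lborel)" for j
      unfolding e[OF t B(1)] using w t unfolding weak_pair_def by blast
    show "(\<integral>z. (U z - c * indicator C z) * frechet_derivative \<phi> (at z) (0, 1) \<partial>lborel) =
      (\<Sum>j\<in>UNIV. \<integral>z. g z $ j * frechet_derivative \<phi> (at z) (axis j 1, 0) \<partial>lborel)"
      unfolding e[OF t B(2)] using w t unfolding weak_pair_def by blast
  qed
qed

lemma square_integrable_mult:
  fixes w :: "'a::euclidean_space \<Rightarrow> 'b::euclidean_space"
  assumes w: "square_integrable A w" and A: "A \<in> sets borel" "bounded A"
    and p: "p \<in> borel_measurable borel" "\<And>x. \<bar>p x\<bar> \<le> M"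
  shows "integrable lebesgue (\<lambda>x. indicator A x *\<^sub>R (p x *\<^sub>R w x))"
proof (rule Bochner_Integration.integrable_bound)
  have AL: "A \<in> sets lebesgue" using A by simp
  have "integrable lebesgue (indicator A :: 'a \<Rightarrow> real)"
    using emeasure_bounded_finite[OF A(2)] A by (intro integrable_real_indicator) auto
  moreover have "integrable lebesgue (\<lambda>x. indicator A x *\<^sub>R (norm (w x))\<^sup>2)"
    using w by (simp add: square_integrable_def set_integrable_def)
  ultimately show "integrable lebesgue (\<lambda>x. M * (indicator A x + indicator A x *\<^sub>R (norm (w x))\<^sup>2))"
    by simp
  have Aw: "(\<lambda>x. indicator A x *\<^sub>R w x) \<in> borel_measurable lebesgue"
    using w lebesgue_on_iff[OF AL, of w] by (simp add: square_integrable_def)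
  have pl: "p \<in> borel_measurable lebesgue" using p(1) by (auto intro: measurable_completion)
  have "(\<lambda>x. p x *\<^sub>R (indicator A x *\<^sub>R w x)) \<in> borel_measurable lebesgue"
    by (rule borel_measurable_scaleR[OF pl Aw])
  then show "(\<lambda>x. indicator A x *\<^sub>R (p x *\<^sub>R w x)) \<in> borel_measurable lebesgue"
    by (simp add: mult.commute)
  show "AE x in lebesgue. norm (indicator A x *\<^sub>R (p x *\<^sub>R w x)) \<le> norm (M * (indicator A x + indicator A x *\<^sub>R (norm (w x))\<^sup>2))"
  proof (rule AE_I2)
    fix x
    have M0: "0 \<le> M" using p(2)[of x] by linarith
    have "2 * norm (w x) \<le> 1 + (norm (w x))\<^sup>2" using sum_squares_bound[of 1 "norm (w x)"] by simp
    then have "norm (w x) \<le> 1 + (norm (w x))\<^sup>2" using norm_ge_zero[of "w x"] by linarith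
    then have "\<bar>p x\<bar> * norm (w x) \<le> M * (1 + (norm (w x))\<^sup>2)"
      using p(2)[of x] M0 by (intro mult_mono) simp_all
    then show "norm (indicator A x *\<^sub>R (p x *\<^sub>R w x)) \<le> norm (M * (indicator A x + indicator A x *\<^sub>R (norm (w x))\<^sup>2))"
      using M0 by (cases "x \<in> A") (simp_all add: abs_mult)
  qed
qed

lemma norm_column_le: "norm (column j M) \<le> norm (M :: real ^ 'n::finite ^ 'N::finite)"
proof (rule power2_le_imp_le)
  have "(norm (column j M))\<^sup>2 = (\<Sum>i\<in>UNIV. (M $ i $ j)\<^sup>2)"
    unfolding norm_vec_sq by (simp add: column_def)
  also have "\<dots> \<le> (\<Sum>i\<in>UNIV. \<Sum>j\<in>UNIV. (M $ i $ j)\<^sup>2)"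
    by (intro sum_mono member_le_sum) simp_all
  finally show "(norm (column j M))\<^sup>2 \<le> (norm M)\<^sup>2" unfolding norm_matrix_sq .
qed simp

lemma square_integrable_column:
  fixes G :: "'a::euclidean_space \<Rightarrow> real ^ 'n::finite ^ 'N::finite"
  assumes G: "square_integrable A G" and A: "A \<in> sets lebesgue"
  shows "square_integrable A (\<lambda>x. column j (G x))"
proof -
  have Gm: "G \<in> borel_measurable (lebesgue_on A)" using G by (simp add: square_integrable_def)
  have "continuous_on UNIV (column j :: real ^ 'n ^ 'N \<Rightarrow> real ^ 'N)"
    unfolding column_def[abs_def] by (intro continuous_intros)
  then have m: "(\<lambda>x. column j (G x)) \<in> borel_measurable (lebesgue_on A)"
    by (rule measurable_compose[OF Gm borel_measurable_continuous_onI])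
  moreover have "set_integrable lebesgue A (\<lambda>x. (norm (column j (G x)))\<^sup>2)"
    using G by (intro set_integrable_component_sq[OF A m _ norm_column_le]) (simp add: square_integrable_def)
  ultimately show ?thesis by (simp add: square_integrable_def)
qed

text \<open>
  The weak gradient is given slice by slice, for almost every time, and Fubini's theorem assembles the
  slices: the null set on which the representatives differ from \<open>u\<close> and \<open>G\<close> meets almost every slice in a
  null set.
\<close>

lemma space_time_weak_gradient:
  fixes u u' :: "(real ^ 'n::finite) \<times> real \<Rightarrow> real ^ 'N::finite" and G G' :: "(real ^ 'n) \<times> real \<Rightarrow> real ^ 'n ^ 'N"
  assumes u': "\<And>i. L2 (\<lambda>z. u' z $ i)" and G': "\<And>i j. L2 (\<lambda>z. G' z $ i $ j)"
    and zero: "\<And>z. z \<notin> A \<times> I \<Longrightarrow> u' z = 0" "\<And>z. z \<notin> A \<times> I \<Longrightarrow> G' z = 0"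
    and ae: "AE z in lborel. z \<in> A \<times> I \<longrightarrow> u' z = u z \<and> G' z = G z"
    and W: "AE t in lborel. t \<in> I \<longrightarrow> W12 A (\<lambda>x. u (x, t)) (\<lambda>x. G (x, t))"
    and A: "open A" "bounded A" "bounded I" and t: "test_function (A \<times> I) \<phi>"
  shows "(\<integral>z. u' z $ i * frechet_derivative \<phi> (at z) (axis j 1, 0) \<partial>lborel) = - (\<integral>z. G' z $ i $ j * \<phi> z \<partial>lborel)"
proof -
  let ?\<phi>' = "\<lambda>z. frechet_derivative \<phi> (at z) (axis j 1, 0)"
  have B: "(axis j 1, 0) \<in> (Basis :: ((real ^ 'n) \<times> real) set)"
    by (auto simp: Basis_prod_def axis_in_Basis_iff)
  obtain M where M: "\<phi> \<in> borel_measurable borel" "\<And>z. \<bar>\<phi> z\<bar> \<le> M"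
    using test_function_bm(1)[OF t B] unfolding bm_def by blast
  obtain M' where M': "?\<phi>' \<in> borel_measurable borel" "\<And>z. \<bar>?\<phi>' z\<bar> \<le> M'"
    using test_function_bm(2)[OF t B] unfolding bm_def by blast
  have bC: "bounded (A \<times> I)" using A by (intro bounded_Times)
  have i1: "integrable lborel (\<lambda>z. u' z $ i * ?\<phi>' z)"
    by (rule integrable_mult_bounded[OF L2_bounded_support_integrable[OF u' bC] M']) (simp add: zero)
  have i2: "integrable lborel (\<lambda>z. G' z $ i $ j * \<phi> z)"
    by (rule integrable_mult_bounded[OF L2_bounded_support_integrable[OF G' bC] M]) (simp add: zero)
  define h where "h z = u' z $ i * ?\<phi>' z + G' z $ i $ j * \<phi> z" for z
  have hi: "integrable lborel h" unfolding h_def[abs_def] using i1 i2 by simp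
  from ae have "AE z in lborel \<Otimes>\<^sub>M lborel. z \<in> A \<times> I \<longrightarrow> u' z = u z \<and> G' z = G z"
    unfolding lborel_prod .
  then obtain N where N: "{z \<in> space (lborel \<Otimes>\<^sub>M lborel). \<not> (z \<in> A \<times> I \<longrightarrow> u' z = u z \<and> G' z = G z)} \<subseteq> N"
      "N \<in> null_sets (lborel \<Otimes>\<^sub>M lborel)"
    unfolding eventually_ae_filter by auto
  have "AE x in lborel. AE t in lborel. (x, t) \<notin> N"
    by (rule lborel_pair.AE_pair[OF AE_not_in[OF N(2)]])
  then have slice: "AE t in lborel. AE x in lborel. (x, t) \<notin> N"
  proof (subst lborel_pair.AE_commute[symmetric])
    have "{x \<in> space (lborel \<Otimes>\<^sub>M lborel). (fst x, snd x) \<notin> N} = space (lborel \<Otimes>\<^sub>M lborel) - N" by auto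
    also have "\<dots> \<in> sets (lborel \<Otimes>\<^sub>M lborel)" using N(2) by (intro sets.compl_sets) auto
    finally show "{x \<in> space (lborel \<Otimes>\<^sub>M lborel). (fst x, snd x) \<notin> N} \<in> sets (lborel \<Otimes>\<^sub>M lborel)" .
  qed
  have inner: "AE t in lborel. (\<integral>x. h (x, t) \<partial>lborel) = 0"
    using slice W
  proof eventually_elim
    case (elim t)
    show ?case
    proof (cases "t \<in> I")
      case False
      then have "h (x, t) = 0" for x using zero[of "(x, t)"] by (simp add: h_def)
      then show ?thesis by simp
    next
      case True
      then have W': "W12 A (\<lambda>x. u (x, t)) (\<lambda>x. G (x, t))" using elim by blast
      have aex: "AE x in lborel. x \<in> A \<longrightarrow> u' (x, t) = u (x, t) \<and> G' (x, t) = G (x, t)"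
        using elim(1)
      proof eventually_elim
        case (elim x)
        then show ?case using N(1) True by (auto simp: space_pair_measure)
      qed
      have AB: "A \<in> sets borel" using A(1) by simp
      have AL: "A \<in> sets lebesgue" using AB by simp
      have pm: "(\<lambda>x. p (x, t)) \<in> borel_measurable borel" if "p \<in> borel_measurable borel" for p :: "(real ^ 'n) \<times> real \<Rightarrow> real"
        by (rule measurable_compose[OF _ that]) (auto intro!: borel_measurable_continuous_onI continuous_intros)
      note sl = test_function_slice[OF t]
      have eq: "(LINT x:A|lebesgue. ?\<phi>' (x, t) *\<^sub>R u (x, t)) = - (LINT x:A|lebesgue. \<phi> (x, t) *\<^sub>R column j (G (x, t)))"
        using W' sl(1)[of t] unfolding W12_def sl(2)[of t, symmetric] by blast
      have s1: "square_integrable A (\<lambda>x. u (x, t))" and s2: "square_integrable A (\<lambda>x. G (x, t))"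
        using W' by (simp_all add: W12_def)
      have I1: "integrable lebesgue (\<lambda>x. indicator A x *\<^sub>R (?\<phi>' (x, t) *\<^sub>R u (x, t)))"
        by (rule square_integrable_mult[OF s1 AB A(2) pm[OF M'(1)] M'(2)])
      have I2: "integrable lebesgue (\<lambda>x. indicator A x *\<^sub>R (\<phi> (x, t) *\<^sub>R column j (G (x, t))))"
        by (rule square_integrable_mult[OF square_integrable_column[OF s2 AL] AB A(2) pm[OF M(1)] M(2)])
      have m1: "(\<lambda>x. u' (x, t) $ i * ?\<phi>' (x, t)) \<in> borel_measurable borel"
        by (rule pm) (intro borel_measurable_times L2_measurable[OF u'] M'(1))
      have m2: "(\<lambda>x. G' (x, t) $ i $ j * \<phi> (x, t)) \<in> borel_measurable borel"
        by (rule pm) (intro borel_measurable_times L2_measurable[OF G'] M(1))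
      have ae1: "AE x in lborel. (indicator A x *\<^sub>R (?\<phi>' (x, t) *\<^sub>R u (x, t))) $ i = u' (x, t) $ i * ?\<phi>' (x, t)"
        using aex
      proof eventually_elim
        case (elim x)
        then show ?case using zero(1)[of "(x, t)"] by (cases "x \<in> A") (simp_all add: mult.commute)
      qed
      have ae2: "AE x in lborel. (indicator A x *\<^sub>R (\<phi> (x, t) *\<^sub>R column j (G (x, t)))) $ i = G' (x, t) $ i $ j * \<phi> (x, t)"
        using aex
      proof eventually_elim
        case (elim x)
        then show ?case using zero(2)[of "(x, t)"] by (cases "x \<in> A") (simp_all add: mult.commute column_def)
      qed
      have "(LINT x:A|lebesgue. ?\<phi>' (x, t) *\<^sub>R u (x, t)) $ i = (\<integral>x. u' (x, t) $ i * ?\<phi>' (x, t) \<partial>lborel)"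
        unfolding set_lebesgue_integral_def
        by (subst integral_bounded_linear[OF bounded_linear_vec_nth I1, symmetric]) (rule integral_lebesgue_eq(3)[OF m1 ae1])
      moreover have "(LINT x:A|lebesgue. \<phi> (x, t) *\<^sub>R column j (G (x, t))) $ i = (\<integral>x. G' (x, t) $ i $ j * \<phi> (x, t) \<partial>lborel)"
        unfolding set_lebesgue_integral_def
        by (subst integral_bounded_linear[OF bounded_linear_vec_nth I2, symmetric]) (rule integral_lebesgue_eq(3)[OF m2 ae2])
      ultimately have sum0: "(\<integral>x. u' (x, t) $ i * ?\<phi>' (x, t) \<partial>lborel) + (\<integral>x. G' (x, t) $ i $ j * \<phi> (x, t) \<partial>lborel) = 0"
        using arg_cong[OF eq, of "\<lambda>v. v $ i"] by simp
      have J1: "integrable lborel (\<lambda>x. u' (x, t) $ i * ?\<phi>' (x, t))"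
        using integral_lebesgue_eq(2)[OF m1 ae1] integrable_bounded_linear[OF bounded_linear_vec_nth I1] by blast
      have J2: "integrable lborel (\<lambda>x. G' (x, t) $ i $ j * \<phi> (x, t))"
        using integral_lebesgue_eq(2)[OF m2 ae2] integrable_bounded_linear[OF bounded_linear_vec_nth I2] by blast
      show ?thesis unfolding h_def using J1 J2 sum0 by simp
    qed
  qed
  have "integrable (lborel \<Otimes>\<^sub>M lborel) (case_prod (\<lambda>x t. h (x, t)))"
    using hi by (simp add: lborel_prod)
  from lborel_pair.integral_snd[OF this]
  have "(\<integral>z. h z \<partial>lborel) = (\<integral>t. (\<integral>x. h (x, t) \<partial>lborel) \<partial>lborel)"
    by (simp add: lborel_prod)
  also have "\<dots> = 0" by (rule integral_eq_zero_AE[OF inner])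
  finally have "(\<integral>z. h z \<partial>lborel) = 0" .
  then show ?thesis unfolding h_def[abs_def] using i1 i2 by simp
qed

text \<open>
  Testing the system with \<open>\<psi>\<close> times the \<open>i\<close>-th unit vector extracts its \<open>i\<close>-th row. Since the test function
  vanishes off \<open>C\<close>, the integrals over \<open>D\<close> only see the representatives.
\<close>

lemma space_time_weak_equation:
  fixes u u' :: "(real ^ 'n::finite) \<times> real \<Rightarrow> real ^ 'N::finite"
    and P P' F F' :: "(real ^ 'n) \<times> real \<Rightarrow> real ^ 'n ^ 'N"
  assumes u': "\<And>i. L2 (\<lambda>z. u' z $ i)" and P': "\<And>i j. L2 (\<lambda>z. P' z $ i $ j)" and F': "\<And>i j. L2 (\<lambda>z. F' z $ i $ j)"
    and zero: "\<And>z. z \<notin> C \<Longrightarrow> u' z = 0" "\<And>z. z \<notin> C \<Longrightarrow> P' z = 0" "\<And>z. z \<notin> C \<Longrightarrow> F' z = 0"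
    and ae: "AE z in lborel. z \<in> C \<longrightarrow> u' z = u z \<and> P' z = P z \<and> F' z = F z"
    and C: "C \<subseteq> D" "bounded C"
    and eq: "\<And>\<phi>. test_function D \<phi> \<Longrightarrow>
      (LINT z:D|lebesgue. - (u z \<bullet> time_derivative \<phi> z) + P z \<bullet> spatial_gradient \<phi> z) =
      (LINT z:D|lebesgue. F z \<bullet> spatial_gradient \<phi> z)"
    and t: "test_function C \<psi>"
  shows "(\<integral>z. u' z $ i * frechet_derivative \<psi> (at z) (0, 1) \<partial>lborel) =
    (\<Sum>j\<in>UNIV. \<integral>z. (P' z - F' z) $ i $ j * frechet_derivative \<psi> (at z) (axis j 1, 0) \<partial>lborel)"
proof -
  let ?t = "\<lambda>z. frechet_derivative \<psi> (at z) (0, 1)" and ?x = "\<lambda>j z. frechet_derivative \<psi> (at z) (axis j 1, 0)"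
  define \<phi> where "\<phi> z = \<psi> z *\<^sub>R (axis i 1 :: real ^ 'N)" for z
  have B: "(axis j 1, 0) \<in> (Basis :: ((real ^ 'n) \<times> real) set)" "(0, 1) \<in> (Basis :: ((real ^ 'n) \<times> real) set)" for j
    by (auto simp: Basis_prod_def axis_in_Basis_iff)
  have sm: "smooth \<psi>" using t by (simp add: test_function_def smooth_def)
  have d: "frechet_derivative \<phi> (at z) e = frechet_derivative \<psi> (at z) e *\<^sub>R axis i 1" for z e
  proof -
    have "(\<phi> has_derivative (\<lambda>e. frechet_derivative \<psi> (at z) e *\<^sub>R axis i 1)) (at z)"
      unfolding \<phi>_def[abs_def]
      by (rule bounded_linear.has_derivative[OF bounded_linear_scaleR_left smooth_has_derivative[OF sm]])
    from frechet_derivative_at[OF this] show ?thesis by (rule fun_cong[symmetric])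
  qed
  have "smooth \<phi>" unfolding \<phi>_def[abs_def] by (intro smooth_scaleR sm smooth_const)
  moreover have "{z. \<phi> z \<noteq> 0} = {z. \<psi> z \<noteq> 0}" by (auto simp: \<phi>_def axis_eq_0_iff)
  ultimately have tC: "test_function C \<phi>" using t by (simp add: test_function_def smooth_def)
  have td: "test_function D \<phi>" by (rule test_function_mono[OF tC C(1)])
  have ip: "v \<bullet> time_derivative \<phi> z = v $ i * ?t z" for v z
    by (simp add: time_derivative_def d inner_axis mult.commute)
  have ig: "M \<bullet> spatial_gradient \<phi> z = (\<Sum>j\<in>UNIV. M $ i $ j * ?x j z)" for M z
  proof -
    have "M \<bullet> spatial_gradient \<phi> z = (\<Sum>k\<in>UNIV. \<Sum>j\<in>UNIV. M $ k $ j * (?x j z * (axis i 1 :: real ^ 'N) $ k))"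
      by (simp add: spatial_gradient_def d inner_vec_def)
    also have "\<dots> = (\<Sum>k\<in>UNIV. if k = i then (\<Sum>j\<in>UNIV. M $ k $ j * ?x j z) else 0)"
      by (intro sum.cong refl) (simp add: axis_def)
    finally show ?thesis by simp
  qed
  have int: "integrable lborel (\<lambda>z. f z * frechet_derivative \<psi> (at z) e)"
    if "L2 f" "\<And>z. z \<notin> C \<Longrightarrow> f z = 0" "e \<in> Basis" for f e
  proof -
    obtain M where M: "(\<lambda>z. frechet_derivative \<psi> (at z) e) \<in> borel_measurable borel" "\<And>z. \<bar>frechet_derivative \<psi> (at z) e\<bar> \<le> M"
      using test_function_bm(2)[OF t \<open>e \<in> Basis\<close>] unfolding bm_def by blast
    show ?thesis by (rule integrable_mult_bounded[OF L2_bounded_support_integrable[OF that(1) C(2) that(2)] M])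
  qed
  have iu: "integrable lborel (\<lambda>z. u' z $ i * ?t z)" by (rule int[OF u' _ B(2)]) (simp add: zero)
  have iP: "integrable lborel (\<lambda>z. P' z $ i $ j * ?x j z)" for j by (rule int[OF P' _ B(1)]) (simp add: zero)
  have iF: "integrable lborel (\<lambda>z. F' z $ i $ j * ?x j z)" for j by (rule int[OF F' _ B(1)]) (simp add: zero)
  have L: "(LINT z:D|lebesgue. - (u z \<bullet> time_derivative \<phi> z) + P z \<bullet> spatial_gradient \<phi> z) =
      (\<integral>z. - (u' z $ i * ?t z) + (\<Sum>j\<in>UNIV. P' z $ i $ j * ?x j z) \<partial>lborel)"
    unfolding set_lebesgue_integral_def ip ig
  proof (rule integral_lebesgue_eq(3))
    show "(\<lambda>z. - (u' z $ i * ?t z) + (\<Sum>j\<in>UNIV. P' z $ i $ j * ?x j z)) \<in> borel_measurable borel"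
      using iu iP by (intro borel_measurable_add borel_measurable_uminus borel_measurable_sum) auto
    show "AE z in lborel. indicat_real D z *\<^sub>R (- (u z $ i * ?t z) + (\<Sum>j\<in>UNIV. P z $ i $ j * ?x j z)) =
        - (u' z $ i * ?t z) + (\<Sum>j\<in>UNIV. P' z $ i $ j * ?x j z)"
      using ae
    proof eventually_elim
      case (elim z)
      show ?case
      proof (cases "z \<in> C")
        case True
        then show ?thesis using elim subsetD[OF C(1) True] by simp
      next
        case False
        then show ?thesis using test_function_outside(2)[OF t False] by simp
      qed
    qed
  qed
  have R: "(LINT z:D|lebesgue. F z \<bullet> spatial_gradient \<phi> z) = (\<integral>z. (\<Sum>j\<in>UNIV. F' z $ i $ j * ?x j z) \<partial>lborel)"
    unfolding set_lebesgue_integral_def ig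
  proof (rule integral_lebesgue_eq(3))
    show "(\<lambda>z. (\<Sum>j\<in>UNIV. F' z $ i $ j * ?x j z)) \<in> borel_measurable borel"
      using iF by (intro borel_measurable_sum) auto
    show "AE z in lborel. indicat_real D z *\<^sub>R (\<Sum>j\<in>UNIV. F z $ i $ j * ?x j z) = (\<Sum>j\<in>UNIV. F' z $ i $ j * ?x j z)"
      using ae
    proof eventually_elim
      case (elim z)
      show ?case
      proof (cases "z \<in> C")
        case True
        then show ?thesis using elim subsetD[OF C(1) True] by simp
      next
        case False
        then show ?thesis using test_function_outside(2)[OF t False] by simp
      qed
    qed
  qed
  have "- (\<integral>z. u' z $ i * ?t z \<partial>lborel) + (\<Sum>j\<in>UNIV. \<integral>z. P' z $ i $ j * ?x j z \<partial>lborel) =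
      (\<Sum>j\<in>UNIV. \<integral>z. F' z $ i $ j * ?x j z \<partial>lborel)"
    using eq[OF td] iu iP iF unfolding L R by simp
  moreover have "(\<integral>z. (P' z - F' z) $ i $ j * ?x j z \<partial>lborel) =
      (\<integral>z. P' z $ i $ j * ?x j z \<partial>lborel) - (\<integral>z. F' z $ i $ j * ?x j z \<partial>lborel)" for j
    using iP[of j] iF[of j] by (simp add: left_diff_distrib)
  ultimately show ?thesis by (simp add: sum_subtractf)
qed

text \<open>
  The constant \<open>a\<close> is subtracted here, as later the mean value of \<open>u\<close> will be. Compact containment
  provides the square integrability up to the boundary of the cylinder and keeps its time
  interval strictly inside \<open>(0, T)\<close>.
\<close>

lemma weak_solution_imp_parabolic_system:
  fixes u :: "(real ^ 'n::finite) \<times> real \<Rightarrow> real ^ 'N::finite" and a :: "real ^ 'N"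
  assumes \<Omega>: "open \<Omega>" and c: "caratheodory (\<Omega> \<times> {0<..<T}) \<A>"
    and gr: "growth_conditions (\<Omega> \<times> {0<..<T}) \<nu> L \<A>" and \<nu>L: "0 < \<nu>" "\<nu> < L"
    and F: "locally_square_integrable (\<Omega> \<times> {0<..<T}) F" and sol: "weak_solution \<Omega> T \<A> F u Du"
    and r: "0 < r" and cc: "compactly_contained (cylinder x0 t0 r) (\<Omega> \<times> {0<..<T})"
  shows "\<exists>v G g F'. parabolic_system \<nu> L (cylinder x0 t0 r) v G g F' \<and>
    (AE z in lborel. z \<in> cylinder x0 t0 r \<longrightarrow> v z = u z - a \<and> F' z = F z)"
proof -
  let ?D = "\<Omega> \<times> {0<..<T}" and ?C = "cylinder x0 t0 r"
  let ?t1 = "t0 - r\<^sup>2" and ?t2 = "t0 + r\<^sup>2"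
  have C: "?C = ball x0 r \<times> {?t1<..<?t2}" by (simp add: cylinder_def)
  have r2: "0 < r\<^sup>2" using r by simp
  have D: "open ?D" using \<Omega> by (intro open_Times) auto
  have DL: "?D \<in> sets lebesgue" using D by simp
  have clC: "closure ?C = cball x0 r \<times> {?t1..?t2}"
    unfolding C closure_Times using r r2 by simp
  have sub: "closure ?C \<subseteq> ?D" and cpt: "compact (closure ?C)"
    using cc by (simp_all add: compactly_contained_def)
  have CD: "?C \<subseteq> ?D" using sub closure_subset by blast
  have CB: "?C \<in> sets borel" by (rule cylinder_sets)
  have CL: "?C \<in> sets lebesgue" using CB by simp
  have "(x0, ?t1) \<in> closure ?C" "(x0, ?t2) \<in> closure ?C" using r r2 by (auto simp: clC)
  then have ts: "0 < ?t1" "?t2 < T" using sub by auto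
  have "cball x0 r \<subseteq> \<Omega>"
  proof
    fix x assume "x \<in> cball x0 r"
    then have "(x, t0) \<in> closure ?C" using r2 by (simp add: clC)
    then show "x \<in> \<Omega>" using sub by auto
  qed
  then have ballc: "compactly_contained (ball x0 r) \<Omega>" using r by (simp add: compactly_contained_def)
  have LW: "L2loc_W12loc \<Omega> T u Du" using sol by (simp add: weak_solution_def)
  have um: "u \<in> borel_measurable (lebesgue_on ?D)" and Dum: "Du \<in> borel_measurable (lebesgue_on ?D)"
    using LW by (simp_all add: L2loc_W12loc_def)
  have "?t1 < ?t2" using r2 by simp
  have both: "(AE t in lebesgue. t \<in> {?t1<..<?t2} \<longrightarrow> W12 (ball x0 r) (\<lambda>x. u (x, t)) (\<lambda>x. Du (x, t))) \<and>
      set_integrable lebesgue (ball x0 r \<times> {?t1<..<?t2}) (\<lambda>z. (norm (u z))\<^sup>2 + (norm (Du z))\<^sup>2)"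
    using LW ballc ts \<open>?t1 < ?t2\<close> open_ball[of x0 r] unfolding L2loc_W12loc_def by blast
  have W: "AE t in lborel. t \<in> {?t1<..<?t2} \<longrightarrow> W12 (ball x0 r) (\<lambda>x. u (x, t)) (\<lambda>x. Du (x, t))"
    using both by (simp only: AE_completion_iff)
  have sq: "set_integrable lebesgue ?C (\<lambda>z. (norm (u z))\<^sup>2 + (norm (Du z))\<^sup>2)"
    using both by (simp only: C)
  have restr: "f \<in> borel_measurable (lebesgue_on ?C)" if "f \<in> borel_measurable (lebesgue_on ?D)"
    for f :: "(real ^ 'n) \<times> real \<Rightarrow> 'b::real_normed_vector"
    using that CD by (rule measurable_restrict_mono)
  have dom: "set_integrable lebesgue ?C (\<lambda>z. (norm (f z))\<^sup>2)"
    if f: "f \<in> borel_measurable (lebesgue_on ?C)" and h: "set_integrable lebesgue ?C h"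
      and le: "AE z in lborel. z \<in> ?C \<longrightarrow> (norm (f z))\<^sup>2 \<le> h z"
    for f :: "(real ^ 'n) \<times> real \<Rightarrow> 'b::euclidean_space" and h
  proof (rule set_integrable_bound[OF h])
    have "(\<lambda>z. (norm (f z))\<^sup>2) \<in> borel_measurable (lebesgue_on ?C)" using f by measurable
    then show "set_borel_measurable lebesgue ?C (\<lambda>z. (norm (f z))\<^sup>2)"
      unfolding set_borel_measurable_def using CL by (simp only: lebesgue_on_iff)
    from AE_completion[OF le] show "AE z in lebesgue. z \<in> ?C \<longrightarrow> norm ((norm (f z))\<^sup>2) \<le> norm (h z)"
      by eventually_elim auto
  qed
  have su: "set_integrable lebesgue ?C (\<lambda>z. (norm (u z))\<^sup>2)"
    by (rule dom[OF restr[OF um] sq]) simp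
  have sDu: "set_integrable lebesgue ?C (\<lambda>z. (norm (Du z))\<^sup>2)"
    by (rule dom[OF restr[OF Dum] sq]) simp
  have Fm: "F \<in> borel_measurable (lebesgue_on ?D)" and Fc: "set_integrable lebesgue (closure ?C) (\<lambda>z. (norm (F z))\<^sup>2)"
    using F cpt sub by (simp_all add: locally_square_integrable_def)
  have sF: "set_integrable lebesgue ?C (\<lambda>z. (norm (F z))\<^sup>2)"
    by (rule set_integrable_subset[OF Fc CL closure_subset])
  obtain P where Pm: "P \<in> borel_measurable (lebesgue_on ?D)" and PA: "AE z in lborel. z \<in> ?D \<longrightarrow> P z = \<A> z (Du z)"
    using caratheodory_measurable[OF c DL Dum] by blast
  have G: "AE z in lborel. z \<in> ?D \<longrightarrow> (\<forall>\<xi>. \<nu> * (norm \<xi>)\<^sup>2 \<le> \<A> z \<xi> \<bullet> \<xi> \<and> norm (\<A> z \<xi>) \<le> L * norm \<xi>)"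
    using gr unfolding growth_conditions_def AE_lebesgue_on_iff[OF DL] .
  have PG: "AE z in lborel. z \<in> ?C \<longrightarrow> \<nu> * (norm (Du z))\<^sup>2 \<le> P z \<bullet> Du z \<and> norm (P z) \<le> L * norm (Du z)"
    using G PA
  proof eventually_elim
    case (elim z)
    show ?case
    proof
      assume "z \<in> ?C"
      then have "z \<in> ?D" using CD by blast
      then show "\<nu> * (norm (Du z))\<^sup>2 \<le> P z \<bullet> Du z \<and> norm (P z) \<le> L * norm (Du z)"
        using elim by simp
    qed
  qed
  have sP: "set_integrable lebesgue ?C (\<lambda>z. (norm (P z))\<^sup>2)"
  proof (rule dom[OF restr[OF Pm]])
    show "set_integrable lebesgue ?C (\<lambda>z. L\<^sup>2 * (norm (Du z))\<^sup>2)"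
      using sDu by simp
    show "AE z in lborel. z \<in> ?C \<longrightarrow> (norm (P z))\<^sup>2 \<le> L\<^sup>2 * (norm (Du z))\<^sup>2"
      using PG
    proof eventually_elim
      case (elim z)
      show ?case
      proof
        assume "z \<in> ?C"
        then have "norm (P z) \<le> L * norm (Du z)" using elim by blast
        then have "(norm (P z))\<^sup>2 \<le> (L * norm (Du z))\<^sup>2" by (rule power_mono) simp
        then show "(norm (P z))\<^sup>2 \<le> L\<^sup>2 * (norm (Du z))\<^sup>2" by (simp add: power_mult_distrib)
      qed
    qed
  qed
  obtain u' where u': "\<forall>i. L2 (\<lambda>z. u' z $ i)" "\<forall>z. z \<notin> ?C \<longrightarrow> u' z = 0" "AE z in lborel. z \<in> ?C \<longrightarrow> u' z = u z"
    using vec_representative[OF CB restr[OF um] su] by blast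
  obtain G' where G': "\<forall>i j. L2 (\<lambda>z. G' z $ i $ j)" "\<forall>z. z \<notin> ?C \<longrightarrow> G' z = 0" "AE z in lborel. z \<in> ?C \<longrightarrow> G' z = Du z"
    using matrix_representative[OF CB restr[OF Dum] sDu] by blast
  obtain P' where P': "\<forall>i j. L2 (\<lambda>z. P' z $ i $ j)" "\<forall>z. z \<notin> ?C \<longrightarrow> P' z = 0" "AE z in lborel. z \<in> ?C \<longrightarrow> P' z = P z"
    using matrix_representative[OF CB restr[OF Pm] sP] by blast
  obtain F' where F': "\<forall>i j. L2 (\<lambda>z. F' z $ i $ j)" "\<forall>z. z \<notin> ?C \<longrightarrow> F' z = 0" "AE z in lborel. z \<in> ?C \<longrightarrow> F' z = F z"
    using matrix_representative[OF CB restr[OF Fm] sF] by blast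
  have eqn: "(LINT z:?D|lebesgue. - (u z \<bullet> time_derivative \<phi> z) + \<A> z (Du z) \<bullet> spatial_gradient \<phi> z) =
      (LINT z:?D|lebesgue. F z \<bullet> spatial_gradient \<phi> z)" if "test_function ?D \<phi>" for \<phi>
    using sol that unfolding weak_solution_def by blast
  have ae3: "AE z in lborel. z \<in> ?C \<longrightarrow> u' z = u z \<and> P' z = \<A> z (Du z) \<and> F' z = F z"
    using u'(3) P'(3) F'(3) PA
  proof eventually_elim
    case (elim z)
    then show ?case using CD by auto
  qed
  have ae2: "AE z in lborel. z \<in> ball x0 r \<times> {?t1<..<?t2} \<longrightarrow> u' z = u z \<and> G' z = Du z"
    unfolding C[symmetric] using u'(3) G'(3) by eventually_elim blast
  \<comment> \<open>The flux: the equation reads \<open>u\<^sub>t = div (P - F)\<close>.\<close>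
  define g where "g z = P' z - F' z" for z
  have bI: "bounded {?t1<..<?t2}" by (rule bounded_subset[OF bounded_closed_interval[of ?t1 ?t2]]) auto
  have zero: "u' z = 0" "G' z = 0" "P' z = 0" "F' z = 0" if "z \<notin> ?C" for z
    using that u'(2) G'(2) P'(2) F'(2) by blast+
  have w: "weak_pair ?C (\<lambda>z. u' z $ i) (\<lambda>z. G' z $ i) (\<lambda>z. g z $ i)" for i
    unfolding weak_pair_def
  proof (intro conjI allI impI)
    show "L2 (\<lambda>z. u' z $ i)" "L2 (\<lambda>z. G' z $ i $ j)" for j using u' G' by blast+
    show "L2 (\<lambda>z. g z $ i $ j)" for j
      unfolding g_def using L2_diff[of "\<lambda>z. P' z $ i $ j" "\<lambda>z. F' z $ i $ j"] P'(1) F'(1) by simp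
    show "bounded ?C" by (rule bounded_cylinder)
    show "u' z $ i = 0" "G' z $ i = 0" "g z $ i = 0" if "z \<notin> ?C" for z
      using zero[OF that] by (simp_all add: g_def)
    fix \<psi> :: "(real ^ 'n) \<times> real \<Rightarrow> real" assume t: "test_function ?C \<psi>"
    show "(\<integral>z. u' z $ i * frechet_derivative \<psi> (at z) (axis j 1, 0) \<partial>lborel) = - (\<integral>z. G' z $ i $ j * \<psi> z \<partial>lborel)" for j
      by (rule space_time_weak_gradient[OF u'(1)[rule_format] G'(1)[rule_format] zero(1)[unfolded C]
            zero(2)[unfolded C] ae2 W open_ball bounded_ball bI t[unfolded C]])
    show "(\<integral>z. u' z $ i * frechet_derivative \<psi> (at z) (0, 1) \<partial>lborel) =
        (\<Sum>j\<in>UNIV. \<integral>z. g z $ i $ j * frechet_derivative \<psi> (at z) (axis j 1, 0) \<partial>lborel)"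
      unfolding g_def
      by (rule space_time_weak_equation[OF u'(1)[rule_format] P'(1)[rule_format] F'(1)[rule_format]
            zero(1) zero(3) zero(4) ae3 CD bounded_cylinder eqn t])
  qed
  define v where "v z = u' z - indicator ?C z *\<^sub>R a" for z
  have wv: "weak_pair ?C (\<lambda>z. v z $ i) (\<lambda>z. G' z $ i) (\<lambda>z. g z $ i)" for i
    using weak_pair_sub_const[OF w CB, of i "a $ i"] by (simp add: v_def mult.commute)
  have "parabolic_system \<nu> L ?C v G' g F'"
    unfolding parabolic_system_def
  proof (intro conjI allI impI wv)
    show "L2 (\<lambda>z. F' z $ i $ j)" for i j using F'(1) by blast
    show "F' z = 0" if "z \<notin> ?C" for z using F'(2) that by blast
    show "AE z in lborel. \<nu> * (norm (G' z))\<^sup>2 \<le> (g z + F' z) \<bullet> G' z \<and> norm (g z + F' z) \<le> L * norm (G' z)"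
      using PG G'(3) P'(3)
    proof eventually_elim
      case (elim z)
      show ?case
      proof (cases "z \<in> ?C")
        case True
        then show ?thesis using elim by (simp add: g_def)
      next
        case False
        then show ?thesis using zero[OF False] by (simp add: g_def)
      qed
    qed
  qed
  moreover have "AE z in lborel. z \<in> ?C \<longrightarrow> v z = u z - a \<and> F' z = F z"
    using u'(3) F'(3) by eventually_elim (simp add: v_def)
  ultimately show ?thesis by blast
qed

section \<open>The oscillation estimate\<close>

text \<open>
  Bound every summand by the largest one.
\<close>

lemma powr_sum_le:
  fixes x :: "'i \<Rightarrow> real"
  assumes q: "1 \<le> q" and I: "finite I" and x: "\<And>i. i \<in> I \<Longrightarrow> 0 \<le> x i" and y: "0 \<le> y"
  shows "((\<Sum>i\<in>I. x i) + y) powr q \<le> (real (card I) + 1) powr q * ((\<Sum>i\<in>I. x i powr q) + y powr q)"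
proof -
  define S where "S = (\<Sum>i\<in>I. x i powr q) + y powr q"
  have S0: "0 \<le> S" unfolding S_def by (intro add_nonneg_nonneg sum_nonneg) simp_all
  have root: "a \<le> S powr (1 / q)" if "0 \<le> a" "a powr q \<le> S" for a
  proof -
    have "a = (a powr q) powr (1 / q)" using that q by (simp add: powr_powr)
    also have "\<dots> \<le> S powr (1 / q)" using that q by (intro powr_mono2) simp_all
    finally show ?thesis .
  qed
  have "x i \<le> S powr (1 / q)" if i: "i \<in> I" for i
  proof (rule root[OF x[OF i]])
    have "x i powr q \<le> (\<Sum>i\<in>I. x i powr q)" using I i by (intro member_le_sum) simp_all
    then show "x i powr q \<le> S" unfolding S_def using powr_ge_zero[of y q] by linarith
  qed
  then have "(\<Sum>i\<in>I. x i) \<le> real (card I) * S powr (1 / q)" by (rule sum_bounded_above)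
  moreover have "y \<le> S powr (1 / q)"
  proof (rule root[OF y])
    have "0 \<le> (\<Sum>i\<in>I. x i powr q)" by (intro sum_nonneg) simp
    then show "y powr q \<le> S" by (simp add: S_def)
  qed
  ultimately have "(\<Sum>i\<in>I. x i) + y \<le> (real (card I) + 1) * S powr (1 / q)"
    by (simp add: distrib_right)
  then have "((\<Sum>i\<in>I. x i) + y) powr q \<le> ((real (card I) + 1) * S powr (1 / q)) powr q"
    using x y q by (intro powr_mono2 add_nonneg_nonneg sum_nonneg) auto
  also have "\<dots> = (real (card I) + 1) powr q * S"
  proof -
    have "(S powr (1 / q)) powr q = S" using q S0 by (simp add: powr_powr)
    then show ?thesis by (simp only: powr_mult)
  qed
  finally show ?thesis by (simp only: S_def)
qed

lemma vec_borel:
  fixes f :: "'a::euclidean_space \<Rightarrow> real ^ 'm::finite"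
  assumes "\<And>i. (\<lambda>z. f z $ i) \<in> borel_measurable borel"
  shows "f \<in> borel_measurable borel"
proof -
  have "(\<lambda>z. \<Sum>i\<in>UNIV. f z $ i *\<^sub>R (axis i 1 :: real ^ 'm)) \<in> borel_measurable borel"
    by (intro borel_measurable_sum borel_measurable_scaleR assms borel_measurable_const)
  then show ?thesis by (simp add: basis_expansion flip: scalar_mult_eq_scaleR)
qed

lemma vec_integrable:
  fixes f :: "'a::euclidean_space \<Rightarrow> real ^ 'm::finite"
  assumes "\<And>i. integrable lborel (\<lambda>z. f z $ i)"
  shows "integrable lborel f"
proof -
  have "integrable lborel (\<lambda>z. \<Sum>i\<in>UNIV. f z $ i *\<^sub>R (axis i 1 :: real ^ 'm))"
    by (intro Bochner_Integration.integrable_sum integrable_scaleR_left assms)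
  then show ?thesis by (simp add: basis_expansion flip: scalar_mult_eq_scaleR)
qed

lemma norm_vec_le_sum: "norm (v :: real ^ 'm::finite) \<le> (\<Sum>i\<in>UNIV. \<bar>v $ i\<bar>)"
  by (rule norm_le_l1_cart)

lemma average_eq:
  fixes f f' :: "(real ^ 'n::finite) \<times> real \<Rightarrow> 'b::euclidean_space"
  assumes r: "0 < r" and f': "f' \<in> borel_measurable borel"
    and ae: "AE z in lborel. z \<in> cylinder x0 t0 r \<longrightarrow> f z = f' z"
  shows "average (cylinder x0 t0 r) f =
      (1 / (cyl_mass TYPE('n) * r ^ (CARD('n) + 2))) *\<^sub>R (\<integral>z. indicator (cylinder x0 t0 r) z *\<^sub>R f' z \<partial>lborel)"
    and "set_integrable lebesgue (cylinder x0 t0 r) f \<longleftrightarrow> integrable lborel (\<lambda>z. indicator (cylinder x0 t0 r) z *\<^sub>R f' z)"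
proof -
  let ?Q = "cylinder x0 t0 r"
  have m: "(\<lambda>z. indicator ?Q z *\<^sub>R f' z) \<in> borel_measurable borel"
    by (intro borel_measurable_scaleR borel_measurable_indicator cylinder_sets f')
  have ae': "AE z in lborel. indicator ?Q z *\<^sub>R f z = indicator ?Q z *\<^sub>R f' z"
    using ae
  proof eventually_elim
    case (elim z)
    then show ?case by (cases "z \<in> ?Q") simp_all
  qed
  show "set_integrable lebesgue ?Q f \<longleftrightarrow> integrable lborel (\<lambda>z. indicator ?Q z *\<^sub>R f' z)"
    unfolding set_integrable_def by (rule integral_lebesgue_eq(2)[OF m ae'])
  have "measure lebesgue ?Q = cyl_mass TYPE('n) * r ^ (CARD('n) + 2)"
    using measure_cylinder[OF r] measure_completion[of ?Q lborel] cylinder_sets by simp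
  then show "average ?Q f = (1 / (cyl_mass TYPE('n) * r ^ (CARD('n) + 2))) *\<^sub>R (\<integral>z. indicator ?Q z *\<^sub>R f' z \<partial>lborel)"
    unfolding average_def set_lebesgue_integral_def by (simp only: integral_lebesgue_eq(3)[OF m ae'])
qed

text \<open>
  With \<open>v = u - a\<close> and \<open>b\<close> the mean of \<open>v\<close>, the oscillation \<open>u - m\<close> equals \<open>v - b\<close>, and \<open>\<bar>b\<bar>\<close> is at most
  \<open>\<Psi> / V\<close>, because the cylinder has volume \<open>V \<rho> ^ (n + 2)\<close>. So the mean
  contributes no more than \<open>v\<close> itself.
\<close>

lemma oscillation_estimate:
  fixes u v :: "(real ^ 'n::finite) \<times> real \<Rightarrow> real ^ 'N::finite" and a :: "real ^ 'N"
  assumes q: "1 \<le> q" and \<rho>: "0 < \<rho>" and K: "0 < K" and \<Psi>: "0 \<le> \<Psi>"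
    and v: "\<And>i. (\<lambda>z. v z $ i) \<in> borel_measurable borel" "\<And>i. integrable lborel (\<lambda>z. v z $ i)"
    and ae: "AE z in lborel. z \<in> cylinder x0 t0 \<rho> \<longrightarrow> v z = u z - a"
    and vb: "(\<integral>z. norm (v z) \<partial>lborel) \<le> \<rho> ^ (CARD('n) + 2) * \<Psi>"
    and comp: "\<And>i. (\<integral>\<^sup>+z. ennreal (\<bar>v z $ i\<bar> powr q) * indicator (cylinder x0 t0 \<rho>) z \<partial>lborel) \<le>
      ennreal (K * (\<rho> ^ (CARD('n) + 2) * \<Psi> powr q))"
  defines "V \<equiv> cyl_mass TYPE('n)" and "m \<equiv> average (cylinder x0 t0 \<rho>) u"
  shows "set_integrable lebesgue (cylinder x0 t0 \<rho>) (\<lambda>z. norm (u z - m) powr q / \<rho> powr q)"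
    and "average (cylinder x0 t0 \<rho>) (\<lambda>z. norm (u z - m) powr q / \<rho> powr q) powr (1 / q) \<le>
      ((real CARD('N) + 1) powr q * (real CARD('N) * K + V * (1 / V) powr q) / V) powr (1 / q) * (\<Psi> / \<rho>)"
proof -
  let ?Q = "cylinder x0 t0 \<rho>" and ?d = "CARD('n) + 2"
  have V: "0 < V" unfolding V_def by (rule cyl_mass_pos)
  have VQ: "0 < V * \<rho> ^ ?d" using V \<rho> by simp
  have QB: "?Q \<in> sets borel" by (rule cylinder_sets)
  have vm: "v \<in> borel_measurable borel" by (rule vec_borel[OF v(1)])
  have vi: "integrable lborel v" by (rule vec_integrable[OF v(2)])
  have iQ: "integrable lborel (\<lambda>z. indicator ?Q z *\<^sub>R v z)"
    by (rule integrable_mult_indicator[OF _ vi]) (use QB in simp)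
  have eQ: "emeasure lborel ?Q = ennreal (V * \<rho> ^ ?d)"
    using emeasure_bounded_finite[OF bounded_cylinder, of x0 t0 \<rho>] measure_cylinder[OF \<rho>, of x0 t0]
    by (subst emeasure_eq_ennreal_measure) (auto simp: V_def)
  have iQa: "integrable lborel (\<lambda>z. indicator ?Q z *\<^sub>R a)"
    using QB emeasure_bounded_finite[OF bounded_cylinder, of x0 t0 \<rho>] by (intro integrable_scaleR_left integrable_real_indicator) auto
  define b where "b = (1 / (V * \<rho> ^ ?d)) *\<^sub>R (\<integral>z. indicator ?Q z *\<^sub>R v z \<partial>lborel)"
  have "m = (1 / (V * \<rho> ^ ?d)) *\<^sub>R (\<integral>z. indicator ?Q z *\<^sub>R (v z + a) \<partial>lborel)"
    unfolding m_def V_def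
  proof (rule average_eq(1)[OF \<rho>])
    show "(\<lambda>z. v z + a) \<in> borel_measurable borel" using vm by measurable
    show "AE z in lborel. z \<in> ?Q \<longrightarrow> u z = v z + a" using ae by eventually_elim simp
  qed
  also have "(\<integral>z. indicator ?Q z *\<^sub>R (v z + a) \<partial>lborel) = (\<integral>z. indicator ?Q z *\<^sub>R v z \<partial>lborel) + (\<integral>z. indicator ?Q z *\<^sub>R a \<partial>lborel)"
    unfolding scaleR_add_right by (rule Bochner_Integration.integral_add[OF iQ iQa])
  also have "(\<integral>z. indicator ?Q z *\<^sub>R a \<partial>lborel) = (V * \<rho> ^ ?d) *\<^sub>R a"
  proof -
    have fin: "emeasure lborel ?Q < \<infinity>" by (simp add: eQ)
    have "integrable lborel (indicator ?Q :: _ \<Rightarrow> real)"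
      by (rule integrable_real_indicator) (use QB fin in simp_all)
    then have "(\<integral>z. indicator ?Q z *\<^sub>R a \<partial>lborel) = (\<integral>z. indicator ?Q z \<partial>lborel) *\<^sub>R a"
      by (intro integral_scaleR_left)
    also have "(\<integral>z. indicator ?Q z \<partial>lborel) = measure lborel ?Q" using QB by simp
    finally show ?thesis unfolding measure_cylinder[OF \<rho>] V_def .
  qed
  finally have m: "m = b + a"
    using VQ \<rho> unfolding b_def scaleR_add_right by auto
  have "norm b = (1 / (V * \<rho> ^ ?d)) * norm (\<integral>z. indicator ?Q z *\<^sub>R v z \<partial>lborel)"
    unfolding b_def norm_scaleR using VQ by (simp only: abs_divide abs_one abs_of_pos)
  also have "\<dots> \<le> (1 / (V * \<rho> ^ ?d)) * (\<rho> ^ ?d * \<Psi>)"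
  proof (rule mult_left_mono)
    have "norm (\<integral>z. indicator ?Q z *\<^sub>R v z \<partial>lborel) \<le> (\<integral>z. norm (indicator ?Q z *\<^sub>R v z) \<partial>lborel)"
      by (rule integral_norm_bound)
    also have "\<dots> \<le> (\<integral>z. norm (v z) \<partial>lborel)"
      by (rule integral_mono[OF integrable_norm[OF iQ] integrable_norm[OF vi]]) (simp add: indicator_def)
    finally show "norm (\<integral>z. indicator ?Q z *\<^sub>R v z \<partial>lborel) \<le> \<rho> ^ ?d * \<Psi>" using vb by linarith
    show "0 \<le> 1 / (V * \<rho> ^ ?d)" using VQ by (intro divide_nonneg_pos) linarith+
  qed
  also have "\<dots> = \<Psi> / V" using \<rho> V by simp
  finally have b: "norm b \<le> \<Psi> / V" .
  define f where "f z = norm (v z - b) powr q / \<rho> powr q" for z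
  have fm: "f \<in> borel_measurable borel"
    unfolding f_def[abs_def] using vm by measurable
  have aef: "AE z in lborel. z \<in> ?Q \<longrightarrow> norm (u z - m) powr q / \<rho> powr q = f z"
    using ae
  proof eventually_elim
    case (elim z)
    have "u z - m = v z - b" if "z \<in> ?Q"
      using elim that by (simp add: m)
    then show ?case unfolding f_def by simp
  qed
  have fm': "(\<lambda>z. indicator ?Q z *\<^sub>R f z) \<in> borel_measurable lborel"
    using fm QB by (intro borel_measurable_scaleR borel_measurable_indicator) simp_all
  have f0: "0 \<le> indicator ?Q z *\<^sub>R f z" for z by (simp add: f_def)
  define cN where "cN = (real CARD('N) + 1) powr q"
  define E where "E = cN * (real CARD('N) * K + V * (1 / V) powr q)"
  have cN: "0 < cN" by (simp add: cN_def)
  have E: "0 < E" unfolding E_def using cN K V by (intro mult_pos_pos add_pos_nonneg) simp_all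
  have rq: "0 < \<rho> powr q" using \<rho> by simp
  have "(\<integral>\<^sup>+z. ennreal (indicator ?Q z *\<^sub>R f z) \<partial>lborel) \<le>
    (\<integral>\<^sup>+z. ennreal (cN / \<rho> powr q) * ((\<Sum>i\<in>UNIV. ennreal (\<bar>v z $ i\<bar> powr q) * indicator ?Q z) + ennreal ((\<Psi> / V) powr q) * indicator ?Q z) \<partial>lborel)"
  proof (rule nn_integral_mono)
    fix z :: "(real ^ 'n) \<times> real"
    show "ennreal (indicator ?Q z *\<^sub>R f z) \<le>
      ennreal (cN / \<rho> powr q) * ((\<Sum>i\<in>UNIV. ennreal (\<bar>v z $ i\<bar> powr q) * indicator ?Q z) + ennreal ((\<Psi> / V) powr q) * indicator ?Q z)"
    proof (cases "z \<in> ?Q")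
      case True
      have "norm (v z - b) \<le> (\<Sum>i\<in>UNIV. \<bar>v z $ i\<bar>) + \<Psi> / V"
        using norm_triangle_ineq4[of "v z" b] norm_vec_le_sum[of "v z"] b by linarith
      then have "norm (v z - b) powr q \<le> ((\<Sum>i\<in>UNIV. \<bar>v z $ i\<bar>) + \<Psi> / V) powr q"
        using q by (intro powr_mono2) simp_all
      also have "\<dots> \<le> cN * ((\<Sum>i\<in>UNIV. \<bar>v z $ i\<bar> powr q) + (\<Psi> / V) powr q)"
        unfolding cN_def using q \<Psi> V by (intro powr_sum_le) simp_all
      finally have "f z \<le> cN / \<rho> powr q * ((\<Sum>i\<in>UNIV. \<bar>v z $ i\<bar> powr q) + (\<Psi> / V) powr q)"
        unfolding f_def using rq by (simp add: divide_right_mono)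
      then have "ennreal (f z) \<le> ennreal (cN / \<rho> powr q * ((\<Sum>i\<in>UNIV. \<bar>v z $ i\<bar> powr q) + (\<Psi> / V) powr q))"
        by (rule ennreal_leI)
      also have "\<dots> = ennreal (cN / \<rho> powr q) * ((\<Sum>i\<in>UNIV. ennreal (\<bar>v z $ i\<bar> powr q)) + ennreal ((\<Psi> / V) powr q))"
      proof -
        have c0: "0 \<le> cN / \<rho> powr q" using cN rq by (intro divide_nonneg_pos) linarith+
        have s0: "0 \<le> (\<Sum>i\<in>UNIV. \<bar>v z $ i\<bar> powr q)" by (intro sum_nonneg) simp
        have s1: "ennreal (\<Sum>i\<in>UNIV. \<bar>v z $ i\<bar> powr q) = (\<Sum>i\<in>UNIV. ennreal (\<bar>v z $ i\<bar> powr q))"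
          by (rule sum_ennreal[symmetric]) simp
        have "ennreal (cN / \<rho> powr q * ((\<Sum>i\<in>UNIV. \<bar>v z $ i\<bar> powr q) + (\<Psi> / V) powr q)) =
          ennreal (cN / \<rho> powr q) * ennreal ((\<Sum>i\<in>UNIV. \<bar>v z $ i\<bar> powr q) + (\<Psi> / V) powr q)"
          by (rule ennreal_mult[OF c0]) (use s0 in simp)
        also have "ennreal ((\<Sum>i\<in>UNIV. \<bar>v z $ i\<bar> powr q) + (\<Psi> / V) powr q) =
          (\<Sum>i\<in>UNIV. ennreal (\<bar>v z $ i\<bar> powr q)) + ennreal ((\<Psi> / V) powr q)"
          unfolding s1[symmetric] by (rule ennreal_plus[OF s0]) simp
        finally show ?thesis .
      qed
      finally show ?thesis using True by simp
    qed simp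
  qed
  also have "\<dots> = ennreal (cN / \<rho> powr q) * ((\<Sum>i\<in>UNIV. \<integral>\<^sup>+z. ennreal (\<bar>v z $ i\<bar> powr q) * indicator ?Q z \<partial>lborel) + ennreal ((\<Psi> / V) powr q) * emeasure lborel ?Q)"
  proof -
    have m1: "(\<lambda>z. ennreal (\<bar>v z $ i\<bar> powr q) * indicator ?Q z) \<in> borel_measurable lborel" for i
      using v(1)[of i] QB by measurable
    have m2: "(\<lambda>z. \<Sum>i\<in>UNIV. ennreal (\<bar>v z $ i\<bar> powr q) * indicator ?Q z) \<in> borel_measurable lborel"
      by (intro borel_measurable_sum m1)
    have m3: "(\<lambda>z. ennreal ((\<Psi> / V) powr q) * indicator ?Q z) \<in> borel_measurable lborel"
      using QB by measurable
    have m4: "(\<lambda>z. (\<Sum>i\<in>UNIV. ennreal (\<bar>v z $ i\<bar> powr q) * indicator ?Q z) + ennreal ((\<Psi> / V) powr q) * indicator ?Q z) \<in> borel_measurable lborel"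
      using m2 m3 by measurable
    show ?thesis
      unfolding nn_integral_cmult[OF m4] nn_integral_add[OF m2 m3] nn_integral_sum[OF m1]
      using QB by (simp add: nn_integral_cmult_indicator)
  qed
  also have "\<dots> \<le> ennreal (cN / \<rho> powr q) * ((\<Sum>i\<in>(UNIV :: 'N set). ennreal (K * (\<rho> ^ ?d * \<Psi> powr q))) + ennreal ((\<Psi> / V) powr q) * ennreal (V * \<rho> ^ ?d))"
    unfolding eQ by (intro mult_left_mono add_mono sum_mono comp order_refl) simp_all
  also have "\<dots> = ennreal (cN / \<rho> powr q * (real CARD('N) * (K * (\<rho> ^ ?d * \<Psi> powr q)) + (\<Psi> / V) powr q * (V * \<rho> ^ ?d)))"
  proof -
    have n1: "0 \<le> K * (\<rho> ^ ?d * \<Psi> powr q)" "0 \<le> V * \<rho> ^ ?d" "0 \<le> cN / \<rho> powr q"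
      using K \<rho> V cN by simp_all
    have "(\<Sum>i\<in>(UNIV :: 'N set). ennreal (K * (\<rho> ^ ?d * \<Psi> powr q))) = ennreal (real CARD('N) * (K * (\<rho> ^ ?d * \<Psi> powr q)))"
      using n1(1) by (subst sum_ennreal) simp_all
    moreover have "ennreal ((\<Psi> / V) powr q) * ennreal (V * \<rho> ^ ?d) = ennreal ((\<Psi> / V) powr q * (V * \<rho> ^ ?d))"
      by (rule ennreal_mult[symmetric]) (use n1 in simp_all)
    moreover have "0 \<le> real CARD('N) * (K * (\<rho> ^ ?d * \<Psi> powr q))" "0 \<le> (\<Psi> / V) powr q * (V * \<rho> ^ ?d)"
      by (rule mult_nonneg_nonneg[OF of_nat_0_le_iff n1(1)], rule mult_nonneg_nonneg[OF powr_ge_zero n1(2)])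
    ultimately show ?thesis
      using n1(3) by (simp only: ennreal_plus[symmetric] ennreal_mult[symmetric] add_nonneg_nonneg)
  qed
  also have "cN / \<rho> powr q * (real CARD('N) * (K * (\<rho> ^ ?d * \<Psi> powr q)) + (\<Psi> / V) powr q * (V * \<rho> ^ ?d)) = E * \<rho> ^ ?d * (\<Psi> / \<rho>) powr q"
  proof -
    have "c / r * (n * (K * (R * P)) + P * iV * (V * R)) = c * (n * K + V * iV) * R * (P / r)" for c r n R P iV :: real
      by (simp add: distrib_left distrib_right divide_inverse algebra_simps)
    moreover have "(\<Psi> / V) powr q = \<Psi> powr q * (1 / V) powr q"
      unfolding powr_mult[symmetric] by simp
    ultimately show ?thesis unfolding E_def powr_divide[of \<Psi> \<rho>] by (simp only:)
  qed
  finally have nn: "(\<integral>\<^sup>+z. ennreal (indicator ?Q z *\<^sub>R f z) \<partial>lborel) \<le> ennreal (E * \<rho> ^ ?d * (\<Psi> / \<rho>) powr q)" .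
  have int: "integrable lborel (\<lambda>z. indicator ?Q z *\<^sub>R f z)"
  proof (rule integrableI_bounded[OF fm'])
    have "(\<integral>\<^sup>+z. ennreal (norm (indicator ?Q z *\<^sub>R f z)) \<partial>lborel) = (\<integral>\<^sup>+z. ennreal (indicator ?Q z *\<^sub>R f z) \<partial>lborel)"
      using f0 by (intro nn_integral_cong) simp
    then show "(\<integral>\<^sup>+z. ennreal (norm (indicator ?Q z *\<^sub>R f z)) \<partial>lborel) < \<infinity>"
      using nn by (simp add: le_less_trans[OF _ ennreal_less_top])
  qed
  show "set_integrable lebesgue ?Q (\<lambda>z. norm (u z - m) powr q / \<rho> powr q)"
    using average_eq(2)[OF \<rho> fm aef] int by blast
  have "ennreal (\<integral>z. indicator ?Q z *\<^sub>R f z \<partial>lborel) \<le> ennreal (E * \<rho> ^ ?d * (\<Psi> / \<rho>) powr q)"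
    using nn nn_integral_eq_integral[OF int] f0 by simp
  moreover have "0 \<le> E * \<rho> ^ ?d * (\<Psi> / \<rho>) powr q" using E \<rho> by (intro mult_nonneg_nonneg) simp_all
  ultimately have le: "(\<integral>z. indicator ?Q z *\<^sub>R f z \<partial>lborel) \<le> E * \<rho> ^ ?d * (\<Psi> / \<rho>) powr q"
    by (simp only: ennreal_le_iff)
  have "average ?Q (\<lambda>z. norm (u z - m) powr q / \<rho> powr q) = (1 / (V * \<rho> ^ ?d)) * (\<integral>z. indicator ?Q z *\<^sub>R f z \<partial>lborel)"
    using average_eq(1)[OF \<rho> fm aef] by (simp only: V_def real_scaleR_def)
  also have "\<dots> \<le> (1 / (V * \<rho> ^ ?d)) * (E * \<rho> ^ ?d * (\<Psi> / \<rho>) powr q)"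
    using le by (rule mult_left_mono) (use VQ in \<open>intro divide_nonneg_pos, linarith+\<close>)
  also have "\<dots> = E / V * (\<Psi> / \<rho>) powr q" using \<rho> by simp
  finally have av: "average ?Q (\<lambda>z. norm (u z - m) powr q / \<rho> powr q) \<le> E / V * (\<Psi> / \<rho>) powr q" .
  have av0: "0 \<le> average ?Q (\<lambda>z. norm (u z - m) powr q / \<rho> powr q)"
    unfolding average_def set_lebesgue_integral_def real_scaleR_def by (intro mult_nonneg_nonneg integral_nonneg_AE AE_I2) simp_all
  have "average ?Q (\<lambda>z. norm (u z - m) powr q / \<rho> powr q) powr (1 / q) \<le> (E / V * (\<Psi> / \<rho>) powr q) powr (1 / q)"
    using av av0 q by (intro powr_mono2) simp_all
  also have "\<dots> = (E / V) powr (1 / q) * ((\<Psi> / \<rho>) powr q) powr (1 / q)"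
    by (rule powr_mult)
  also have "((\<Psi> / \<rho>) powr q) powr (1 / q) = \<Psi> / \<rho>"
    using q \<Psi> \<rho> by (simp add: powr_powr)
  finally show "average ?Q (\<lambda>z. norm (u z - m) powr q / \<rho> powr q) powr (1 / q) \<le>
      ((real CARD('N) + 1) powr q * (real CARD('N) * K + V * (1 / V) powr q) / V) powr (1 / q) * (\<Psi> / \<rho>)"
    by (simp only: E_def cN_def)
qed

theorem theorem4p3:
  fixes q \<nu> L :: real
  assumes "0 < \<nu>" and "\<nu> < L"
    and "2 \<le> q" and "q < 2 * (1 + 2 / real CARD('n::finite))"
  shows "\<exists>c>0. \<forall>(\<Omega> :: (real ^ 'n) set) (T :: real)
      (\<A> :: (real ^ 'n) \<times> real \<Rightarrow> real ^ 'n ^ 'N \<Rightarrow> real ^ 'n ^ 'N)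
      (F :: (real ^ 'n) \<times> real \<Rightarrow> real ^ 'n ^ 'N)
      (u :: (real ^ 'n) \<times> real \<Rightarrow> real ^ 'N)
      (Du :: (real ^ 'n) \<times> real \<Rightarrow> real ^ 'n ^ 'N)
      (x0 :: real ^ 'n) (t0 :: real) (\<rho> :: real).
    open \<Omega> \<and> connected \<Omega> \<and> bounded \<Omega> \<and> 0 < T \<and>
    caratheodory (\<Omega> \<times> {0<..<T}) \<A> \<and>
    growth_conditions (\<Omega> \<times> {0<..<T}) \<nu> L \<A> \<and>
    locally_square_integrable (\<Omega> \<times> {0<..<T}) F \<and>
    weak_solution \<Omega> T \<A> F u Du \<and>
    0 < \<rho> \<and> compactly_contained (cylinder x0 t0 (2 * \<rho>)) (\<Omega> \<times> {0<..<T})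
    \<longrightarrow>
    (let Q = cylinder x0 t0 \<rho>; Q2 = cylinder x0 t0 (2 * \<rho>) in
      set_integrable lebesgue Q (\<lambda>z. norm (u z - average Q u) powr q / \<rho> powr q) \<and>
      average Q (\<lambda>z. norm (u z - average Q u) powr q / \<rho> powr q) powr (1 / q)
        \<le> c * average Q2 (\<lambda>z. norm (u z - average Q2 u) / (2 * \<rho>))
          + c * (average Q2 (\<lambda>z. (norm (F z))\<^sup>2)) powr (1 / 2))"
proof -
  let ?d = "CARD('n) + 2"
  have L: "0 < L" using assms by linarith
  have \<gamma>: "0 < q - real ?d * (q / 2 - 1)"
  proof -
    have n: "0 < real CARD('n)" by simp
    have "q * real CARD('n) < 2 * (1 + 2 / real CARD('n)) * real CARD('n)"
      using assms(4) n by (rule mult_strict_right_mono)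
    also have "\<dots> = 2 * real CARD('n) + 4" using n by (simp add: distrib_right)
    finally show ?thesis by (simp add: algebra_simps)
  qed
  have "\<exists>K>0. \<forall>x0 t0 \<rho> (v :: (real ^ 'n) \<times> real \<Rightarrow> real ^ 'N) G g F \<Psi> i.
    parabolic_system \<nu> L (cylinder x0 t0 (2 * \<rho>)) v G g F \<longrightarrow> 0 < \<rho> \<longrightarrow> 0 \<le> \<Psi> \<longrightarrow>
    \<rho>\<^sup>2 * (\<integral>z. (norm (F z))\<^sup>2 \<partial>lborel) \<le> \<rho> ^ ?d * \<Psi>\<^sup>2 \<longrightarrow>
    (\<integral>z. norm (v z) \<partial>lborel) \<le> \<rho> ^ ?d * \<Psi> \<longrightarrow>
    (\<integral>\<^sup>+z. ennreal (\<bar>v z $ i\<bar> powr q) * indicator (cylinder x0 t0 \<rho>) z \<partial>lborel) \<le>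
      ennreal (K * (\<rho> ^ ?d * \<Psi> powr q))" (is "\<exists>K. ?P K")
    by (rule system_Lq_estimate[OF assms(1) L assms(3) \<gamma>])
  then obtain K where K': "?P K" by (rule exE)
  note K = K'[THEN conjunct1] and est = K'[THEN conjunct2, rule_format]
  define V where "V = cyl_mass TYPE('n)"
  have V: "0 < V" unfolding V_def by (rule cyl_mass_pos)
  define c1 where "c1 = ((real CARD('N) + 1) powr q * (real CARD('N) * K + V * (1 / V) powr q) / V) powr (1 / q)"
  have "0 < real CARD('N) * K + V * (1 / V) powr q"
    using K V by (intro add_pos_nonneg mult_pos_pos mult_nonneg_nonneg) simp_all
  then have c1: "0 < c1" unfolding c1_def using V by simp
  \<comment> \<open>The factor \<open>V * 2 ^ ?d\<close> converts averages over the doubled cylinder into integrals divided by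
    \<open>\<rho> ^ ?d\<close>, and the last factor 2 comes from the \<open>2 * \<rho>\<close> in the denominator of the claim.\<close>
  define c where "c = c1 * (sqrt (V * 2 ^ ?d) + V * 2 ^ ?d * 2)"
  have c: "0 < c" unfolding c_def using c1 V by (intro mult_pos_pos add_nonneg_pos) simp_all
  show ?thesis
  proof (intro exI[of _ c] conjI c allI impI)
    fix \<Omega> :: "(real ^ 'n) set" and T and \<A> :: "(real ^ 'n) \<times> real \<Rightarrow> real ^ 'n ^ 'N \<Rightarrow> real ^ 'n ^ 'N"
      and F :: "(real ^ 'n) \<times> real \<Rightarrow> real ^ 'n ^ 'N" and u :: "(real ^ 'n) \<times> real \<Rightarrow> real ^ 'N"
      and Du :: "(real ^ 'n) \<times> real \<Rightarrow> real ^ 'n ^ 'N" and x0 :: "real ^ 'n" and t0 \<rho> :: real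
    assume H: "open \<Omega> \<and> connected \<Omega> \<and> bounded \<Omega> \<and> 0 < T \<and>
      caratheodory (\<Omega> \<times> {0<..<T}) \<A> \<and> growth_conditions (\<Omega> \<times> {0<..<T}) \<nu> L \<A> \<and>
      locally_square_integrable (\<Omega> \<times> {0<..<T}) F \<and> weak_solution \<Omega> T \<A> F u Du \<and>
      0 < \<rho> \<and> compactly_contained (cylinder x0 t0 (2 * \<rho>)) (\<Omega> \<times> {0<..<T})"
    then have \<rho>: "0 < \<rho>" by blast
    let ?Q = "cylinder x0 t0 \<rho>" and ?C = "cylinder x0 t0 (2 * \<rho>)"
    have r2: "0 < 2 * \<rho>" using \<rho> by simp
    define a where "a = average ?C u"
    obtain v G g F' where sys: "parabolic_system \<nu> L ?C v G g F'"
      and ae: "AE z in lborel. z \<in> ?C \<longrightarrow> v z = u z - a \<and> F' z = F z"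
      using weak_solution_imp_parabolic_system[of \<Omega> T \<A> \<nu> L F u Du "2 * \<rho>" x0 t0 a] H assms(1,2) r2 by blast
    have w: "weak_pair ?C (\<lambda>z. v z $ i) (\<lambda>z. G z $ i) (\<lambda>z. g z $ i)" for i
      using sys by (simp add: parabolic_system_def)
    have vmi: "(\<lambda>z. v z $ i) \<in> borel_measurable borel" for i
      using weak_pair_L2(1)[OF w] by (rule L2_measurable)
    have v0: "v z = 0" if "z \<notin> ?C" for z
      using weak_pair_zero(1)[OF w that] by (simp add: vec_eq_iff)
    have F'0: "F' z = 0" if "z \<notin> ?C" for z
      using sys that unfolding parabolic_system_def by blast
    define FF where "FF = (\<integral>z. (norm (F' z))\<^sup>2 \<partial>lborel)"
    define v1 where "v1 = (\<integral>z. norm (v z) \<partial>lborel)"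
    have nn: "0 \<le> FF" "0 \<le> v1" by (simp_all add: FF_def v1_def)
    have rd: "0 < \<rho> ^ ?d" using \<rho> by simp
    \<comment> \<open>With this value both hypotheses of \<open>system_Lq_estimate\<close> hold, and its two summands
      become the two terms of the claim.\<close>
    define \<Psi> where "\<Psi> = \<rho> * sqrt (FF / \<rho> ^ ?d) + v1 / \<rho> ^ ?d"
    have p1: "0 \<le> \<rho> * sqrt (FF / \<rho> ^ ?d)" using \<rho> nn rd by (intro mult_nonneg_nonneg real_sqrt_ge_zero divide_nonneg_pos) linarith+
    have p2: "0 \<le> v1 / \<rho> ^ ?d" using nn rd by (intro divide_nonneg_pos)
    have \<Psi>: "0 \<le> \<Psi>" using p1 p2 by (simp only: \<Psi>_def add_nonneg_nonneg)
    have Fb: "\<rho>\<^sup>2 * FF \<le> \<rho> ^ ?d * \<Psi>\<^sup>2"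
    proof -
      have "(\<rho> * sqrt (FF / \<rho> ^ ?d))\<^sup>2 \<le> \<Psi>\<^sup>2"
        using p1 p2 by (intro power_mono) (simp_all only: \<Psi>_def le_add_same_cancel1)
      also have "(\<rho> * sqrt (FF / \<rho> ^ ?d))\<^sup>2 = \<rho>\<^sup>2 * (FF / \<rho> ^ ?d)"
        unfolding power_mult_distrib using nn rd by (subst real_sqrt_pow2) (intro divide_nonneg_pos, simp_all only:)
      finally have "\<rho> ^ ?d * (\<rho>\<^sup>2 * (FF / \<rho> ^ ?d)) \<le> \<rho> ^ ?d * \<Psi>\<^sup>2"
        using rd by (intro mult_left_mono) linarith+
      moreover have "\<rho> ^ ?d * (\<rho>\<^sup>2 * (FF / \<rho> ^ ?d)) = \<rho>\<^sup>2 * FF" using \<rho> by simp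
      ultimately show ?thesis by (simp only:)
    qed
    have vb: "v1 \<le> \<rho> ^ ?d * \<Psi>"
    proof -
      have "v1 = \<rho> ^ ?d * (v1 / \<rho> ^ ?d)" using \<rho> by simp
      also have "\<dots> \<le> \<rho> ^ ?d * \<Psi>" using rd p1 by (intro mult_left_mono) (simp_all only: \<Psi>_def le_add_same_cancel2 less_imp_le)
      finally show ?thesis .
    qed
    have comp: "(\<integral>\<^sup>+z. ennreal (\<bar>v z $ i\<bar> powr q) * indicator ?Q z \<partial>lborel) \<le> ennreal (K * (\<rho> ^ ?d * \<Psi> powr q))" for i
      by (rule est[OF sys \<rho> \<Psi> Fb[unfolded FF_def] vb[unfolded v1_def]])
    have QC: "?Q \<subseteq> ?C" using \<rho> by (intro cylinder_mono) simp_all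
    have aeQ: "AE z in lborel. z \<in> ?Q \<longrightarrow> v z = u z - a"
      using ae
    proof eventually_elim
      case (elim z)
      then show ?case using QC by blast
    qed
    have q1: "1 \<le> q" using assms by linarith
    note osc = oscillation_estimate[OF q1 \<rho> K \<Psi> vmi weak_pair_integrable(1)[OF w] aeQ vb[unfolded v1_def] comp]
    have I1: "average ?Q (\<lambda>z. norm (u z - average ?Q u) powr q / \<rho> powr q) powr (1 / q) \<le> c1 * (\<Psi> / \<rho>)"
      using osc(2) by (simp only: c1_def V_def)
    define AV where "AV = average ?C (\<lambda>z. norm (u z - a) / (2 * \<rho>))"
    define AF where "AF = average ?C (\<lambda>z. (norm (F z))\<^sup>2)"
    have AV: "AV = (1 / (V * (2 * \<rho>) ^ ?d)) * (v1 / (2 * \<rho>))"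
    proof -
      have "AV = (1 / (V * (2 * \<rho>) ^ ?d)) *\<^sub>R (\<integral>z. indicator ?C z *\<^sub>R (norm (v z) / (2 * \<rho>)) \<partial>lborel)"
        unfolding AV_def V_def
      proof (rule average_eq(1)[OF r2])
        show "(\<lambda>z. norm (v z) / (2 * \<rho>)) \<in> borel_measurable borel" using vec_borel[OF vmi] by measurable
        show "AE z in lborel. z \<in> ?C \<longrightarrow> norm (u z - a) / (2 * \<rho>) = norm (v z) / (2 * \<rho>)"
          using ae by eventually_elim simp
      qed
      also have "(\<lambda>z. indicator ?C z *\<^sub>R (norm (v z) / (2 * \<rho>))) = (\<lambda>z. norm (v z) / (2 * \<rho>))"
      proof
        show "indicator ?C z *\<^sub>R (norm (v z) / (2 * \<rho>)) = norm (v z) / (2 * \<rho>)" for z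
          using v0[of z] by (cases "z \<in> ?C") simp_all
      qed
      finally show ?thesis unfolding v1_def real_scaleR_def by (simp only: integral_divide_zero)
    qed
    have AF: "AF = (1 / (V * (2 * \<rho>) ^ ?d)) * FF"
    proof -
      have "AF = (1 / (V * (2 * \<rho>) ^ ?d)) *\<^sub>R (\<integral>z. indicator ?C z *\<^sub>R ((norm (F' z))\<^sup>2) \<partial>lborel)"
        unfolding AF_def V_def
      proof (rule average_eq(1)[OF r2])
        show "(\<lambda>z. (norm (F' z))\<^sup>2) \<in> borel_measurable borel"
          using system_integrable(4)[OF sys] by auto
        show "AE z in lborel. z \<in> ?C \<longrightarrow> (norm (F z))\<^sup>2 = (norm (F' z))\<^sup>2"
          using ae by eventually_elim simp
      qed
      also have "(\<lambda>z. indicator ?C z *\<^sub>R ((norm (F' z))\<^sup>2)) = (\<lambda>z. (norm (F' z))\<^sup>2)"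
      proof
        show "indicator ?C z *\<^sub>R ((norm (F' z))\<^sup>2) = (norm (F' z))\<^sup>2" for z
          using F'0[of z] by (cases "z \<in> ?C") simp_all
      qed
      finally show ?thesis unfolding FF_def real_scaleR_def .
    qed
    have AFe: "FF / \<rho> ^ ?d = V * 2 ^ ?d * AF"
      unfolding AF power_mult_distrib using V \<rho> by simp
    have AVe: "v1 / \<rho> ^ ?d / \<rho> = V * 2 ^ ?d * 2 * AV"
      unfolding AV power_mult_distrib using V \<rho> by simp
    have AF0: "0 \<le> AF" unfolding AF using nn V \<rho> by simp
    have AV0: "0 \<le> AV" unfolding AV using nn V \<rho> by simp
    have "\<Psi> / \<rho> = sqrt (FF / \<rho> ^ ?d) + v1 / \<rho> ^ ?d / \<rho>"
    proof -
      have "(\<rho> * a + b) / \<rho> = a + b / \<rho>" for a b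
        using \<rho> by (simp add: add_divide_distrib)
      then show ?thesis unfolding \<Psi>_def .
    qed
    also have "\<dots> = sqrt (V * 2 ^ ?d) * AF powr (1 / 2) + V * 2 ^ ?d * 2 * AV"
      unfolding AFe AVe real_sqrt_mult[of "V * 2 ^ ?d"] powr_half_sqrt[OF AF0] ..
    also have "\<dots> \<le> (sqrt (V * 2 ^ ?d) + V * 2 ^ ?d * 2) * AF powr (1 / 2) + (sqrt (V * 2 ^ ?d) + V * 2 ^ ?d * 2) * AV"
      using V AV0 by (intro add_mono mult_right_mono) simp_all
    finally have "c1 * (\<Psi> / \<rho>) \<le> c1 * ((sqrt (V * 2 ^ ?d) + V * 2 ^ ?d * 2) * AF powr (1 / 2) + (sqrt (V * 2 ^ ?d) + V * 2 ^ ?d * 2) * AV)"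
      using c1 by (intro mult_left_mono) simp_all
    also have "\<dots> = c * AV + c * AF powr (1 / 2)"
    proof -
      have "c1 * (k * A + k * B) = c1 * k * B + c1 * k * A" for k A B :: real
        by (simp add: distrib_left)
      then show ?thesis unfolding c_def .
    qed
    finally have I2: "average ?Q (\<lambda>z. norm (u z - average ?Q u) powr q / \<rho> powr q) powr (1 / q) \<le> c * AV + c * AF powr (1 / 2)"
      using I1 by linarith
    show "let Q = cylinder x0 t0 \<rho>; Q2 = cylinder x0 t0 (2 * \<rho>) in
      set_integrable lebesgue Q (\<lambda>z. norm (u z - average Q u) powr q / \<rho> powr q) \<and>
      average Q (\<lambda>z. norm (u z - average Q u) powr q / \<rho> powr q) powr (1 / q)
        \<le> c * average Q2 (\<lambda>z. norm (u z - average Q2 u) / (2 * \<rho>))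
          + c * (average Q2 (\<lambda>z. (norm (F z))\<^sup>2)) powr (1 / 2)"
      unfolding Let_def using osc(1) I2 by (simp only: AV_def AF_def a_def)
  qed
qed

end
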